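(* Let $1\le p,q<\infty$ and $1\le r\le\infty$. Then the Banach spaces $\big(\sum_{n\in\mathbb N}H^p_n(H^q_n)\big)_r$ and $\big(\sum_{n\in\mathbb N}H^p_n(H^q_n)^*\big)_r$ are primary. In particular, for $1<s<\infty$, the spaces $$\big(\sum_{n}H^1_n(H^s_n)\big)_r,\quad \big(\sum_{n}H^s_n(H^1_n)\big)_r,\quad \big(\sum_{n}\mathrm{BMO}_n(H^s_n)\big)_r,\quad \big(\sum_{n}H^s_n(\mathrm{BMO}_n)\big)_r$$ are primary.
   Context: A Banach space $X$ is primary if for every bounded projection $Q:X\to X$, either $Q(X)$ or $(\mathrm{Id}-Q)(X)$ is isomorphic to $X$. $\mathscr D=\{[k2^{-n},(k+1)2^{-n}):n,k\in\mathbb N_0,\ 0\le k\le 2^n-1\}$ is the set of dyadic intervals in $[0,1)$ and $\mathscr D^{n}=\{I\in\mathscr D:|I|\ge 2^{-n}\}$. For $I\in\mathscr D$, $h_I$ is the $L^\infty$-normalized Haar function: $+1$ on the left half of $I$, $-1$ on the right half, $0$ elsewhere; $h_{I\times J}(x,y)=h_I(x)h_J(y)$. For $1\le p,q<\infty$ and a finite sum $f=\sum_{I\times J}a_{I\times J}h_{I\times J}$ put $$\|f\|_{H^p(H^q)}=\bigg(\int_0^1\Big(\int_0^1\big(\sum_{I\times J}|a_{I\times J}|^2h_{I\times J}^2(x,y)\big)^{q/2}dy\Big)^{p/q}dx\bigg)^{1/p}.$$ $H^p_n(H^q_n)$ is the finite dimensional space $\mathrm{span}\{h_{I\times J}:I,J\in\mathscr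 D^n\}$ with this norm, and $H^p_n(H^q_n)^*$ is its dual space with the dual norm. For $1<s<\infty$ and $\frac1s+\frac1{s'}=1$, $\mathrm{BMO}_n(H^s_n)$ denotes $H^1_n(H^{s'}_n)^*$ and $H^s_n(\mathrm{BMO}_n)$ denotes $H^{s'}_n(H^1_n)^*$ (these identifications hold up to equivalence of norms with constants independent of $n$). For Banach spaces $X_n$, $\big(\sum_{n}X_n\big)_r$ is the space of sequences $(f_n)$ with $f_n\in X_n$ and finite norm $\big(\sum_n\|f_n\|^r\big)^{1/r}$ if $r<\infty$, respectively $\sup_n\|f_n\|$ if $r=\infty$. *)

theory Defs
  imports "HOL-Analysis.Analysis" "HOL-Library.Function_Algebras"
begin

text \<open>Pointwise scalar multiplication. It turns the ambient types used below (functions on the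
  plane, functionals, sequences) into real vector spaces.\<close>

instantiation "fun" :: (type, real_vector) real_vector
begin

definition scaleR_fun :: "real \<Rightarrow> ('a \<Rightarrow> 'b) \<Rightarrow> 'a \<Rightarrow> 'b"
  where "scaleR_fun c f = (\<lambda>x. c *\<^sub>R f x)"

instance
  by standard (auto simp: scaleR_fun_def fun_eq_iff scaleR_add_right scaleR_add_left)

end


section \<open>Normed spaces on carriers, primary spaces\<close>

text \<open>The spaces depend on real parameters and on \<open>n\<close>, so they are represented as a carrier set in an
  ambient real vector space together with a norm. The norm function is only meaningful on the
  carrier, and operators are only considered on the carrier.\<close>

record 'a nspace =
  carr :: "'a set"
  nrm :: "'a \<Rightarrow> real"

definition normed_space :: "'a::real_vector nspace \<Rightarrow> bool" where
  "normed_space X \<longleftrightarrow> subspace (carr X) \<and>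
     (\<forall>x\<in>carr X. 0 \<le> nrm X x \<and> (nrm X x = 0 \<longleftrightarrow> x = 0)) \<and>
     (\<forall>c. \<forall>x\<in>carr X. nrm X (c *\<^sub>R x) = \<bar>c\<bar> * nrm X x) \<and>
     (\<forall>x\<in>carr X. \<forall>y\<in>carr X. nrm X (x + y) \<le> nrm X x + nrm X y)"

definition banach_space :: "'a::real_vector nspace \<Rightarrow> bool" where
  "banach_space X \<longleftrightarrow> normed_space X \<and>
     (\<forall>u::nat \<Rightarrow> 'a. (\<forall>k. u k \<in> carr X) \<and>
        (\<forall>e>0. \<exists>M. \<forall>k\<ge>M. \<forall>l\<ge>M. nrm X (u k - u l) < e) \<longrightarrow>
        (\<exists>x\<in>carr X. (\<lambda>k. nrm X (u k - x)) \<longlonglongrightarrow> 0))"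

definition bounded_op ::
    "'a::real_vector nspace \<Rightarrow> 'b::real_vector nspace \<Rightarrow> ('a \<Rightarrow> 'b) \<Rightarrow> bool" where
  "bounded_op X Y T \<longleftrightarrow> T ` carr X \<subseteq> carr Y \<and>
     (\<forall>x\<in>carr X. \<forall>y\<in>carr X. T (x + y) = T x + T y) \<and>
     (\<forall>c. \<forall>x\<in>carr X. T (c *\<^sub>R x) = c *\<^sub>R T x) \<and>
     (\<exists>C. \<forall>x\<in>carr X. nrm Y (T x) \<le> C * nrm X x)"

definition isomorphic_spaces :: "'a::real_vector nspace \<Rightarrow> 'b::real_vector nspace \<Rightarrow> bool" where
  "isomorphic_spaces X Y \<longleftrightarrow> (\<exists>T S. bounded_op X Y T \<and> bounded_op Y X S \<and>
     (\<forall>x\<in>carr X. S (T x) = x) \<and> (\<forall>y\<in>carr Y. T (S y) = y))"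

definition bounded_projection :: "'a::real_vector nspace \<Rightarrow> ('a \<Rightarrow> 'a) \<Rightarrow> bool" where
  "bounded_projection X Q \<longleftrightarrow> bounded_op X X Q \<and> (\<forall>x\<in>carr X. Q (Q x) = Q x)"

definition op_range :: "'a nspace \<Rightarrow> ('a \<Rightarrow> 'a) \<Rightarrow> 'a nspace" where
  "op_range X Q = \<lparr>carr = Q ` carr X, nrm = nrm X\<rparr>"

definition primary :: "'a::real_vector nspace \<Rightarrow> bool" where
  "primary X \<longleftrightarrow> banach_space X \<and>
     (\<forall>Q. bounded_projection X Q \<longrightarrow>
        isomorphic_spaces (op_range X Q) X \<or>
        isomorphic_spaces (op_range X (\<lambda>x. x - Q x)) X)"

text \<open>Functionals on \<open>X\<close> are total functions, normalized to vanish off the carrier so that each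
  functional on the carrier has exactly one representative.\<close>

definition dual_space :: "'a::real_vector nspace \<Rightarrow> ('a \<Rightarrow> real) nspace" where
  "dual_space X = \<lparr>
     carr = {\<phi>. (\<forall>x\<in>carr X. \<forall>y\<in>carr X. \<phi> (x + y) = \<phi> x + \<phi> y) \<and>
                (\<forall>c. \<forall>x\<in>carr X. \<phi> (c *\<^sub>R x) = c * \<phi> x) \<and>
                (\<exists>C. \<forall>x\<in>carr X. \<bar>\<phi> x\<bar> \<le> C * nrm X x) \<and>
                (\<forall>x. x \<notin> carr X \<longrightarrow> \<phi> x = 0)},
     nrm = (\<lambda>\<phi>. Sup {\<bar>\<phi> x\<bar> | x. x \<in> carr X \<and> nrm X x \<le> 1})\<rparr>"

text \<open>The \<open>\<ell>\<^sup>r\<close>-sum of the spaces \<open>X n\<close> over the index set \<open>A\<close>; sequences are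
  normalized to vanish off \<open>A\<close>.\<close>

definition lr_sum ::
    "ereal \<Rightarrow> nat set \<Rightarrow> (nat \<Rightarrow> 'a::real_vector nspace) \<Rightarrow> (nat \<Rightarrow> 'a) nspace" where
  "lr_sum r A X = \<lparr>
     carr = {f. (\<forall>n\<in>A. f n \<in> carr (X n)) \<and> (\<forall>n. n \<notin> A \<longrightarrow> f n = 0) \<and>
                (if r = \<infinity> then bdd_above ((\<lambda>n. nrm (X n) (f n)) ` A)
                 else (\<lambda>n. nrm (X n) (f n) powr real_of_ereal r) summable_on A)},
     nrm = (\<lambda>f. if r = \<infinity> then (SUP n\<in>A. nrm (X n) (f n))
                else (\<Sum>\<^sub>\<infinity>n\<in>A. nrm (X n) (f n) powr real_of_ereal r)
                       powr (1 / real_of_ereal r))\<rparr>"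


section \<open>Biparameter Haar system Hardy spaces\<close>

definition dyadic :: "real set set" where
  "dyadic = {{real k / 2 ^ n ..< (real k + 1) / 2 ^ n} | n k. k \<le> 2 ^ n - 1}"

definition dyadic_upto :: "nat \<Rightarrow> real set set" where
  "dyadic_upto n = {I \<in> dyadic. measure lborel I \<ge> 1 / 2 ^ n}"

definition haar :: "real set \<Rightarrow> real \<Rightarrow> real" where
  "haar I x = (if x \<in> I then (if x < (Inf I + Sup I) / 2 then 1 else - 1) else 0)"

definition haar2 :: "real set \<Rightarrow> real set \<Rightarrow> real \<times> real \<Rightarrow> real" where
  "haar2 I J = (\<lambda>(x, y). haar I x * haar J y)"

definition haar_system :: "(real \<times> real \<Rightarrow> real) set" where
  "haar_system = {haar2 I J | I J. I \<in> dyadic \<and> J \<in> dyadic}"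

text \<open>The coefficient of \<open>haar2 I J\<close> in the unique expansion of \<open>f\<close> as a finite linear combination
  of the (linearly independent) Haar system.\<close>

definition haar_coeff :: "(real \<times> real \<Rightarrow> real) \<Rightarrow> real set \<Rightarrow> real set \<Rightarrow> real" where
  "haar_coeff f I J = representation haar_system f (haar2 I J)"

text \<open>The sum is restricted to the finitely many nonzero coefficients because a sum over an infinite
  index set is 0 by convention.\<close>

definition hardy_norm :: "real \<Rightarrow> real \<Rightarrow> (real \<times> real \<Rightarrow> real) \<Rightarrow> real" where
  "hardy_norm p q f =
     (LBINT x:{0..1}.
        (LBINT y:{0..1}.
           (\<Sum>(I, J) \<in> {(I, J) \<in> dyadic \<times> dyadic. haar_coeff f I J \<noteq> 0}.
              \<bar>haar_coeff f I J\<bar>\<^sup>2 * (haar2 I J (x, y))\<^sup>2) powr (q / 2)) powr (p / q)) powr (1 / p)"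

definition hardy :: "real \<Rightarrow> real \<Rightarrow> nat \<Rightarrow> (real \<times> real \<Rightarrow> real) nspace" where
  "hardy p q n = \<lparr>carr = span {haar2 I J | I J. I \<in> dyadic_upto n \<and> J \<in> dyadic_upto n},
                 nrm = hardy_norm p q\<rparr>"

text \<open>\<open>s / (s - 1)\<close> is the conjugate exponent \<open>s'\<close> of \<open>s > 1\<close>, that is, \<open>1 / s + 1 / s' = 1\<close>.\<close>

definition conj_exp :: "real \<Rightarrow> real" where
  "conj_exp s = s / (s - 1)"

definition BMO_hardy :: "real \<Rightarrow> nat \<Rightarrow> ((real \<times> real \<Rightarrow> real) \<Rightarrow> real) nspace" where
  "BMO_hardy s n = dual_space (hardy 1 (conj_exp s) n)"

definition hardy_BMO :: "real \<Rightarrow> nat \<Rightarrow> ((real \<times> real \<Rightarrow> real) \<Rightarrow> real) nspace" where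
  "hardy_BMO s n = dual_space (hardy (conj_exp s) 1 n)"

end

theory Submission
 imports Defs
begin

text \<open>Expanding in the Haar system turns a function in \<open>H\<^sup>p\<^sub>n(H\<^sup>q\<^sub>n)\<close> into an array of coefficients
 indexed by pairs of binary words of length at most \<open>n\<close>. Only a few properties of the norm of such
 arrays matter: it is unconditional, it decreases under the maps that re-code words along a set
 \<open>S\<close> of levels with signs prescribed by a set \<open>G\<close> of words, and it is controlled by powers of the
 density on blocks of a single level. The dual norm has the same properties with conjugate
 exponents, so spaces and duals are treated simultaneously (locale \<open>haar_norm\<close>).

 Choosing \<open>G\<close> at random makes the off-diagonal entries of an operator on the \<open>N\<close>-th space small in
 the mean square, and a Ramsey argument on the levels makes its diagonal nearly constant. Hence the
 identity of the \<open>n\<close>-th space factors through \<open>Q\<close> or through \<open>Id - Q\<close> restricted to the \<open>N\<close>-th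
 space, with constants independent of \<open>n\<close> and \<open>N\<close>. A gliding hump selection of the indices \<open>N\<close>
 produces an operator on the whole sum that is close to the identity and factors through \<open>Q\<close> or
 \<open>Id - Q\<close>, and the decomposition method of Pelczynski turns this factorization into an isomorphism.\<close>

text \<open>The density exponents \<open>x\<close> and \<open>y\<close> of \<open>haar_norm\<close>
  stand for \<open>1 / p\<close> and \<open>1 / q\<close>. One of \<open>x\<close> and
  \<open>1 - x\<close> is at least \<open>1/2\<close>, so the rows or the columns of the block
  matrix have a summability gain, even at the end point exponent 1. The two variables are
  diagonalized one after the other: the first for all pairs of second-variable words in a window
  fixed beforehand, then the second for the diagonal sums that are left. The surviving diagonal
  depends on a pair of levels only. All its entries have to lie on one side of \<open>1/2\<close>;
  then the diagonal of \<open>Q\<close> or of \<open>Id - Q\<close> can be divided out, and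
  unconditionality bounds this by the factor 2. The obstacle is the interaction between different
  summands. Within one column, levels add up like an l2 sum, so a functional is large on few levels
  only; a window of first-variable levels can slide past them, provided that the columns were fixed
  earlier. For finite \<open>r\<close>, estimates on single coordinates then suffice by density. For
  \<open>r = \<infinity>\<close> finitely supported sequences are not dense, and the later indices
  must be taken from infinite sets on which the relevant functionals are already small.\<close>

lemma powr_convex2:
 fixes a b u v p :: real
 assumes "1 \<le> p" "0 \<le> a" "0 \<le> b" "0 \<le> u" "0 \<le> v" "u + v = 1"
 shows "(u * a + v * b) powr p \<le> u * a powr p + v * b powr p"
proof -
 \<comment> \<open>When an argument or a weight vanishes, the claim reduces to this bound on the
   unit interval; positive data are left to convexity.\<close>
 have small: "c powr p \<le> c" if "0 \<le> c" "c \<le> 1" for c :: real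
 proof (cases "c = 0")
  case False
  then show ?thesis using powr_mono'[of 1 p c] that assms(1) by simp
 qed simp
 show ?thesis
 proof (cases "a = 0 \<or> b = 0 \<or> u = 0 \<or> v = 0")
  case True
  have "(u * a) powr p \<le> u * a powr p"
   using small[of u] assms by (simp add: powr_mult mult_right_mono)
  moreover have "(v * b) powr p \<le> v * b powr p"
   using small[of v] assms by (simp add: powr_mult mult_right_mono)
  ultimately show ?thesis using True assms by (auto simp: powr_mult)
 next
  case False
  have "(\<lambda>x. x powr p) ((1 - v) *\<^sub>R a + v *\<^sub>R b) \<le> (1 - v) * a powr p + v * b powr p"
   using assms False by (intro convex_onD[OF powr_convex[OF assms(1)]]) auto
  moreover have "1 - v = u" using assms by simp
  ultimately show ?thesis by simp
 qed
qed

section \<open>Finite weighted $\ell^p$ norms\<close>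

definition wlp :: "real => ('i => real) => 'i set => ('i => real) => real" where
 "wlp p w F t = (\<Sum>i\<in>F. w i * t i powr p) powr (1 / p)"

lemma wlp_nonneg [simp]: "0 \<le> wlp p w F t"
 by (simp add: wlp_def)

lemma wlp_powr:
 assumes "1 \<le> p" "\<And>i. i \<in> F ==> 0 \<le> w i"
 shows "wlp p w F t powr p = (\<Sum>i\<in>F. w i * t i powr p)"
 using assms by (simp add: wlp_def powr_powr sum_nonneg)

lemma wlp_leI:
 assumes "1 \<le> p" "\<And>i. i \<in> F ==> 0 \<le> w i" "0 \<le> C"
  "(\<Sum>i\<in>F. w i * t i powr p) \<le> C powr p"
 shows "wlp p w F t \<le> C"
proof -
 have "wlp p w F t \<le> (C powr p) powr (1 / p)"
  unfolding wlp_def using assms by (intro powr_mono2) (auto intro!: sum_nonneg)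
 also have "... = C" using assms by (simp add: powr_powr)
 finally show ?thesis .
qed

lemma wlp_mono:
 assumes "1 \<le> p" "\<And>i. i \<in> F ==> 0 \<le> w i" "\<And>i. i \<in> F ==> 0 \<le> s i" "\<And>i. i \<in> F ==> s i \<le> t i"
 shows "wlp p w F s \<le> wlp p w F t"
 unfolding wlp_def using assms
 by (intro powr_mono2 sum_mono mult_left_mono sum_nonneg) auto

lemma wlp_scale:
 assumes "1 \<le> p" "0 \<le> c" "\<And>i. i \<in> F ==> 0 \<le> w i" "\<And>i. i \<in> F ==> 0 \<le> t i"
 shows "wlp p w F (\<lambda>i. c * t i) = c * wlp p w F t"
proof -
 have "(\<Sum>i\<in>F. w i * (c * t i) powr p) = c powr p * (\<Sum>i\<in>F. w i * t i powr p)"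
  unfolding sum_distrib_left using assms by (intro sum.cong) (auto simp: powr_mult)
 then show ?thesis
  using assms by (simp add: wlp_def powr_mult powr_powr sum_nonneg)
qed

lemma wlp_eq_0:
 assumes "1 \<le> p" "finite F" "\<And>i. i \<in> F ==> 0 \<le> w i" "wlp p w F t = 0" "i \<in> F"
 shows "w i = 0 \<or> t i = 0"
proof -
 have "(\<Sum>i\<in>F. w i * t i powr p) = 0" using assms(4) by (simp add: wlp_def)
 then have "w i * t i powr p = 0"
  using assms by (subst (asm) sum_nonneg_eq_0_iff) auto
 then show ?thesis by auto
qed

text \<open>Minkowski's inequality from convexity: with \<open>A\<close> and \<open>B\<close> the
  two norms, \<open>s + t\<close> is \<open>A + B\<close> times the convex combination of
  \<open>s / A\<close> and \<open>t / B\<close> with weights \<open>A / (A + B)\<close> and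
  \<open>B / (A + B)\<close>, and both quotients have norm 1. A vanishing norm is treated apart,
  since then each index has weight 0 or value 0.\<close>

lemma wlp_triangle:
 assumes p: "1 \<le> p" and F: "finite F" and w: "\<And>i. i \<in> F ==> 0 \<le> w i"
  and s: "\<And>i. i \<in> F ==> 0 \<le> s i" and t: "\<And>i. i \<in> F ==> 0 \<le> t i"
 shows "wlp p w F (\<lambda>i. s i + t i) \<le> wlp p w F s + wlp p w F t"
proof -
 let ?A = "wlp p w F s" and ?B = "wlp p w F t"
 consider "?A = 0" | "?B = 0" | "0 < ?A" "0 < ?B"
  using wlp_nonneg[of p w F s] wlp_nonneg[of p w F t] by linarith
 then show ?thesis
 proof cases
  case 1
  have "w i * (s i + t i) powr p = w i * t i powr p" if "i \<in> F" for i
   using wlp_eq_0[OF p F w 1 that] by auto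
  then have "(\<Sum>i\<in>F. w i * (s i + t i) powr p) = (\<Sum>i\<in>F. w i * t i powr p)"
   by (intro sum.cong) auto
  then have "wlp p w F (\<lambda>i. s i + t i) = ?B" by (simp only: wlp_def)
  then show ?thesis using 1 by simp
 next
  case 2
  have "w i * (s i + t i) powr p = w i * s i powr p" if "i \<in> F" for i
   using wlp_eq_0[OF p F w 2 that] by auto
  then have "(\<Sum>i\<in>F. w i * (s i + t i) powr p) = (\<Sum>i\<in>F. w i * s i powr p)"
   by (intro sum.cong) auto
  then have "wlp p w F (\<lambda>i. s i + t i) = ?A" by (simp only: wlp_def)
  then show ?thesis using 2 by simp
 next
  case 3
  define A where "A = ?A"
  define B where "B = ?B"
  have A: "0 < A" and B: "0 < B" using 3 by (auto simp: A_def B_def)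
  have SA: "(\<Sum>i\<in>F. w i * s i powr p) = A powr p" and SB: "(\<Sum>i\<in>F. w i * t i powr p) = B powr p"
   unfolding A_def B_def using wlp_powr[OF p, of F w s] wlp_powr[OF p, of F w t] w by simp_all
  have *: "w i * (s i + t i) powr p \<le> (A + B) powr p *
    (A / (A + B) * (w i * s i powr p / A powr p) + B / (A + B) * (w i * t i powr p / B powr p))"
   if i: "i \<in> F" for i
  proof -
   have "A / (A + B) * (s i / A) + B / (A + B) * (t i / B) = (s i + t i) / (A + B)"
    using A B by (simp add: add_divide_distrib)
   then have "s i + t i = (A + B) * (A / (A + B) * (s i / A) + B / (A + B) * (t i / B))"
    using A B by simp
   then have "(s i + t i) powr p
     = (A + B) powr p * (A / (A + B) * (s i / A) + B / (A + B) * (t i / B)) powr p"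
    using A B s[OF i] t[OF i] by (metis powr_mult)
   also have "... \<le> (A + B) powr p *
     (A / (A + B) * (s i / A) powr p + B / (A + B) * (t i / B) powr p)"
    using A B s[OF i] t[OF i] p
    by (intro mult_left_mono powr_convex2) (auto simp: add_divide_distrib[symmetric])
   also have "... = (A + B) powr p *
     (A / (A + B) * (s i powr p / A powr p) + B / (A + B) * (t i powr p / B powr p))"
    using A B s[OF i] t[OF i] by (simp add: powr_divide)
   finally have "w i * (s i + t i) powr p \<le> w i * ((A + B) powr p *
     (A / (A + B) * (s i powr p / A powr p) + B / (A + B) * (t i powr p / B powr p)))"
    using w[OF i] by (intro mult_left_mono) auto
   also have "... = (A + B) powr p *
    (A / (A + B) * (w i * s i powr p / A powr p) + B / (A + B) * (w i * t i powr p / B powr p))"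
    by (simp only: distrib_left mult_ac times_divide_eq_right times_divide_eq_left)
   finally show ?thesis .
  qed
  have "(\<Sum>i\<in>F. w i * (s i + t i) powr p) \<le> (\<Sum>i\<in>F. (A + B) powr p *
    (A / (A + B) * (w i * s i powr p / A powr p) + B / (A + B) * (w i * t i powr p / B powr p)))"
   by (intro sum_mono *)
  also have "... = (A + B) powr p * (A / (A + B) * ((\<Sum>i\<in>F. w i * s i powr p) / A powr p)
    + B / (A + B) * ((\<Sum>i\<in>F. w i * t i powr p) / B powr p))"
   by (simp only: sum_distrib_left[symmetric] sum_divide_distrib[symmetric] sum.distrib)
  also have "... = (A + B) powr p * (A / (A + B) + B / (A + B))"
   using A B by (simp add: SA SB)
  also have "... = (A + B) powr p"
   using A B by (simp add: add_divide_distrib[symmetric])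
  finally show ?thesis
   using A B w by (intro wlp_leI[OF p w]) (auto simp: A_def B_def)
 qed
qed

section \<open>Finite sections of $\ell^r$ sums\<close>

text \<open>Finite sections treat all \<open>r\<close> alike, including
  \<open>r = \<infinity>\<close>, and need no summability. The \<open>insert 0\<close> gives the
  empty section the value 0 when \<open>r = \<infinity>\<close>.\<close>

definition lrf :: "ereal => 'i set => ('i => real) => real" where
 "lrf r F t = (if r = \<infinity> then Max (insert 0 (t ` F)) else wlp (real_of_ereal r) (\<lambda>_. 1) F t)"

lemma real_of_ereal_ge_1: "1 \<le> r ==> r \<noteq> \<infinity> ==> 1 \<le> real_of_ereal r"
 by (cases r) auto

lemma lrf_nonneg [simp]: "finite F ==> 0 \<le> lrf r F t"
 by (auto simp: lrf_def)

lemma lrf_mono: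
 assumes "1 \<le> r" "finite F" "\<And>i. i \<in> F ==> 0 \<le> s i" "\<And>i. i \<in> F ==> s i \<le> t i"
 shows "lrf r F s \<le> lrf r F t"
proof (cases "r = \<infinity>")
 case True
 have "x \<le> Max (insert 0 (t ` F))" if x: "x \<in> insert 0 (s ` F)" for x
 proof (cases "x = 0")
  case True then show ?thesis using assms by simp
 next
  case False
  then obtain i where i: "i \<in> F" "x = s i" using x by auto
  have "x \<le> t i" using assms i by simp
  also have "t i \<le> Max (insert 0 (t ` F))" using assms i by (intro Max_ge) auto
  finally show ?thesis .
 qed
 then show ?thesis using True assms by (simp add: lrf_def)
next
 case False
 then show ?thesis using assms real_of_ereal_ge_1 by (auto simp: lrf_def intro!: wlp_mono)
qed

lemma lrf_cong: "(\<And>i. i \<in> F ==> s i = t i) ==> lrf r F s = lrf r F t"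
 by (simp add: lrf_def wlp_def cong: image_cong)

lemma lrf_subset:
 assumes "1 \<le> r" "finite G" "F \<subseteq> G" "\<And>i. i \<in> G ==> 0 \<le> t i"
 shows "lrf r F t \<le> lrf r G t"
proof (cases "r = \<infinity>")
 case True
 then show ?thesis using assms by (auto simp: lrf_def intro!: Max_mono)
next
 case False
 then have "1 \<le> real_of_ereal r" using assms real_of_ereal_ge_1 by auto
 then show ?thesis using assms False
  by (auto simp: lrf_def wlp_def intro!: powr_mono2 sum_mono2 sum_nonneg)
qed

lemma lrf_triangle:
 assumes "1 \<le> r" "finite F" "\<And>i. i \<in> F ==> 0 \<le> s i" "\<And>i. i \<in> F ==> 0 \<le> t i"
 shows "lrf r F (\<lambda>i. s i + t i) \<le> lrf r F s + lrf r F t"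
proof (cases "r = \<infinity>")
 case True
 have "s i + t i \<le> Max (insert 0 (s ` F)) + Max (insert 0 (t ` F))" if "i \<in> F" for i
  using assms that by (intro add_mono Max_ge) auto
 moreover have "0 \<le> Max (insert 0 (s ` F)) + Max (insert 0 (t ` F))" using assms by simp
 ultimately show ?thesis using True assms by (auto simp: lrf_def)
next
 case False
 then show ?thesis using assms real_of_ereal_ge_1
  by (auto simp: lrf_def intro!: wlp_triangle)
qed

lemma lrf_scale:
 assumes "1 \<le> r" "finite F" "0 \<le> c" "\<And>i. i \<in> F ==> 0 \<le> t i"
 shows "lrf r F (\<lambda>i. c * t i) = c * lrf r F t"
proof (cases "r = \<infinity>")
 case True
 have "mono (\<lambda>x. c * x)" using assms by (auto intro!: monoI mult_left_mono)
 then have "c * Max (insert 0 (t ` F)) = Max ((\<lambda>x. c * x) ` insert 0 (t ` F))"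
  using assms by (subst mono_Max_commute) auto
 also have "... = Max (insert 0 ((\<lambda>i. c * t i) ` F))" by (simp add: image_image)
 finally show ?thesis using True by (simp add: lrf_def)
next
 case False
 then show ?thesis using assms real_of_ereal_ge_1 by (auto simp: lrf_def intro!: wlp_scale)
qed

lemma lrf_empty [simp]: "lrf r {} t = 0"
 by (simp add: lrf_def wlp_def)

lemma lrf_singleton [simp]: "1 \<le> r ==> 0 \<le> t i ==> lrf r {i} t = t i"
 using real_of_ereal_ge_1[of r] by (auto simp: lrf_def wlp_def powr_powr max_def)

lemma lrf_ge:
 assumes "1 \<le> r" "finite F" "i \<in> F" "\<And>i. i \<in> F ==> 0 \<le> t i"
 shows "t i \<le> lrf r F t"
 using lrf_subset[of r F "{i}" t] assms by simp

lemma lrf_0 [simp]: "1 \<le> r ==> finite F ==> lrf r F (\<lambda>_. 0) = 0"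
 using lrf_scale[of r F 0 "\<lambda>_. 0"] by simp

text \<open>Both restrictions are extended by zero to the union, where the triangle inequality
  applies.\<close>

lemma lrf_Un:
 assumes r: "1 \<le> r" and fin: "finite F" "finite G" and t: "\<And>i. i \<in> F \<union> G ==> 0 \<le> t i"
 shows "lrf r (F \<union> G) t \<le> lrf r F t + lrf r G t"
proof -
 have ext: "lrf r (F \<union> G) (\<lambda>i. if i \<in> H then t i else 0) \<le> lrf r H t"
  if "H \<subseteq> F \<union> G" "finite H" for H
 proof (cases "r = \<infinity>")
  case True
  then show ?thesis using that fin by (auto simp: lrf_def intro!: Max_mono)
 next
  case False
  have "(\<Sum>i\<in>F \<union> G. (if i \<in> H then t i else 0) powr real_of_ereal r)
    = (\<Sum>i\<in>H. t i powr real_of_ereal r)"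
   using that fin by (intro sum.mono_neutral_cong_right) auto
  then show ?thesis using False by (simp add: lrf_def wlp_def)
 qed
 have "lrf r (F \<union> G) t \<le> lrf r (F \<union> G) (\<lambda>i. (if i \<in> F then t i else 0) + (if i \<in> G then t i else 0))"
  using r fin t by (intro lrf_mono) auto
 also have "... \<le> lrf r (F \<union> G) (\<lambda>i. if i \<in> F then t i else 0)
   + lrf r (F \<union> G) (\<lambda>i. if i \<in> G then t i else 0)"
  using r fin t by (intro lrf_triangle) auto
 also have "... \<le> lrf r F t + lrf r G t"
  using fin by (intro add_mono ext) auto
 finally show ?thesis .
qed

lemma lrf_le_sum:
 assumes "1 \<le> r" "finite F" "\<And>i. i \<in> F ==> 0 \<le> t i"
 shows "lrf r F t \<le> sum t F"
 using assms(2,3)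
proof (induction F rule: finite_induct)
 case (insert i F)
 have "lrf r (insert i F) t \<le> lrf r {i} t + lrf r F t"
  using lrf_Un[of r "{i}" F t] insert assms(1) by simp
 then show ?case using insert assms(1) by simp
qed simp

lemma lrf_image:
 assumes "inj_on h F"
 shows "lrf r (h ` F) t = lrf r F (\<lambda>i. t (h i))"
 using assms by (simp add: lrf_def wlp_def sum.reindex image_image)

text \<open>Iterated \<open>r\<close>-norms collapse to one norm on the product. This is what makes
  an \<open>r\<close>-sum of \<open>r\<close>-sums again an \<open>r\<close>-sum.\<close>

lemma lrf_Times:
 assumes r: "1 \<le> r" and fin: "finite F" "finite G"
  and t: "\<And>i j. i \<in> F ==> j \<in> G ==> 0 \<le> t i j"
 shows "lrf r (F \<times> G) (\<lambda>(i, j). t i j) = lrf r F (\<lambda>i. lrf r G (t i))"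
proof (cases "r = \<infinity>")
 case True
 show ?thesis
 proof (rule antisym)
  have "t i j \<le> lrf r F (\<lambda>i. lrf r G (t i))" if "i \<in> F" "j \<in> G" for i j
  proof -
   have "t i j \<le> lrf r G (t i)" using that r fin t by (intro lrf_ge) auto
   also have "... \<le> lrf r F (\<lambda>i. lrf r G (t i))"
    using that r fin lrf_ge[of r F i "\<lambda>i. lrf r G (t i)"] by auto
   finally show ?thesis .
  qed
  moreover have "0 \<le> lrf r F (\<lambda>i. lrf r G (t i))" using fin by simp
  ultimately show "lrf r (F \<times> G) (\<lambda>(i, j). t i j) \<le> lrf r F (\<lambda>i. lrf r G (t i))"
   using True fin by (subst lrf_def) auto
  have "t i j \<le> lrf r (F \<times> G) (\<lambda>(i, j). t i j)" if "i \<in> F" "j \<in> G" for i j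
   using lrf_ge[of r "F \<times> G" "(i, j)" "\<lambda>(i, j). t i j"] that r fin t by auto
  moreover have "0 \<le> lrf r (F \<times> G) (\<lambda>(i, j). t i j)" using fin by simp
  ultimately show "lrf r F (\<lambda>i. lrf r G (t i)) \<le> lrf r (F \<times> G) (\<lambda>(i, j). t i j)"
   using True fin by (auto simp: lrf_def[of "\<infinity>" F] lrf_def[of "\<infinity>" G])
 qed
next
 case False
 define \<rho> where "\<rho> = real_of_ereal r"
 have \<rho>: "1 \<le> \<rho>" using False r real_of_ereal_ge_1 by (simp add: \<rho>_def)
 have "lrf r F (\<lambda>i. lrf r G (t i)) = (\<Sum>i\<in>F. wlp \<rho> (\<lambda>_. 1) G (t i) powr \<rho>) powr (1 / \<rho>)"
  using False by (simp add: lrf_def wlp_def[of _ _ F] \<rho>_def)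
 also have "... = (\<Sum>i\<in>F. \<Sum>j\<in>G. t i j powr \<rho>) powr (1 / \<rho>)"
  using \<rho> by (subst wlp_powr) auto
 also have "... = lrf r (F \<times> G) (\<lambda>(i, j). t i j)"
  using False by (simp add: lrf_def wlp_def \<rho>_def sum.cartesian_product case_prod_unfold)
 finally show ?thesis by simp
qed

section \<open>Normed spaces and their $\ell^r$ sums\<close>

lemma normed_spaceD:
 assumes "normed_space X"
 shows "subspace (carr X)" "x \<in> carr X ==> 0 \<le> nrm X x"
  "x \<in> carr X ==> nrm X x = 0 \<longleftrightarrow> x = 0"
  "x \<in> carr X ==> nrm X (c *\<^sub>R x) = \<bar>c\<bar> * nrm X x"
  "x \<in> carr X ==> y \<in> carr X ==> nrm X (x + y) \<le> nrm X x + nrm X y"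
  "0 \<in> carr X" "x \<in> carr X ==> y \<in> carr X ==> x + y \<in> carr X"
  "x \<in> carr X ==> y \<in> carr X ==> x - y \<in> carr X"
  "x \<in> carr X ==> c *\<^sub>R x \<in> carr X" "nrm X 0 = 0"
 using assms unfolding normed_space_def
 by (auto simp: subspace_0 subspace_add subspace_diff subspace_scale)

lemma normed_space_diff:
 assumes "normed_space X" "x \<in> carr X" "y \<in> carr X"
 shows "nrm X (x - y) \<le> nrm X x + nrm X y" "nrm X (x - y) = nrm X (y - x)"
proof -
 have m: "- y \<in> carr X" "nrm X (- y) = nrm X y"
  using normed_spaceD(9)[OF assms(1,3), of "-1"] normed_spaceD(4)[OF assms(1,3), of "-1"] by auto
 show "nrm X (x - y) \<le> nrm X x + nrm X y"
  using normed_spaceD(5)[OF assms(1,2) m(1)] m by simp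
 have "x - y \<in> carr X" by (rule normed_spaceD(8)[OF assms])
 then show "nrm X (x - y) = nrm X (y - x)"
  using normed_spaceD(4)[OF assms(1), of "x - y" "-1"] by simp
qed

lemma bounded_opD:
 assumes "bounded_op X Y T"
 shows "x \<in> carr X ==> T x \<in> carr Y"
  "x \<in> carr X ==> y \<in> carr X ==> T (x + y) = T x + T y"
  "x \<in> carr X ==> T (c *\<^sub>R x) = c *\<^sub>R T x"
 using assms by (auto simp: bounded_op_def)

lemma bounded_op_diff:
 assumes "normed_space X" "bounded_op X Y T" "x \<in> carr X" "y \<in> carr X"
 shows "T (x - y) = T x - T y"
 using bounded_opD(2)[OF assms(2,3) normed_spaceD(9)[OF assms(1,4), of "-1"]]
  bounded_opD(3)[OF assms(2,4), of "-1"] by simp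

lemma bounded_op_0:
 assumes "normed_space X" "bounded_op X Y T" shows "T 0 = 0"
 using bounded_opD(3)[OF assms(2) normed_spaceD(6)[OF assms(1)], of 0] by simp

lemma bounded_op_bound:
 assumes "normed_space X" "bounded_op X Y T"
 obtains C where "0 \<le> C" "\<And>x. x \<in> carr X ==> nrm Y (T x) \<le> C * nrm X x"
proof -
 obtain C where C: "\<forall>x\<in>carr X. nrm Y (T x) \<le> C * nrm X x"
  using assms by (auto simp: bounded_op_def)
 have "nrm Y (T x) \<le> max C 0 * nrm X x" if "x \<in> carr X" for x
  using C that mult_right_mono[of C "max C 0" "nrm X x"] normed_spaceD(2)[OF assms(1) that]
  by fastforce
 then show ?thesis using that[of "max C 0"] by simp
qed

lemma bounded_opI:
 assumes "\<And>x. x \<in> carr X ==> T x \<in> carr Y"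
  "\<And>x y. x \<in> carr X ==> y \<in> carr X ==> T (x + y) = T x + T y"
  "\<And>c x. x \<in> carr X ==> T (c *\<^sub>R x) = c *\<^sub>R T x"
  "\<And>x. x \<in> carr X ==> nrm Y (T x) \<le> C * nrm X x"
 shows "bounded_op X Y T"
 using assms unfolding bounded_op_def by blast

lemma bounded_op_comp:
 assumes "normed_space X" "normed_space Y" "bounded_op X Y T" "bounded_op Y Z S"
 shows "bounded_op X Z (\<lambda>x. S (T x))"
proof -
 obtain C where C: "0 \<le> C" "\<And>x. x \<in> carr X ==> nrm Y (T x) \<le> C * nrm X x"
  using bounded_op_bound assms by blast
 obtain D where D: "0 \<le> D" "\<And>x. x \<in> carr Y ==> nrm Z (S x) \<le> D * nrm Y x"
  using bounded_op_bound assms by blast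
 have "nrm Z (S (T x)) \<le> D * C * nrm X x" if "x \<in> carr X" for x
 proof -
  have "nrm Z (S (T x)) \<le> D * nrm Y (T x)" using D that assms bounded_opD by blast
  also have "... \<le> D * (C * nrm X x)" using C that D by (intro mult_left_mono) auto
  finally show ?thesis by (simp add: mult.assoc)
 qed
 then show ?thesis
  using assms by (intro bounded_opI) (auto simp: bounded_opD)
qed

text \<open>A common bound on all finite sections is the shared form of the two membership
  conditions, boundedness for \<open>r = \<infinity>\<close> and summability otherwise. Later
  constructions then only have to estimate finite sections.\<close>

lemma lr_sum_carr:
 assumes r: "1 \<le> r" and X: "\<forall>n\<in>A. normed_space (X n)"
 shows "f \<in> carr (lr_sum r A X) \<longleftrightarrow> (\<forall>n\<in>A. f n \<in> carr (X n)) \<and> (\<forall>n. n \<notin> A --> f n = 0) \<and>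
  (\<exists>C. \<forall>F. finite F --> F \<subseteq> A --> lrf r F (\<lambda>n. nrm (X n) (f n)) \<le> C)"
proof -
 define t where "t n = nrm (X n) (f n)" for n
 have main: "(if r = \<infinity> then bdd_above (t ` A) else (\<lambda>n. t n powr real_of_ereal r) summable_on A)
   \<longleftrightarrow> (\<exists>C. \<forall>F. finite F --> F \<subseteq> A --> lrf r F t \<le> C)"
  if f: "\<forall>n\<in>A. f n \<in> carr (X n)"
 proof -
  have t: "0 \<le> t n" if "n \<in> A" for n using X f that normed_spaceD(2) by (auto simp: t_def)
  show ?thesis
  proof (cases "r = \<infinity>")
   case True
   have "bdd_above (t ` A)" if C: "\<forall>F. finite F --> F \<subseteq> A --> lrf r F t \<le> C" for C
   proof (rule bdd_aboveI[of _ C])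
    fix s assume "s \<in> t ` A"
    then obtain n where "n \<in> A" "s = t n" by auto
    then show "s \<le> C" using C[rule_format, of "{n}"] t r by simp
   qed
   moreover have "\<exists>C. \<forall>F. finite F --> F \<subseteq> A --> lrf r F t \<le> C" if "bdd_above (t ` A)"
   proof -
    obtain C where "\<forall>x\<in>t ` A. x \<le> C" using \<open>bdd_above (t ` A)\<close> by (auto simp: bdd_above_def)
    then have "\<forall>F. finite F --> F \<subseteq> A --> lrf r F t \<le> max 0 C"
     using True by (fastforce simp: lrf_def)
    then show ?thesis by blast
   qed
   ultimately show ?thesis using True by auto
  next
   case False
   define \<rho> where "\<rho> = real_of_ereal r"
   have \<rho>: "1 \<le> \<rho>" using False r real_of_ereal_ge_1 by (simp add: \<rho>_def)
   have "(\<lambda>n. t n powr \<rho>) summable_on A"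
    if C: "\<forall>F. finite F --> F \<subseteq> A --> lrf r F t \<le> C" for C
   proof (rule nonneg_bdd_above_summable_on)
    show "bdd_above (sum (\<lambda>n. t n powr \<rho>) ` {F. F \<subseteq> A \<and> finite F})"
    proof (rule bdd_aboveI[of _ "C powr \<rho>"])
     fix s assume "s \<in> sum (\<lambda>n. t n powr \<rho>) ` {F. F \<subseteq> A \<and> finite F}"
     then obtain F where F: "F \<subseteq> A" "finite F" "s = (\<Sum>n\<in>F. t n powr \<rho>)" by auto
     have "s = lrf r F t powr \<rho>"
      using F False wlp_powr[OF \<rho>, of F "\<lambda>_. 1" t] by (simp add: lrf_def \<rho>_def)
     also have "... \<le> C powr \<rho>" using C F \<rho> by (intro powr_mono2) auto
     finally show "s \<le> C powr \<rho>" .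
    qed
   qed auto
   moreover have "\<exists>C. \<forall>F. finite F --> F \<subseteq> A --> lrf r F t \<le> C"
    if s: "(\<lambda>n. t n powr \<rho>) summable_on A"
   proof -
    have "lrf r F t \<le> (\<Sum>\<^sub>\<infinity>n\<in>A. t n powr \<rho>) powr (1 / \<rho>)" if "finite F" "F \<subseteq> A" for F
     unfolding lrf_def wlp_def using False \<rho> that s
     by (auto simp: \<rho>_def[symmetric] intro!: powr_mono2 finite_sum_le_infsum sum_nonneg)
    then show ?thesis by blast
   qed
   ultimately show ?thesis using False by (auto simp: \<rho>_def)
  qed
 qed
 show ?thesis
  using main unfolding lr_sum_def t_def by (cases "\<forall>n\<in>A. f n \<in> carr (X n)") auto
qed

text \<open>For \<open>r = \<infinity>\<close> the supremum carries information only over a nonempty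
  \<open>A\<close>. The case of the empty section \<open>F\<close> yields that the norm is
  nonnegative.\<close>

lemma lr_sum_nrm_ge:
 assumes r: "1 \<le> r" and X: "\<forall>n\<in>A. normed_space (X n)" and f: "f \<in> carr (lr_sum r A X)"
  and A: "A \<noteq> {}" and F: "finite F" "F \<subseteq> A"
 shows "lrf r F (\<lambda>n. nrm (X n) (f n)) \<le> nrm (lr_sum r A X) f"
proof -
 have fn: "f n \<in> carr (X n)" if "n \<in> A" for n using f that by (auto simp: lr_sum_def)
 have t: "0 \<le> nrm (X n) (f n)" if "n \<in> A" for n using X fn that normed_spaceD(2) by auto
 show ?thesis
 proof (cases "F = {}")
  case True
  show ?thesis
  proof (cases "r = \<infinity>")
   case True
   then obtain n where n: "n \<in> A" using A by auto
   have "bdd_above ((\<lambda>n. nrm (X n) (f n)) ` A)" using f True by (auto simp: lr_sum_def)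
   then have "nrm (X n) (f n) \<le> (SUP n\<in>A. nrm (X n) (f n))" using n by (intro cSUP_upper)
   then show ?thesis using t[OF n] True \<open>F = {}\<close> by (simp add: lr_sum_def)
  next
   case False
   then show ?thesis using \<open>F = {}\<close> by (simp add: lr_sum_def)
  qed
 next
  case False
  show ?thesis
  proof (cases "r = \<infinity>")
   case True
   have bdd: "bdd_above ((\<lambda>n. nrm (X n) (f n)) ` A)" using f True by (auto simp: lr_sum_def)
   then have *: "nrm (X n) (f n) \<le> (SUP n\<in>A. nrm (X n) (f n))" if "n \<in> A" for n
    using that by (intro cSUP_upper)
   obtain n where "n \<in> F" using False by auto
   then have "0 \<le> (SUP n\<in>A. nrm (X n) (f n))" using *[of n] t[of n] F by auto
   then show ?thesis using * True F by (auto simp: lrf_def lr_sum_def)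
  next
   case False
   define \<rho> where "\<rho> = real_of_ereal r"
   have \<rho>: "1 \<le> \<rho>" using False r real_of_ereal_ge_1 by (simp add: \<rho>_def)
   have "(\<lambda>n. nrm (X n) (f n) powr \<rho>) summable_on A"
    using f False by (auto simp: lr_sum_def \<rho>_def)
   then show ?thesis
    unfolding lrf_def wlp_def lr_sum_def using False \<rho> F
    by (auto simp: \<rho>_def[symmetric] intro!: powr_mono2 finite_sum_le_infsum sum_nonneg)
  qed
 qed
qed

lemma lr_sum_nrm_le:
 assumes r: "1 \<le> r" and X: "\<forall>n\<in>A. normed_space (X n)" and f: "f \<in> carr (lr_sum r A X)"
  and A: "A \<noteq> {}" and C: "\<And>F. finite F ==> F \<subseteq> A ==> lrf r F (\<lambda>n. nrm (X n) (f n)) \<le> C"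
 shows "nrm (lr_sum r A X) f \<le> C"
proof (cases "r = \<infinity>")
 case True
 have fn: "f n \<in> carr (X n)" if "n \<in> A" for n using f that by (auto simp: lr_sum_def)
 have "nrm (X n) (f n) \<le> C" if "n \<in> A" for n
  using C[of "{n}"] that r normed_spaceD(2)[OF X[rule_format, OF that] fn[OF that]] by simp
 then show ?thesis using True A by (auto simp: lr_sum_def intro!: cSUP_least)
next
 case False
 define \<rho> where "\<rho> = real_of_ereal r"
 have \<rho>: "1 \<le> \<rho>" using False r real_of_ereal_ge_1 by (simp add: \<rho>_def)
 have C0: "0 \<le> C" using C[of "{}"] by simp
 have s: "(\<lambda>n. nrm (X n) (f n) powr \<rho>) summable_on A"
  using f False by (auto simp: lr_sum_def \<rho>_def)
 have "(\<Sum>\<^sub>\<infinity>n\<in>A. nrm (X n) (f n) powr \<rho>) \<le> C powr \<rho>"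
 proof (rule infsum_le_finite_sums[OF s])
  fix F assume F: "finite F" "F \<subseteq> A"
  have "(\<Sum>n\<in>F. nrm (X n) (f n) powr \<rho>) = lrf r F (\<lambda>n. nrm (X n) (f n)) powr \<rho>"
   using F False wlp_powr[OF \<rho>, of F "\<lambda>_. 1"] by (simp add: lrf_def \<rho>_def)
  also have "... \<le> C powr \<rho>" using C[OF F] F \<rho> by (intro powr_mono2) auto
  finally show "(\<Sum>n\<in>F. nrm (X n) (f n) powr \<rho>) \<le> C powr \<rho>" .
 qed
 then have "(\<Sum>\<^sub>\<infinity>n\<in>A. nrm (X n) (f n) powr \<rho>) powr (1 / \<rho>) \<le> (C powr \<rho>) powr (1 / \<rho>)"
  using \<rho> by (intro powr_mono2) (auto intro!: infsum_nonneg)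
 then show ?thesis using C0 \<rho> False by (simp add: lr_sum_def powr_powr \<rho>_def[symmetric])
qed

lemma lr_sumI:
 assumes r: "1 \<le> r" and X: "\<forall>n\<in>A. normed_space (X n)" and A: "A \<noteq> {}"
  and f: "\<And>n. n \<in> A ==> f n \<in> carr (X n)" "\<And>n. n \<notin> A ==> f n = 0"
  and C: "\<And>F. finite F ==> F \<subseteq> A ==> lrf r F (\<lambda>n. nrm (X n) (f n)) \<le> C"
 shows "f \<in> carr (lr_sum r A X)" "nrm (lr_sum r A X) f \<le> C"
proof -
 show *: "f \<in> carr (lr_sum r A X)"
  using f C by (subst lr_sum_carr[OF r X]) auto
 show "nrm (lr_sum r A X) f \<le> C"
  by (rule lr_sum_nrm_le[OF r X * A C])
qed

lemma lr_sum_coord: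
 assumes "f \<in> carr (lr_sum r A X)"
 shows "n \<in> A ==> f n \<in> carr (X n)" "n \<notin> A ==> f n = 0"
 using assms by (auto simp: lr_sum_def)

lemma lr_sum_coord_le:
 assumes r: "1 \<le> r" and X: "\<forall>n\<in>A. normed_space (X n)" and f: "f \<in> carr (lr_sum r A X)"
  and n: "n \<in> A"
 shows "nrm (X n) (f n) \<le> nrm (lr_sum r A X) f"
 using lr_sum_nrm_ge[OF r X f _ , where F = "{n}"] n r normed_spaceD(2)[OF X[rule_format, OF n] lr_sum_coord(1)[OF f n]]
 by auto

lemma lr_sum_nrm_approx:
 assumes r: "1 \<le> r" and X: "\<forall>n\<in>A. normed_space (X n)" and A: "A \<noteq> {}"
  and f: "f \<in> carr (lr_sum r A X)" and e: "0 < e"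
 obtains F where "finite F" "F \<subseteq> A" "nrm (lr_sum r A X) f \<le> lrf r F (\<lambda>n. nrm (X n) (f n)) + e"
proof -
 have "\<exists>F. finite F \<and> F \<subseteq> A \<and> \<not> lrf r F (\<lambda>n. nrm (X n) (f n)) \<le> nrm (lr_sum r A X) f - e"
  using lr_sum_nrm_le[OF r X f A, where C = "nrm (lr_sum r A X) f - e"] e by force
 then obtain F where "finite F" "F \<subseteq> A" "\<not> lrf r F (\<lambda>n. nrm (X n) (f n)) \<le> nrm (lr_sum r A X) f - e"
  by blast
 then show ?thesis using that[of F] by simp
qed

lemma lr_sum_normed:
 assumes r: "1 \<le> r" and X: "\<forall>n\<in>A. normed_space (X n)" and A: "A \<noteq> {}"
 shows "normed_space (lr_sum r A X)"
proof -
 let ?Y = "lr_sum r A X"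
 note co = lr_sum_coord(1)[where r = r and A = A and X = X]
 have nn: "0 \<le> nrm (X n) (f n)" if "f \<in> carr ?Y" "n \<in> A" for f n
  using normed_spaceD(2)[OF X[rule_format, OF that(2)] co[OF that]] .
 have add: "f + g \<in> carr ?Y \<and> nrm ?Y (f + g) \<le> nrm ?Y f + nrm ?Y g"
  if f: "f \<in> carr ?Y" and g: "g \<in> carr ?Y" for f g
 proof -
  have "lrf r F (\<lambda>n. nrm (X n) ((f + g) n)) \<le> nrm ?Y f + nrm ?Y g"
   if F: "finite F" "F \<subseteq> A" for F
  proof -
   have "lrf r F (\<lambda>n. nrm (X n) ((f + g) n)) \<le> lrf r F (\<lambda>n. nrm (X n) (f n) + nrm (X n) (g n))"
    using F X co f g by (intro lrf_mono[OF r]) (auto intro!: normed_spaceD(2,5,7))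
   also have "... \<le> lrf r F (\<lambda>n. nrm (X n) (f n)) + lrf r F (\<lambda>n. nrm (X n) (g n))"
    using F nn f g by (intro lrf_triangle[OF r]) auto
   also have "... \<le> nrm ?Y f + nrm ?Y g"
    using lr_sum_nrm_ge[OF r X f A F] lr_sum_nrm_ge[OF r X g A F] by simp
   finally show ?thesis .
  qed
  moreover have "(f + g) n \<in> carr (X n)" if "n \<in> A" for n
   using normed_spaceD(7)[OF bspec[OF X that] co[OF f that] co[OF g that]] by simp
  moreover have "(f + g) n = 0" if "n \<notin> A" for n
   using lr_sum_coord(2)[OF f that] lr_sum_coord(2)[OF g that] by simp
  ultimately show ?thesis
   using lr_sumI[OF r X A, where f = "f + g" and C = "nrm ?Y f + nrm ?Y g"] by blast
 qed
 have sc: "c *\<^sub>R f \<in> carr ?Y \<and> nrm ?Y (c *\<^sub>R f) \<le> \<bar>c\<bar> * nrm ?Y f" if f: "f \<in> carr ?Y" for f c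
 proof -
  have "lrf r F (\<lambda>n. nrm (X n) ((c *\<^sub>R f) n)) \<le> \<bar>c\<bar> * nrm ?Y f" if F: "finite F" "F \<subseteq> A" for F
  proof -
   have "lrf r F (\<lambda>n. nrm (X n) ((c *\<^sub>R f) n)) = lrf r F (\<lambda>n. \<bar>c\<bar> * nrm (X n) (f n))"
    using F co[OF f] X by (intro lrf_cong) (auto simp: scaleR_fun_def intro!: normed_spaceD(4))
   also have "... = \<bar>c\<bar> * lrf r F (\<lambda>n. nrm (X n) (f n))"
    using F nn[OF f] by (intro lrf_scale[OF r]) auto
   also have "... \<le> \<bar>c\<bar> * nrm ?Y f"
    using lr_sum_nrm_ge[OF r X f A F] by (intro mult_left_mono) auto
   finally show ?thesis .
  qed
  moreover have "(c *\<^sub>R f) n \<in> carr (X n)" if "n \<in> A" for n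
   using normed_spaceD(9)[OF bspec[OF X that] co[OF f that]] by (simp add: scaleR_fun_def)
  moreover have "(c *\<^sub>R f) n = 0" if "n \<notin> A" for n
   using lr_sum_coord(2)[OF f that] by (simp add: scaleR_fun_def)
  ultimately show ?thesis
   using lr_sumI[OF r X A, where f = "c *\<^sub>R f" and C = "\<bar>c\<bar> * nrm ?Y f"] by blast
 qed
 have zero: "0 \<in> carr ?Y" "nrm ?Y 0 \<le> 0"
 proof -
  have "lrf r F (\<lambda>n. nrm (X n) ((0::nat => 'a) n)) \<le> 0" if "finite F" "F \<subseteq> A" for F
  proof -
   have "lrf r F (\<lambda>n. nrm (X n) ((0::nat => 'a) n)) = lrf r F (\<lambda>n. 0)"
    using that X by (intro lrf_cong) (auto simp: normed_spaceD(10))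
   then show ?thesis using that r by simp
  qed
  then show "0 \<in> carr ?Y" "nrm ?Y 0 \<le> 0"
   using lr_sumI[OF r X A, where f = 0 and C = 0] X by (auto simp: normed_spaceD(6))
 qed
 have pos: "0 \<le> nrm ?Y f" if "f \<in> carr ?Y" for f
  using lr_sum_nrm_ge[OF r X that A, where F = "{}"] by simp
 have def0: "f = 0" if f: "f \<in> carr ?Y" and 0: "nrm ?Y f = 0" for f
 proof
  fix n
  show "f n = 0 n"
  proof (cases "n \<in> A")
   case True
   then show ?thesis
    using lr_sum_coord_le[OF r X f True] 0 nn[OF f True] normed_spaceD(3)[OF X[rule_format, OF True] co[OF f True]]
    by simp
  qed (use lr_sum_coord(2)[OF f] in auto)
 qed
 have sceq: "nrm ?Y (c *\<^sub>R f) = \<bar>c\<bar> * nrm ?Y f" if f: "f \<in> carr ?Y" for f c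
 proof (cases "c = 0")
  case True
  then show ?thesis using zero pos[OF zero(1)] by simp
 next
  case False
  have cf: "c *\<^sub>R f \<in> carr ?Y" using sc[OF f] by blast
  have "nrm ?Y f = nrm ?Y (inverse c *\<^sub>R (c *\<^sub>R f))" using False by simp
  also have "... \<le> \<bar>inverse c\<bar> * nrm ?Y (c *\<^sub>R f)" using sc[OF cf] by blast
  finally have "\<bar>c\<bar> * nrm ?Y f \<le> nrm ?Y (c *\<^sub>R f)" using False by (simp add: field_simps)
  then show ?thesis using sc[OF f, of c] by simp
 qed
 show ?thesis
  unfolding normed_space_def subspace_def
  using add sc zero pos def0 sceq pos[OF zero(1)] by (auto intro: antisym)
qed

lemma banach_spaceD:
 assumes "banach_space X" "\<And>k. u k \<in> carr X"
  "\<And>e. e > 0 ==> \<exists>M. \<forall>k\<ge>M. \<forall>l\<ge>M. nrm X (u k - u l) < e"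
 obtains x where "x \<in> carr X" "(\<lambda>k. nrm X (u k - x)) \<longlonglongrightarrow> 0"
 using assms unfolding banach_space_def by metis

text \<open>Limits exist coordinatewise. The Cauchy bound on a finite section survives the passage
  to the limit, because there the distance to the limit is at most a finite sum of coordinate
  distances, which tends to 0.\<close>

lemma lr_sum_banach:
 assumes r: "1 \<le> r" and B: "\<forall>n\<in>A. banach_space (X n)" and A: "A \<noteq> {}"
 shows "banach_space (lr_sum r A X)"
proof -
 let ?Y = "lr_sum r A X"
 have X: "\<forall>n\<in>A. normed_space (X n)" using B by (simp add: banach_space_def)
 have Y: "normed_space ?Y" by (rule lr_sum_normed[OF r X A])
 have "\<exists>x\<in>carr ?Y. (\<lambda>k. nrm ?Y (u k - x)) \<longlonglongrightarrow> 0"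
  if u: "\<And>k. u k \<in> carr ?Y"
   and cauchy: "\<And>e. e > 0 ==> \<exists>M. \<forall>k\<ge>M. \<forall>l\<ge>M. nrm ?Y (u k - u l) < e" for u
 proof -
  have un: "u k n \<in> carr (X n)" if "n \<in> A" for k n by (rule lr_sum_coord(1)[OF u that])
  have ukl: "u k - u l \<in> carr ?Y" for k l using u by (intro normed_spaceD(8)[OF Y])
  have "\<exists>x\<in>carr (X n). (\<lambda>k. nrm (X n) (u k n - x)) \<longlonglongrightarrow> 0" if n: "n \<in> A" for n
  proof -
   have "\<exists>M. \<forall>k\<ge>M. \<forall>l\<ge>M. nrm (X n) (u k n - u l n) < e" if "e > 0" for e
   proof -
    obtain M where M: "\<forall>k\<ge>M. \<forall>l\<ge>M. nrm ?Y (u k - u l) < e" using cauchy[OF \<open>e > 0\<close>] by blast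
    have "nrm (X n) (u k n - u l n) < e" if "k \<ge> M" "l \<ge> M" for k l
     using lr_sum_coord_le[OF r X ukl[of k l] n] M that by fastforce
    then show ?thesis by blast
   qed
   then show ?thesis using banach_spaceD[OF B[rule_format, OF n], of "\<lambda>k. u k n"] un[OF n] by metis
  qed
  then obtain x0 where x0: "\<And>n. n \<in> A ==> x0 n \<in> carr (X n)"
    "\<And>n. n \<in> A ==> (\<lambda>k. nrm (X n) (u k n - x0 n)) \<longlonglongrightarrow> 0"
   by metis
  define x where "x n = (if n \<in> A then x0 n else 0)" for n
  have xn: "x n \<in> carr (X n)" if "n \<in> A" for n using x0 that by (simp add: x_def)
  have key: "u k - x \<in> carr ?Y \<and> nrm ?Y (u k - x) \<le> e"
   if M: "\<forall>k\<ge>M. \<forall>l\<ge>M. nrm ?Y (u k - u l) < e" and k: "k \<ge> M" for M e k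
  proof -
   have "lrf r F (\<lambda>n. nrm (X n) ((u k - x) n)) \<le> e" if F: "finite F" "F \<subseteq> A" for F
   proof (rule LIMSEQ_le_const)
    show "(\<lambda>l. e + (\<Sum>n\<in>F. nrm (X n) (u l n - x n))) \<longlonglongrightarrow> e"
     using x0(2) F by (auto simp: x_def subset_iff intro!: tendsto_eq_intros tendsto_null_sum)
    show "\<exists>N. \<forall>l\<ge>N. lrf r F (\<lambda>n. nrm (X n) ((u k - x) n)) \<le> e + (\<Sum>n\<in>F. nrm (X n) (u l n - x n))"
    proof (intro exI[of _ M] allI impI)
     fix l assume l: "l \<ge> M"
     have c: "u k n - u l n \<in> carr (X n)" "u l n - x n \<in> carr (X n)" "u k n - x n \<in> carr (X n)"
      if "n \<in> F" for n using un xn that F X by (auto intro!: normed_spaceD(8))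
     have "lrf r F (\<lambda>n. nrm (X n) ((u k - x) n))
       \<le> lrf r F (\<lambda>n. nrm (X n) (u k n - u l n) + nrm (X n) (u l n - x n))"
     proof (rule lrf_mono[OF r F(1)])
      fix n assume n: "n \<in> F"
      then show "0 \<le> nrm (X n) ((u k - x) n)" using c[OF n] X F normed_spaceD(2) by auto
      show "nrm (X n) ((u k - x) n) \<le> nrm (X n) (u k n - u l n) + nrm (X n) (u l n - x n)"
       using normed_spaceD(5)[OF _ c(1,2)[OF n]] X n F by auto
     qed
     also have "... \<le> lrf r F (\<lambda>n. nrm (X n) (u k n - u l n)) + lrf r F (\<lambda>n. nrm (X n) (u l n - x n))"
      using c X F by (intro lrf_triangle[OF r F(1)]) (auto intro!: normed_spaceD(2))
     also have "lrf r F (\<lambda>n. nrm (X n) (u k n - u l n)) \<le> e"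
      using lr_sum_nrm_ge[OF r X ukl[of k l] A F] M k l by fastforce
     also have "lrf r F (\<lambda>n. nrm (X n) (u l n - x n)) \<le> (\<Sum>n\<in>F. nrm (X n) (u l n - x n))"
      using c X F by (intro lrf_le_sum[OF r F(1)]) (auto intro!: normed_spaceD(2))
     finally show "lrf r F (\<lambda>n. nrm (X n) ((u k - x) n)) \<le> e + (\<Sum>n\<in>F. nrm (X n) (u l n - x n))"
      by simp
    qed
   qed
   moreover have "(u k - x) n \<in> carr (X n)" if "n \<in> A" for n
    using normed_spaceD(8)[OF bspec[OF X that] un[OF that] xn[OF that]] by simp
   moreover have "(u k - x) n = 0" if "n \<notin> A" for n
    using lr_sum_coord(2)[OF u that] that by (simp add: x_def)
   ultimately show ?thesis
    using lr_sumI[OF r X A, where f = "u k - x" and C = e] by blast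
  qed
  obtain M1 where M1: "\<forall>k\<ge>M1. \<forall>l\<ge>M1. nrm ?Y (u k - u l) < 1" using cauchy[of 1] by auto
  have "u M1 - x \<in> carr ?Y" using key[OF M1 order_refl] by blast
  then have "u M1 - (u M1 - x) \<in> carr ?Y" by (rule normed_spaceD(8)[OF Y u])
  moreover have "u M1 - (u M1 - x) = x" by (simp add: fun_eq_iff)
  ultimately have x: "x \<in> carr ?Y" by simp
  have "(\<lambda>k. nrm ?Y (u k - x)) \<longlonglongrightarrow> 0"
  proof (rule LIMSEQ_I)
   fix e :: real assume "e > 0"
   then obtain M where M: "\<forall>k\<ge>M. \<forall>l\<ge>M. nrm ?Y (u k - u l) < e / 2" using cauchy[of "e / 2"] by auto
   have "norm (nrm ?Y (u k - x) - 0) < e" if "k \<ge> M" for k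
   proof -
    have "0 \<le> nrm ?Y (u k - x)" using key[OF M that] normed_spaceD(2)[OF Y] by blast
    then show ?thesis using key[OF M that] \<open>e > 0\<close> by auto
   qed
   then show "\<exists>M. \<forall>k\<ge>M. norm (nrm ?Y (u k - x) - 0) < e" by blast
  qed
  then show ?thesis using x by blast
 qed
 then show ?thesis unfolding banach_space_def using Y by blast
qed

section \<open>Operators with explicit constants and coordinatewise maps\<close>

text \<open>Unlike \<open>bounded_op\<close>, the constant is visible: operators on the coordinates
  can be glued to an operator on a sum only when one constant serves them all.\<close>

definition op_le :: "'a::real_vector nspace => 'b::real_vector nspace => real => ('a => 'b) => bool" where
 "op_le X Y C T \<longleftrightarrow> T ` carr X \<subseteq> carr Y \<and>
   (\<forall>x\<in>carr X. \<forall>y\<in>carr X. T (x + y) = T x + T y) \<and>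
   (\<forall>c. \<forall>x\<in>carr X. T (c *\<^sub>R x) = c *\<^sub>R T x) \<and>
   (\<forall>x\<in>carr X. nrm Y (T x) \<le> C * nrm X x)"

lemma op_le_bounded: "op_le X Y C T ==> bounded_op X Y T"
 unfolding op_le_def bounded_op_def by blast

lemma op_leD:
 assumes "op_le X Y C T"
 shows "x \<in> carr X ==> T x \<in> carr Y" "x \<in> carr X ==> nrm Y (T x) \<le> C * nrm X x"
  "x \<in> carr X ==> y \<in> carr X ==> T (x + y) = T x + T y"
  "x \<in> carr X ==> T (c *\<^sub>R x) = c *\<^sub>R T x"
 using assms by (auto simp: op_le_def)

lemma op_leI:
 assumes "\<And>x. x \<in> carr X ==> T x \<in> carr Y"
  "\<And>x y. x \<in> carr X ==> y \<in> carr X ==> T (x + y) = T x + T y"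
  "\<And>c x. x \<in> carr X ==> T (c *\<^sub>R x) = c *\<^sub>R T x"
  "\<And>x. x \<in> carr X ==> nrm Y (T x) \<le> C * nrm X x"
 shows "op_le X Y C T"
 using assms unfolding op_le_def by blast

lemma op_le_comp:
 assumes "op_le X Y C T" "op_le Y Z D S" "0 \<le> D"
 shows "op_le X Z (D * C) (\<lambda>x. S (T x))"
proof (rule op_leI)
 fix x assume x: "x \<in> carr X"
 have "nrm Z (S (T x)) \<le> D * nrm Y (T x)" using op_leD[OF assms(1)] op_leD[OF assms(2)] x by blast
 also have "... \<le> D * (C * nrm X x)" using op_leD[OF assms(1)] x assms(3) by (intro mult_left_mono) auto
 finally show "nrm Z (S (T x)) \<le> D * C * nrm X x" by (simp add: mult.assoc)
qed (use op_leD[OF assms(1)] op_leD[OF assms(2)] in auto)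

lemma bounded_op_le:
 assumes "normed_space X" "bounded_op X Y T"
 obtains C where "0 \<le> C" "op_le X Y C T"
proof -
 obtain C where "0 \<le> C" "\<And>x. x \<in> carr X ==> nrm Y (T x) \<le> C * nrm X x"
  using bounded_op_bound[OF assms] by blast
 then show ?thesis using assms(2) by (intro that[of C] op_leI) (auto simp: bounded_opD)
qed

text \<open>The common source of operators between sums. As \<open>\<sigma>\<close> is injective on
  \<open>B0\<close>, each source coordinate is used at most once, so a finite section of the image
  is dominated by a finite section of the argument. Inclusions, truncations, shifts and changes of
  index are instances.\<close>

lemma lr_sum_map:
 assumes r: "1 \<le> r" and X: "\<forall>n\<in>A. normed_space (X n)" and A: "A \<noteq> {}"
  and Y: "\<forall>m\<in>B. normed_space (Y m)" and B: "B \<noteq> {}"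
  and B0: "B0 \<subseteq> B" "inj_on \<sigma> B0" "\<sigma> ` B0 \<subseteq> A" and C: "0 \<le> C"
  and T: "\<And>m. m \<in> B0 ==> op_le (X (\<sigma> m)) (Y m) C (T m)"
 shows "op_le (lr_sum r A X) (lr_sum r B Y) C (\<lambda>f m. if m \<in> B0 then T m (f (\<sigma> m)) else 0)"
proof (rule op_leI)
 let ?X = "lr_sum r A X" and ?Y = "lr_sum r B Y"
 note co = lr_sum_coord(1)[where r = r and A = A and X = X]
 let ?g = "\<lambda>f m. if m \<in> B0 then T m (f (\<sigma> m)) else 0"
 have main: "?g f \<in> carr ?Y" "nrm ?Y (?g f) \<le> C * nrm ?X f" if f: "f \<in> carr ?X" for f
 proof -
  have nX: "0 \<le> nrm (X n) (f n)" if "n \<in> A" for n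
   using normed_spaceD(2)[OF X[rule_format, OF that] co[OF f that]] .
  have "lrf r F (\<lambda>m. nrm (Y m) (?g f m)) \<le> C * nrm ?X f" if F: "finite F" "F \<subseteq> B" for F
  proof -
   let ?F = "F \<inter> B0"
   have s: "\<sigma> m \<in> A" if "m \<in> ?F" for m using B0 that by auto
   have z: "nrm (Y m) 0 = 0" if "m \<in> B" for m using normed_spaceD(10)[OF Y[rule_format, OF that]] .
   have "lrf r F (\<lambda>m. nrm (Y m) (?g f m))
     \<le> lrf r ?F (\<lambda>m. nrm (Y m) (?g f m)) + lrf r (F - B0) (\<lambda>m. nrm (Y m) (?g f m))"
   proof -
    have "0 \<le> nrm (Y m) (?g f m)" if "m \<in> F" for m
    proof (cases "m \<in> B0")
     case True
     then have "T m (f (\<sigma> m)) \<in> carr (Y m)" using op_leD(1)[OF T[OF True]] co[OF f] B0 by blast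
     then show ?thesis using True normed_spaceD(2)[OF bspec[OF Y]] B0 by auto
    qed (use z that F in auto)
    then show ?thesis using lrf_Un[OF r, of ?F "F - B0"] F by (simp add: Int_Diff_Un)
   qed
   also have "lrf r (F - B0) (\<lambda>m. nrm (Y m) (?g f m)) = lrf r (F - B0) (\<lambda>m. 0)"
    using F z by (intro lrf_cong) auto
   also have "... = 0" using F r by simp
   also have "lrf r ?F (\<lambda>m. nrm (Y m) (?g f m)) \<le> lrf r ?F (\<lambda>m. C * nrm (X (\<sigma> m)) (f (\<sigma> m)))"
   proof (rule lrf_mono[OF r])
    fix m assume m: "m \<in> ?F"
    then have fm: "f (\<sigma> m) \<in> carr (X (\<sigma> m))" and Tm: "op_le (X (\<sigma> m)) (Y m) C (T m)"
     using co[OF f] s T by auto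
    show "0 \<le> nrm (Y m) (?g f m)"
     using m op_leD(1)[OF Tm fm] normed_spaceD(2)[OF bspec[OF Y]] B0 by auto
    show "nrm (Y m) (?g f m) \<le> C * nrm (X (\<sigma> m)) (f (\<sigma> m))"
     using m op_leD(2)[OF Tm fm] by simp
   qed (use F in auto)
   also have "... = C * lrf r ?F (\<lambda>m. nrm (X (\<sigma> m)) (f (\<sigma> m)))"
    using F C nX s by (intro lrf_scale[OF r]) auto
   also have "lrf r ?F (\<lambda>m. nrm (X (\<sigma> m)) (f (\<sigma> m))) = lrf r (\<sigma> ` ?F) (\<lambda>n. nrm (X n) (f n))"
    using B0 by (intro lrf_image[symmetric]) (auto simp: inj_on_def)
   also have "... \<le> nrm ?X f"
    using F s by (intro lr_sum_nrm_ge[OF r X f A]) auto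
   finally show ?thesis using C by (simp add: mult_left_mono)
  qed
  moreover have "?g f m \<in> carr (Y m)" if "m \<in> B" for m
   using that op_leD(1)[OF T] co[OF f] B0 normed_spaceD(6)[OF bspec[OF Y]] by auto
  moreover have "?g f m = 0" if "m \<notin> B" for m using that B0 by auto
  ultimately show "?g f \<in> carr ?Y" "nrm ?Y (?g f) \<le> C * nrm ?X f"
   using lr_sumI[OF r Y B, where f = "?g f" and C = "C * nrm ?X f"] by blast+
 qed
 show "?g f \<in> carr ?Y" "nrm ?Y (?g f) \<le> C * nrm ?X f" if "f \<in> carr ?X" for f
  using main that by blast+
 show "?g (f + h) = ?g f + ?g h" if "f \<in> carr ?X" "h \<in> carr ?X" for f h
  using op_leD(3)[OF T] co[OF that(1)] co[OF that(2)] B0 by (fastforce simp: fun_eq_iff)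
 show "?g (c *\<^sub>R f) = c *\<^sub>R ?g f" if "f \<in> carr ?X" for c f
  using op_leD(4)[OF T] co[OF that(1)] B0 by (fastforce simp: fun_eq_iff scaleR_fun_def)
qed

section \<open>Isomorphism, complemented subspaces and products\<close>

lemma isomorphic_spacesI:
 assumes "bounded_op X Y T" "bounded_op Y X S"
  "\<And>x. x \<in> carr X ==> S (T x) = x" "\<And>y. y \<in> carr Y ==> T (S y) = y"
 shows "isomorphic_spaces X Y"
 using assms unfolding isomorphic_spaces_def by blast

lemma isomorphic_spaces_sym: "isomorphic_spaces X Y ==> isomorphic_spaces Y X"
 unfolding isomorphic_spaces_def by blast

lemma isomorphic_spaces_trans:
 assumes "normed_space X" "normed_space Y" "normed_space Z"
  "isomorphic_spaces X Y" "isomorphic_spaces Y Z"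
 shows "isomorphic_spaces X Z"
proof -
 obtain T S where TS: "bounded_op X Y T" "bounded_op Y X S"
   "\<And>x. x \<in> carr X ==> S (T x) = x" "\<And>y. y \<in> carr Y ==> T (S y) = y"
  using assms(4) unfolding isomorphic_spaces_def by blast
 obtain T' S' where TS': "bounded_op Y Z T'" "bounded_op Z Y S'"
   "\<And>x. x \<in> carr Y ==> S' (T' x) = x" "\<And>y. y \<in> carr Z ==> T' (S' y) = y"
  using assms(5) unfolding isomorphic_spaces_def by blast
 show ?thesis
 proof (rule isomorphic_spacesI)
  show "bounded_op X Z (\<lambda>x. T' (T x))" using TS TS' assms bounded_op_comp by blast
  show "bounded_op Z X (\<lambda>x. S (S' x))" using TS TS' assms bounded_op_comp by blast
 qed (use TS TS' in \<open>auto simp: bounded_opD\<close>)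
qed

definition complemented :: "'a::real_vector nspace => 'b::real_vector nspace => bool" where
 "complemented Y W \<longleftrightarrow> (\<exists>i p. bounded_op Y W i \<and> bounded_op W Y p \<and> (\<forall>y\<in>carr Y. p (i y) = y))"

lemma isomorphic_complemented: "isomorphic_spaces X Y ==> complemented X Y"
 unfolding isomorphic_spaces_def complemented_def by blast

lemma complemented_trans:
 assumes "normed_space X" "normed_space Y" "normed_space Z" "complemented X Y" "complemented Y Z"
 shows "complemented X Z"
proof -
 obtain i p where ip: "bounded_op X Y i" "bounded_op Y X p" "\<And>x. x \<in> carr X ==> p (i x) = x"
  using assms(4) unfolding complemented_def by blast
 obtain j q where jq: "bounded_op Y Z j" "bounded_op Z Y q" "\<And>y. y \<in> carr Y ==> q (j y) = y"
  using assms(5) unfolding complemented_def by blast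
 have "bounded_op X Z (\<lambda>x. j (i x))" "bounded_op Z X (\<lambda>z. p (q z))"
  using ip jq assms bounded_op_comp by blast+
 moreover have "p (q (j (i x))) = x" if "x \<in> carr X" for x
  using that ip jq bounded_opD(1)[OF ip(1)] by simp
 ultimately show ?thesis unfolding complemented_def by blast
qed

definition nprod :: "'a nspace => 'b nspace => ('a \<times> 'b) nspace" where
 "nprod X Y = \<lparr>carr = carr X \<times> carr Y, nrm = (\<lambda>(x, y). nrm X x + nrm Y y)\<rparr>"

lemma nprod_normed:
 assumes X: "normed_space X" and Y: "normed_space Y"
 shows "normed_space (nprod X Y)"
 unfolding normed_space_def
proof (intro conjI)
 show "subspace (carr (nprod X Y))"
  unfolding nprod_def subspace_def using normed_spaceD(6,7,9)[OF X] normed_spaceD(6,7,9)[OF Y]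
  by (auto simp: zero_prod_def)
 show "\<forall>x\<in>carr (nprod X Y). 0 \<le> nrm (nprod X Y) x \<and> (nrm (nprod X Y) x = 0) = (x = 0)"
  using normed_spaceD(2,3)[OF X] normed_spaceD(2,3)[OF Y]
  by (auto simp: nprod_def zero_prod_def add_nonneg_eq_0_iff)
 show "\<forall>c. \<forall>x\<in>carr (nprod X Y). nrm (nprod X Y) (c *\<^sub>R x) = \<bar>c\<bar> * nrm (nprod X Y) x"
  using normed_spaceD(4)[OF X] normed_spaceD(4)[OF Y] by (auto simp: nprod_def distrib_left)
 show "\<forall>x\<in>carr (nprod X Y). \<forall>y\<in>carr (nprod X Y).
   nrm (nprod X Y) (x + y) \<le> nrm (nprod X Y) x + nrm (nprod X Y) y"
  using normed_spaceD(5)[OF X] normed_spaceD(5)[OF Y] by (fastforce simp: nprod_def)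
qed

lemma bounded_op_nprod_map:
 assumes X: "normed_space X" "normed_space Y" and T: "bounded_op X X' T" and S: "bounded_op Y Y' S"
 shows "bounded_op (nprod X Y) (nprod X' Y') (\<lambda>(x, y). (T x, S y))"
proof -
 obtain C where C: "0 \<le> C" "\<And>x. x \<in> carr X ==> nrm X' (T x) \<le> C * nrm X x"
  using bounded_op_bound[OF X(1) T] by blast
 obtain D where D: "0 \<le> D" "\<And>x. x \<in> carr Y ==> nrm Y' (S x) \<le> D * nrm Y x"
  using bounded_op_bound[OF X(2) S] by blast
 have "nrm X' (T x) + nrm Y' (S y) \<le> (C + D) * (nrm X x + nrm Y y)"
  if "x \<in> carr X" "y \<in> carr Y" for x y
 proof -
  have "nrm X' (T x) + nrm Y' (S y) \<le> C * nrm X x + D * nrm Y y"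
   by (intro add_mono C D that)
  moreover have "0 \<le> D * nrm X x" "0 \<le> C * nrm Y y"
   using C D that normed_spaceD(2)[OF X(1)] normed_spaceD(2)[OF X(2)] by auto
  ultimately show ?thesis by (simp add: algebra_simps)
 qed
 then show ?thesis
  using bounded_opD[OF T] bounded_opD[OF S]
  by (intro bounded_opI[where C = "C + D"]) (auto simp: nprod_def)
qed

lemma bounded_op_pair:
 assumes X: "normed_space X" and T: "bounded_op X Y T" and S: "bounded_op X Z S"
 shows "bounded_op X (nprod Y Z) (\<lambda>x. (T x, S x))"
proof -
 obtain C where C: "op_le X Y C T" using bounded_op_le[OF X T] by blast
 obtain D where D: "op_le X Z D S" using bounded_op_le[OF X S] by blast
 show ?thesis
 proof (rule bounded_opI)
  show "nrm (nprod Y Z) (T x, S x) \<le> (C + D) * nrm X x" if "x \<in> carr X" for x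
   using op_leD(2)[OF C that] op_leD(2)[OF D that] by (simp add: nprod_def algebra_simps)
 qed (use op_leD[OF C] op_leD[OF D] in \<open>auto simp: nprod_def\<close>)
qed

lemma bounded_op_add:
 assumes X: "normed_space X" and Y: "normed_space Y" and T: "bounded_op X Y T" and S: "bounded_op X Y S"
 shows "bounded_op X Y (\<lambda>x. T x + S x)"
proof -
 obtain C where C: "op_le X Y C T" using bounded_op_le[OF X T] by blast
 obtain D where D: "op_le X Y D S" using bounded_op_le[OF X S] by blast
 show ?thesis
 proof (rule bounded_opI)
  fix x assume x: "x \<in> carr X"
  show "nrm Y (T x + S x) \<le> (C + D) * nrm X x"
   using normed_spaceD(5)[OF Y op_leD(1)[OF C x] op_leD(1)[OF D x]]
    op_leD(2)[OF C x] op_leD(2)[OF D x] by (simp add: algebra_simps)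
  show "T x + S x \<in> carr Y" using op_leD(1)[OF C x] op_leD(1)[OF D x] normed_spaceD(7)[OF Y] by auto
 qed (use op_leD(3,4)[OF C] op_leD(3,4)[OF D] in \<open>auto simp: scaleR_add_right\<close>)
qed

lemma bounded_op_fst:
 assumes "normed_space X" "normed_space Y" shows "bounded_op (nprod X Y) X fst"
 by (rule bounded_opI[where C = 1]) (use normed_spaceD(2)[OF assms(2)] in \<open>auto simp: nprod_def\<close>)

lemma bounded_op_snd:
 assumes "normed_space X" "normed_space Y" shows "bounded_op (nprod X Y) Y snd"
 by (rule bounded_opI[where C = 1]) (use normed_spaceD(2)[OF assms(1)] in \<open>auto simp: nprod_def\<close>)

lemma isomorphic_nprod_cong:
 assumes X: "normed_space X" "normed_space Y" "normed_space X'" "normed_space Y'"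
  and "isomorphic_spaces X X'" "isomorphic_spaces Y Y'"
 shows "isomorphic_spaces (nprod X Y) (nprod X' Y')"
proof -
 obtain T S where TS: "bounded_op X X' T" "bounded_op X' X S"
   "\<And>x. x \<in> carr X ==> S (T x) = x" "\<And>y. y \<in> carr X' ==> T (S y) = y"
  using assms(5) unfolding isomorphic_spaces_def by blast
 obtain U V where UV: "bounded_op Y Y' U" "bounded_op Y' Y V"
   "\<And>x. x \<in> carr Y ==> V (U x) = x" "\<And>y. y \<in> carr Y' ==> U (V y) = y"
  using assms(6) unfolding isomorphic_spaces_def by blast
 show ?thesis
  by (rule isomorphic_spacesI[OF bounded_op_nprod_map[OF X(1,2) TS(1) UV(1)]
     bounded_op_nprod_map[OF X(3,4) TS(2) UV(2)]])
   (auto simp: nprod_def TS UV)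
qed

lemma isomorphic_refl: "isomorphic_spaces X X"
proof -
 have "bounded_op X X (\<lambda>x. x)" by (rule bounded_opI[where C = 1]) auto
 then show ?thesis by (intro isomorphic_spacesI) auto
qed

lemma isomorphic_nprod_comm: "isomorphic_spaces (nprod X Y) (nprod Y X)"
 by (rule isomorphic_spacesI[where T = prod.swap and S = prod.swap];
   (rule bounded_opI[where C = 1])?) (auto simp: nprod_def)

lemma isomorphic_nprod_assoc:
 "isomorphic_spaces (nprod (nprod X Y) Z) (nprod X (nprod Y Z))"
 by (rule isomorphic_spacesI[where T = "\<lambda>((x, y), z). (x, y, z)" and S = "\<lambda>(x, y, z). ((x, y), z)"];
   (rule bounded_opI[where C = 1])?) (auto simp: nprod_def)

lemma op_range_normed:
 assumes X: "normed_space X" and Q: "bounded_op X X Q"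
 shows "normed_space (op_range X Q)"
proof -
 have sub: "Q ` carr X \<subseteq> carr X" using bounded_opD(1)[OF Q] by auto
 have "subspace (Q ` carr X)"
  unfolding subspace_def
 proof (intro conjI ballI allI)
  show "0 \<in> Q ` carr X" using bounded_op_0[OF X Q] normed_spaceD(6)[OF X] by force
  show "a + b \<in> Q ` carr X" if "a \<in> Q ` carr X" "b \<in> Q ` carr X" for a b
   using that bounded_opD(2)[OF Q] normed_spaceD(7)[OF X] by (auto simp flip: bounded_opD(2)[OF Q])
  show "c *\<^sub>R a \<in> Q ` carr X" if "a \<in> Q ` carr X" for a c
   using that normed_spaceD(9)[OF X] by (auto simp flip: bounded_opD(3)[OF Q])
 qed
 then show ?thesis
  using X sub unfolding normed_space_def op_range_def by (auto simp: subset_iff)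
qed

section \<open>The decomposition method\<close>

text \<open>\<open>j (q y)\<close> is a projection of \<open>y\<close>, so \<open>y\<close> splits
  into this part and the remainder. Addition inverts the splitting because \<open>q\<close> vanishes
  on the remainders.\<close>

lemma complemented_split:
 assumes Y: "normed_space Y" and W: "normed_space W"
  and j: "bounded_op W Y j" and q: "bounded_op Y W q" and qj: "\<And>w. w \<in> carr W ==> q (j w) = w"
 shows "isomorphic_spaces Y (nprod W (op_range Y (\<lambda>y. y - j (q y))))"
  "bounded_op Y Y (\<lambda>y. y - j (q y))"
proof -
 obtain C where C: "0 \<le> C" "op_le W Y C j" using bounded_op_le[OF W j] by blast
 obtain D where D: "0 \<le> D" "op_le Y W D q" using bounded_op_le[OF Y q] by blast
 have jq: "op_le Y Y (C * D) (\<lambda>y. j (q y))" by (rule op_le_comp[OF D(2) C(2) C(1)])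
 have nr: "nrm Y (y - j (q y)) \<le> (1 + C * D) * nrm Y y" if "y \<in> carr Y" for y
  using normed_space_diff(1)[OF Y that op_leD(1)[OF jq that]] op_leD(2)[OF jq that]
  by (simp add: algebra_simps)
 have m: "y - j (q y) \<in> carr Y" if "y \<in> carr Y" for y
  using normed_spaceD(8)[OF Y that op_leD(1)[OF jq that]] .
 show bd: "bounded_op Y Y (\<lambda>y. y - j (q y))"
  using m nr op_leD(3,4)[OF jq]
  by (intro bounded_opI[where C = "1 + C * D"]) (auto simp: algebra_simps)
 let ?V = "op_range Y (\<lambda>y. y - j (q y))"
 have q0: "q (y - j (q y)) = 0" if "y \<in> carr Y" for y
  using bounded_op_diff[OF Y q that op_leD(1)[OF jq that]] qj[OF op_leD(1)[OF D(2) that]] by simp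
 have V: "v \<in> carr Y" "q v = 0" if "v \<in> carr ?V" for v
  using that m q0 by (auto simp: op_range_def)
 show "isomorphic_spaces Y (nprod W ?V)"
 proof (rule isomorphic_spacesI)
  show "bounded_op Y (nprod W ?V) (\<lambda>y. (q y, y - j (q y)))"
  proof (rule bounded_opI)
   fix y assume y: "y \<in> carr Y"
   show "nrm (nprod W ?V) (q y, y - j (q y)) \<le> (D + (1 + C * D)) * nrm Y y"
    using op_leD(2)[OF D(2) y] nr[OF y] by (simp add: nprod_def op_range_def algebra_simps)
  qed (use op_leD[OF D(2)] bounded_opD[OF bd] in \<open>auto simp: nprod_def op_range_def\<close>)
  show "bounded_op (nprod W ?V) Y (\<lambda>(w, v). j w + v)"
  proof (rule bounded_opI)
   fix x assume x: "x \<in> carr (nprod W ?V)"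
   obtain w v where wv: "x = (w, v)" "w \<in> carr W" "v \<in> carr ?V"
    using x by (auto simp: nprod_def)
   show "(case x of (w, v) => j w + v) \<in> carr Y"
    using wv V op_leD(1)[OF C(2)] normed_spaceD(7)[OF Y] by auto
   have "nrm Y (j w + v) \<le> nrm Y (j w) + nrm Y v"
    using wv V op_leD(1)[OF C(2)] by (intro normed_spaceD(5)[OF Y]) auto
   also have "... \<le> C * nrm W w + nrm Y v" using op_leD(2)[OF C(2) wv(2)] by simp
   also have "... \<le> (C + 1) * (nrm W w + nrm Y v)"
    using C(1) normed_spaceD(2)[OF W wv(2)] normed_spaceD(2)[OF Y V(1)[OF wv(3)]]
    by (simp add: algebra_simps)
   finally show "nrm Y (case x of (w, v) => j w + v) \<le> (C + 1) * nrm (nprod W ?V) x"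
    using wv by (simp add: nprod_def op_range_def)
  qed (use op_leD[OF C(2)] in \<open>auto simp: nprod_def scaleR_add_right\<close>)
  show "(case (q y, y - j (q y)) of (w, v) => j w + v) = y" for y by simp
  fix x assume x: "x \<in> carr (nprod W ?V)"
  obtain w v where wv: "x = (w, v)" "w \<in> carr W" "v \<in> carr ?V"
   using x by (auto simp: nprod_def)
  have "q (j w + v) = w"
   using bounded_opD(2)[OF q op_leD(1)[OF C(2) wv(2)] V(1)[OF wv(3)]] V(2)[OF wv(3)] qj[OF wv(2)] by simp
  then show "(\<lambda>y. (q y, y - j (q y))) (case x of (w, v) => j w + v) = x" using wv by simp
 qed
qed

text \<open>Shifting the \<open>Y\<close>-components of a sequence by one position exhibits \<open>Y\<close> as a factor.\<close>

lemma lr_power_absorbs: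
 assumes r: "1 \<le> r" and Y: "normed_space Y" and W: "normed_space W" and c: "complemented Y W"
 defines "L \<equiv> lr_sum r UNIV (\<lambda>_. W)"
 shows "isomorphic_spaces L (nprod Y L)"
proof -
 obtain i p where ip: "bounded_op Y W i" "bounded_op W Y p" "\<And>y. y \<in> carr Y ==> p (i y) = y"
  using c unfolding complemented_def by blast
 obtain C where C: "0 \<le> C" "op_le Y W C i" using bounded_op_le[OF Y ip(1)] by blast
 obtain D where D: "0 \<le> D" "op_le W Y D p" using bounded_op_le[OF W ip(2)] by blast
 have L: "normed_space L" unfolding L_def using W by (intro lr_sum_normed[OF r]) auto
 define P where "P w = i (p w)" for w
 have P: "op_le W W (C * D) P" unfolding P_def by (rule op_le_comp[OF D(2) C(2) C(1)])
 have P0: "P 0 = 0" using bounded_op_0[OF W op_le_bounded[OF P]] .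
 have PP: "P (P w) = P w" if "w \<in> carr W" for w
  using that ip(3) op_leD(1)[OF D(2)] by (simp add: P_def)
 have pP: "p (P w) = p w" if "w \<in> carr W" for w
  using that ip(3) op_leD(1)[OF D(2)] by (simp add: P_def)
 have id: "op_le W W 1 (\<lambda>w. w)" by (rule op_leI) auto
 have CD: "0 \<le> C * D" using C D by simp
 define Q where "Q w = w - P w" for w
 have Pd: "P (a - b) = P a - P b" if "a \<in> carr W" "b \<in> carr W" for a b
  using bounded_op_diff[OF W op_le_bounded[OF P] that] .
 have Q: "op_le W W (1 + C * D) Q"
  unfolding Q_def
 proof (rule op_leI)
  fix w assume w: "w \<in> carr W"
  show "w - P w \<in> carr W" using w op_leD(1)[OF P] normed_spaceD(8)[OF W] by auto
  show "nrm W (w - P w) \<le> (1 + C * D) * nrm W w"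
   using normed_space_diff(1)[OF W w op_leD(1)[OF P w]] op_leD(2)[OF P w]
   by (simp add: algebra_simps)
 qed (use op_leD(3,4)[OF P] in \<open>auto simp: algebra_simps\<close>)
 have QD: "0 \<le> 1 + C * D" using CD by simp
 have coQ: "op_le L L (1 + C * D) (\<lambda>f k. Q (f k))"
  using lr_sum_map[OF r _ _ _ _ _ _ _ QD, of UNIV "\<lambda>_. W" UNIV "\<lambda>_. W" UNIV "\<lambda>k. k" "\<lambda>_. Q"] W Q
  by (simp add: L_def)
 have shl: "op_le L L (C * D) (\<lambda>f k. P (f (Suc k)))"
  using lr_sum_map[OF r _ _ _ _ _ _ _ CD, of UNIV "\<lambda>_. W" UNIV "\<lambda>_. W" UNIV Suc "\<lambda>_. P"] W P
  by (simp add: L_def)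
 have shr: "op_le L L (C * D) (\<lambda>f k. if k \<in> {1..} then P (f (k - 1)) else 0)"
  unfolding L_def
 proof (rule lr_sum_map[OF r])
  show "inj_on (\<lambda>k::nat. k - 1) {1..}" by (auto simp: inj_on_def)
 qed (use W P CD in simp_all)
 have co: "f k \<in> carr W" if "f \<in> carr L" for f k
  using lr_sum_coord(1)[of f r UNIV "\<lambda>_. W"] that by (simp add: L_def)
 have cole: "nrm W (f k) \<le> nrm L f" if "f \<in> carr L" for f k
  using lr_sum_coord_le[OF r, of UNIV "\<lambda>_. W" f k] that W by (simp add: L_def)
 have inj: "op_le Y L C (\<lambda>y k. if k = 0 then i y else 0)"
 proof (rule op_leI)
  fix y assume y: "y \<in> carr Y"
  have iy: "i y \<in> carr W" "0 \<le> nrm W (i y)" using op_leD(1)[OF C(2) y] normed_spaceD(2)[OF W] by auto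
  have "lrf r F (\<lambda>k. nrm W (if k = 0 then i y else 0)) \<le> C * nrm Y y" if F: "finite F" for F :: "nat set"
  proof -
   have "lrf r F (\<lambda>k. nrm W (if k = 0 then i y else 0)) \<le> (\<Sum>k\<in>F. nrm W (if k = 0 then i y else 0))"
    using F iy normed_spaceD(10)[OF W] by (intro lrf_le_sum[OF r]) auto
   also have "... = (\<Sum>k\<in>F. if k = 0 then nrm W (i y) else 0)"
    using normed_spaceD(10)[OF W] by (intro sum.cong) auto
   also have "... \<le> nrm W (i y)" using F iy by (simp add: sum.delta)
   also have "... \<le> C * nrm Y y" by (rule op_leD(2)[OF C(2) y])
   finally show ?thesis .
  qed
  then show "(\<lambda>k. if k = 0 then i y else 0) \<in> carr L"
    "nrm L (\<lambda>k. if k = 0 then i y else 0) \<le> C * nrm Y y"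
   using lr_sumI[OF r, of UNIV "\<lambda>_. W" "\<lambda>k. if k = 0 then i y else 0" "C * nrm Y y"]
    W iy normed_spaceD(6)[OF W] by (auto simp: L_def)
 qed (use op_leD(3,4)[OF C(2)] in \<open>auto simp: fun_eq_iff scaleR_fun_def\<close>)
 have p0: "p (Q w) = 0" "P (Q w) = 0" "Q (P w) = 0" "Q (Q w) = Q w" "P w \<in> carr W" "Q w \<in> carr W"
  if w: "w \<in> carr W" for w
 proof -
  have Pw: "P w \<in> carr W" using op_leD(1)[OF P w] .
  show "p (Q w) = 0" using bounded_op_diff[OF W ip(2) w Pw] pP[OF w] by (simp add: Q_def)
  show PQ: "P (Q w) = 0" using Pd[OF w Pw] PP[OF w] by (simp add: Q_def)
  show "Q (P w) = 0" using PP[OF w] by (simp add: Q_def)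
  show "Q (Q w) = Q w" using PQ by (simp add: Q_def)
  show "P w \<in> carr W" "Q w \<in> carr W" using Pw op_leD(1)[OF Q w] by auto
 qed
 note Padd = op_leD(3)[OF P] and Qadd = op_leD(3)[OF Q] and padd = op_leD(3)[OF D(2)]
 have iy: "i y \<in> carr W" "P (i y) = i y" "Q (i y) = 0" if "y \<in> carr Y" for y
  using op_leD(1)[OF C(2) that] ip(3)[OF that] by (auto simp: P_def Q_def)
 define T where "T f = (\<lambda>k. Q (f k)) + (\<lambda>k. P (f (Suc k)))" for f :: "nat => 'b"
 define S where "S x = (\<lambda>k. if k = 0 then i (fst x) else 0) + ((\<lambda>k. Q (snd x k))
   + (\<lambda>k. if k \<in> {1..} then P (snd x (k - 1)) else 0))" for x :: "'a \<times> (nat => 'b)"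
 have YL: "normed_space (nprod Y L)" using nprod_normed[OF Y L] .
 show ?thesis
 proof (rule isomorphic_spacesI)
  have "bounded_op L W (\<lambda>f. f 0)" by (rule bounded_opI[where C = 1]) (auto simp: co cole scaleR_fun_def)
  then show "bounded_op L (nprod Y L) (\<lambda>f. (p (f 0), T f))"
   unfolding T_def
   by (intro bounded_op_pair[OF L] bounded_op_add[OF L L] bounded_op_comp[OF L W _ ip(2)]
     op_le_bounded[OF coQ] op_le_bounded[OF shl])
  show "bounded_op (nprod Y L) L S"
   unfolding S_def
   by (intro bounded_op_add[OF YL L] bounded_op_comp[OF YL L _ op_le_bounded[OF coQ]]
     bounded_op_comp[OF YL L _ op_le_bounded[OF shr]] bounded_op_comp[OF YL Y _ op_le_bounded[OF inj]]
     bounded_op_fst[OF Y L] bounded_op_snd[OF Y L])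
  show "S (p (f 0), T f) = f" if f: "f \<in> carr L" for f
  proof
   fix k
   note fc = co[OF f]
   have a: "Q (T f k) = Q (f k)" "P (T f k) = P (f (Suc k))" for k
    using fc p0[OF fc] by (simp_all add: T_def Qadd Padd PP)
   have PQ: "P (f k) + Q (f k) = f k" for k by (simp add: Q_def)
   show "S (p (f 0), T f) k = f k"
    using PQ[of k] by (cases k) (simp_all add: S_def a P_def[of "f 0", symmetric] add.commute)
  qed
  show "(\<lambda>f. (p (f 0), T f)) (S x) = x" if x: "x \<in> carr (nprod Y L)" for x
  proof -
   obtain y v where yv: "x = (y, v)" "y \<in> carr Y" "v \<in> carr L" using x by (auto simp: nprod_def)
   note vc = co[OF yv(3)]
   have s0: "S x 0 = i y + Q (v 0)" by (simp add: S_def yv)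
   have s: "S x (Suc k) = Q (v (Suc k)) + P (v k)" for k by (simp add: S_def yv)
   have "p (S x 0) = y" unfolding s0 using iy[OF yv(2)] p0[OF vc] by (simp add: padd ip(3) yv(2))
   moreover have "T (S x) k = v k" for k
   proof -
    have "Q (S x k) = Q (v k)"
     using iy[OF yv(2)] p0[OF vc] by (cases k) (simp_all add: s0 s Qadd)
    moreover have "P (S x (Suc k)) = P (v k)" using p0[OF vc] by (simp add: s Padd PP vc)
    ultimately show ?thesis by (simp add: T_def Q_def)
   qed
   ultimately show ?thesis using yv by (auto simp: fun_eq_iff)
  qed
 qed
qed

text \<open>The isomorphism only changes indices through the pairing bijection. On the way back to
  the iterated sum every inner norm is approximated by one of its finite sections; for finitely many
  outer indices these sections are enlarged to one common finite set, so that
  \<open>lrf_Times\<close> applies.\<close>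

lemma lr_flatten:
 assumes r: "1 \<le> r" and X: "\<forall>n\<in>A. normed_space (X n)" and A: "A \<noteq> {}"
 defines "B \<equiv> {k. snd (prod_decode k) \<in> A}"
 shows "isomorphic_spaces (lr_sum r UNIV (\<lambda>_. lr_sum r A X)) (lr_sum r B (\<lambda>k. X (snd (prod_decode k))))"
  (is "isomorphic_spaces ?L ?M")
proof (rule isomorphic_spacesI)
 have N: "\<forall>n\<in>UNIV. normed_space (lr_sum r A X)" using lr_sum_normed[OF r X A] by simp
 obtain n where "n \<in> A" using A by blast
 then have "prod_encode (0, n) \<in> B" by (simp add: B_def)
 then have B: "B \<noteq> {}" by blast
 have XB: "\<forall>k\<in>B. normed_space (X (snd (prod_decode k)))" using X by (auto simp: B_def)
 define T where "T f k = f (fst (prod_decode k)) (snd (prod_decode k))" for f :: "nat => nat => 'a" and k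
 define S where "S g i j = g (prod_encode (i, j))" for g :: "nat => 'a" and i j
 have co: "f i \<in> carr (lr_sum r A X)" if "f \<in> carr ?L" for f i
  using lr_sum_coord(1)[OF that] by simp
 have T: "T f \<in> carr ?M" "nrm ?M (T f) \<le> nrm ?L f" if f: "f \<in> carr ?L" for f
 proof -
  have fij: "f i j \<in> carr (X j)" "0 \<le> nrm (X j) (f i j)" if "j \<in> A" for i j
   using lr_sum_coord(1)[OF co[OF f] that] normed_spaceD(2)[OF bspec[OF X that]] by auto
  have "lrf r F (\<lambda>k. nrm (X (snd (prod_decode k))) (T f k)) \<le> nrm ?L f"
   if F: "finite F" "F \<subseteq> B" for F
  proof -
   let ?t = "\<lambda>(i, j). nrm (X j) (f i j)"
   let ?F = "fst ` prod_decode ` F" and ?G = "snd ` prod_decode ` F"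
   have G: "?G \<subseteq> A" using F by (auto simp: B_def)
   have "lrf r F (\<lambda>k. nrm (X (snd (prod_decode k))) (T f k)) = lrf r F (\<lambda>k. ?t (prod_decode k))"
    by (intro lrf_cong) (simp add: T_def case_prod_unfold)
   also have "... = lrf r (prod_decode ` F) ?t"
    by (intro lrf_image[symmetric] inj_on_subset[OF inj_prod_decode]) auto
   also have "... \<le> lrf r (?F \<times> ?G) ?t"
   proof (rule lrf_subset[OF r])
    show "prod_decode ` F \<subseteq> ?F \<times> ?G"
    proof
     fix z assume "z \<in> prod_decode ` F"
     then have "fst z \<in> ?F" "snd z \<in> ?G" by blast+
     then show "z \<in> ?F \<times> ?G" by (simp add: mem_Times_iff)
    qed
    show "0 \<le> ?t z" if "z \<in> ?F \<times> ?G" for z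
     using that fij(2) G by (cases z) (simp add: mem_Times_iff subset_iff)
   qed (use F in simp)
   also have "... = lrf r ?F (\<lambda>i. lrf r ?G (\<lambda>j. nrm (X j) (f i j)))"
   proof (rule lrf_Times[OF r])
    show "0 \<le> nrm (X j) (f i j)" if "j \<in> ?G" for i j using fij(2) G that by blast
   qed (use F in simp_all)
   also have "... \<le> lrf r ?F (\<lambda>i. nrm (lr_sum r A X) (f i))"
    using F G lr_sum_nrm_ge[OF r X co[OF f] A] by (intro lrf_mono[OF r]) auto
   also have "... \<le> nrm ?L f"
    using F lr_sum_nrm_ge[OF r N f] by simp
   finally show ?thesis .
  qed
  moreover have "T f k \<in> carr (X (snd (prod_decode k)))" if "k \<in> B" for k
   using fij(1) that by (simp add: T_def B_def)
  moreover have "T f k = 0" if "k \<notin> B" for k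
   using lr_sum_coord(2)[OF co[OF f]] that by (simp add: T_def B_def)
  ultimately show "T f \<in> carr ?M" "nrm ?M (T f) \<le> nrm ?L f"
   using lr_sumI[OF r XB B, where f = "T f" and C = "nrm ?L f"] by blast+
 qed
 have S: "S g \<in> carr ?L" "nrm ?L (S g) \<le> nrm ?M g" if g: "g \<in> carr ?M" for g
 proof -
  have B_iff: "prod_encode (i, j) \<in> B \<longleftrightarrow> j \<in> A" for i j by (simp add: B_def)
  have gij: "S g i j \<in> carr (X j)" "0 \<le> nrm (X j) (S g i j)" if "j \<in> A" for i j
   using lr_sum_coord(1)[OF g, of "prod_encode (i, j)"] that normed_spaceD(2)[OF bspec[OF X that]]
   by (auto simp: S_def B_iff)
  have g0: "S g i j = 0" if "j \<notin> A" for i j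
   using lr_sum_coord(2)[OF g, of "prod_encode (i, j)"] that by (auto simp: S_def B_iff)
  have fin: "lrf r F (\<lambda>i. lrf r G (\<lambda>j. nrm (X j) (S g i j))) \<le> nrm ?M g"
   if F: "finite F" and G: "finite G" "G \<subseteq> A" for F G
  proof -
   have "lrf r F (\<lambda>i. lrf r G (\<lambda>j. nrm (X j) (S g i j))) = lrf r (F \<times> G) (\<lambda>(i, j). nrm (X j) (S g i j))"
    using gij G F by (intro lrf_Times[OF r, symmetric]) auto
   also have "... = lrf r (F \<times> G) (\<lambda>z. nrm (X (snd (prod_decode (prod_encode z)))) (g (prod_encode z)))"
    by (intro lrf_cong) (auto simp: S_def)
   also have "... = lrf r (prod_encode ` (F \<times> G)) (\<lambda>k. nrm (X (snd (prod_decode k))) (g k))"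
    by (intro lrf_image[symmetric] inj_on_subset[OF inj_prod_encode]) auto
   also have "... \<le> nrm ?M g"
    using F G by (intro lr_sum_nrm_ge[OF r XB g B]) (auto simp: B_iff)
   finally show ?thesis .
  qed
  have Si: "S g i \<in> carr (lr_sum r A X)" for i
   using lr_sumI(1)[OF r X A, where f = "S g i" and C = "nrm ?M g"] gij g0 fin[of "{i}"] r by simp
  have "lrf r F (\<lambda>i. nrm (lr_sum r A X) (S g i)) \<le> nrm ?M g" if F: "finite F" for F
  proof (rule field_le_epsilon)
   fix e :: real assume e: "0 < e"
   \<comment> \<open>Each of the \<open>card F\<close> inner norms is approximated within
     \<open>?e\<close>, which keeps the total error below \<open>e\<close>; the summand 1 covers an
     empty \<open>F\<close>.\<close>
   let ?e = "e / (card F + 1)"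
   have e': "0 < ?e" using e by simp
   have "\<exists>G. finite G \<and> G \<subseteq> A \<and> nrm (lr_sum r A X) (S g i) \<le> lrf r G (\<lambda>j. nrm (X j) (S g i j)) + ?e" for i
    by (rule lr_sum_nrm_approx[OF r X A Si[of i] e']) blast
   then obtain G where G: "\<And>i. finite (G i)" "\<And>i. G i \<subseteq> A"
     "\<And>i. nrm (lr_sum r A X) (S g i) \<le> lrf r (G i) (\<lambda>j. nrm (X j) (S g i j)) + ?e"
    by metis
   let ?H = "\<Union>i\<in>F. G i"
   have H: "finite ?H" "?H \<subseteq> A" using F G by auto
   have "lrf r F (\<lambda>i. nrm (lr_sum r A X) (S g i)) \<le> lrf r F (\<lambda>i. lrf r ?H (\<lambda>j. nrm (X j) (S g i j)) + ?e)"
   proof (rule lrf_mono[OF r F])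
    fix i assume i: "i \<in> F"
    show "0 \<le> nrm (lr_sum r A X) (S g i)" using normed_spaceD(2)[OF bspec[OF N] Si] by simp
    have "lrf r (G i) (\<lambda>j. nrm (X j) (S g i j)) \<le> lrf r ?H (\<lambda>j. nrm (X j) (S g i j))"
     using H i gij by (intro lrf_subset[OF r]) auto
    then show "nrm (lr_sum r A X) (S g i) \<le> lrf r ?H (\<lambda>j. nrm (X j) (S g i j)) + ?e"
     using G(3)[of i] by simp
   qed
   also have "... \<le> lrf r F (\<lambda>i. lrf r ?H (\<lambda>j. nrm (X j) (S g i j))) + lrf r F (\<lambda>i. ?e)"
    using F H e by (intro lrf_triangle[OF r]) auto
   also have "lrf r F (\<lambda>i. ?e) \<le> (\<Sum>i\<in>F. ?e)" using e by (intro lrf_le_sum[OF r F]) auto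
   also have "(\<Sum>i\<in>F. ?e) \<le> e" using e by (simp add: field_simps)
   finally show "lrf r F (\<lambda>i. nrm (lr_sum r A X) (S g i)) \<le> nrm ?M g + e"
    using fin[OF F H] by simp
  qed
  then show "S g \<in> carr ?L" "nrm ?L (S g) \<le> nrm ?M g"
   using lr_sumI[OF r N, where f = "S g" and C = "nrm ?M g"] Si by auto
 qed
 show "bounded_op ?L ?M T"
  using T by (intro bounded_opI[where C = 1]) (auto simp: T_def fun_eq_iff scaleR_fun_def)
 show "bounded_op ?M ?L S"
  using S by (intro bounded_opI[where C = 1]) (auto simp: S_def fun_eq_iff scaleR_fun_def)
qed (auto simp: fun_eq_iff)

text \<open>Write \<open>W\<close> for the power of \<open>X\<close> and \<open>V\<close> for the
  complement of \<open>W\<close> in \<open>Y\<close>. Up to isomorphism, Y = W + V = (W + W) + V = W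
  + (W + V) = W + Y = W. The two absorptions, of \<open>W\<close> and of \<open>Y\<close> into
  \<open>W\<close>, hold because \<open>W\<close> is isomorphic to its own power and both spaces are
  complemented in \<open>W\<close>.\<close>

lemma pelczynski:
 assumes r: "1 \<le> r" and Y: "normed_space Y" and X: "normed_space X"
  and YW: "complemented Y (lr_sum r UNIV (\<lambda>_::nat. X))" and WY: "complemented (lr_sum r UNIV (\<lambda>_::nat. X)) Y"
 shows "isomorphic_spaces Y (lr_sum r UNIV (\<lambda>_::nat. X))"
proof -
 define W where "W = lr_sum r UNIV (\<lambda>_::nat. X)"
 define L where "L = lr_sum r UNIV (\<lambda>_::nat. W)"
 have W: "normed_space W" unfolding W_def using X by (intro lr_sum_normed[OF r]) auto
 have L: "normed_space L" unfolding L_def using W by (intro lr_sum_normed[OF r]) auto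
 have LW: "isomorphic_spaces L W"
  using lr_flatten[OF r, of UNIV "\<lambda>_. X"] X by (simp add: L_def W_def)
 have absorb: "isomorphic_spaces W (nprod Z W)" if Z: "normed_space Z" and c: "complemented Z W"
  for Z :: "'c::real_vector nspace"
 proof -
  have "isomorphic_spaces L (nprod Z L)" unfolding L_def by (rule lr_power_absorbs[OF r Z W c])
  moreover have "isomorphic_spaces (nprod Z L) (nprod Z W)"
   by (rule isomorphic_nprod_cong[OF Z L Z W isomorphic_refl LW])
  ultimately show ?thesis
   using isomorphic_spaces_trans[OF W L nprod_normed[OF Z W] isomorphic_spaces_sym[OF LW]]
    isomorphic_spaces_trans[OF L nprod_normed[OF Z L] nprod_normed[OF Z W]] by blast
 qed
 obtain j q where jq: "bounded_op W Y j" "bounded_op Y W q" "\<And>w. w \<in> carr W ==> q (j w) = w"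
  using WY unfolding complemented_def W_def by blast
 define V where "V = op_range Y (\<lambda>y. y - j (q y))"
 note sp = complemented_split[OF Y W jq]
 have V: "normed_space V" unfolding V_def by (rule op_range_normed[OF Y sp(2)])
 have 1: "isomorphic_spaces Y (nprod W V)" using sp(1) by (simp add: V_def)
 have WW: "isomorphic_spaces W (nprod W W)"
  by (rule absorb[OF W isomorphic_complemented[OF isomorphic_refl]])
 note n = nprod_normed[OF W V] nprod_normed[OF W W] nprod_normed[OF nprod_normed[OF W W] V]
  nprod_normed[OF W nprod_normed[OF W V]] nprod_normed[OF W Y] nprod_normed[OF Y W]
 have 2: "isomorphic_spaces (nprod W V) (nprod (nprod W W) V)"
  by (rule isomorphic_nprod_cong[OF W V n(2) V WW isomorphic_refl])
 have 3: "isomorphic_spaces (nprod (nprod W W) V) (nprod W (nprod W V))"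
  by (rule isomorphic_nprod_assoc)
 have 4: "isomorphic_spaces (nprod W (nprod W V)) (nprod W Y)"
  by (rule isomorphic_nprod_cong[OF W n(1) W Y isomorphic_refl isomorphic_spaces_sym[OF 1]])
 have 5: "isomorphic_spaces (nprod W Y) (nprod Y W)" by (rule isomorphic_nprod_comm)
 have 6: "isomorphic_spaces (nprod Y W) W"
  using absorb[OF Y] YW isomorphic_spaces_sym by (simp add: W_def)
 note tr = isomorphic_spaces_trans
 have "isomorphic_spaces (nprod Y W) W" by (rule 6)
 then have "isomorphic_spaces (nprod W Y) W" by (rule tr[OF n(5,6) W 5])
 then have "isomorphic_spaces (nprod W (nprod W V)) W" by (rule tr[OF n(4,5) W 4])
 then have "isomorphic_spaces (nprod (nprod W W) V) W" by (rule tr[OF n(3,4) W 3])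
 then have "isomorphic_spaces (nprod W V) W" by (rule tr[OF n(1,3) W 2])
 then have "isomorphic_spaces Y W" by (rule tr[OF Y n(1) W 1])
 then show ?thesis by (simp add: W_def)
qed

section \<open>Operators close to the identity\<close>

text \<open>A Neumann series in iterative form: the correction
  \<open>s (Suc k) = s k + (y - U (s k))\<close> halves the residual, so the iterates converge to a
  preimage of \<open>y\<close>. The estimate \<open>lower\<close> makes \<open>U\<close> injective;
  this turns the chosen preimages into a linear map and bounds it by 2.\<close>

lemma near_identity_right_inverse:
 assumes B: "banach_space X" and U: "bounded_op X X U"
  and near: "\<And>x. x \<in> carr X ==> nrm X (U x - x) \<le> (1 / 2) * nrm X x"
 obtains V where "bounded_op X X V" "\<And>y. y \<in> carr X ==> U (V y) = y"
proof -
 have X: "normed_space X" using B by (simp add: banach_space_def)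
 obtain C where C: "0 \<le> C" "op_le X X C U" using bounded_op_le[OF X U] by blast
 note Ux = op_leD(1)[OF C(2)]
 have lower: "nrm X x \<le> 2 * nrm X (U x)" if x: "x \<in> carr X" for x
 proof -
  have "U x - (U x - x) = x" by simp
  then have "nrm X x \<le> nrm X (U x) + nrm X (U x - x)"
   using normed_space_diff(1)[OF X Ux[OF x] normed_spaceD(8)[OF X Ux[OF x] x]] by simp
  then show ?thesis using near[OF x] by simp
 qed
 have surj: "\<exists>x\<in>carr X. U x = y" if y: "y \<in> carr X" for y
 proof -
  define s where "s = rec_nat 0 (\<lambda>_ z. z + (y - U z))"
  have s: "s 0 = 0" "\<And>k. s (Suc k) = s k + (y - U (s k))" by (auto simp: s_def)
  have sc: "s k \<in> carr X" for k
   by (induction k) (auto simp: s normed_spaceD(6)[OF X] Ux y intro!: normed_spaceD(7,8)[OF X])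
  have rc: "y - U (s k) \<in> carr X" for k by (intro normed_spaceD(8)[OF X] y Ux sc)
  have res: "nrm X (y - U (s k)) \<le> (1/2)^k * nrm X y" for k
  proof (induction k)
   case 0
   then show ?case using bounded_op_0[OF X U] by (simp add: s)
  next
   case (Suc k)
   have "y - U (s (Suc k)) = (y - U (s k)) - U (y - U (s k))"
    using op_leD(3)[OF C(2) sc rc] by (simp add: s)
   then have "nrm X (y - U (s (Suc k))) = nrm X (U (y - U (s k)) - (y - U (s k)))"
    by (simp only: normed_space_diff(2)[OF X rc Ux[OF rc]])
   also have "... \<le> 1 / 2 * nrm X (y - U (s k))" by (rule near[OF rc])
   finally show ?case using Suc by simp
  qed
  \<comment> \<open>The bracket is the sum of the residual bounds \<open>(1/2)^i\<close> from
    \<open>i = k\<close> to \<open>k + j - 1\<close>; in this closed form the induction goes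
    through.\<close>
  have diff: "nrm X (s (k + j) - s k) \<le> (2 * (1/2)^k - 2 * (1/2)^(k + j)) * nrm X y" for k j
  proof (induction j)
   case 0
   then show ?case using normed_spaceD(10)[OF X] by simp
  next
   case (Suc j)
   have "s (k + Suc j) - s k = (s (k + j) - s k) + (y - U (s (k + j)))" by (simp add: s)
   then have "nrm X (s (k + Suc j) - s k) \<le> nrm X (s (k + j) - s k) + nrm X (y - U (s (k + j)))"
    using normed_spaceD(5)[OF X normed_spaceD(8)[OF X sc sc] rc] by metis
   also have "... \<le> (2 * (1/2)^k - 2 * (1/2)^(k + j)) * nrm X y + (1/2)^(k + j) * nrm X y"
    by (intro add_mono Suc res)
   finally show ?case by (simp add: algebra_simps)
  qed
  have diff2: "nrm X (s l - s k) \<le> 2 * (1/2)^k * nrm X y" if "k \<le> l" for k l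
  proof -
   have "nrm X (s l - s k) \<le> (2 * (1/2)^k - 2 * (1/2)^l) * nrm X y"
    using diff[of k "l - k"] that by simp
   also have "... \<le> 2 * (1/2)^k * nrm X y"
    using normed_spaceD(2)[OF X y] by (intro mult_right_mono) auto
   finally show ?thesis .
  qed
  have lim0: "(\<lambda>k. 2 * (1/2)^k * nrm X y) \<longlonglongrightarrow> 0"
   by (intro tendsto_eq_intros LIMSEQ_power_zero | simp)+
  have cauchy: "\<exists>M. \<forall>k\<ge>M. \<forall>l\<ge>M. nrm X (s k - s l) < e" if e: "0 < e" for e
  proof -
   have "\<exists>M. \<forall>k\<ge>M. \<bar>2 * (1/2)^k * nrm X y\<bar> < e"
    using LIMSEQ_D[OF lim0 e] by simp
   then obtain M where "\<forall>k\<ge>M. \<bar>2 * (1/2)^k * nrm X y\<bar> < e" by blast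
   then have M: "2 * (1/2)^k * nrm X y < e" if "k \<ge> M" for k using that by (meson abs_less_iff)
   have "nrm X (s k - s l) < e" if "k \<ge> M" "l \<ge> M" for k l
   proof (cases "k \<le> l")
    case True
    then show ?thesis
     using diff2[OF True] M[OF that(1)] normed_space_diff(2)[OF X sc[of k] sc[of l]] by simp
   next
    case False
    then show ?thesis using diff2[of l k] M[OF that(2)] by simp
   qed
   then show ?thesis by blast
  qed
  obtain x where x: "x \<in> carr X" "(\<lambda>k. nrm X (s k - x)) \<longlonglongrightarrow> 0"
   using banach_spaceD[OF B sc cauchy] by blast
  have "nrm X (y - U x) \<le> 0"
  proof (rule LIMSEQ_le_const)
   show "(\<lambda>k. (1/2)^k * nrm X y + C * nrm X (s k - x)) \<longlonglongrightarrow> 0"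
   proof -
    have "(\<lambda>k. (1/2)^k * nrm X y) \<longlonglongrightarrow> 0"
     by (intro tendsto_mult_left_zero LIMSEQ_power_zero) simp
    from tendsto_add[OF this tendsto_mult_right_zero[OF x(2), of C]] show ?thesis by simp
   qed
   show "\<exists>N. \<forall>k\<ge>N. nrm X (y - U x) \<le> (1/2)^k * nrm X y + C * nrm X (s k - x)"
   proof (intro exI allI impI)
    fix k
    have dc: "s k - x \<in> carr X" using normed_spaceD(8)[OF X sc x(1)] .
    have "y - U x = (y - U (s k)) + U (s k - x)"
     using bounded_op_diff[OF X U sc x(1)] by simp
    then have "nrm X (y - U x) \<le> nrm X (y - U (s k)) + nrm X (U (s k - x))"
     using normed_spaceD(5)[OF X rc Ux[OF dc]] by metis
    also have "... \<le> (1/2)^k * nrm X y + C * nrm X (s k - x)"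
     by (intro add_mono res op_leD(2)[OF C(2) dc])
    finally show "nrm X (y - U x) \<le> (1/2)^k * nrm X y + C * nrm X (s k - x)" .
   qed
  qed
  then have "y - U x = 0"
   using normed_spaceD(2,3)[OF X normed_spaceD(8)[OF X y Ux[OF x(1)]]] by simp
  then show ?thesis using x by auto
 qed
 have inj: "x = z" if x: "x \<in> carr X" and z: "z \<in> carr X" and "U x = U z" for x z
 proof -
  have d: "x - z \<in> carr X" by (rule normed_spaceD(8)[OF X x z])
  have "nrm X (x - z) \<le> 2 * nrm X (U (x - z))" by (rule lower[OF d])
  also have "U (x - z) = 0" using bounded_op_diff[OF X U x z] that by simp
  finally show ?thesis using normed_spaceD(2,3)[OF X d] normed_spaceD(10)[OF X] by simp
 qed
 obtain V where V: "\<And>y. y \<in> carr X ==> V y \<in> carr X" "\<And>y. y \<in> carr X ==> U (V y) = y"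
  using surj by metis
 have "bounded_op X X V"
 proof (rule bounded_opI)
  fix x y assume xy: "x \<in> carr X" "y \<in> carr X"
  have xpy: "x + y \<in> carr X" using normed_spaceD(7)[OF X] xy by blast
  show "V (x + y) = V x + V y"
  proof (rule inj)
   show "V x + V y \<in> carr X" using normed_spaceD(7)[OF X V(1)[OF xy(1)] V(1)[OF xy(2)]] .
   show "U (V (x + y)) = U (V x + V y)"
    using op_leD(3)[OF C(2) V(1)[OF xy(1)] V(1)[OF xy(2)]] V(2) xy xpy by simp
  qed (rule V(1)[OF xpy])
 next
  fix c y assume y: "y \<in> carr X"
  have cy: "c *\<^sub>R y \<in> carr X" using normed_spaceD(9)[OF X] y by blast
  show "V (c *\<^sub>R y) = c *\<^sub>R V y"
  proof (rule inj)
   show "c *\<^sub>R V y \<in> carr X" using normed_spaceD(9)[OF X V(1)[OF y]] .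
   show "U (V (c *\<^sub>R y)) = U (c *\<^sub>R V y)"
    using op_leD(4)[OF C(2) V(1)[OF y]] V(2) y cy by simp
  qed (rule V(1)[OF cy])
 next
  fix y assume y: "y \<in> carr X"
  show "nrm X (V y) \<le> 2 * nrm X y" using lower[OF V(1)[OF y]] V(2)[OF y] by simp
 qed (use V in auto)
 then show ?thesis using V that by blast
qed

section \<open>Invariance of primariness under isomorphism\<close>

lemma op_range_isomorphic:
 assumes T: "bounded_op X Y T" and S: "bounded_op Y X S"
  and ST: "\<And>x. x \<in> carr X ==> S (T x) = x" and TS: "\<And>y. y \<in> carr Y ==> T (S y) = y"
  and R: "bounded_op Y Y R" and R': "bounded_op X X R'"
  and TR: "\<And>x. x \<in> carr X ==> T (R' x) = R (T x)"
 shows "isomorphic_spaces (op_range X R') (op_range Y R)"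
proof (rule isomorphic_spacesI)
 note c = bounded_opD(1)[OF R] bounded_opD(1)[OF R'] bounded_opD(1)[OF T] bounded_opD(1)[OF S]
 have SR: "S (R y) = R' (S y)" if "y \<in> carr Y" for y
  using ST TR TS that c by metis
 obtain C where C: "\<forall>x\<in>carr X. nrm Y (T x) \<le> C * nrm X x" using T by (auto simp: bounded_op_def)
 obtain D where D: "\<forall>x\<in>carr Y. nrm X (S x) \<le> D * nrm Y x" using S by (auto simp: bounded_op_def)
 show "bounded_op (op_range X R') (op_range Y R) T"
  using C c TR bounded_opD(2,3)[OF T]
  by (intro bounded_opI[where C = C]) (auto simp: op_range_def)
 show "bounded_op (op_range Y R) (op_range X R') S"
  using D c SR bounded_opD(2,3)[OF S]
  by (intro bounded_opI[where C = D]) (auto simp: op_range_def)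
qed (use ST TS bounded_opD(1)[OF R] bounded_opD(1)[OF R'] in \<open>auto simp: op_range_def\<close>)

lemma bounded_op_id_minus:
 assumes X: "normed_space X" and Q: "bounded_op X X Q"
 shows "bounded_op X X (\<lambda>x. x - Q x)"
proof -
 obtain C where C: "op_le X X C Q" using bounded_op_le[OF X Q] by blast
 show ?thesis
 proof (rule bounded_opI)
  fix x assume x: "x \<in> carr X"
  show "nrm X (x - Q x) \<le> (1 + C) * nrm X x"
   using normed_space_diff(1)[OF X x op_leD(1)[OF C x]] op_leD(2)[OF C x] by (simp add: algebra_simps)
  show "x - Q x \<in> carr X" using normed_spaceD(8)[OF X x op_leD(1)[OF C x]] .
 qed (use op_leD(3,4)[OF C] in \<open>auto simp: algebra_simps\<close>)
qed

lemma banach_space_isomorphic: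
 assumes B: "banach_space X" and Y: "normed_space Y" and iso: "isomorphic_spaces X Y"
 shows "banach_space Y"
proof -
 have X: "normed_space X" using B by (simp add: banach_space_def)
 obtain T S where T: "bounded_op X Y T" and S: "bounded_op Y X S"
  and TS: "\<And>y. y \<in> carr Y ==> T (S y) = y"
  using iso unfolding isomorphic_spaces_def by blast
 obtain C where C: "0 \<le> C" "op_le X Y C T" using bounded_op_le[OF X T] by blast
 obtain D where D: "0 \<le> D" "op_le Y X D S" using bounded_op_le[OF Y S] by blast
 have "\<exists>x\<in>carr Y. (\<lambda>k. nrm Y (u k - x)) \<longlonglongrightarrow> 0"
  if u: "\<And>k. u k \<in> carr Y"
   and cauchy: "\<And>e. e > 0 ==> \<exists>M. \<forall>k\<ge>M. \<forall>l\<ge>M. nrm Y (u k - u l) < e" for u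
 proof -
  have Su: "S (u k) \<in> carr X" for k using op_leD(1)[OF D(2) u] .
  have "\<exists>M. \<forall>k\<ge>M. \<forall>l\<ge>M. nrm X (S (u k) - S (u l)) < e" if "e > 0" for e
  proof -
   have "0 < e / (D + 1)" using that D by simp
   then obtain M where M: "\<And>k l. k \<ge> M ==> l \<ge> M ==> nrm Y (u k - u l) < e / (D + 1)"
    using cauchy by blast
   have "nrm X (S (u k) - S (u l)) < e" if "k \<ge> M" "l \<ge> M" for k l
   proof -
    have d: "u k - u l \<in> carr Y" by (rule normed_spaceD(8)[OF Y u u])
    have "nrm X (S (u k) - S (u l)) = nrm X (S (u k - u l))"
     using bounded_op_diff[OF Y S u u] by simp
    also have "... \<le> D * nrm Y (u k - u l)" by (rule op_leD(2)[OF D(2) d])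
    also have "... \<le> (D + 1) * nrm Y (u k - u l)"
     using normed_spaceD(2)[OF Y d] by (intro mult_right_mono) auto
    also have "... < (D + 1) * (e / (D + 1))" using M[OF that] D by (intro mult_strict_left_mono) auto
    finally show ?thesis using D by simp
   qed
   then show ?thesis by blast
  qed
  then obtain x where x: "x \<in> carr X" "(\<lambda>k. nrm X (S (u k) - x)) \<longlonglongrightarrow> 0"
   using banach_spaceD[OF B, of "\<lambda>k. S (u k)"] Su by metis
  have d: "S (u k) - x \<in> carr X" for k by (rule normed_spaceD(8)[OF X Su x(1)])
  have Tx: "T x \<in> carr Y" using op_leD(1)[OF C(2) x(1)] .
  have "(\<lambda>k. nrm Y (u k - T x)) \<longlonglongrightarrow> 0"
  proof (rule tendsto_sandwich[of "\<lambda>_. 0" _ _ "\<lambda>k. C * nrm X (S (u k) - x)"])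
   show "(\<lambda>k. C * nrm X (S (u k) - x)) \<longlonglongrightarrow> 0" using tendsto_mult_right_zero[OF x(2)] .
   have "nrm Y (u k - T x) \<le> C * nrm X (S (u k) - x)" for k
    using op_leD(2)[OF C(2) d[of k]] bounded_op_diff[OF X T Su[of k] x(1)] TS[OF u] by simp
   then show "\<forall>\<^sub>F k in sequentially. nrm Y (u k - T x) \<le> C * nrm X (S (u k) - x)" by simp
   show "\<forall>\<^sub>F k in sequentially. 0 \<le> nrm Y (u k - T x)"
    using normed_spaceD(2)[OF Y normed_spaceD(8)[OF Y u Tx]] by simp
  qed simp
  then show ?thesis using Tx by blast
 qed
 then show ?thesis unfolding banach_space_def using Y by blast
qed

text \<open>Conjugation with the isomorphism turns a projection of \<open>Y\<close> into one of
  \<open>X\<close>. The intertwining relation holds for \<open>Q\<close> and for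
  \<open>Id - Q\<close>, so the ranges correspond in both cases.\<close>

lemma primary_isomorphic:
 assumes P: "primary X" and Y: "normed_space Y" and iso: "isomorphic_spaces X Y"
 shows "primary Y"
proof -
 have B: "banach_space X" using P by (simp add: primary_def)
 then have X: "normed_space X" by (simp add: banach_space_def)
 obtain T S where T: "bounded_op X Y T" and S: "bounded_op Y X S"
  and ST: "\<And>x. x \<in> carr X ==> S (T x) = x" and TS: "\<And>y. y \<in> carr Y ==> T (S y) = y"
  using iso unfolding isomorphic_spaces_def by blast
 have "isomorphic_spaces (op_range Y Q) Y \<or> isomorphic_spaces (op_range Y (\<lambda>x. x - Q x)) Y"
  if Q: "bounded_projection Y Q" for Q
 proof -
  have Qb: "bounded_op Y Y Q" and QQ: "\<And>y. y \<in> carr Y ==> Q (Q y) = Q y"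
   using Q by (auto simp: bounded_projection_def)
  define Q' where "Q' x = S (Q (T x))" for x
  have Q'b: "bounded_op X X Q'" unfolding Q'_def
   by (intro bounded_op_comp[OF X Y _ S] bounded_op_comp[OF X Y T Qb])
  note c = bounded_opD(1)[OF T] bounded_opD(1)[OF Qb]
  have TQ: "T (Q' x) = Q (T x)" if "x \<in> carr X" for x using that c by (simp add: Q'_def TS)
  have "Q' (Q' x) = Q' x" if "x \<in> carr X" for x
   using that c TQ[OF that] by (simp add: Q'_def[of "Q' x"] QQ) (simp add: Q'_def)
  then have "bounded_projection X Q'" using Q'b by (simp add: bounded_projection_def)
  then have alt: "isomorphic_spaces (op_range X Q') X \<or> isomorphic_spaces (op_range X (\<lambda>x. x - Q' x)) X"
   using P by (simp add: primary_def)
  have tr: "isomorphic_spaces (op_range Y R) Y"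
   if R: "bounded_op Y Y R" "bounded_op X X R'" "\<And>x. x \<in> carr X ==> T (R' x) = R (T x)"
    and i: "isomorphic_spaces (op_range X R') X" for R R'
  proof -
   have "isomorphic_spaces (op_range X R') (op_range Y R)"
    by (rule op_range_isomorphic[OF T S ST TS R])
   then have "isomorphic_spaces (op_range Y R) X"
    using isomorphic_spaces_trans[OF op_range_normed[OF Y R(1)] op_range_normed[OF X R(2)] X _ i]
     isomorphic_spaces_sym by blast
   then show ?thesis by (rule isomorphic_spaces_trans[OF op_range_normed[OF Y R(1)] X Y _ iso])
  qed
  have TI: "T (x - Q' x) = T x - Q (T x)" if "x \<in> carr X" for x
   using bounded_op_diff[OF X T that bounded_opD(1)[OF Q'b that]] TQ[OF that] by simp
  show ?thesis
   using alt tr[OF Qb Q'b TQ]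
    tr[OF bounded_op_id_minus[OF Y Qb] bounded_op_id_minus[OF X Q'b] TI] by blast
 qed
 then show ?thesis
  using banach_space_isomorphic[OF B Y iso] by (simp add: primary_def)
qed

lemma lr_sum_isomorphic:
 assumes r: "1 \<le> r" and A: "A \<noteq> {}"
  and X: "\<forall>n\<in>A. normed_space (X n)" and Y: "\<forall>n\<in>A. normed_space (Y n)"
  and T: "\<And>n. n \<in> A ==> op_le (X n) (Y n) 1 (T n)" and S: "\<And>n. n \<in> A ==> op_le (Y n) (X n) 1 (S n)"
  and ST: "\<And>n x. n \<in> A ==> x \<in> carr (X n) ==> S n (T n x) = x"
  and TS: "\<And>n y. n \<in> A ==> y \<in> carr (Y n) ==> T n (S n y) = y"
 shows "isomorphic_spaces (lr_sum r A X) (lr_sum r A Y)"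
proof (rule isomorphic_spacesI)
 show "bounded_op (lr_sum r A X) (lr_sum r A Y) (\<lambda>f m. if m \<in> A then T m (f m) else 0)"
  by (rule op_le_bounded[where C = 1], rule lr_sum_map[OF r X A Y A]) (use T in auto)
 show "bounded_op (lr_sum r A Y) (lr_sum r A X) (\<lambda>f m. if m \<in> A then S m (f m) else 0)"
  by (rule op_le_bounded[where C = 1], rule lr_sum_map[OF r Y A X A]) (use S in auto)
qed (use ST TS lr_sum_coord in \<open>fastforce simp: fun_eq_iff\<close>)+

section \<open>Finitely supported sequences\<close>

definition cut :: "nat set => (nat => 'a::real_vector) => nat => 'a" where
 "cut F f = (\<lambda>n. if n \<in> F then f n else 0)"

definition single :: "nat => 'a::real_vector => nat => 'a" where
 "single n a = (\<lambda>m. if m = n then a else 0)"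

lemma op_le_cut:
 assumes r: "1 \<le> r" and X: "\<forall>n\<in>A. normed_space (X n)" and A: "A \<noteq> {}"
 shows "op_le (lr_sum r A X) (lr_sum r A X) 1 (cut F)"
proof -
 have "op_le (lr_sum r A X) (lr_sum r A X) 1 (\<lambda>f m. if m \<in> A \<inter> F then f m else 0)"
  by (rule lr_sum_map[OF r X A X A]) (auto intro: op_leI)
 moreover have "(if m \<in> A \<inter> F then f m else 0) = cut F f m" if "f \<in> carr (lr_sum r A X)" for f m
  using lr_sum_coord(2)[OF that, of m] by (simp add: cut_def)
 ultimately show ?thesis
  by (auto simp: op_le_def cut_def fun_eq_iff scaleR_fun_def cong: if_cong)
qed

lemma op_le_single:
 assumes r: "1 \<le> r" and X: "\<forall>n\<in>A. normed_space (X n)" and n: "n \<in> A"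
 shows "op_le (X n) (lr_sum r A X) 1 (single n)"
proof (rule op_leI)
 fix a assume a: "a \<in> carr (X n)"
 have A: "A \<noteq> {}" using n by blast
 have "lrf r F (\<lambda>m. nrm (X m) (single n a m)) \<le> nrm (X n) a" if F: "finite F" "F \<subseteq> A" for F
 proof -
  have "nrm (X m) (single n a m) = (if m = n then nrm (X n) a else 0)" if "m \<in> F" for m
   using F that X normed_spaceD(10) by (auto simp: single_def)
  then have "lrf r F (\<lambda>m. nrm (X m) (single n a m)) = lrf r F (\<lambda>m. if m = n then nrm (X n) a else 0)"
   by (intro lrf_cong) auto
  also have "... \<le> (\<Sum>m\<in>F. if m = n then nrm (X n) a else 0)"
   using normed_spaceD(2)[OF bspec[OF X n] a] F by (intro lrf_le_sum[OF r]) auto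
  also have "... \<le> nrm (X n) a"
   using normed_spaceD(2)[OF bspec[OF X n] a] F by (simp add: sum.delta)
  finally show ?thesis .
 qed
 moreover have "single n a m \<in> carr (X m)" if "m \<in> A" for m
  using a normed_spaceD(6)[OF bspec[OF X that]] by (simp add: single_def)
 moreover have "single n a m = 0" if "m \<notin> A" for m using n that by (auto simp: single_def)
 ultimately show "single n a \<in> carr (lr_sum r A X)" "nrm (lr_sum r A X) (single n a) \<le> 1 * nrm (X n) a"
  using lr_sumI[OF r X A, where f = "single n a" and C = "nrm (X n) a"] by auto
qed (auto simp: single_def fun_eq_iff scaleR_fun_def)

text \<open>The tails of a convergent sum are small. There is no such statement for
  \<open>r = \<infinity>\<close>, and this is what separates the two cases of the gliding hump
  argument.\<close>

lemma lr_sum_cut_dense: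
 assumes r: "1 \<le> r" "r \<noteq> \<infinity>" and X: "\<forall>n\<in>A. normed_space (X n)" and A: "A \<noteq> {}"
  and f: "f \<in> carr (lr_sum r A X)" and e: "0 < e"
 obtains F where "finite F" "F \<subseteq> A" "nrm (lr_sum r A X) (f - cut F f) \<le> e"
proof -
 define \<rho> where "\<rho> = real_of_ereal r"
 have \<rho>: "1 \<le> \<rho>" using real_of_ereal_ge_1 r by (simp add: \<rho>_def)
 define t where "t n = nrm (X n) (f n) powr \<rho>" for n
 have s: "t summable_on A" using f r by (auto simp: lr_sum_def t_def[abs_def] \<rho>_def)
 have "(sum t \<longlongrightarrow> infsum t A) (finite_subsets_at_top A)"
  using has_sum_infsum[OF s] by (simp add: has_sum_def)
 then have "\<forall>\<^sub>F F in finite_subsets_at_top A. dist (sum t F) (infsum t A) < e powr \<rho>"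
  using e by (intro tendstoD) auto
 then obtain F where F: "finite F" "F \<subseteq> A" "dist (sum t F) (infsum t A) < e powr \<rho>"
  by (auto simp: eventually_finite_subsets_at_top)
 let ?g = "f - cut F f"
 have g: "?g \<in> carr (lr_sum r A X)"
  using normed_spaceD(8)[OF lr_sum_normed[OF r(1) X A] f op_leD(1)[OF op_le_cut[OF r(1) X A] f]] .
 have "nrm (lr_sum r A X) ?g \<le> e"
 proof (rule lr_sum_nrm_le[OF r(1) X g A])
  fix G assume G: "finite G" "G \<subseteq> A"
  have z: "nrm (X n) 0 = 0" if "n \<in> A" for n using X that normed_spaceD(10) by auto
  have "(\<Sum>n\<in>G. 1 * nrm (X n) (?g n) powr \<rho>) = sum t (G - F)"
   using G z by (intro sum.mono_neutral_cong_right) (auto simp: cut_def t_def subset_iff)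
  also have "... = sum t (F \<union> (G - F)) - sum t F"
   using G F by (subst sum.union_disjoint) auto
  also have "... \<le> infsum t A - sum t F"
   using F G s by (intro diff_right_mono finite_sum_le_infsum) (auto simp: t_def)
  also have "... \<le> e powr \<rho>" using F(3) by (simp add: dist_real_def)
  finally show "lrf r G (\<lambda>n. nrm (X n) (?g n)) \<le> e"
   using r e \<rho> by (auto simp: lrf_def \<rho>_def[symmetric] intro!: wlp_leI)
 qed
 then show ?thesis using that F by blast
qed

text \<open>On a finitely supported vector the operator is estimated coordinate by coordinate, with
  \<open>nrm (X n) (f n)\<close> bounded by the norm of \<open>f\<close>. Density of such vectors
  and boundedness of \<open>Z\<close> give the general case.\<close>

lemma lr_sum_op_small:
 assumes r: "1 \<le> r" "r \<noteq> \<infinity>" and X: "\<forall>n\<in>A. normed_space (X n)" and A: "A \<noteq> {}"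
  and Y: "normed_space Y" and Z: "bounded_op (lr_sum r A X) Y Z"
  and e: "\<And>n. n \<in> A ==> 0 \<le> e n"
   "\<And>n a. n \<in> A ==> a \<in> carr (X n) ==> nrm Y (Z (single n a)) \<le> e n * nrm (X n) a"
   "\<And>F. finite F ==> F \<subseteq> A ==> sum e F \<le> E"
  and f: "f \<in> carr (lr_sum r A X)"
 shows "nrm Y (Z f) \<le> E * nrm (lr_sum r A X) f"
proof (rule field_le_epsilon)
 let ?L = "lr_sum r A X"
 have L: "normed_space ?L" by (rule lr_sum_normed[OF r(1) X A])
 obtain C where C: "0 \<le> C" "op_le ?L Y C Z" using bounded_op_le[OF L Z] by blast
 fix d :: real assume d: "0 < d"
 then have "0 < d / (C + 1)" using C by simp
 then obtain F where F: "finite F" "F \<subseteq> A" "nrm ?L (f - cut F f) \<le> d / (C + 1)"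
  using lr_sum_cut_dense[OF r X A f] by blast
 have fn: "f n \<in> carr (X n)" "nrm (X n) (f n) \<le> nrm ?L f" "0 \<le> nrm (X n) (f n)" if "n \<in> A" for n
  using lr_sum_coord(1)[OF f that] lr_sum_coord_le[OF r(1) X f that] normed_spaceD(2)[OF bspec[OF X that]]
  by auto
 have cutc: "cut G f \<in> carr ?L" for G using op_leD(1)[OF op_le_cut[OF r(1) X A] f] .
 have fin: "nrm Y (Z (cut G f)) \<le> (\<Sum>n\<in>G. e n * nrm (X n) (f n))" if "finite G" "G \<subseteq> A" for G
  using that
 proof (induction G rule: finite_induct)
  case empty
  have "cut {} f = 0" by (simp add: cut_def fun_eq_iff)
  then have "Z (cut {} f) = 0" using bounded_op_0[OF L Z] by (simp only:)
  then show ?case using normed_spaceD(10)[OF Y] by simp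
 next
  case (insert n G)
  have n: "n \<in> A" using insert by simp
  have sc: "single n (f n) \<in> carr ?L" using op_leD(1)[OF op_le_single[OF r(1) X n] fn(1)[OF n]] .
  have "cut (insert n G) f = single n (f n) + cut G f"
   using insert by (auto simp: cut_def single_def fun_eq_iff)
  then have "nrm Y (Z (cut (insert n G) f)) \<le> nrm Y (Z (single n (f n))) + nrm Y (Z (cut G f))"
   using op_leD(3)[OF C(2) sc cutc] normed_spaceD(5)[OF Y op_leD(1)[OF C(2) sc] op_leD(1)[OF C(2) cutc]]
   by simp
  also have "... \<le> e n * nrm (X n) (f n) + (\<Sum>n\<in>G. e n * nrm (X n) (f n))"
   using insert e(2)[OF n fn(1)[OF n]] by simp
  finally show ?case using insert by simp
 qed
 have "nrm Y (Z (cut F f)) \<le> (\<Sum>n\<in>F. e n * nrm (X n) (f n))" by (rule fin[OF F(1,2)])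
 also have "... \<le> (\<Sum>n\<in>F. e n * nrm ?L f)"
  using F fn e(1) by (intro sum_mono mult_left_mono) auto
 also have "... \<le> E * nrm ?L f"
  unfolding sum_distrib_right[symmetric]
  using e(3)[OF F(1,2)] normed_spaceD(2)[OF L f] by (intro mult_right_mono)
 finally have 1: "nrm Y (Z (cut F f)) \<le> E * nrm ?L f" .
 have gd: "f - cut F f \<in> carr ?L" using normed_spaceD(8)[OF L f cutc] .
 have "nrm Y (Z (f - cut F f)) \<le> C * nrm ?L (f - cut F f)" by (rule op_leD(2)[OF C(2) gd])
 also have "... \<le> C * (d / (C + 1))" using F C by (intro mult_left_mono) auto
 also have "... \<le> d" using C d by (simp add: field_simps)
 finally have 2: "nrm Y (Z (f - cut F f)) \<le> d" .
 have "cut F f + (f - cut F f) = f" by simp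
 then have "nrm Y (Z f) \<le> nrm Y (Z (cut F f)) + nrm Y (Z (f - cut F f))"
  using op_leD(3)[OF C(2) cutc gd] normed_spaceD(5)[OF Y op_leD(1)[OF C(2) cutc] op_leD(1)[OF C(2) gd]]
  by metis
 then show "nrm Y (Z f) \<le> E * nrm ?L f + d" using 1 2 by simp
qed

section \<open>Words and re-coded words\<close>

text \<open>Binary words stand for dyadic intervals: the empty word for the unit interval, every
  further letter for the choice of a half. The length is the level, and a prefix is an interval
  containing the given one.\<close>

definition Lw :: "nat => bool list set" where "Lw m = {w. length w = m}"

definition Ww :: "nat => bool list set" where "Ww n = {w. length w \<le> n}"

lemma finite_Lw [simp]: "finite (Lw m)" and card_Lw [simp]: "card (Lw m) = 2 ^ m"
 using finite_lists_length_eq[of "UNIV :: bool set" m] card_lists_length_eq[of "UNIV :: bool set" m]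
 by (auto simp: Lw_def)

lemma finite_Ww [simp]: "finite (Ww n)"
 using finite_lists_length_le[of "UNIV :: bool set" n] by (simp add: Ww_def)

lemma Lw_iff [simp]: "w \<in> Lw m \<longleftrightarrow> length w = m" by (simp add: Lw_def)
lemma Ww_iff [simp]: "w \<in> Ww m \<longleftrightarrow> length w \<le> m" by (simp add: Ww_def)

lemma Lw_nonempty [simp]: "Lw m \<noteq> {}"
 using card_Lw[of m] by (metis card.empty power_not_zero zero_neq_numeral)

lemma card_Lw_prefix:
 assumes "length z \<le> m"
 shows "card {K \<in> Lw m. take (length z) K = z} = 2 ^ (m - length z)"
proof -
 have "bij_betw (\<lambda>v. z @ v) (Lw (m - length z)) {K \<in> Lw m. take (length z) K = z}"
  by (rule bij_betw_byWitness[where f' = "drop (length z)"])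
   (use assms in \<open>auto, metis append_take_drop_id\<close>)
 then have "card (Lw (m - length z)) = card {K \<in> Lw m. take (length z) K = z}"
  by (rule bij_betw_same_card)
 then show ?thesis by simp
qed

text \<open>The map keeping the letters of a word at the positions in \<open>S\<close>, each letter being flipped when
 the prefix before it belongs to \<open>G\<close>. With \<open>chi\<close> it encodes the block basis
 \<open>\<Sum>\<^sub>K chi S G I K h\<^sub>K\<close>, where \<open>K\<close> runs over the words whose length lies in \<open>S\<close>.\<close>

definition phi :: "nat set => bool list set => bool list => bool list" where
 "phi S G w = map (\<lambda>t. w ! t \<noteq> (take t w \<in> G)) (filter (\<lambda>t. t \<in> S) [0..<length w])"

definition chi :: "nat set => bool list set => bool list => bool list => real" where
 "chi S G I K = (if length K \<in> S \<and> phi S G K = I then if K \<in> G then -1 else 1 else 0)"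

lemma length_phi: "length (phi S G w) = card (S \<inter> {..<length w})"
proof -
 have "length (phi S G w) = card (set (filter (\<lambda>t. t \<in> S) [0..<length w]))"
  by (simp only: phi_def length_map distinct_card distinct_filter distinct_upt)
 also have "set (filter (\<lambda>t. t \<in> S) [0..<length w]) = S \<inter> {..<length w}" by auto
 finally show ?thesis .
qed

lemma phi_Nil [simp]: "phi S G [] = []" by (simp add: phi_def)

lemma phi_snoc:
 "phi S G (w @ [b]) = (if length w \<in> S then phi S G w @ [b \<noteq> (w \<in> G)] else phi S G w)"
proof -
 have "map (\<lambda>t. (w @ [b]) ! t \<noteq> (take t (w @ [b]) \<in> G)) (filter (\<lambda>t. t \<in> S) [0..<length w])
   = map (\<lambda>t. w ! t \<noteq> (take t w \<in> G)) (filter (\<lambda>t. t \<in> S) [0..<length w])"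
  by (intro map_cong) (auto simp: nth_append)
 then show ?thesis by (simp add: phi_def)
qed

text \<open>Each kept letter is flipped according to the proper prefix before it, so
  \<open>G\<close> is consulted at those prefixes only. The symmetry and independence arguments rest
  on this locality.\<close>

lemma phi_cong:
 assumes "\<And>s. s \<in> S ==> s < length K ==> take s K \<in> G \<longleftrightarrow> take s K \<in> G'"
 shows "phi S G K = phi S G' K"
 unfolding phi_def using assms by (intro map_cong) auto

text \<open>Re-coding respects prefixes and therefore maps nested intervals to nested intervals. The
  number of letters kept among the first \<open>m\<close> is the rank of \<open>m\<close> in
  \<open>S\<close>.\<close>

lemma phi_take:
 assumes "m \<le> length w"
 shows "take (card (S \<inter> {..<m})) (phi S G w) = phi S G (take m w)"
 using assms
proof (induction w rule: rev_induct)
 case (snoc b w)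
 show ?case
 proof (cases "m = length (w @ [b])")
  case True
  then show ?thesis using length_phi[of S G "w @ [b]"] by simp
 next
  case False
  then have m: "m \<le> length w" using snoc by simp
  have "card (S \<inter> {..<m}) \<le> card (S \<inter> {..<length w})"
   using m by (intro card_mono) auto
  then show ?thesis using snoc.IH[OF m] m by (simp add: phi_snoc length_phi)
 qed
qed simp

lemma chi_abs_le: "\<bar>chi S G I K\<bar> \<le> 1" by (simp add: chi_def)

lemma chi_nz_length: "chi S G I K \<noteq> 0 ==> length K \<in> S \<and> length I = card (S \<inter> {..<length K})"
 by (auto simp: chi_def length_phi split: if_splits)

section \<open>Uniformly distributed sign choices\<close>

text \<open>Symmetric difference. Translating \<open>G\<close> by a fixed \<open>D\<close> preserves
  the uniform distribution on \<open>Pow V\<close>; expectations appear below as plain sums over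
  \<open>Pow V\<close>, not divided by its cardinality.\<close>

definition sd :: "'a set => 'a set => 'a set" where "sd G D = (G - D) \<union> (D - G)"

lemma sum_sd:
 assumes "D \<subseteq> V"
 shows "(\<Sum>G\<in>Pow V. f (sd G D)) = (\<Sum>G\<in>Pow V. f G)"
 by (rule sum.reindex_bij_witness[of _ "\<lambda>G. sd G D" "\<lambda>G. sd G D"]) (use assms in \<open>auto simp: sd_def\<close>)

lemma sum_sd_odd:
 fixes f :: "'a set => real"
 assumes "D \<subseteq> V" "\<And>G. G \<subseteq> V ==> f (sd G D) = - f G"
 shows "(\<Sum>G\<in>Pow V. f G) = 0"
proof -
 have "(\<Sum>G\<in>Pow V. f G) = (\<Sum>G\<in>Pow V. - f G)"
  using sum_sd[OF assms(1), of f] assms(2) by (metis (mono_tags, lifting) PowD sum.cong)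
 then show ?thesis by (simp add: sum_negf)
qed

text \<open>Independence: exchanging the part in \<open>D\<close> of two independent copies of \<open>G\<close> preserves the
 product measure.\<close>

lemma sum_indep:
 fixes f h :: "'a set => real"
 assumes V: "finite V" and f: "\<And>G. G \<subseteq> V ==> f G = f (G \<inter> D)" and h: "\<And>G. G \<subseteq> V ==> h G = h (G - D)"
  and D: "D \<subseteq> V"
 shows "card (Pow V) * (\<Sum>G\<in>Pow V. f G * h G) = (\<Sum>G\<in>Pow V. f G) * (\<Sum>G\<in>Pow V. h G)"
proof -
 define ex where "ex p = ((fst p - D) \<union> (snd p \<inter> D), (snd p - D) \<union> (fst p \<inter> D))" for p :: "'a set \<times> 'a set"
 have "card (Pow V) * (\<Sum>G\<in>Pow V. f G * h G) = (\<Sum>G\<in>Pow V. \<Sum>G'\<in>Pow V. f G * h G)"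
  by (simp add: sum_distrib_left)
 also have "... = (\<Sum>p\<in>Pow V \<times> Pow V. f (fst p) * h (fst p))"
  by (simp only: sum.cartesian_product case_prod_unfold)
 also have "... = (\<Sum>p\<in>Pow V \<times> Pow V. f (snd p) * h (fst p))"
 proof (rule sum.reindex_bij_witness[of _ ex ex])
  fix p assume p: "p \<in> Pow V \<times> Pow V"
  show "ex (ex p) = p" by (cases p) (auto simp: ex_def)
  show "ex p \<in> Pow V \<times> Pow V" using p by (auto simp: ex_def)
  have "f (snd (ex p)) = f (fst p)"
  proof -
   have "snd (ex p) \<inter> D = fst p \<inter> D" by (auto simp: ex_def)
   moreover have "snd (ex p) \<subseteq> V" using p by (auto simp: ex_def)
   ultimately show ?thesis using f[of "snd (ex p)"] f[of "fst p"] p by auto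
  qed
  moreover have "h (fst (ex p)) = h (fst p)"
  proof -
   have "fst (ex p) - D = fst p - D" by (auto simp: ex_def)
   moreover have "fst (ex p) \<subseteq> V" using p by (auto simp: ex_def)
   ultimately show ?thesis using h[of "fst (ex p)"] h[of "fst p"] p by auto
  qed
  ultimately show "f (snd (ex p)) * h (fst (ex p)) = f (fst p) * h (fst p)" by simp
 next
  fix p assume p: "p \<in> Pow V \<times> Pow V"
  show "ex (ex p) = p" by (cases p) (auto simp: ex_def)
  show "ex p \<in> Pow V \<times> Pow V" using p by (auto simp: ex_def)
 qed
 also have "... = (\<Sum>G\<in>Pow V. \<Sum>G'\<in>Pow V. f G' * h G)"
  by (simp add: sum.cartesian_product case_prod_unfold)
 also have "... = (\<Sum>G\<in>Pow V. f G) * (\<Sum>G\<in>Pow V. h G)"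
  by (subst sum.swap) (simp add: sum_product)
 finally show ?thesis .
qed

lemma sum_square_expand:
 fixes X :: "'a => 'g => real"
 shows "(\<Sum>G\<in>P. (\<Sum>a\<in>A. X a G)\<^sup>2) = (\<Sum>a\<in>A. \<Sum>b\<in>A. \<Sum>G\<in>P. X a G * X b G)"
proof -
 have "(\<Sum>G\<in>P. (\<Sum>a\<in>A. X a G)\<^sup>2) = (\<Sum>G\<in>P. \<Sum>a\<in>A. \<Sum>b\<in>A. X a G * X b G)"
  by (simp add: power2_eq_square sum_product)
 also have "... = (\<Sum>a\<in>A. \<Sum>G\<in>P. \<Sum>b\<in>A. X a G * X b G)" by (rule sum.swap)
 also have "... = (\<Sum>a\<in>A. \<Sum>b\<in>A. \<Sum>G\<in>P. X a G * X b G)" by (intro sum.cong refl sum.swap)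
 finally show ?thesis .
qed

lemma sum_square_orth:
 fixes X :: "'a => 'g => real"
 assumes "finite A" "\<And>a b. a \<in> A ==> b \<in> A ==> a \<noteq> b ==> (\<Sum>G\<in>P. X a G * X b G) = 0"
 shows "(\<Sum>G\<in>P. (\<Sum>a\<in>A. X a G)\<^sup>2) = (\<Sum>a\<in>A. \<Sum>G\<in>P. (X a G)\<^sup>2)"
proof -
 have "(\<Sum>b\<in>A. \<Sum>G\<in>P. X a G * X b G) = (\<Sum>G\<in>P. (X a G)\<^sup>2)" if a: "a \<in> A" for a
 proof -
  have "(\<Sum>b\<in>A. \<Sum>G\<in>P. X a G * X b G) = (\<Sum>b\<in>{a}. \<Sum>G\<in>P. X a G * X b G)"
   using assms a by (intro sum.mono_neutral_right) auto
  then show ?thesis by (simp add: power2_eq_square)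
 qed
 then show ?thesis unfolding sum_square_expand by (intro sum.cong) auto
qed

text \<open>For pairs of distinct cells, \<open>(z, z')\<close> and its swap react alike to every
  sign flip and remain correlated. The product with the swap is at most half the sum of the two
  squares, and both squares are summed over the same index set; so the total at most
  doubles.\<close>

lemma sum_square_pairs:
 fixes X :: "'z \<times> 'z => 'g => real"
 assumes Z: "finite Z" and A: "A = {(z, z'). z \<in> Z \<and> z' \<in> Z \<and> z \<noteq> z'}"
  and 0: "\<And>a b. a \<in> A ==> b \<in> A ==> b \<noteq> a ==> b \<noteq> prod.swap a ==> (\<Sum>G\<in>P. X a G * X b G) = 0"
 shows "(\<Sum>G\<in>P. (\<Sum>a\<in>A. X a G)\<^sup>2) \<le> 2 * (\<Sum>a\<in>A. \<Sum>G\<in>P. (X a G)\<^sup>2)"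
proof -
 let ?C = "\<lambda>a b. \<Sum>G\<in>P. X a G * X b G"
 have fin: "finite A" using Z by (rule_tac finite_subset[of _ "Z \<times> Z"]) (auto simp: A)
 have "(\<Sum>b\<in>A. ?C a b) \<le> (\<Sum>G\<in>P. (X a G)\<^sup>2) + ((\<Sum>G\<in>P. (X a G)\<^sup>2) + (\<Sum>G\<in>P. (X (prod.swap a) G)\<^sup>2)) / 2"
  if a: "a \<in> A" for a
 proof -
  have "(\<Sum>b\<in>A. ?C a b) = (\<Sum>b\<in>{a, prod.swap a}. ?C a b)"
   using 0[OF a] a fin by (intro sum.mono_neutral_right) (auto simp: A)
  also have "... = ?C a a + ?C a (prod.swap a)"
   using a by (subst sum.insert) (auto simp: A)
  also have "?C a (prod.swap a) \<le> (\<Sum>G\<in>P. ((X a G)\<^sup>2 + (X (prod.swap a) G)\<^sup>2) / 2)"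
  proof (rule sum_mono)
   fix G
   show "X a G * X (prod.swap a) G \<le> ((X a G)\<^sup>2 + (X (prod.swap a) G)\<^sup>2) / 2"
    using sum_squares_bound[of "X a G" "X (prod.swap a) G"] by simp
  qed
  also have "... = ((\<Sum>G\<in>P. (X a G)\<^sup>2) + (\<Sum>G\<in>P. (X (prod.swap a) G)\<^sup>2)) / 2"
   by (simp add: sum.distrib sum_divide_distrib add_divide_distrib)
  finally show ?thesis by (simp add: power2_eq_square)
 qed
 then have "(\<Sum>G\<in>P. (\<Sum>a\<in>A. X a G)\<^sup>2) \<le> (\<Sum>a\<in>A. (\<Sum>G\<in>P. (X a G)\<^sup>2)
   + ((\<Sum>G\<in>P. (X a G)\<^sup>2) + (\<Sum>G\<in>P. (X (prod.swap a) G)\<^sup>2)) / 2)"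
  unfolding sum_square_expand by (rule sum_mono)
 also have "(\<Sum>a\<in>A. (\<Sum>G\<in>P. (X a G)\<^sup>2) + ((\<Sum>G\<in>P. (X a G)\<^sup>2) + (\<Sum>G\<in>P. (X (prod.swap a) G)\<^sup>2)) / 2)
   = (\<Sum>a\<in>A. \<Sum>G\<in>P. (X a G)\<^sup>2) + ((\<Sum>a\<in>A. \<Sum>G\<in>P. (X a G)\<^sup>2)
    + (\<Sum>a\<in>A. \<Sum>G\<in>P. (X (prod.swap a) G)\<^sup>2)) / 2"
  by (simp add: sum.distrib sum_divide_distrib[symmetric])
 also have "(\<Sum>a\<in>A. \<Sum>G\<in>P. (X (prod.swap a) G)\<^sup>2) = (\<Sum>a\<in>A. \<Sum>G\<in>P. (X a G)\<^sup>2)"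
  by (rule sum.reindex_bij_witness[of _ prod.swap prod.swap]) (auto simp: A)
 finally show ?thesis by simp
qed

text \<open>The words of level \<open>\<mu>\<close> inside the cell \<open>w\<close> of level
  \<open>m0\<close>. Flipping the membership of exactly these words in \<open>G\<close> is the basic
  symmetry of the random choice.\<close>

definition Dz :: "nat => bool list => nat => bool list set" where
 "Dz m0 w \<mu> = {K \<in> Lw \<mu>. take m0 K = w}"

text \<open>A word of length at most \<open>\<mu>\<close> has all proper prefixes shorter than
  \<open>\<mu>\<close>, and a word outside the cell never meets it. Hence \<open>phi\<close> is
  unchanged and only the sign attached to \<open>K\<close> itself can change.\<close>

lemma chi_flip:
 assumes "m0 \<le> \<mu>" "length K \<le> \<mu> \<or> take m0 K \<noteq> w"
 shows "chi S (sd G (Dz m0 w \<mu>)) I K = (if K \<in> Dz m0 w \<mu> then -1 else 1) * chi S G I K"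
proof -
 have "phi S (sd G (Dz m0 w \<mu>)) K = phi S G K"
  by (rule phi_cong) (use assms in \<open>auto simp: sd_def Dz_def min_def\<close>)
 then show ?thesis by (auto simp: chi_def sd_def)
qed

text \<open>The last kept letter is equidistributed, because toggling the prefix before it in
  \<open>G\<close> flips this letter and leaves the earlier ones alone.\<close>

lemma prob_phi:
 assumes "length w \<le> M" "length I = card (S \<inter> {..<length w})"
 shows "(\<Sum>G\<in>Pow (Ww M). if phi S G w = I then 1 else 0 :: real) = card (Pow (Ww M)) * (1/2) ^ length I"
 using assms
proof (induction w arbitrary: I rule: rev_induct)
 case Nil
 then show ?case by simp
next
 case (snoc b w)
 show ?case
 proof (cases "length w \<in> S")
  case False
  then have "S \<inter> {..<length (w @ [b])} = S \<inter> {..<length w}" by (auto simp: less_Suc_eq)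
  then show ?thesis using snoc False by (simp add: phi_snoc)
 next
  case True
  then have "S \<inter> {..<length (w @ [b])} = insert (length w) (S \<inter> {..<length w})"
   by (auto simp: less_Suc_eq)
  then have l: "length I = Suc (card (S \<inter> {..<length w}))" using snoc by simp
  then obtain J c where I: "I = J @ [c]" "length J = card (S \<inter> {..<length w})"
   by (metis append_butlast_last_id diff_Suc_1 length_butlast list.size(3) nat.distinct(1))
  have w: "length w \<le> M" using snoc by simp
  let ?f = "\<lambda>c G. if phi S G w = J \<and> (w \<in> G) = c then 1 else 0 :: real"
  have ph: "phi S (sd G {w}) w = phi S G w" for G
   by (rule phi_cong) (auto simp: sd_def dest: arg_cong[where f = length])
  have half: "(\<Sum>G\<in>Pow (Ww M). ?f c G) = (\<Sum>G\<in>Pow (Ww M). ?f (\<not> c) G)" for c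
  proof -
   have "?f c (sd G {w}) = ?f (\<not> c) G" for G by (auto simp: ph) (auto simp: sd_def)
   then show ?thesis using sum_sd[of "{w}" "Ww M" "?f c"] w by simp
  qed
  have "(\<Sum>G\<in>Pow (Ww M). ?f True G) + (\<Sum>G\<in>Pow (Ww M). ?f False G)
    = (\<Sum>G\<in>Pow (Ww M). if phi S G w = J then 1 else 0)"
   unfolding sum.distrib[symmetric] by (intro sum.cong) auto
  then have "2 * (\<Sum>G\<in>Pow (Ww M). ?f (b \<noteq> c) G) = card (Pow (Ww M)) * (1/2) ^ length J"
   using snoc.IH[OF w I(2)] half[of True] by (cases "b \<noteq> c") simp_all
  moreover have "(\<Sum>G\<in>Pow (Ww M). if phi S G (w @ [b]) = I then 1 else 0 :: real)
    = (\<Sum>G\<in>Pow (Ww M). ?f (b \<noteq> c) G)"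
   using True by (intro sum.cong) (auto simp: phi_snoc I)
  ultimately show ?thesis by (simp add: I)
 qed
qed

section \<open>Diagonalization in one parameter\<close>

text \<open>This is what diagonalization in one variable needs: a bound for the form on blocks of a
  single level each, by the powers \<open>x\<close> and \<open>1 - x\<close> of their densities. As
  the levels in \<open>S\<close> start at \<open>m0\<close>, each word on them lies in one of the
  \<open>2 ^ m0\<close> cells given by its first \<open>m0\<close> letters, and a large
  \<open>m0\<close> makes the cells small.\<close>

locale block_form =
 fixes S :: "nat set" and m0 M :: nat and \<Gamma> x :: real and t :: "bool list => bool list => real"
 assumes S: "S \<subseteq> {m0..M}" and x: "0 \<le> x" "x \<le> 1" and \<Gamma>: "0 \<le> \<Gamma>"
  and form_bound: "\<And>m m' P P' a b. m \<in> S ==> m' \<in> S ==> P \<subseteq> Lw m ==> P' \<subseteq> Lw m' ==>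
   (\<And>K. \<bar>a K\<bar> \<le> (if K \<in> P then 1 else 0)) ==> (\<And>K. \<bar>b K\<bar> \<le> (if K \<in> P' then 1 else 0)) ==>
   \<bar>\<Sum>K\<in>Lw m. \<Sum>K'\<in>Lw m'. a K * b K' * t K K'\<bar>
    \<le> \<Gamma> * (card P / 2 ^ m) powr x * (card P' / 2 ^ m') powr (1 - x)"
begin

text \<open>Exchanging the arguments exchanges \<open>x\<close> and \<open>1 - x\<close>; this
  reduces \<open>x < 1/2\<close> to the opposite case and one order of the two levels to the
  other.\<close>

lemma transposed: "block_form S m0 M \<Gamma> (1 - x) (\<lambda>K K'. t K' K)"
proof
 fix m m' P P' and a b :: "bool list => real"
 assume *: "m \<in> S" "m' \<in> S" "P \<subseteq> Lw m" "P' \<subseteq> Lw m'"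
  "\<And>K. \<bar>a K\<bar> \<le> (if K \<in> P then 1 else 0)" "\<And>K. \<bar>b K\<bar> \<le> (if K \<in> P' then 1 else 0)"
 have "\<bar>\<Sum>K\<in>Lw m'. \<Sum>K'\<in>Lw m. b K * a K' * t K K'\<bar>
    \<le> \<Gamma> * (card P' / 2 ^ m') powr x * (card P / 2 ^ m) powr (1 - x)"
  by (rule form_bound) (use * in auto)
 then show "\<bar>\<Sum>K\<in>Lw m. \<Sum>K'\<in>Lw m'. a K * b K' * t K' K\<bar>
    \<le> \<Gamma> * (card P / 2 ^ m) powr (1 - x) * (card P' / 2 ^ m') powr (1 - (1 - x))"
  by (subst sum.swap) (simp add: mult_ac)
qed (use S x \<Gamma> in auto)

text \<open>The part of a block vector inside the cell \<open>z\<close>. The form on two such parts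
  is \<open>F\<close>, the object whose squares and correlations are computed.\<close>

definition U :: "bool list set => bool list => bool list => bool list => real" where
 "U G I z K = (if take m0 K = z then chi S G I K else 0)"

definition F :: "nat => bool list => nat => bool list => bool list => bool list => bool list set => real" where
 "F m I m' I' z z' G = (\<Sum>K\<in>Lw m. \<Sum>K'\<in>Lw m'. U G I z K * U G I' z' K' * t K K')"

lemma U_abs_le: "\<bar>U G I z K\<bar> \<le> (if take m0 K = z then 1 else 0)"
 by (simp add: U_def chi_abs_le)

lemma sum_U:
 assumes "m \<in> S" "K \<in> Lw m"
 shows "(\<Sum>z\<in>Lw m0. c z * U G I z K) = c (take m0 K) * chi S G I K"
proof -
 have "take m0 K \<in> Lw m0" using assms S by auto
 then have "(\<Sum>z\<in>Lw m0. c z * U G I z K) = (\<Sum>z\<in>{take m0 K}. c z * U G I z K)"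
  by (intro sum.mono_neutral_right) (auto simp: U_def)
 then show ?thesis by (simp add: U_def)
qed

lemma sum_F:
 assumes "m \<in> S" "m' \<in> S"
 shows "(\<Sum>z\<in>Lw m0. \<Sum>z'\<in>Lw m0. F m I m' I' z z' G)
  = (\<Sum>K\<in>Lw m. \<Sum>K'\<in>Lw m'. chi S G I K * chi S G I' K' * t K K')"
proof -
 have "(\<Sum>z\<in>Lw m0. \<Sum>z'\<in>Lw m0. F m I m' I' z z' G)
   = (\<Sum>z\<in>Lw m0. \<Sum>K\<in>Lw m. \<Sum>z'\<in>Lw m0. \<Sum>K'\<in>Lw m'. U G I z K * U G I' z' K' * t K K')"
  unfolding F_def by (intro sum.cong refl sum.swap)
 also have "... = (\<Sum>K\<in>Lw m. \<Sum>z\<in>Lw m0. \<Sum>K'\<in>Lw m'. \<Sum>z'\<in>Lw m0. U G I z K * U G I' z' K' * t K K')"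
  by (subst sum.swap) (intro sum.cong refl sum.swap)
 also have "... = (\<Sum>K\<in>Lw m. \<Sum>K'\<in>Lw m'. \<Sum>z\<in>Lw m0. \<Sum>z'\<in>Lw m0. U G I z K * U G I' z' K' * t K K')"
  by (intro sum.cong refl sum.swap)
 also have "... = (\<Sum>K\<in>Lw m. \<Sum>K'\<in>Lw m'. (\<Sum>z\<in>Lw m0. 1 * U G I z K) * (\<Sum>z'\<in>Lw m0. 1 * U G I' z' K') * t K K')"
 proof -
  have "(\<Sum>z\<in>Lw m0. \<Sum>z'\<in>Lw m0. u z * v z' * c) = (\<Sum>z\<in>Lw m0. 1 * u z) * (\<Sum>z'\<in>Lw m0. 1 * v z') * c"
   for u v :: "bool list => real" and c
   by (subst sum_product) (simp add: sum_distrib_right)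
  then show ?thesis by simp
 qed
 also have "... = (\<Sum>K\<in>Lw m. \<Sum>K'\<in>Lw m'. chi S G I K * chi S G I' K' * t K K')"
  by (intro sum.cong refl)
   (use sum_U[OF assms(1), where c = "\<lambda>_. 1"] sum_U[OF assms(2), where c = "\<lambda>_. 1"] in simp)
 finally show ?thesis .
qed

lemma prefix_density:
 assumes "m \<in> S" "z \<in> Lw m0"
 shows "card {K \<in> Lw m. take m0 K = z} / 2 ^ m = (1/2) ^ m0"
proof -
 have "m0 \<le> m" using assms S by auto
 then obtain k where "m = m0 + k" using le_Suc_ex by blast
 then show ?thesis
  using card_Lw_prefix[of z m] assms by (simp add: power_add power_one_over)
qed

text \<open>Both cells have density \<open>(1/2) ^ m0\<close>, and the two exponents add up to
  1.\<close>

lemma F_abs_le: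
 assumes "m \<in> S" "m' \<in> S" "z \<in> Lw m0" "z' \<in> Lw m0"
 shows "\<bar>F m I m' I' z z' G\<bar> \<le> \<Gamma> * (1/2) ^ m0"
proof -
 let ?P = "\<lambda>m z. {K \<in> Lw m. take m0 K = z}"
 define a where "a K = (if K \<in> Lw m then U G I z K else 0)" for K
 define b where "b K = (if K \<in> Lw m' then U G I' z' K else 0)" for K
 have "F m I m' I' z z' G = (\<Sum>K\<in>Lw m. \<Sum>K'\<in>Lw m'. a K * b K' * t K K')"
  unfolding F_def by (intro sum.cong refl) (simp add: a_def b_def)
 also have "\<bar>...\<bar> \<le> \<Gamma> * (card (?P m z) / 2 ^ m) powr x * (card (?P m' z') / 2 ^ m') powr (1 - x)"
 proof (rule form_bound)
  show "\<bar>a K\<bar> \<le> (if K \<in> ?P m z then 1 else 0)" "\<bar>b K\<bar> \<le> (if K \<in> ?P m' z' then 1 else 0)" for K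
   using U_abs_le[of G I z K] U_abs_le[of G I' z' K] by (auto simp: a_def b_def split: if_splits)
 qed (use assms in auto)
 also have "... = \<Gamma> * (((1/2) ^ m0) powr x * ((1/2) ^ m0) powr (1 - x))"
  using assms by (simp only: prefix_density mult.assoc)
 also have "((1/2 :: real) ^ m0) powr x * ((1/2) ^ m0) powr (1 - x) = (1/2) ^ m0"
  unfolding powr_add[symmetric] by simp
 finally show ?thesis .
qed

text \<open>Signs \<open>?c\<close> chosen cell by cell join the vectors for all \<open>z'\<close>
  into one vector with entries at most 1, so the block estimate is used only once. The second block
  then fills its level and contributes density 1.\<close>

lemma F_row_le:
 assumes "m \<in> S" "m' \<in> S" "z \<in> Lw m0"
 shows "(\<Sum>z'\<in>Lw m0. \<bar>F m I m' I' z z' G\<bar>) \<le> \<Gamma> * ((1/2) ^ m0) powr x"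
proof -
 let ?P = "\<lambda>m z. {K \<in> Lw m. take m0 K = z}"
 let ?c = "\<lambda>z'. sgn (F m I m' I' z z' G)"
 define a where "a K = (if K \<in> Lw m then U G I z K else 0)" for K
 define b where "b K = (if K \<in> Lw m' then ?c (take m0 K) * chi S G I' K else 0)" for K
 have "(\<Sum>z'\<in>Lw m0. \<bar>F m I m' I' z z' G\<bar>) = (\<Sum>z'\<in>Lw m0. ?c z' * F m I m' I' z z' G)"
  by (simp add: abs_sgn mult.commute)
 also have "... = (\<Sum>z'\<in>Lw m0. \<Sum>K\<in>Lw m. \<Sum>K'\<in>Lw m'. U G I z K * (?c z' * U G I' z' K') * t K K')"
  unfolding F_def[of _ _ _ _ _ _ G] sum_distrib_left by (simp add: mult_ac)
 also have "... = (\<Sum>K\<in>Lw m. \<Sum>K'\<in>Lw m'. \<Sum>z'\<in>Lw m0. U G I z K * (?c z' * U G I' z' K') * t K K')"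
  by (subst sum.swap) (intro sum.cong refl sum.swap)
 also have "... = (\<Sum>K\<in>Lw m. \<Sum>K'\<in>Lw m'. U G I z K * (\<Sum>z'\<in>Lw m0. ?c z' * U G I' z' K') * t K K')"
  by (simp only: sum_distrib_left sum_distrib_right)
 also have "... = (\<Sum>K\<in>Lw m. \<Sum>K'\<in>Lw m'. a K * b K' * t K K')"
  using assms by (intro sum.cong refl) (simp add: sum_U[of m'] a_def b_def)
 also have "... \<le> \<bar>...\<bar>" by simp
 also have "... \<le> \<Gamma> * (card (?P m z) / 2 ^ m) powr x * (card (Lw m') / 2 ^ m') powr (1 - x)"
 proof (rule form_bound)
  fix K
  show "\<bar>b K\<bar> \<le> (if K \<in> Lw m' then 1 else 0)"
   using mult_mono[of "\<bar>?c (take m0 K)\<bar>" 1 "\<bar>chi S G I' K\<bar>" 1] chi_abs_le[of S G I' K]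
   by (auto simp: b_def abs_mult abs_sgn_eq)
  show "\<bar>a K\<bar> \<le> (if K \<in> ?P m z then 1 else 0)"
   using U_abs_le[of G I z K] by (auto simp: a_def split: if_splits)
 qed (use assms in auto)
 finally show ?thesis using prefix_density[OF assms(1,3)] by simp
qed

text \<open>Largest entry times row sum, over \<open>2 ^ m0\<close> rows: the entry bound
  \<open>(1/2) ^ m0\<close> cancels the number of rows, and the row bound leaves the power
  \<open>x\<close> of \<open>(1/2) ^ m0\<close>.\<close>

lemma sum_F_square_le_half:
 assumes "m \<in> S" "m' \<in> S" "1/2 \<le> x"
 shows "(\<Sum>z\<in>Lw m0. \<Sum>z'\<in>Lw m0. (F m I m' I' z z' G)\<^sup>2) \<le> \<Gamma>\<^sup>2 * ((1/2) ^ m0) powr (1/2)"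
proof -
 have "(\<Sum>z'\<in>Lw m0. (F m I m' I' z z' G)\<^sup>2) \<le> \<Gamma> * (1/2) ^ m0 * (\<Gamma> * ((1/2) ^ m0) powr (1/2))"
  if z: "z \<in> Lw m0" for z
 proof -
  have "(\<Sum>z'\<in>Lw m0. (F m I m' I' z z' G)\<^sup>2)
    \<le> (\<Sum>z'\<in>Lw m0. \<Gamma> * (1/2) ^ m0 * \<bar>F m I m' I' z z' G\<bar>)"
  proof (rule sum_mono)
   fix z' assume z': "z' \<in> Lw m0"
   have "(F m I m' I' z z' G)\<^sup>2 = \<bar>F m I m' I' z z' G\<bar> * \<bar>F m I m' I' z z' G\<bar>"
    by (simp add: power2_eq_square)
   also have "... \<le> \<Gamma> * (1/2) ^ m0 * \<bar>F m I m' I' z z' G\<bar>"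
    by (intro mult_right_mono F_abs_le assms z z') simp
   finally show "(F m I m' I' z z' G)\<^sup>2 \<le> \<Gamma> * (1/2) ^ m0 * \<bar>F m I m' I' z z' G\<bar>" .
  qed
  also have "... = \<Gamma> * (1/2) ^ m0 * (\<Sum>z'\<in>Lw m0. \<bar>F m I m' I' z z' G\<bar>)"
   by (rule sum_distrib_left[symmetric])
  also have "... \<le> \<Gamma> * (1/2) ^ m0 * (\<Gamma> * ((1/2) ^ m0) powr x)"
   using \<Gamma> by (intro mult_left_mono F_row_le assms z) auto
  also have "... \<le> \<Gamma> * (1/2) ^ m0 * (\<Gamma> * ((1/2) ^ m0) powr (1/2))"
   using \<Gamma> assms by (intro mult_left_mono powr_mono') (auto simp: power_le_one)
  finally show ?thesis .
 qed
 then have "(\<Sum>z\<in>Lw m0. \<Sum>z'\<in>Lw m0. (F m I m' I' z z' G)\<^sup>2)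
   \<le> (\<Sum>z\<in>Lw m0. \<Gamma> * (1/2) ^ m0 * (\<Gamma> * ((1/2) ^ m0) powr (1/2)))"
  by (rule sum_mono)
 also have "... = \<Gamma>\<^sup>2 * ((1/2) ^ m0) powr (1/2)"
  by (simp add: power2_eq_square power_one_over)
 finally show ?thesis .
qed

end

context block_form
begin

text \<open>One of \<open>x\<close> and \<open>1 - x\<close> is at least \<open>1/2\<close>, so
  either the rows or the columns give the gain, also when \<open>x\<close> is 0 or 1.\<close>

lemma sum_F_square_le:
 assumes m: "m \<in> S" "m' \<in> S"
 shows "(\<Sum>z\<in>Lw m0. \<Sum>z'\<in>Lw m0. (F m I m' I' z z' G)\<^sup>2) \<le> \<Gamma>\<^sup>2 * ((1/2) ^ m0) powr (1/2)"
proof (cases "1/2 \<le> x")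
 case True
 then show ?thesis using sum_F_square_le_half m by blast
next
 case False
 interpret T: block_form S m0 M \<Gamma> "1 - x" "\<lambda>K K'. t K' K" by (rule transposed)
 have "T.F m' I' m I z' z G = F m I m' I' z z' G" for z z'
  unfolding T.F_def F_def by (subst sum.swap) (simp add: U_def T.U_def mult_ac)
 then show ?thesis
  using T.sum_F_square_le_half[OF m(2,1), of I' I G] False by (subst sum.swap) simp
qed

lemma U_flip:
 assumes "m0 \<le> \<mu>" "length K = m" "m \<le> \<mu> \<or> z \<noteq> w"
 shows "U (sd G (Dz m0 w \<mu>)) I z K = (if m = \<mu> \<and> z = w then -1 else 1) * U G I z K"
proof (cases "take m0 K = z")
 case True
 then show ?thesis using chi_flip[OF assms(1), of K w S G I] assms by (auto simp: U_def Dz_def)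
qed (simp add: U_def)

lemma F_flip:
 assumes "m0 \<le> \<mu>" "m \<le> \<mu> \<or> z \<noteq> w" "m' \<le> \<mu> \<or> z' \<noteq> w"
 shows "F m I m' I' z z' (sd G (Dz m0 w \<mu>)) = (if m = \<mu> \<and> z = w then -1 else 1)
  * (if m' = \<mu> \<and> z' = w then -1 else 1) * F m I m' I' z z' G"
proof -
 define c c' :: real where "c = (if m = \<mu> \<and> z = w then -1 else 1)"
  and "c' = (if m' = \<mu> \<and> z' = w then -1 else 1)"
 have "F m I m' I' z z' (sd G (Dz m0 w \<mu>))
   = (\<Sum>K\<in>Lw m. \<Sum>K'\<in>Lw m'. (c * U G I z K) * (c' * U G I' z' K') * t K K')"
  unfolding F_def using assms U_flip[OF assms(1) _ assms(2), of _ G I] U_flip[OF assms(1) _ assms(3), of _ G I']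
  by (intro sum.cong refl) (simp add: c_def c'_def)
 also have "... = c * c' * F m I m' I' z z' G"
  unfolding F_def by (simp add: sum_distrib_left mult_ac)
 finally show ?thesis by (simp add: c_def c'_def)
qed

lemma Dz_subset: "\<mu> \<in> S ==> Dz m0 w \<mu> \<subseteq> Ww M"
 using S by (auto simp: Dz_def)

text \<open>The hypothesis \<open>odd\<close> says that the flip in cell \<open>w\<close> on level
  \<open>\<mu>\<close> reverses exactly one of the two factors; the others ensure that this flip
  acts on both by signs only.\<close>

lemma cross_zero:
 assumes \<mu>: "\<mu> \<in> S" and m: "m \<le> \<mu> \<or> z1 \<noteq> w" "m' \<le> \<mu> \<or> z1' \<noteq> w" "m \<le> \<mu> \<or> z2 \<noteq> w" "m' \<le> \<mu> \<or> z2' \<noteq> w"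
  and odd: "((m = \<mu> \<and> z1 = w) = (m' = \<mu> \<and> z1' = w)) \<noteq> ((m = \<mu> \<and> z2 = w) = (m' = \<mu> \<and> z2' = w))"
 shows "(\<Sum>G\<in>Pow (Ww M). F m I m' I' z1 z1' G * F m I m' I' z2 z2' G) = 0"
proof (rule sum_sd_odd[OF Dz_subset[OF \<mu>, of w]])
 have m0: "m0 \<le> \<mu>" using \<mu> S by auto
 show "F m I m' I' z1 z1' (sd G (Dz m0 w \<mu>)) * F m I m' I' z2 z2' (sd G (Dz m0 w \<mu>))
   = - (F m I m' I' z1 z1' G * F m I m' I' z2 z2' G)" for G
  unfolding F_flip[OF m0 m(1,2)] F_flip[OF m0 m(3,4)] using odd by (auto split: if_splits)
qed

text \<open>On different levels all distinct pairs of cells are uncorrelated. Different first cells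
  are separated by a flip on the higher level \<open>m\<close>. If the first cells agree, a flip on
  \<open>m'\<close> is used in a second cell other than this common one, so that \<open>phi\<close>
  on level \<open>m\<close> is not disturbed. What remains is a sum of squares.\<close>

lemma second_moment_less:
 assumes m: "m \<in> S" "m' \<in> S" "m' < m"
 shows "(\<Sum>G\<in>Pow (Ww M). (\<Sum>K\<in>Lw m. \<Sum>K'\<in>Lw m'. chi S G I K * chi S G I' K' * t K K')\<^sup>2)
  \<le> card (Pow (Ww M)) * (\<Gamma>\<^sup>2 * ((1/2) ^ m0) powr (1/2))"
proof -
 let ?Z = "Lw m0"
 have cross: "(\<Sum>G\<in>Pow (Ww M). F m I m' I' z1 z1' G * F m I m' I' z2 z2' G) = 0"
  if ne: "(z1, z1') \<noteq> (z2, z2')" for z1 z1' z2 z2'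
 proof (cases "z1 = z2")
  case False
  then show ?thesis using m by (intro cross_zero[of m _ z1]) auto
 next
  case True
  show ?thesis
  proof (cases "z1' = z1")
   case False
   then show ?thesis using m True ne by (intro cross_zero[of m' _ _ z1']) auto
  next
   case eq: True
   then show ?thesis using m True ne by (intro cross_zero[of m' _ _ z2']) auto
  qed
 qed
 have "(\<Sum>G\<in>Pow (Ww M). (\<Sum>K\<in>Lw m. \<Sum>K'\<in>Lw m'. chi S G I K * chi S G I' K' * t K K')\<^sup>2)
   = (\<Sum>G\<in>Pow (Ww M). (\<Sum>p\<in>?Z \<times> ?Z. F m I m' I' (fst p) (snd p) G)\<^sup>2)"
  unfolding sum_F[OF m(1,2), symmetric] by (simp only: sum.cartesian_product case_prod_unfold)
 also have "... = (\<Sum>p\<in>?Z \<times> ?Z. \<Sum>G\<in>Pow (Ww M). (F m I m' I' (fst p) (snd p) G)\<^sup>2)"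
  using cross by (intro sum_square_orth) (auto simp: prod_eq_iff)
 also have "... = (\<Sum>G\<in>Pow (Ww M). \<Sum>z\<in>?Z. \<Sum>z'\<in>?Z. (F m I m' I' z z' G)\<^sup>2)"
  by (subst sum.swap) (simp only: sum.cartesian_product case_prod_unfold)
 also have "... \<le> (\<Sum>G\<in>Pow (Ww M). \<Gamma>\<^sup>2 * ((1/2) ^ m0) powr (1/2))"
  by (intro sum_mono sum_F_square_le m)
 finally show ?thesis by simp
qed

text \<open>For distinct words of equal length, toggling \<open>K\<close> in \<open>G\<close>
  reverses one sign and affects no \<open>phi\<close> on their level. For \<open>K = K'\<close> and
  \<open>I = I'\<close> the product is the indicator of \<open>phi S G K = I\<close>, whose mean is
  known from \<open>prob_phi\<close>.\<close>

lemma chi_correlation: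
 assumes m: "m \<in> S" and K: "length K = m" "length K' = m" and I: "length I = card (S \<inter> {..<m})"
 shows "(\<Sum>G\<in>Pow (Ww M). chi S G I K * chi S G I' K')
  = (if K = K' \<and> I = I' then card (Pow (Ww M)) * (1/2) ^ length I else 0)"
proof (cases "K = K'")
 case False
 have mM: "m \<le> M" using m S by auto
 have ph: "phi S (sd G {K}) L = phi S G L" if "length L = m" for G L
 proof (rule phi_cong)
  fix s assume "s < length L"
  then have "length (take s L) \<noteq> length K" using K that by simp
  then have "take s L \<noteq> K" by metis
  then show "take s L \<in> sd G {K} \<longleftrightarrow> take s L \<in> G" by (simp add: sd_def)
 qed
 have "chi S (sd G {K}) I K * chi S (sd G {K}) I' K' = - (chi S G I K * chi S G I' K')" for G
 proof -
  have "K \<in> sd G {K} \<longleftrightarrow> K \<notin> G" "K' \<in> sd G {K} \<longleftrightarrow> K' \<in> G" using False by (auto simp: sd_def)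
  then show ?thesis using K by (simp add: chi_def ph)
 qed
 then show ?thesis using sum_sd_odd[of "{K}" "Ww M"] False K mM by simp
next
 case True
 show ?thesis
 proof (cases "I = I'")
  case False
  then have "chi S G I K * chi S G I' K' = 0" for G using True by (simp add: chi_def)
  then show ?thesis using False by (simp only:) simp
 next
  case eq: True
  have "chi S G I K * chi S G I' K' = (if phi S G K = I then 1 else 0)" for G
   using True eq m K by (auto simp: chi_def)
  then show ?thesis using prob_phi[of K M I S] True eq m K I S by auto
 qed
qed

text \<open>Averaging leaves only the diagonal of \<open>t\<close>, with a weight that depends on
  \<open>I\<close> through its length alone. This is the origin of a diagonal indexed by
  levels.\<close>

lemma mean_diag_block:
 assumes m: "m \<in> S" and I: "length I = card (S \<inter> {..<m})"
 shows "(\<Sum>G\<in>Pow (Ww M). F m I m I' z z G)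
  = card (Pow (Ww M)) * (if I = I' then (1/2) ^ length I * (\<Sum>K\<in>{K \<in> Lw m. take m0 K = z}. t K K) else 0)"
proof -
 let ?b = "\<lambda>K K'. (if take m0 K = z \<and> take m0 K' = z then t K K' else 0)"
 have "(\<Sum>G\<in>Pow (Ww M). F m I m I' z z G)
   = (\<Sum>G\<in>Pow (Ww M). \<Sum>K\<in>Lw m. \<Sum>K'\<in>Lw m. chi S G I K * chi S G I' K' * ?b K K')"
  unfolding F_def U_def by (intro sum.cong refl) auto
 also have "... = (\<Sum>K\<in>Lw m. \<Sum>G\<in>Pow (Ww M). \<Sum>K'\<in>Lw m. chi S G I K * chi S G I' K' * ?b K K')"
  by (rule sum.swap)
 also have "... = (\<Sum>K\<in>Lw m. \<Sum>K'\<in>Lw m. \<Sum>G\<in>Pow (Ww M). chi S G I K * chi S G I' K' * ?b K K')"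
  by (intro sum.cong refl sum.swap)
 also have "... = (\<Sum>K\<in>Lw m. \<Sum>K'\<in>Lw m. (\<Sum>G\<in>Pow (Ww M). chi S G I K * chi S G I' K') * ?b K K')"
  by (simp only: sum_distrib_right)
 also have "... = (\<Sum>K\<in>Lw m. \<Sum>K'\<in>Lw m.
   (if K = K' then (if I = I' then card (Pow (Ww M)) * (1/2) ^ length I else 0) * ?b K K' else 0))"
  using m I by (intro sum.cong refl) (simp add: chi_correlation)
 also have "... = (\<Sum>K\<in>Lw m. (if I = I' then card (Pow (Ww M)) * (1/2) ^ length I else 0) * ?b K K)"
  by (intro sum.cong refl) (simp add: sum.delta)
 also have "... = (if I = I' then card (Pow (Ww M)) * (1/2) ^ length I else 0) * (\<Sum>K\<in>Lw m. ?b K K)"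
  by (rule sum_distrib_left[symmetric])
 also have "(\<Sum>K\<in>Lw m. ?b K K) = (\<Sum>K\<in>{K \<in> Lw m. take m0 K = z}. t K K)"
  by (subst sum.inter_filter) auto
 finally show ?thesis by simp
qed

text \<open>The levels in \<open>S\<close> start at \<open>m0\<close>, so every prefix consulted by
  \<open>phi\<close> is long enough to lie in the same cell as the word itself.\<close>

lemma F_cong:
 assumes "m \<in> S" "m' \<in> S"
  and "\<And>K. take m0 K = z \<or> take m0 K = z' ==> m0 \<le> length K ==> length K \<le> M ==> K \<in> G \<longleftrightarrow> K \<in> G'"
 shows "F m I m' I' z z' G = F m I m' I' z z' G'"
proof -
 have ch: "chi S G J K = chi S G' J K" if K: "length K \<in> S" "take m0 K = z \<or> take m0 K = z'" for J K
 proof -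
  have sub: "take s K \<in> G \<longleftrightarrow> take s K \<in> G'" if "s \<in> S" "s \<le> length K" for s
   using assms(3)[of "take s K"] that K S by (auto simp: min_def subset_iff)
  have "phi S G K = phi S G' K" by (rule phi_cong) (use sub in auto)
  moreover have "K \<in> G \<longleftrightarrow> K \<in> G'" using sub[of "length K"] K by simp
  ultimately show ?thesis by (simp add: chi_def)
 qed
 have "U G J y K = U G' J y K" if "length K \<in> S" "y = z \<or> y = z'" for J y K
  using ch[of K J] that by (auto simp: U_def)
 then show ?thesis unfolding F_def using assms(1,2) by (intro sum.cong refl) simp
qed

text \<open>Diagonal contributions of different cells depend on disjoint parts of \<open>G\<close>
  and are therefore independent; centering makes them orthogonal.\<close>

lemma diag_blocks_orth:
 fixes c :: "bool list => real"
 assumes m: "m \<in> S" and zw: "z \<noteq> w"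
  and c: "\<And>z. card (Pow (Ww M)) * c z = (\<Sum>G\<in>Pow (Ww M). F m I m I' z z G)"
 shows "(\<Sum>G\<in>Pow (Ww M). (F m I m I' z z G - c z) * (F m I m I' w w G - c w)) = 0"
proof -
 let ?D = "{K \<in> Ww M. m0 \<le> length K \<and> take m0 K = z}"
 let ?f = "\<lambda>z G. F m I m I' z z G - c z"
 have "card (Pow (Ww M)) * (\<Sum>G\<in>Pow (Ww M). ?f z G * ?f w G)
   = (\<Sum>G\<in>Pow (Ww M). ?f z G) * (\<Sum>G\<in>Pow (Ww M). ?f w G)"
 proof (rule sum_indep)
  show "?f z G = ?f z (G \<inter> ?D)" for G
   using F_cong[OF m m, of z z G "G \<inter> ?D" I I'] by auto
  show "?f w G = ?f w (G - ?D)" for G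
   using F_cong[OF m m, of w w G "G - ?D" I I'] zw by auto
 qed auto
 also have "(\<Sum>G\<in>Pow (Ww M). ?f z G) = 0" using c[of z] by (simp add: sum_subtractf)
 finally show ?thesis by (simp add: card_Pow)
qed

text \<open>On a common level the form splits into pairs of distinct cells and pairs of equal cells.
  The first part has mean square at most \<open>2 * B\<close>, as only swapped pairs correlate; the
  centered second part has at most \<open>B\<close>, by independence and because a variance is below
  the second moment. The square of the sum of both parts costs a further 2, and 2 * 2 + 2 * 1 =
  6.\<close>

lemma second_moment_eq:
 fixes I I' :: "bool list"
 assumes m: "m \<in> S" and I: "length I = card (S \<inter> {..<m})"
 defines "\<tau> \<equiv> (if I = I' then (1/2) ^ length I * (\<Sum>K\<in>Lw m. t K K) else 0)"
 shows "(\<Sum>G\<in>Pow (Ww M). ((\<Sum>K\<in>Lw m. \<Sum>K'\<in>Lw m. chi S G I K * chi S G I' K' * t K K') - \<tau>)\<^sup>2)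
  \<le> card (Pow (Ww M)) * (6 * (\<Gamma>\<^sup>2 * ((1/2) ^ m0) powr (1/2)))"
proof -
 let ?Z = "Lw m0" and ?P = "Pow (Ww M)"
 define B where "B = \<Gamma>\<^sup>2 * ((1/2) ^ m0) powr (1/2)"
 define X where "X p G = F m I m I' (fst p) (snd p) G" for p G
 define A where "A = {(z, z'). z \<in> ?Z \<and> z' \<in> ?Z \<and> z \<noteq> z'}"
 define c where "c z = (if I = I' then (1/2) ^ length I * (\<Sum>K\<in>{K \<in> Lw m. take m0 K = z}. t K K) else 0)" for z
 have c: "card ?P * c z = (\<Sum>G\<in>?P. X (z, z) G)" for z
  using mean_diag_block[OF m I, of I' z] by (simp add: c_def X_def)
 have sq: "(\<Sum>p\<in>?Z \<times> ?Z. (X p G)\<^sup>2) \<le> B" for G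
  using sum_F_square_le[OF m m, of I I' G]
  by (simp only: X_def B_def sum.cartesian_product case_prod_unfold)
 have sub: "A \<subseteq> ?Z \<times> ?Z" by (auto simp: A_def)
 have finA: "finite A" by (rule finite_subset[OF sub]) simp
 have "(\<Sum>G\<in>?P. (\<Sum>p\<in>A. X p G)\<^sup>2) \<le> 2 * (\<Sum>p\<in>A. \<Sum>G\<in>?P. (X p G)\<^sup>2)"
 proof (rule sum_square_pairs[OF _ A_def])
  fix a b assume ab: "a \<in> A" "b \<in> A" "b \<noteq> a" "b \<noteq> prod.swap a"
  obtain z1 z1' z2 z2' where z: "a = (z1, z1')" "b = (z2, z2')" by (cases a, cases b)
  have "z1 \<noteq> z1'" "z2 \<noteq> z2'" using ab z by (auto simp: A_def)
  then consider "z1 \<noteq> z2" "z1 \<noteq> z2'" "z1 \<noteq> z1'" | "z1' \<noteq> z2" "z1' \<noteq> z2'" "z1 \<noteq> z1'"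
   using ab z by auto
  then show "(\<Sum>G\<in>?P. X a G * X b G) = 0"
  proof cases
   case 1
   then show ?thesis unfolding X_def z fst_conv snd_conv
    by (intro cross_zero[of m _ z1]) (use m in auto)
  next
   case 2
   then show ?thesis unfolding X_def z fst_conv snd_conv
    by (intro cross_zero[of m _ z1 z1']) (use m in auto)
  qed
 qed simp
 also have "(\<Sum>p\<in>A. \<Sum>G\<in>?P. (X p G)\<^sup>2) = (\<Sum>G\<in>?P. \<Sum>p\<in>A. (X p G)\<^sup>2)" by (rule sum.swap)
 also have "... \<le> (\<Sum>G\<in>?P. B)"
 proof (rule sum_mono)
  fix G
  have "(\<Sum>p\<in>A. (X p G)\<^sup>2) \<le> (\<Sum>p\<in>?Z \<times> ?Z. (X p G)\<^sup>2)"
   using sub by (intro sum_mono2) auto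
  then show "(\<Sum>p\<in>A. (X p G)\<^sup>2) \<le> B" using sq[of G] by simp
 qed
 finally have off: "(\<Sum>G\<in>?P. (\<Sum>p\<in>A. X p G)\<^sup>2) \<le> 2 * (card ?P * B)" by simp
 have "(\<Sum>G\<in>?P. (\<Sum>z\<in>?Z. X (z, z) G - c z)\<^sup>2) = (\<Sum>z\<in>?Z. \<Sum>G\<in>?P. (X (z, z) G - c z)\<^sup>2)"
  using diag_blocks_orth[OF m _ , where c = c] c
  by (intro sum_square_orth) (auto simp: X_def)
 also have "... \<le> (\<Sum>z\<in>?Z. \<Sum>G\<in>?P. (X (z, z) G)\<^sup>2)"
 proof (rule sum_mono)
  fix z
  have "(\<Sum>G\<in>?P. (X (z, z) G - c z)\<^sup>2)
    = (\<Sum>G\<in>?P. (X (z, z) G)\<^sup>2) - 2 * c z * (\<Sum>G\<in>?P. X (z, z) G) + card ?P * (c z)\<^sup>2"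
   by (simp add: power2_diff sum.distrib sum_subtractf sum_distrib_left mult_ac)
  also have "... = (\<Sum>G\<in>?P. (X (z, z) G)\<^sup>2) - card ?P * (c z)\<^sup>2"
   unfolding c[symmetric] by (simp add: power2_eq_square)
  also have "... \<le> (\<Sum>G\<in>?P. (X (z, z) G)\<^sup>2)" by simp
  finally show "(\<Sum>G\<in>?P. (X (z, z) G - c z)\<^sup>2) \<le> (\<Sum>G\<in>?P. (X (z, z) G)\<^sup>2)" .
 qed
 also have "... = (\<Sum>G\<in>?P. \<Sum>z\<in>?Z. (X (z, z) G)\<^sup>2)" by (rule sum.swap)
 also have "... \<le> (\<Sum>G\<in>?P. B)"
 proof (rule sum_mono)
  fix G
  have "(\<Sum>z\<in>?Z. (X (z, z) G)\<^sup>2) = (\<Sum>p\<in>(\<lambda>z. (z, z)) ` ?Z. (X p G)\<^sup>2)"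
   by (subst sum.reindex) (auto simp: inj_on_def)
  also have "... \<le> (\<Sum>p\<in>?Z \<times> ?Z. (X p G)\<^sup>2)" by (intro sum_mono2) auto
  finally show "(\<Sum>z\<in>?Z. (X (z, z) G)\<^sup>2) \<le> B" using sq[of G] by simp
 qed
 finally have diag: "(\<Sum>G\<in>?P. (\<Sum>z\<in>?Z. X (z, z) G - c z)\<^sup>2) \<le> card ?P * B" by simp
 have tau: "\<tau> = (\<Sum>z\<in>?Z. c z)"
 proof -
  have "(\<Sum>z\<in>?Z. \<Sum>K\<in>{K \<in> Lw m. take m0 K = z}. t K K) = (\<Sum>K\<in>Lw m. t K K)"
   by (rule sum.group) (use m S in auto)
  then show ?thesis by (simp add: \<tau>_def c_def sum_distrib_left[symmetric])
 qed
 have split: "(\<Sum>K\<in>Lw m. \<Sum>K'\<in>Lw m. chi S G I K * chi S G I' K' * t K K') - \<tau>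
   = (\<Sum>p\<in>A. X p G) + (\<Sum>z\<in>?Z. X (z, z) G - c z)" for G
 proof -
  have "(\<Sum>K\<in>Lw m. \<Sum>K'\<in>Lw m. chi S G I K * chi S G I' K' * t K K') = (\<Sum>p\<in>?Z \<times> ?Z. X p G)"
   using sum_F[OF m m, of I I' G] by (simp add: X_def sum.cartesian_product case_prod_unfold)
  also have "?Z \<times> ?Z = A \<union> (\<lambda>z. (z, z)) ` ?Z" by (auto simp: A_def)
  also have "(\<Sum>p\<in>A \<union> (\<lambda>z. (z, z)) ` ?Z. X p G) = (\<Sum>p\<in>A. X p G) + (\<Sum>p\<in>(\<lambda>z. (z, z)) ` ?Z. X p G)"
   using finA by (intro sum.union_disjoint) (auto simp: A_def)
  also have "(\<Sum>p\<in>(\<lambda>z. (z, z)) ` ?Z. X p G) = (\<Sum>z\<in>?Z. X (z, z) G)"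
   by (subst sum.reindex) (auto simp: inj_on_def)
  finally show ?thesis by (simp add: tau sum_subtractf)
 qed
 have "(\<Sum>G\<in>?P. ((\<Sum>K\<in>Lw m. \<Sum>K'\<in>Lw m. chi S G I K * chi S G I' K' * t K K') - \<tau>)\<^sup>2)
   \<le> (\<Sum>G\<in>?P. 2 * (\<Sum>p\<in>A. X p G)\<^sup>2 + 2 * (\<Sum>z\<in>?Z. X (z, z) G - c z)\<^sup>2)"
 proof (rule sum_mono)
  fix G
  have "(u + v)\<^sup>2 \<le> 2 * u\<^sup>2 + 2 * v\<^sup>2" for u v :: real
   using sum_squares_bound[of u v] by (simp add: power2_sum)
  then show "((\<Sum>K\<in>Lw m. \<Sum>K'\<in>Lw m. chi S G I K * chi S G I' K' * t K K') - \<tau>)\<^sup>2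
    \<le> 2 * (\<Sum>p\<in>A. X p G)\<^sup>2 + 2 * (\<Sum>z\<in>?Z. X (z, z) G - c z)\<^sup>2"
   unfolding split .
 qed
 also have "... = 2 * (\<Sum>G\<in>?P. (\<Sum>p\<in>A. X p G)\<^sup>2) + 2 * (\<Sum>G\<in>?P. (\<Sum>z\<in>?Z. X (z, z) G - c z)\<^sup>2)"
  by (simp add: sum.distrib sum_distrib_left)
 also have "... \<le> card ?P * (6 * B)" using off diag by simp
 finally show ?thesis by (simp add: B_def)
qed

end

section \<open>Levels by rank and simultaneous diagonalization\<close>

text \<open>The words with length in \<open>S\<close> that \<open>phi\<close> shortens to length
  \<open>i\<close>. They fill one entire level when \<open>i\<close> is a rank in \<open>S\<close>,
  and there are none otherwise.\<close>

definition lev :: "nat set => nat => bool list set" where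
 "lev S i = {K. length K \<in> S \<and> card (S \<inter> {..<length K}) = i}"

lemma rank_strict:
 assumes "finite S" "m \<in> S" "m < (m'::nat)"
 shows "card (S \<inter> {..<m}) < card (S \<inter> {..<m'})"
 using assms by (intro psubset_card_mono) auto

lemma rank_inj:
 assumes "finite S" "m \<in> S" "m' \<in> S" "card (S \<inter> {..<m}) = card (S \<inter> {..<(m'::nat)})"
 shows "m = m'"
 using rank_strict[of S m m'] rank_strict[of S m' m] assms by (metis less_irrefl linorder_neqE_nat)

lemma rank_surj:
 assumes S: "finite S" and i: "i < card S"
 obtains m :: nat where "m \<in> S" "card (S \<inter> {..<m}) = i"
proof -
 let ?r = "\<lambda>m. card (S \<inter> {..<m})"
 have "inj_on ?r S" using rank_inj[OF S] by (auto simp: inj_on_def)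
 then have "card (?r ` S) = card S" by (rule card_image)
 moreover have "?r ` S \<subseteq> {..<card S}"
 proof
  fix j assume "j \<in> ?r ` S"
  then obtain m where m: "m \<in> S" "j = ?r m" by auto
  have "S \<inter> {..<m} \<subset> S" using m by auto
  then show "j \<in> {..<card S}" using psubset_card_mono[OF S] m by auto
 qed
 ultimately have "?r ` S = {..<card S}" by (intro card_subset_eq) auto
 then have "i \<in> ?r ` S" using i by auto
 then show ?thesis using that by auto
qed

lemma lev_eq_Lw:
 assumes "finite S" "m \<in> S" "card (S \<inter> {..<m}) = i"
 shows "lev S i = Lw m"
 using rank_inj[OF assms(1)] assms by (auto simp: lev_def)

lemma sum_chi_level:
 assumes "finite S" "m \<in> S" "m \<le> M" "length I = card (S \<inter> {..<m})"
 shows "(\<Sum>K\<in>Ww M. chi S G I K * c K) = (\<Sum>K\<in>Lw m. chi S G I K * c K)"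
proof (rule sum.mono_neutral_right)
 show "\<forall>K\<in>Ww M - Lw m. chi S G I K * c K = 0"
  using chi_nz_length[of S G I] rank_inj[OF assms(1)] assms by fastforce
qed (use assms in auto)

lemma average_exists:
 fixes f :: "'a => real" and c :: real
 assumes "finite P" "P \<noteq> {}" "(\<Sum>G\<in>P. f G) \<le> card P * c"
 obtains G where "G \<in> P" "f G \<le> c"
proof -
 have "\<exists>G\<in>P. f G \<le> c"
 proof (rule ccontr)
  assume "\<not> (\<exists>G\<in>P. f G \<le> c)"
  then have "(\<Sum>G\<in>P. c) < (\<Sum>G\<in>P. f G)" using assms by (intro sum_strict_mono) auto
  then show False using assms by simp
 qed
 then show ?thesis using that by blast
qed

text \<open>The mean squares of all errors, over \<open>\<Sigma>\<close> and all pairs of words up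
  to length \<open>n\<close>, have a sum of at most \<open>\<eta>\<close> squared. Hence a single
  \<open>G\<close> makes every error at most \<open>\<eta>\<close>.\<close>

lemma diagonalize:
 fixes t :: "'s => bool list => bool list => real"
 assumes fin: "finite \<Sigma>" and bf: "\<And>s. s \<in> \<Sigma> ==> block_form S m0 M \<Gamma> x (t s)"
  and SM: "S \<subseteq> {m0..M}" and cardS: "card S = Suc n" and \<eta>: "0 \<le> \<eta>"
  and small: "card \<Sigma> * (card (Ww n))\<^sup>2 * (6 * (\<Gamma>\<^sup>2 * ((1/2) ^ m0) powr (1/2))) \<le> \<eta>\<^sup>2"
 obtains G where "G \<subseteq> Ww M" "\<And>s I I'. s \<in> \<Sigma> ==> length I \<le> n ==> length I' \<le> n ==>
  \<bar>(\<Sum>K\<in>Ww M. \<Sum>K'\<in>Ww M. chi S G I K * chi S G I' K' * t s K K')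
   - (if I = I' then (1/2) ^ length I * (\<Sum>K\<in>lev S (length I). t s K K) else 0)\<bar> \<le> \<eta>"
proof -
 define B where "B = 6 * (\<Gamma>\<^sup>2 * ((1/2) ^ m0) powr (1/2))"
 define P where "P = Pow (Ww M)"
 define E where "E s I I' G = (\<Sum>K\<in>Ww M. \<Sum>K'\<in>Ww M. chi S G I K * chi S G I' K' * t s K K')
   - (if I = I' then (1/2) ^ length I * (\<Sum>K\<in>lev S (length I). t s K K) else 0)" for s I I' G
 have finS: "finite S" using SM finite_subset by blast
 have bound: "(\<Sum>G\<in>P. (E s I I' G)\<^sup>2) \<le> card P * B"
  if s: "s \<in> \<Sigma>" and I: "I \<in> Ww n" "I' \<in> Ww n" for s I I'
 proof -
  interpret block_form S m0 M \<Gamma> x "t s" by (rule bf[OF s])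
  obtain m where m: "m \<in> S" "card (S \<inter> {..<m}) = length I"
   using rank_surj[OF finS, of "length I"] I cardS by auto
  obtain m' where m': "m' \<in> S" "card (S \<inter> {..<m'}) = length I'"
   using rank_surj[OF finS, of "length I'"] I cardS by auto
  have mM: "m \<le> M" "m' \<le> M" using m m' SM by auto
  have lv: "lev S (length I) = Lw m" by (rule lev_eq_Lw[OF finS m])
  have "(\<Sum>K\<in>Ww M. \<Sum>K'\<in>Ww M. chi S G I K * chi S G I' K' * t s K K')
    = (\<Sum>K\<in>Lw m. \<Sum>K'\<in>Lw m'. chi S G I K * chi S G I' K' * t s K K')" for G
  proof -
   have "(\<Sum>K\<in>Ww M. \<Sum>K'\<in>Ww M. chi S G I K * chi S G I' K' * t s K K')
     = (\<Sum>K\<in>Ww M. chi S G I K * (\<Sum>K'\<in>Ww M. chi S G I' K' * t s K K'))"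
    by (simp add: sum_distrib_left mult.assoc)
   also have "... = (\<Sum>K\<in>Lw m. chi S G I K * (\<Sum>K'\<in>Lw m'. chi S G I' K' * t s K K'))"
    using finS m m' mM by (simp add: sum_chi_level)
   finally show ?thesis by (simp add: sum_distrib_left mult.assoc)
  qed
  then have E: "E s I I' G = (\<Sum>K\<in>Lw m. \<Sum>K'\<in>Lw m'. chi S G I K * chi S G I' K' * t s K K')
   - (if I = I' then (1/2) ^ length I * (\<Sum>K\<in>Lw m. t s K K) else 0)" for G
   by (simp only: E_def lv)
  have le: "card P * (\<Gamma>\<^sup>2 * ((1/2) ^ m0) powr (1/2)) \<le> card P * B"
   unfolding B_def by (intro mult_left_mono) auto
  consider "m = m'" | "m' < m" | "m < m'" by linarith
  then show ?thesis
  proof cases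
   case 1
   then show ?thesis using second_moment_eq[OF m(1) m(2)[symmetric], of I'] by (simp add: E P_def B_def)
  next
   case 2
   then have "I \<noteq> I'" using rank_inj[OF finS m(1) m'(1)] m m' by auto
   then show ?thesis
    using second_moment_less[OF m(1) m'(1) 2, of I I'] le by (simp add: E P_def)
  next
   case 3
   then have ne: "I \<noteq> I'" using rank_inj[OF finS m(1) m'(1)] m m' by auto
   interpret T: block_form S m0 M \<Gamma> "1 - x" "\<lambda>K K'. t s K' K" by (rule transposed)
   have "(\<Sum>K\<in>Lw m. \<Sum>K'\<in>Lw m'. chi S G I K * chi S G I' K' * t s K K')
     = (\<Sum>K\<in>Lw m'. \<Sum>K'\<in>Lw m. chi S G I' K * chi S G I K' * t s K' K)" for G
    by (subst sum.swap) (simp add: mult_ac)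
   then show ?thesis
    using T.second_moment_less[OF m'(1) m(1) 3, of I' I] le ne by (simp add: E P_def)
  qed
 qed
 define f where "f G = (\<Sum>s\<in>\<Sigma>. \<Sum>I\<in>Ww n. \<Sum>I'\<in>Ww n. (E s I I' G)\<^sup>2)" for G
 have "(\<Sum>G\<in>P. f G) = (\<Sum>s\<in>\<Sigma>. \<Sum>G\<in>P. \<Sum>I\<in>Ww n. \<Sum>I'\<in>Ww n. (E s I I' G)\<^sup>2)"
  unfolding f_def by (rule sum.swap)
 also have "... = (\<Sum>s\<in>\<Sigma>. \<Sum>I\<in>Ww n. \<Sum>G\<in>P. \<Sum>I'\<in>Ww n. (E s I I' G)\<^sup>2)"
  by (intro sum.cong refl sum.swap)
 also have "... = (\<Sum>s\<in>\<Sigma>. \<Sum>I\<in>Ww n. \<Sum>I'\<in>Ww n. \<Sum>G\<in>P. (E s I I' G)\<^sup>2)"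
  by (intro sum.cong refl sum.swap)
 also have "... \<le> (\<Sum>s\<in>\<Sigma>. \<Sum>I\<in>Ww n. \<Sum>I'\<in>Ww n. card P * B)"
  by (intro sum_mono bound)
 also have "... = card P * (card \<Sigma> * (card (Ww n))\<^sup>2 * B)" by (simp add: power2_eq_square)
 also have "... \<le> card P * \<eta>\<^sup>2" using small by (intro mult_left_mono) (auto simp: B_def)
 finally have "(\<Sum>G\<in>P. f G) \<le> card P * \<eta>\<^sup>2" .
 then obtain G where G: "G \<in> P" "f G \<le> \<eta>\<^sup>2"
  using average_exists[of P f "\<eta>\<^sup>2"] by (auto simp: P_def)
 have "\<bar>E s I I' G\<bar> \<le> \<eta>" if "s \<in> \<Sigma>" "length I \<le> n" "length I' \<le> n" for s I I'
 proof -
  have "(E s I I' G)\<^sup>2 \<le> (\<Sum>I'\<in>Ww n. (E s I I' G)\<^sup>2)"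
   using that by (intro member_le_sum) auto
  also have "... \<le> (\<Sum>I\<in>Ww n. \<Sum>I'\<in>Ww n. (E s I I' G)\<^sup>2)"
   using that by (intro member_le_sum[of I]) (auto intro: sum_nonneg)
  also have "... \<le> f G"
   unfolding f_def using that fin by (intro member_le_sum[of s]) (auto intro!: sum_nonneg)
  finally have "(E s I I' G)\<^sup>2 \<le> \<eta>\<^sup>2" using G by simp
  then show ?thesis using \<eta> power2_le_imp_le[of "\<bar>E s I I' G\<bar>" \<eta>] by simp
 qed
 then show ?thesis using that[of G] G(1) unfolding E_def P_def by blast
qed

section \<open>Finite combinatorics\<close>

text \<open>Pigeonhole on the \<open>2 ^ (2 * q)\<close> possible neighbourhoods in
  \<open>U\<close>: some \<open>q\<close> elements of \<open>V\<close> share one neighbourhood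
  \<open>X\<close>, and \<open>X\<close> or its complement contains at least half of the
  \<open>2 * q\<close> elements of \<open>U\<close>.\<close>

lemma bipartite_ramsey:
 fixes c :: "'a => 'b => bool"
 assumes U: "finite U" "card U = 2 * q" and V: "finite V" "card V = q * 2 ^ (2 * q)"
 obtains b S S' where "S \<subseteq> U" "S' \<subseteq> V" "card S = q" "card S' = q" "\<And>s s'. s \<in> S ==> s' \<in> S' ==> c s s' = b"
proof (cases "q = 0")
 case True
 then show ?thesis using that[of "{}" "{}"] by auto
next
 case False
 define p where "p v = {u \<in> U. c u v}" for v
 have "\<exists>X\<in>Pow U. q \<le> card {v \<in> V. p v = X}"
 proof (rule ccontr)
  assume "\<not> ?thesis"
  then have nq: "\<not> q \<le> card {v \<in> V. p v = X}" if "X \<in> Pow U" for X using that by blast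
  have le: "card {v \<in> V. p v = X} \<le> q - 1" if "X \<in> Pow U" for X using nq[OF that] by linarith
  have "card V = (\<Sum>X\<in>Pow U. card {v \<in> V. p v = X})"
  proof -
   have "(\<Sum>X\<in>Pow U. \<Sum>v\<in>{v \<in> V. p v = X}. 1) = (\<Sum>v\<in>V. 1 :: nat)"
    by (rule sum.group) (use U V in \<open>auto simp: p_def\<close>)
   then show ?thesis by simp
  qed
  also have "... \<le> (\<Sum>X\<in>Pow U. q - 1)" by (intro sum_mono le)
  also have "... = 2 ^ (2 * q) * (q - 1)" using U by (simp add: card_Pow)
  also have "... < 2 ^ (2 * q) * q" using False by (intro mult_strict_left_mono) auto
  finally show False using V by (simp add: mult.commute)
 qed
 then obtain X where X: "X \<subseteq> U" "q \<le> card {v \<in> V. p v = X}" by auto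
 obtain S' where S': "S' \<subseteq> {v \<in> V. p v = X}" "card S' = q"
  using obtain_subset_with_card_n[OF X(2)] by metis
 have fX: "finite X" using X U finite_subset by blast
 have "card X + card (U - X) = 2 * q" using X U fX card_mono[of U X] by (simp add: card_Diff_subset)
 then consider "q \<le> card X" | "q \<le> card (U - X)" by linarith
 then show ?thesis
 proof cases
  case 1
  then obtain S where "S \<subseteq> X" "card S = q" using obtain_subset_with_card_n by metis
  then show ?thesis using that[of S S' True] S' X by (auto simp: p_def)
 next
  case 2
  then obtain S where "S \<subseteq> U - X" "card S = q" using obtain_subset_with_card_n by metis
  then show ?thesis using that[of S S' False] S' X by (auto simp: p_def)
 qed
qed

text \<open>The \<open>b + 1\<close> windows are pairwise disjoint, so \<open>b\<close> points
  cannot meet all of them.\<close>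

lemma free_window:
 fixes Bad :: "nat set"
 assumes "finite Bad" "card Bad \<le> b"
 obtains w where "w \<le> b" "{m0 + w * R..<m0 + (w + 1) * R} \<inter> Bad = {}"
proof -
 have "\<exists>w\<le>b. {m0 + w * R..<m0 + (w + 1) * R} \<inter> Bad = {}"
 proof (rule ccontr)
  assume *: "\<not> ?thesis"
  have "\<exists>m. m \<in> {m0 + w * R..<m0 + (w + 1) * R} \<inter> Bad" if "w \<le> b" for w using * that by blast
  then obtain f where f: "\<And>w. w \<le> b ==> f w \<in> {m0 + w * R..<m0 + (w + 1) * R} \<inter> Bad" by metis
  have "inj_on f {..b}"
  proof (rule linorder_inj_onI)
   fix u v assume uv: "u < v" "u \<in> {..b}" "v \<in> {..b}"
   have "(u + 1) * R \<le> v * R" using uv by (intro mult_right_mono) auto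
   then show "f u \<noteq> f v" using f[of u] f[of v] uv by auto
  qed auto
  moreover have "f ` {..b} \<subseteq> Bad" using f by auto
  ultimately have "card {..b} \<le> card Bad" using assms by (metis card_inj_on_le)
  then show False using assms by simp
 qed
 then show ?thesis using that by blast
qed

text \<open>The diagonal sum is the average over all sign choices of the signed forms, so it
  inherits every bound that is uniform in the signs.\<close>

lemma diag_le_signs:
 fixes c :: "'a => 'a => real"
 assumes fin: "finite Z" and B: "\<And>\<sigma>. (\<And>K. \<bar>\<sigma> K\<bar> \<le> 1) ==> \<bar>\<Sum>K\<in>Z. \<Sum>K'\<in>Z. \<sigma> K * \<sigma> K' * c K K'\<bar> \<le> B"
 shows "\<bar>\<Sum>K\<in>Z. c K K\<bar> \<le> B"
proof -
 define s where "s G K = (if K \<in> G then -1 else 1 :: real)" for G and K :: 'a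
 have orth: "(\<Sum>G\<in>Pow Z. s G K * s G K') = (if K = K' then card (Pow Z) else 0)"
  if "K \<in> Z" for K K'
 proof (cases "K = K'")
  case True
  have "s G K * s G K = 1" for G by (simp add: s_def)
  then show ?thesis using True by simp
 next
  case False
  have "s (sd G {K}) K * s (sd G {K}) K' = - (s G K * s G K')" for G
   using False by (auto simp: s_def sd_def)
  then show ?thesis using sum_sd_odd[of "{K}" Z "\<lambda>G. s G K * s G K'"] that False by simp
 qed
 have "(\<Sum>G\<in>Pow Z. \<Sum>K\<in>Z. \<Sum>K'\<in>Z. s G K * s G K' * c K K')
   = (\<Sum>K\<in>Z. \<Sum>G\<in>Pow Z. \<Sum>K'\<in>Z. s G K * s G K' * c K K')" by (rule sum.swap)
 also have "... = (\<Sum>K\<in>Z. \<Sum>K'\<in>Z. \<Sum>G\<in>Pow Z. s G K * s G K' * c K K')"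
  by (intro sum.cong refl sum.swap)
 also have "... = (\<Sum>K\<in>Z. \<Sum>K'\<in>Z. if K = K' then card (Pow Z) * c K K' else 0)"
  by (intro sum.cong refl) (simp add: sum_distrib_right[symmetric] orth)
 also have "... = card (Pow Z) * (\<Sum>K\<in>Z. c K K)" using fin by (simp add: sum.delta sum_distrib_left)
 finally have "card (Pow Z) * \<bar>\<Sum>K\<in>Z. c K K\<bar> = \<bar>\<Sum>G\<in>Pow Z. \<Sum>K\<in>Z. \<Sum>K'\<in>Z. s G K * s G K' * c K K'\<bar>"
  by (simp add: abs_mult)
 also have "... \<le> (\<Sum>G\<in>Pow Z. \<bar>\<Sum>K\<in>Z. \<Sum>K'\<in>Z. s G K * s G K' * c K K'\<bar>)" by (rule sum_abs)
 also have "... \<le> (\<Sum>G\<in>Pow Z. B)" by (intro sum_mono B) (simp add: s_def)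
 finally show ?thesis using fin by (simp add: card_Pow)
qed

text \<open>On a level in \<open>S\<close> the next letter of \<open>K\<close> is forced by the next
  letter of \<open>I\<close>; on the other levels it is free and doubles the count.\<close>

lemma phi_fibre_card:
 assumes "length I = card (S \<inter> {..<m})"
 shows "card {K \<in> Lw m. phi S G K = I} * 2 ^ length I = 2 ^ m"
 using assms
proof (induction m arbitrary: I)
 case 0
 have "{K \<in> Lw 0. phi S G K = I} = {[]}" using 0 by auto
 then show ?case using 0 by simp
next
 case (Suc m)
 show ?case
 proof (cases "m \<in> S")
  case True
  then have "S \<inter> {..<Suc m} = insert m (S \<inter> {..<m})" by (auto simp: less_Suc_eq)
  then have l: "length I = Suc (card (S \<inter> {..<m}))" using Suc by simp
  then obtain J c where I: "I = J @ [c]" "length J = card (S \<inter> {..<m})"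
   by (metis append_butlast_last_id diff_Suc_1 length_butlast list.size(3) nat.distinct(1))
  have "{K \<in> Lw (Suc m). phi S G K = I} = (\<lambda>w. w @ [c \<noteq> (w \<in> G)]) ` {K \<in> Lw m. phi S G K = J}" (is "?A = ?B")
  proof
   show "?A \<subseteq> ?B"
   proof
    fix K assume K: "K \<in> ?A"
    then obtain w b where w: "K = w @ [b]" "length w = m"
     by (metis (mono_tags, lifting) Lw_iff append_butlast_last_id diff_Suc_1 length_butlast list.size(3) mem_Collect_eq nat.distinct(1))
    then have "phi S G w = J" "(b \<noteq> (w \<in> G)) = c" using K True I by (auto simp: phi_snoc)
    then show "K \<in> ?B" using w by (intro image_eqI[of _ _ w]) auto
   qed
   show "?B \<subseteq> ?A" using True I by (auto simp: phi_snoc)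
  qed
  then have "card {K \<in> Lw (Suc m). phi S G K = I} = card {K \<in> Lw m. phi S G K = J}"
   by (simp add: card_image inj_on_def)
  then show ?thesis using Suc.IH[OF I(2)] I by simp
 next
  case False
  then have "S \<inter> {..<Suc m} = S \<inter> {..<m}" by (auto simp: less_Suc_eq)
  then have l: "length I = card (S \<inter> {..<m})" using Suc by simp
  have "bij_betw (\<lambda>(w, b). w @ [b]) ({K \<in> Lw m. phi S G K = I} \<times> (UNIV :: bool set)) {K \<in> Lw (Suc m). phi S G K = I}"
   by (rule bij_betw_byWitness[where f' = "\<lambda>K. (butlast K, last K)"])
    (use False in \<open>auto simp: phi_snoc length_Suc_conv_rev\<close>)
  then have "card {K \<in> Lw (Suc m). phi S G K = I} = card ({K \<in> Lw m. phi S G K = I} \<times> (UNIV :: bool set))"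
   by (simp add: bij_betw_same_card)
  then show ?thesis using Suc.IH[OF l] by (simp add: card_cartesian_product)
 qed
qed

section \<open>Coefficient arrays\<close>

type_synonym arr = "bool list => bool list => real"

text \<open>Rectangular frames are needed because re-coding acts on one variable at a time.\<close>

definition arrs2 :: "nat => nat => arr set" where
 "arrs2 n l = {a. \<forall>K L. n < length K \<or> l < length L --> a K L = 0}"

definition arrs :: "nat => arr set" where "arrs n = arrs2 n n"

definition hb :: "bool list => bool list => arr" where
 "hb K L = (\<lambda>K' L'. if K' = K \<and> L' = L then 1 else 0)"

definition tens :: "(bool list => real) => (bool list => real) => arr" where
 "tens u v = (\<lambda>K L. u K * v L)"

text \<open>The length of the interval coded by \<open>K\<close>, that is, the squared L2 norm of
  its Haar function.\<close>

definition wt :: "bool list => real" where "wt K = (1/2) ^ length K"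

text \<open>The coefficient form of the \<open>L\<^sup>2\<close> pairing of two Haar expansions.\<close>

definition pair :: "nat => arr => arr => real" where
 "pair N a b = (\<Sum>K\<in>Ww N. \<Sum>L\<in>Ww N. wt K * wt L * (a K L * b K L))"

text \<open>In coefficients, the substitution of a block basis for the Haar system in the first
  variable: the unit array at \<open>(I, L)\<close> goes to the sum over \<open>K\<close> of
  \<open>chi S G I K\<close> times the unit array at \<open>(K, L)\<close>.\<close>

definition upx :: "nat set => bool list set => arr => arr" where
 "upx S G a = (\<lambda>K L. if length K \<in> S then (if K \<in> G then -1 else 1) * a (phi S G K) L else 0)"

text \<open>The adjoint of \<open>upx\<close> under \<open>pair\<close>; the factor
  \<open>2 ^ length I\<close> cancels the weight \<open>wt I\<close>. It averages coefficients over
  a fibre of \<open>phi\<close> and inverts \<open>upx\<close> from the left.\<close>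

definition dnx :: "nat set => bool list set => nat => arr => arr" where
 "dnx S G N b = (\<lambda>I L. 2 ^ length I * (\<Sum>K\<in>Ww N. chi S G I K * (wt K * b K L)))"

definition tr :: "arr => arr" where "tr a = (\<lambda>K L. a L K)"

definition upy :: "nat set => bool list set => arr => arr" where
 "upy S G a = tr (upx S G (tr a))"

definition dny :: "nat set => bool list set => nat => arr => arr" where
 "dny S G N b = tr (dnx S G N (tr b))"

lemma wt_pos [simp]: "0 < wt K" and wt_nonneg [simp]: "0 \<le> wt K" and wt_le_1: "wt K \<le> 1"
 by (auto simp: wt_def power_le_one)

lemma arrs2D: "a \<in> arrs2 n l ==> n < length K \<or> l < length L ==> a K L = 0"
 by (auto simp: arrs2_def)

lemma arrsD: "a \<in> arrs n ==> n < length K \<or> n < length L ==> a K L = 0"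
 by (auto simp: arrs_def arrs2_def)

lemma arrs_mono: "n \<le> m ==> a \<in> arrs n ==> a \<in> arrs m"
 unfolding arrs_def arrs2_def by force

lemma arrs_closed [simp, intro]:
 "0 \<in> arrs n" "a \<in> arrs n ==> b \<in> arrs n ==> a + b \<in> arrs n"
 "a \<in> arrs n ==> b \<in> arrs n ==> a - b \<in> arrs n" "a \<in> arrs n ==> c *\<^sub>R a \<in> arrs n"
 by (auto simp: arrs_def arrs2_def scaleR_fun_def)

lemma hb_arrs [simp]: "length K \<le> n ==> length L \<le> n ==> hb K L \<in> arrs n"
 by (auto simp: arrs_def arrs2_def hb_def)

definition part :: "(bool list \<times> bool list) set => arr => arr" where
 "part Q a = (\<lambda>K L. if (K, L) \<in> Q then a K L else 0)"

lemma part_arrs [simp]: "a \<in> arrs n ==> part Q a \<in> arrs n"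
 by (auto simp: arrs_def arrs2_def part_def)

lemma part_all: "a \<in> arrs n ==> part (Ww n \<times> Ww n) a = a"
 using arrsD[of a n] by (auto simp: part_def fun_eq_iff not_le)

lemma part_insert:
 assumes "(K, L) \<notin> Q" shows "part (insert (K, L) Q) a = a K L *\<^sub>R hb K L + part Q a"
 using assms by (auto simp: part_def hb_def fun_eq_iff scaleR_fun_def)

definition lin :: "nat => (arr => real) => bool" where
 "lin n f \<longleftrightarrow> (\<forall>a\<in>arrs n. \<forall>b\<in>arrs n. f (a + b) = f a + f b) \<and> (\<forall>c. \<forall>a\<in>arrs n. f (c *\<^sub>R a) = c * f a)"

lemma lin_expand:
 assumes f: "lin n f" and a: "a \<in> arrs n"
 shows "f a = (\<Sum>K\<in>Ww n. \<Sum>L\<in>Ww n. a K L * f (hb K L))"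
proof -
 have "f (part Q a) = (\<Sum>p\<in>Q. a (fst p) (snd p) * f (hb (fst p) (snd p)))"
  if "finite Q" "Q \<subseteq> Ww n \<times> Ww n" for Q
  using that
 proof (induction Q rule: finite_induct)
  case empty
  have "part {} a = 0 *\<^sub>R a" by (auto simp: part_def fun_eq_iff scaleR_fun_def)
  then have "f (part {} a) = 0 * f a" using f a unfolding lin_def by metis
  then show ?case by simp
 next
  case (insert p Q)
  obtain K L where p: "p = (K, L)" by (cases p)
  have h: "hb K L \<in> arrs n" using insert p by simp
  then have "a K L *\<^sub>R hb K L \<in> arrs n" by simp
  then have "f (part (insert p Q) a) = a K L * f (hb K L) + f (part Q a)"
   using f h a insert part_insert[of K L Q a] part_arrs[OF a, of Q] unfolding lin_def p by metis
  then show ?case using insert p by simp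
 qed
 from this[of "Ww n \<times> Ww n"] show ?thesis
  using part_all[OF a] by (simp add: sum.cartesian_product case_prod_unfold)
qed

lemma pair_commute: "pair N a b = pair N b a"
 by (simp add: pair_def mult_ac)

lemma pair_hb: "K \<in> Ww N ==> L \<in> Ww N ==> pair N a (hb K L) = wt K * wt L * a K L"
proof -
 assume "K \<in> Ww N" "L \<in> Ww N"
 have "pair N a (hb K L) = (\<Sum>K'\<in>Ww N. \<Sum>L'\<in>Ww N. if L' = L then if K' = K then wt K * wt L * a K L else 0 else 0)"
  unfolding pair_def by (intro sum.cong refl) (auto simp: hb_def)
 then show ?thesis using \<open>K \<in> Ww N\<close> \<open>L \<in> Ww N\<close> by (simp add: sum.delta)
qed

lemma pair_add: "pair N (a + a') b = pair N a b + pair N a' b"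
 by (simp add: pair_def distrib_right distrib_left sum.distrib)

lemma pair_scale: "pair N (c *\<^sub>R a) b = c * pair N a b"
 by (simp add: pair_def scaleR_fun_def sum_distrib_left mult_ac)

lemma lin_pair: "lin N (\<lambda>b. pair N a b)"
proof -
 have "pair N a (b + b') = pair N a b + pair N a b'" for b b'
  using pair_add[of N b b' a] by (simp only: pair_commute[of N a])
 moreover have "pair N a (c *\<^sub>R b) = c * pair N a b" for b c
  using pair_scale[of N c b a] by (simp only: pair_commute[of N a])
 ultimately show ?thesis by (simp add: lin_def)
qed

section \<open>Linear structure of the re-coding operators\<close>

lemma card_rank_le:
 fixes S :: "nat set"
 assumes "S \<subseteq> {..N}" "card S = Suc n" "k \<in> S"
 shows "card (S \<inter> {..<k}) \<le> n"
proof -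
 have "finite S" using finite_subset[OF assms(1)] by simp
 moreover have "S \<inter> {..<k} \<subset> S" using assms(3) by auto
 ultimately show ?thesis using psubset_card_mono[of S "S \<inter> {..<k}"] assms by auto
qed

lemma card_le_Suc_bound: "S \<subseteq> {..N::nat} ==> card S = Suc n ==> n \<le> N"
 using card_mono[of "{..N}" S] by simp

lemma upx_arrs2:
 assumes "S \<subseteq> {..N}" "a \<in> arrs2 n l" shows "upx S G a \<in> arrs2 N l"
 using assms by (auto simp: upx_def arrs2_def)

lemma upy_arrs2:
 assumes "S \<subseteq> {..N}" "a \<in> arrs2 n l" shows "upy S G a \<in> arrs2 n N"
 using assms by (auto simp: upy_def upx_def tr_def arrs2_def)

lemma chi_0_long:
 assumes "S \<subseteq> {..N}" "card S = Suc n" "n < length I" shows "chi S G I K = 0"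
 using card_rank_le[OF assms(1,2)] chi_nz_length[of S G I K] assms(3) by fastforce

lemma dnx_arrs2:
 assumes "S \<subseteq> {..N}" "card S = Suc n" "b \<in> arrs2 N l" shows "dnx S G N b \<in> arrs2 n l"
 using chi_0_long[OF assms(1,2)] assms(3) by (auto simp: dnx_def arrs2_def)

lemma dny_arrs2:
 assumes "S \<subseteq> {..N}" "card S = Suc n" "b \<in> arrs2 l N" shows "dny S G N b \<in> arrs2 l n"
 using chi_0_long[OF assms(1,2)] assms(3) by (auto simp: dny_def dnx_def tr_def arrs2_def)

text \<open>The fibre of \<open>I\<close> lies on one level and its intervals have the same total
  length as the interval of \<open>I\<close>. So the block vectors have the right normalization for
  \<open>dnx\<close> to undo \<open>upx\<close>.\<close>

lemma chi_fibre_weight: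
 assumes S: "S \<subseteq> {..N}" "card S = Suc n" and I: "length I \<le> n"
 shows "2 ^ length I * (\<Sum>K\<in>Ww N. chi S G I K * chi S G I K * wt K) = 1"
proof -
 have fin: "finite S" using finite_subset[OF S(1)] by simp
 obtain m where m: "m \<in> S" "card (S \<inter> {..<m}) = length I"
  using rank_surj[OF fin, of "length I"] S I by auto
 have mN: "m \<le> N" using m S by auto
 have "(\<Sum>K\<in>Ww N. chi S G I K * (chi S G I K * wt K)) = (\<Sum>K\<in>Lw m. chi S G I K * (chi S G I K * wt K))"
  by (rule sum_chi_level[OF fin m(1) mN m(2)[symmetric]])
 also have "... = (\<Sum>K\<in>{K \<in> Lw m. phi S G K = I}. (1/2) ^ m)"
  unfolding sum.inter_filter[OF finite_Lw] using m by (intro sum.cong refl) (auto simp: chi_def wt_def)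
 also have "... = card {K \<in> Lw m. phi S G K = I} * (1/2) ^ m" by simp
 also have "2 ^ length I * ... = (card {K \<in> Lw m. phi S G K = I} * 2 ^ length I) * (1/2) ^ m" by simp
 also have "real (card {K \<in> Lw m. phi S G K = I} * 2 ^ length I) = 2 ^ m"
  using phi_fibre_card[of I S m G] m by (metis of_nat_numeral of_nat_power)
 then have "(card {K \<in> Lw m. phi S G K = I} * 2 ^ length I) * (1/2 :: real) ^ m = 1"
  by (simp add: power_one_over)
 finally show ?thesis by (simp add: mult.assoc)
qed

lemma dnx_upx:
 assumes S: "S \<subseteq> {..N}" "card S = Suc n" and a: "a \<in> arrs2 n l"
 shows "dnx S G N (upx S G a) = a"
proof (intro ext)
 fix I L
 show "dnx S G N (upx S G a) I L = a I L"
 proof (cases "length I \<le> n")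
  case True
  have "chi S G I K * (wt K * upx S G a K L) = a I L * (chi S G I K * chi S G I K * wt K)" for K
   by (auto simp: chi_def upx_def)
  then have "dnx S G N (upx S G a) I L = 2 ^ length I * (\<Sum>K\<in>Ww N. a I L * (chi S G I K * chi S G I K * wt K))"
   by (simp only: dnx_def)
  also have "... = a I L * (2 ^ length I * (\<Sum>K\<in>Ww N. chi S G I K * chi S G I K * wt K))"
   by (simp only: sum_distrib_left[symmetric] mult.left_commute)
  finally show ?thesis using chi_fibre_weight[OF S True, of G] by simp
 next
  case False
  then show ?thesis using chi_0_long[OF S, of I G] arrs2D[OF a, of I L] by (simp add: dnx_def)
 qed
qed

lemma dny_upy:
 assumes S: "S \<subseteq> {..N}" "card S = Suc n" and a: "a \<in> arrs2 l n"
 shows "dny S G N (upy S G a) = a"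
proof -
 have "tr a \<in> arrs2 n l" using a by (auto simp: tr_def arrs2_def)
 then show ?thesis using dnx_upx[OF S] by (simp add: dny_def upy_def tr_def)
qed

lemma up_linear:
 "upx S G (a + b) = upx S G a + upx S G b" "upx S G (c *\<^sub>R a) = c *\<^sub>R upx S G a"
 "upy S G (a + b) = upy S G a + upy S G b" "upy S G (c *\<^sub>R a) = c *\<^sub>R upy S G a"
 by (auto simp: upx_def upy_def tr_def fun_eq_iff scaleR_fun_def algebra_simps)

lemma dn_linear:
 "dnx S G N (a + b) = dnx S G N a + dnx S G N b" "dnx S G N (c *\<^sub>R a) = c *\<^sub>R dnx S G N a"
 "dny S G N (a + b) = dny S G N a + dny S G N b" "dny S G N (c *\<^sub>R a) = c *\<^sub>R dny S G N a"
 by (simp_all add: dnx_def dny_def tr_def fun_eq_iff scaleR_fun_def distrib_left sum.distrib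
   sum_distrib_left mult_ac)

lemma up_hb: "upx S G (upy S' G' (hb I J)) = tens (chi S G I) (chi S' G' J)"
 by (auto simp: upx_def upy_def tr_def hb_def tens_def chi_def fun_eq_iff)

lemma dn_pair: "dny S' G' N (dnx S G N b) I J
  = 2 ^ length I * 2 ^ length J * pair N b (tens (chi S G I) (chi S' G' J))"
proof -
 have "dny S' G' N (dnx S G N b) I J
   = (\<Sum>L\<in>Ww N. \<Sum>K\<in>Ww N. 2 ^ length I * 2 ^ length J * (wt K * wt L * (b K L * (chi S G I K * chi S' G' J L))))"
  unfolding dny_def dnx_def tr_def sum_distrib_left by (intro sum.cong refl) (simp add: mult_ac)
 also have "... = 2 ^ length I * 2 ^ length J * pair N b (tens (chi S G I) (chi S' G' J))"
  unfolding pair_def tens_def by (subst sum.swap) (simp only: sum_distrib_left)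
 finally show ?thesis .
qed

lemma tens_chi_arrs: "S \<subseteq> {..N} ==> S' \<subseteq> {..N} ==> tens (chi S G I) (chi S' G' J) \<in> arrs N"
 by (auto simp: arrs_def arrs2_def tens_def chi_def)

section \<open>Norms of Haar type and diagonalization of operators\<close>

text \<open>The list is closed under duality: \<open>nu_level\<close> and \<open>pair_level\<close>
  change places, so do \<open>nu_column\<close> and \<open>pair_column\<close>, and the
  \<open>up\<close> and \<open>dn\<close> maps are adjoint to each other. The norm is a function of
  the array alone, which makes the inclusions between frames isometric. The bound
  \<open>sqrt (card T)\<close> reflects that a point lies in exactly one dyadic interval of each
  level, so in one column at most \<open>card T\<close> coefficients enter the square function at
  any point.\<close>

locale haar_norm =
 fixes \<nu> :: "arr => real" and x y :: real
 assumes xy: "0 \<le> x" "x \<le> 1" "0 \<le> y" "y \<le> 1"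
  and nu_nonneg: "a \<in> arrs n ==> 0 \<le> \<nu> a"
  and nu_zero: "a \<in> arrs n ==> \<nu> a = 0 \<longleftrightarrow> a = 0"
  and nu_scale: "a \<in> arrs n ==> \<nu> (r *\<^sub>R a) = \<bar>r\<bar> * \<nu> a"
  and nu_triangle: "a \<in> arrs n ==> b \<in> arrs n ==> \<nu> (a + b) \<le> \<nu> a + \<nu> b"
  and nu_mono: "a \<in> arrs n ==> b \<in> arrs n ==> (\<And>K L. \<bar>a K L\<bar> \<le> \<bar>b K L\<bar>) ==> \<nu> a \<le> \<nu> b"
  and nu_upx: "S \<subseteq> {..N} ==> card S = Suc n ==> a \<in> arrs2 n l ==> \<nu> (upx S G a) \<le> \<nu> a"
  and nu_upy: "S \<subseteq> {..N} ==> card S = Suc n ==> a \<in> arrs2 l n ==> \<nu> (upy S G a) \<le> \<nu> a"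
  and nu_dnx: "S \<subseteq> {..N} ==> card S = Suc n ==> b \<in> arrs2 N l ==> \<nu> (dnx S G N b) \<le> \<nu> b"
  and nu_dny: "S \<subseteq> {..N} ==> card S = Suc n ==> b \<in> arrs2 l N ==> \<nu> (dny S G N b) \<le> \<nu> b"
  and nu_level: "P \<subseteq> Lw m ==> P' \<subseteq> Lw m' ==> (\<And>K L. \<bar>a K L\<bar> \<le> (if K \<in> P \<and> L \<in> P' then 1 else 0)) ==>
   \<nu> a \<le> (real (card P) / 2 ^ m) powr x * (real (card P') / 2 ^ m') powr y"
  and pair_level: "m \<le> N ==> m' \<le> N ==> P \<subseteq> Lw m ==> P' \<subseteq> Lw m' ==>
   (\<And>K L. \<bar>a K L\<bar> \<le> (if K \<in> P \<and> L \<in> P' then 1 else 0)) ==> c \<in> arrs N ==>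
   \<bar>pair N c a\<bar> \<le> \<nu> c * ((real (card P) / 2 ^ m) powr (1 - x) * (real (card P') / 2 ^ m') powr (1 - y))"
  and nu_column: "T \<subseteq> {..N} ==> length L0 \<le> N ==>
   (\<And>K L. \<bar>a K L\<bar> \<le> (if length K \<in> T \<and> L = L0 then 1 else 0)) ==> \<nu> a \<le> sqrt (card T)"
  and pair_column: "T \<subseteq> {..N} ==> length L0 \<le> N ==>
   (\<And>K L. \<bar>a K L\<bar> \<le> (if length K \<in> T \<and> L = L0 then 1 else 0)) ==> c \<in> arrs N ==>
   \<bar>pair N c a\<bar> \<le> \<nu> c * sqrt (card T)"
begin

definition Cs :: "nat => arr nspace" where "Cs n = \<lparr>carr = arrs n, nrm = \<nu>\<rparr>"

lemma Cs_simps [simp]: "carr (Cs n) = arrs n" "nrm (Cs n) = \<nu>"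
 by (simp_all add: Cs_def)

lemma Cs_normed: "normed_space (Cs n)"
 unfolding normed_space_def subspace_def
 using nu_nonneg[of _ n] nu_zero[of _ n] nu_scale[of _ n] nu_triangle[of _ n] by auto

lemma nu_hb_le: assumes "length K \<le> n" "length L \<le> n" shows "\<nu> (hb K L) \<le> 1"
proof -
 have "\<nu> (hb K L) \<le> (real (card {K}) / 2 ^ length K) powr x * (real (card {L}) / 2 ^ length L) powr y"
  by (rule nu_level) (auto simp: hb_def)
 also have "... \<le> 1 * 1"
  using xy by (intro mult_mono powr_le1) auto
 finally show ?thesis by simp
qed

text \<open>Pairing with a unit array reads off the entry with weight \<open>wt K * wt L\<close>,
  which is at least \<open>(1/4) ^ n\<close>. Such crude constants are harmless, since they only
  multiply errors that are chosen small after \<open>n\<close> is known.\<close>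

lemma abs_entry_le:
 assumes a: "a \<in> arrs n" shows "\<bar>a K L\<bar> \<le> 4 ^ n * \<nu> a"
proof (cases "length K \<le> n \<and> length L \<le> n")
 case True
 have "\<bar>pair n a (hb K L)\<bar> \<le> \<nu> a * ((real (card {K}) / 2 ^ length K) powr (1 - x) * (real (card {L}) / 2 ^ length L) powr (1 - y))"
  by (rule pair_level) (use True a in \<open>auto simp: hb_def\<close>)
 also have "... \<le> \<nu> a * (1 * 1)"
  using xy nu_nonneg[OF a] by (intro mult_left_mono mult_mono powr_le1) auto
 finally have "wt K * wt L * \<bar>a K L\<bar> \<le> \<nu> a"
  using pair_hb[of K n L a] True by (simp add: abs_mult)
 moreover have "(1/4) ^ n \<le> wt K * wt L"
 proof -
  have "(1/2 :: real) ^ n * (1/2) ^ n \<le> wt K * wt L"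
   unfolding wt_def using True by (intro mult_mono power_decreasing) auto
  then show ?thesis by (simp add: power_mult_distrib[symmetric])
 qed
 ultimately have "(1/4) ^ n * \<bar>a K L\<bar> \<le> \<nu> a" by (meson abs_ge_zero mult_right_mono order_trans)
 then show ?thesis by (simp add: power_one_over field_simps)
next
 case False
 then show ?thesis using arrsD[OF a, of K L] nu_nonneg[OF a] by auto
qed

lemma nu_le_sum:
 assumes a: "a \<in> arrs n" shows "\<nu> a \<le> (\<Sum>K\<in>Ww n. \<Sum>L\<in>Ww n. \<bar>a K L\<bar>)"
proof -
 have "\<nu> (part Q a) \<le> (\<Sum>p\<in>Q. \<bar>a (fst p) (snd p)\<bar>)" if "finite Q" "Q \<subseteq> Ww n \<times> Ww n" for Q
  using that
 proof (induction Q rule: finite_induct)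
  case empty
  have "part {} a = 0" by (auto simp: part_def fun_eq_iff)
  moreover have "\<nu> 0 = 0" using nu_zero[OF arrs_closed(1)] by simp
  ultimately show ?case by (simp only: sum.empty)
 next
  case (insert p Q)
  obtain K L where p: "p = (K, L)" by (cases p)
  have h: "hb K L \<in> arrs n" using insert p by simp
  have "\<nu> (part (insert p Q) a) \<le> \<nu> (a K L *\<^sub>R hb K L) + \<nu> (part Q a)"
   using insert p nu_triangle[OF arrs_closed(4)[OF h] part_arrs[OF a, of Q], of "a K L"]
   by (simp add: part_insert)
  also have "\<nu> (a K L *\<^sub>R hb K L) = \<bar>a K L\<bar> * \<nu> (hb K L)" by (rule nu_scale[OF h])
  also have "... \<le> \<bar>a K L\<bar> * 1" using insert p by (intro mult_left_mono nu_hb_le[of _ n]) auto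
  finally show ?case using insert p by simp
 qed
 from this[of "Ww n \<times> Ww n"] show ?thesis
  using part_all[OF a] by (simp add: sum.cartesian_product case_prod_unfold)
qed

lemma nu_le_bound:
 fixes c :: real
 assumes a: "a \<in> arrs n" and c: "\<And>K L. K \<in> Ww n ==> L \<in> Ww n ==> \<bar>a K L\<bar> \<le> c"
 shows "\<nu> a \<le> (card (Ww n))\<^sup>2 * c"
proof -
 have "\<nu> a \<le> (\<Sum>K\<in>Ww n. \<Sum>L\<in>Ww n. \<bar>a K L\<bar>)" by (rule nu_le_sum[OF a])
 also have "... \<le> (\<Sum>K\<in>Ww n. \<Sum>L\<in>Ww n. c)" by (intro sum_mono c)
 finally have "\<nu> a \<le> (\<Sum>K\<in>Ww n. \<Sum>L\<in>Ww n. c)" .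
 then show ?thesis by (simp add: power2_eq_square)
qed

lemma up_op_le:
 assumes S: "S \<subseteq> {..N}" "card S = Suc n" and S': "S' \<subseteq> {..N}" "card S' = Suc n"
 shows "op_le (Cs n) (Cs N) 1 (\<lambda>a. upx S G (upy S' G' a))"
proof (rule op_leI)
 fix a assume "a \<in> carr (Cs n)"
 then have a: "a \<in> arrs2 n n" by (simp add: arrs_def)
 have u: "upy S' G' a \<in> arrs2 n N" by (rule upy_arrs2[OF S'(1) a])
 show "upx S G (upy S' G' a) \<in> carr (Cs N)" using upx_arrs2[OF S(1) u] by (simp add: arrs_def)
 show "nrm (Cs N) (upx S G (upy S' G' a)) \<le> 1 * nrm (Cs n) a"
  using nu_upx[OF S u, of G] nu_upy[OF S' a, of G'] by simp
qed (auto simp: up_linear)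

lemma dn_op_le:
 assumes S: "S \<subseteq> {..N}" "card S = Suc n" and S': "S' \<subseteq> {..N}" "card S' = Suc n"
 shows "op_le (Cs N) (Cs n) 1 (\<lambda>b. dny S' G' N (dnx S G N b))"
proof (rule op_leI)
 fix b assume "b \<in> carr (Cs N)"
 then have b: "b \<in> arrs2 N N" by (simp add: arrs_def)
 have d: "dnx S G N b \<in> arrs2 n N" by (rule dnx_arrs2[OF S b])
 show "dny S' G' N (dnx S G N b) \<in> carr (Cs n)" using dny_arrs2[OF S' d] by (simp add: arrs_def)
 show "nrm (Cs n) (dny S' G' N (dnx S G N b)) \<le> 1 * nrm (Cs N) b"
  using nu_dnx[OF S b, of G] nu_dny[OF S' d, of G'] by simp
qed (auto simp: dn_linear)

end

section \<open>The matrix of an operator, diagonalized in both variables\<close>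

lemma sum4_swap:
 "(\<Sum>K\<in>A. \<Sum>L\<in>B. \<Sum>K'\<in>C. \<Sum>L'\<in>D. f K L K' L') = (\<Sum>L\<in>B. \<Sum>L'\<in>D. \<Sum>K\<in>A. \<Sum>K'\<in>C. (f K L K' L' :: real))"
proof -
 have "(\<Sum>K\<in>A. \<Sum>L\<in>B. \<Sum>K'\<in>C. \<Sum>L'\<in>D. f K L K' L') = (\<Sum>L\<in>B. \<Sum>K\<in>A. \<Sum>K'\<in>C. \<Sum>L'\<in>D. f K L K' L')"
  by (rule sum.swap)
 also have "... = (\<Sum>L\<in>B. \<Sum>K\<in>A. \<Sum>L'\<in>D. \<Sum>K'\<in>C. f K L K' L')"
  by (intro sum.cong refl sum.swap)
 also have "... = (\<Sum>L\<in>B. \<Sum>L'\<in>D. \<Sum>K\<in>A. \<Sum>K'\<in>C. f K L K' L')"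
  by (intro sum.cong refl sum.swap)
 finally show ?thesis .
qed

lemma sum_delta2:
 assumes "finite A" "l \<in> A" "l' \<in> A"
 shows "(\<Sum>i\<in>A. \<Sum>j\<in>A. (if i = l then 1 else 0) * (if j = l' then 1 else 0) * t i j) = (t l l' :: real)"
proof -
 have "(\<Sum>i\<in>A. \<Sum>j\<in>A. (if i = l then 1 else 0) * (if j = l' then 1 else 0) * t i j)
   = (\<Sum>i\<in>A. if i = l then \<Sum>j\<in>A. if j = l' then t i j else 0 else 0)"
  by (intro sum.cong refl) (auto intro!: sum.cong)
 then show ?thesis using assms by (simp add: sum.delta)
qed

lemma sum_Ww_restrict:
 assumes "m \<le> N" "\<And>K. length K \<noteq> m ==> f K = (0 :: real)"
 shows "(\<Sum>K\<in>Ww N. f K) = (\<Sum>K\<in>Lw m. f K)"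
 by (rule sum.mono_neutral_right) (use assms in auto)

context haar_norm
begin

lemma tens_level_arrs:
 assumes "P \<subseteq> Lw m" "Q \<subseteq> Lw l" "m \<le> N" "l \<le> N"
  "\<And>K. \<bar>u K\<bar> \<le> (if K \<in> P then 1 else 0)" "\<And>L. \<bar>v L\<bar> \<le> (if L \<in> Q then 1 else 0)"
 shows "tens u v \<in> arrs N"
proof -
 have "u K = 0" if "N < length K" for K using assms(5)[of K] that assms(1,3) by (auto split: if_splits)
 moreover have "v K = 0" if "N < length K" for K using assms(6)[of K] that assms(2,4) by (auto split: if_splits)
 ultimately show ?thesis by (auto simp: arrs_def arrs2_def tens_def)
qed

lemma tens_level_le:
 fixes u v :: "bool list => real"
 assumes "\<And>K. \<bar>u K\<bar> \<le> (if K \<in> P then 1 else 0)" "\<And>L. \<bar>v L\<bar> \<le> (if L \<in> Q then 1 else 0)"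
 shows "\<bar>tens u v K L\<bar> \<le> (if K \<in> P \<and> L \<in> Q then 1 else 0)"
 using assms(1)[of K] assms(2)[of L] mult_mono[of "\<bar>u K\<bar>" 1 "\<bar>v L\<bar>" 1]
 by (auto simp: tens_def abs_mult split: if_splits)

context
 fixes N :: nat and \<Gamma> :: real and T :: "arr => arr"
 assumes T: "op_le (Cs N) (Cs N) \<Gamma> T"
begin

text \<open>Matrix entries for the weighted pairing, so they carry the weights of \<open>K'\<close>
  and \<open>L'\<close>; the \<open>dn\<close> maps restore the normalization later.\<close>

definition tm :: "bool list => bool list => bool list => bool list => real" where
 "tm K L K' L' = pair N (T (hb K L)) (hb K' L')"

lemma lin_pair_T: "lin N (\<lambda>a. pair N (T a) b)"
 unfolding lin_def using op_leD(3,4)[OF T] by (auto simp: pair_add pair_scale)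

lemma pair_T_tens:
 assumes "tens u v \<in> arrs N" "tens u' v' \<in> arrs N"
 shows "pair N (T (tens u v)) (tens u' v')
  = (\<Sum>L\<in>Ww N. \<Sum>L'\<in>Ww N. v L * v' L' * (\<Sum>K\<in>Ww N. \<Sum>K'\<in>Ww N. u K * u' K' * tm K L K' L'))"
proof -
 have "pair N (T (tens u v)) (tens u' v')
   = (\<Sum>K\<in>Ww N. \<Sum>L\<in>Ww N. tens u v K L * pair N (T (hb K L)) (tens u' v'))"
  by (rule lin_expand[OF lin_pair_T assms(1)])
 also have "... = (\<Sum>K\<in>Ww N. \<Sum>L\<in>Ww N. tens u v K L * (\<Sum>K'\<in>Ww N. \<Sum>L'\<in>Ww N. tens u' v' K' L' * tm K L K' L'))"
  unfolding tm_def by (intro sum.cong refl arg_cong2[of _ _ _ _ "(*)"] lin_expand[OF lin_pair assms(2)])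
 also have "... = (\<Sum>K\<in>Ww N. \<Sum>L\<in>Ww N. \<Sum>K'\<in>Ww N. \<Sum>L'\<in>Ww N. v L * v' L' * (u K * u' K' * tm K L K' L'))"
  unfolding sum_distrib_left by (intro sum.cong refl) (simp add: tens_def mult_ac)
 also have "... = (\<Sum>L\<in>Ww N. \<Sum>L'\<in>Ww N. \<Sum>K\<in>Ww N. \<Sum>K'\<in>Ww N. v L * v' L' * (u K * u' K' * tm K L K' L'))"
  by (rule sum4_swap)
 finally show ?thesis by (simp only: sum_distrib_left)
qed

lemma pair_T_level:
 assumes P: "P \<subseteq> Lw m" "Q \<subseteq> Lw l" "P' \<subseteq> Lw m'" "Q' \<subseteq> Lw l'"
  and N: "m \<le> N" "l \<le> N" "m' \<le> N" "l' \<le> N"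
  and u: "\<And>K. \<bar>u K\<bar> \<le> (if K \<in> P then 1 else 0)" "\<And>L. \<bar>v L\<bar> \<le> (if L \<in> Q then 1 else 0)"
   "\<And>K. \<bar>u' K\<bar> \<le> (if K \<in> P' then 1 else 0)" "\<And>L. \<bar>v' L\<bar> \<le> (if L \<in> Q' then 1 else 0)"
  and \<Gamma>: "0 \<le> \<Gamma>"
 shows "\<bar>pair N (T (tens u v)) (tens u' v')\<bar>
  \<le> \<Gamma> * ((real (card P) / 2 ^ m) powr x * (real (card Q) / 2 ^ l) powr y)
    * ((real (card P') / 2 ^ m') powr (1 - x) * (real (card Q') / 2 ^ l') powr (1 - y))"
proof -
 have a: "tens u v \<in> arrs N" by (rule tens_level_arrs[OF P(1,2) N(1,2) u(1,2)])
 then have Ta: "T (tens u v) \<in> arrs N" using op_leD(1)[OF T] by simp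
 have "\<bar>pair N (T (tens u v)) (tens u' v')\<bar>
   \<le> \<nu> (T (tens u v)) * ((real (card P') / 2 ^ m') powr (1 - x) * (real (card Q') / 2 ^ l') powr (1 - y))"
  by (rule pair_level[OF N(3,4) P(3,4) _ Ta]) (rule tens_level_le[OF u(3,4)])
 also have "\<nu> (T (tens u v)) \<le> \<Gamma> * ((real (card P) / 2 ^ m) powr x * (real (card Q) / 2 ^ l) powr y)"
 proof -
  have "\<nu> (T (tens u v)) \<le> \<Gamma> * \<nu> (tens u v)" using op_leD(2)[OF T] a by simp
  also have "... \<le> \<Gamma> * ((real (card P) / 2 ^ m) powr x * (real (card Q) / 2 ^ l) powr y)"
   using \<Gamma> by (intro mult_left_mono nu_level[OF P(1,2)] tens_level_le[OF u(1,2)])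
  finally show ?thesis .
 qed
 finally show ?thesis by (simp add: mult_right_mono)
qed

lemma density_le_1: "P \<subseteq> Lw m ==> real (card P) / 2 ^ m \<le> 1"
 using card_mono[OF finite_Lw, of P m] by (simp add: divide_le_eq_1 flip: of_nat_le_iff)

text \<open>The second-variable words are frozen by testing with the indicators of \<open>L\<close>
  and \<open>L'\<close>. Their densities are at most 1 and drop out of the bound.\<close>

lemma block_form_x:
 assumes S: "S \<subseteq> {m0..N}" and L: "length L \<le> N" "length L' \<le> N" and \<Gamma>: "0 \<le> \<Gamma>"
 shows "block_form S m0 N \<Gamma> x (\<lambda>K K'. tm K L K' L')"
proof
 fix m m' P P' and a b :: "bool list => real"
 assume m: "m \<in> S" "m' \<in> S" and P: "P \<subseteq> Lw m" "P' \<subseteq> Lw m'"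
  and a: "\<And>K. \<bar>a K\<bar> \<le> (if K \<in> P then 1 else 0)" and b: "\<And>K. \<bar>b K\<bar> \<le> (if K \<in> P' then 1 else 0)"
 define v v' where "v = (\<lambda>L1. if L1 = L then 1 else 0 :: real)" and "v' = (\<lambda>L1. if L1 = L' then 1 else 0 :: real)"
 have mN: "m \<le> N" "m' \<le> N" using m S by auto
 have v: "\<bar>v K\<bar> \<le> (if K \<in> {L} then 1 else 0)" "\<bar>v' K\<bar> \<le> (if K \<in> {L'} then 1 else 0)" for K
  by (auto simp: v_def v'_def)
 have Q: "{L} \<subseteq> Lw (length L)" "{L'} \<subseteq> Lw (length L')" by auto
 have "pair N (T (tens a v)) (tens b v')
   = (\<Sum>L1\<in>Ww N. \<Sum>L1'\<in>Ww N. v L1 * v' L1' * (\<Sum>K\<in>Ww N. \<Sum>K'\<in>Ww N. a K * b K' * tm K L1 K' L1'))"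
  by (intro pair_T_tens tens_level_arrs[OF P(1) Q(1) mN(1) L(1) a v(1)] tens_level_arrs[OF P(2) Q(2) mN(2) L(2) b v(2)])
 also have "... = (\<Sum>K\<in>Ww N. \<Sum>K'\<in>Ww N. a K * b K' * tm K L K' L')"
  unfolding v_def v'_def by (rule sum_delta2) (use L in auto)
 also have "... = (\<Sum>K\<in>Lw m. \<Sum>K'\<in>Lw m'. a K * b K' * tm K L K' L')"
 proof -
  have a0: "a K = 0" if "length K \<noteq> m" for K using a[of K] that P by (auto split: if_splits)
  have b0: "b K = 0" if "length K \<noteq> m'" for K using b[of K] that P by (auto split: if_splits)
  show ?thesis using a0 b0 mN by (simp add: sum_Ww_restrict)
 qed
 finally have eq: "(\<Sum>K\<in>Lw m. \<Sum>K'\<in>Lw m'. a K * b K' * tm K L K' L') = pair N (T (tens a v)) (tens b v')" ..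
 have "\<bar>pair N (T (tens a v)) (tens b v')\<bar>
  \<le> \<Gamma> * ((real (card P) / 2 ^ m) powr x * (real (card {L}) / 2 ^ length L) powr y)
    * ((real (card P') / 2 ^ m') powr (1 - x) * (real (card {L'}) / 2 ^ length L') powr (1 - y))"
  by (rule pair_T_level[OF P(1) Q(1) P(2) Q(2) mN(1) L(1) mN(2) L(2) a v(1) b v(2) \<Gamma>])
 also have "... \<le> \<Gamma> * ((real (card P) / 2 ^ m) powr x * 1) * ((real (card P') / 2 ^ m') powr (1 - x) * 1)"
  using \<Gamma> xy density_le_1[OF Q(1)] density_le_1[OF Q(2)]
  by (intro mult_mono mult_left_mono powr_le1) auto
 finally show "\<bar>\<Sum>K\<in>Lw m. \<Sum>K'\<in>Lw m'. a K * b K' * tm K L K' L'\<bar>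
   \<le> \<Gamma> * (real (card P) / 2 ^ m) powr x * (real (card P') / 2 ^ m') powr (1 - x)"
  unfolding eq by simp
qed (use S xy \<Gamma> in auto)

text \<open>This form is what remains after the first variable has been diagonalized: a diagonal sum
  over the level \<open>k\<close>. By \<open>diag_le_signs\<close> it suffices to bound the form
  with random signs on that level. There the whole level is used, of density 1, so the constant does
  not depend on \<open>k\<close>.\<close>

lemma block_form_y:
 assumes S: "S \<subseteq> {l0..M}" and M: "M \<le> N" and k: "k \<le> N" and \<Gamma>: "0 \<le> \<Gamma>"
 shows "block_form S l0 M \<Gamma> y (\<lambda>L L'. \<Sum>K\<in>Lw k. tm K L K L')"
proof
 fix m m' P P' and a b :: "bool list => real"
 assume m: "m \<in> S" "m' \<in> S" and P: "P \<subseteq> Lw m" "P' \<subseteq> Lw m'"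
  and a: "\<And>K. \<bar>a K\<bar> \<le> (if K \<in> P then 1 else 0)" and b: "\<And>K. \<bar>b K\<bar> \<le> (if K \<in> P' then 1 else 0)"
 have mN: "m \<le> N" "m' \<le> N" using m S M by auto
 have a0: "a K = 0" if "length K \<noteq> m" for K using a[of K] that P by (auto split: if_splits)
 have b0: "b K = 0" if "length K \<noteq> m'" for K using b[of K] that P by (auto split: if_splits)
 define c where "c K K' = (\<Sum>L\<in>Lw m. \<Sum>L'\<in>Lw m'. a L * b L' * tm K L K' L')" for K K'
 have "(\<Sum>L\<in>Lw m. \<Sum>L'\<in>Lw m'. a L * b L' * (\<Sum>K\<in>Lw k. tm K L K L'))
   = (\<Sum>L\<in>Lw m. \<Sum>K\<in>Lw k. \<Sum>L'\<in>Lw m'. a L * b L' * tm K L K L')"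
  unfolding sum_distrib_left by (intro sum.cong refl sum.swap)
 also have "... = (\<Sum>K\<in>Lw k. c K K)" unfolding c_def by (rule sum.swap)
 also have "\<bar>...\<bar> \<le> \<Gamma> * (real (card P) / 2 ^ m) powr y * (real (card P') / 2 ^ m') powr (1 - y)"
 proof (rule diag_le_signs[OF finite_Lw, where c = c])
  fix \<sigma> :: "bool list => real" assume \<sigma>: "\<And>K. \<bar>\<sigma> K\<bar> \<le> 1"
  define u where "u K = (if K \<in> Lw k then \<sigma> K else 0)" for K
  have u: "\<bar>u K\<bar> \<le> (if K \<in> Lw k then 1 else 0)" for K using \<sigma> by (simp add: u_def)
  have u0: "u K = 0" if "length K \<noteq> k" for K using that by (simp add: u_def)
  have "pair N (T (tens u a)) (tens u b)
    = (\<Sum>L\<in>Ww N. \<Sum>L'\<in>Ww N. a L * b L' * (\<Sum>K\<in>Ww N. \<Sum>K'\<in>Ww N. u K * u K' * tm K L K' L'))"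
   by (intro pair_T_tens tens_level_arrs[OF subset_refl P(1) k mN(1) u a] tens_level_arrs[OF subset_refl P(2) k mN(2) u b])
  also have "... = (\<Sum>L\<in>Lw m. \<Sum>L'\<in>Lw m'. a L * b L' * (\<Sum>K\<in>Lw k. \<Sum>K'\<in>Lw k. u K * u K' * tm K L K' L'))"
   using a0 b0 u0 mN k by (simp add: sum_Ww_restrict)
  also have "... = (\<Sum>L\<in>Lw m. \<Sum>L'\<in>Lw m'. \<Sum>K\<in>Lw k. \<Sum>K'\<in>Lw k. \<sigma> K * \<sigma> K' * (a L * b L' * tm K L K' L'))"
   unfolding sum_distrib_left by (intro sum.cong refl) (simp add: u_def mult_ac)
  also have "... = (\<Sum>K\<in>Lw k. \<Sum>K'\<in>Lw k. \<sigma> K * \<sigma> K' * c K K')"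
   unfolding c_def sum_distrib_left
   by (subst sum4_swap[symmetric]) (intro sum.cong refl sum.swap)
  finally have eq: "(\<Sum>K\<in>Lw k. \<Sum>K'\<in>Lw k. \<sigma> K * \<sigma> K' * c K K') = pair N (T (tens u a)) (tens u b)" ..
  show "\<bar>\<Sum>K\<in>Lw k. \<Sum>K'\<in>Lw k. \<sigma> K * \<sigma> K' * c K K'\<bar>
    \<le> \<Gamma> * (real (card P) / 2 ^ m) powr y * (real (card P') / 2 ^ m') powr (1 - y)"
   using pair_T_level[OF subset_refl P(1) subset_refl P(2) k mN(1) k mN(2) u a u b \<Gamma>]
   unfolding eq by simp
 qed
 finally show "\<bar>\<Sum>L\<in>Lw m. \<Sum>L'\<in>Lw m'. a L * b L' * (\<Sum>K\<in>Lw k. tm K L K L')\<bar>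
   \<le> \<Gamma> * (real (card P) / 2 ^ m) powr y * (real (card P') / 2 ^ m') powr (1 - y)" .
qed (use S xy \<Gamma> in auto)

text \<open>Expanding the second-variable block vectors costs one error \<open>\<eta>1\<close> for
  each pair of words in \<open>Ww M\<close>, with coefficients at most 1. This is why
  \<open>\<eta>1\<close> has to be chosen when \<open>M\<close> is already known.\<close>

lemma matrix_near_diagonal:
 fixes \<eta>1 \<eta>2 :: real
 assumes Sx: "Sx \<subseteq> {..N}" and Sy: "Sy \<subseteq> {..M}" and M: "M \<le> N"
  and hx: "\<And>L L'. L \<in> Ww M ==> L' \<in> Ww M ==>
   \<bar>(\<Sum>K\<in>Ww N. \<Sum>K'\<in>Ww N. chi Sx Gx I K * chi Sx Gx I' K' * tm K L K' L')
    - (if I = I' then (1/2) ^ length I * (\<Sum>K\<in>lev Sx (length I). tm K L K L') else 0)\<bar> \<le> \<eta>1"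
  and hy: "\<bar>(\<Sum>L\<in>Ww M. \<Sum>L'\<in>Ww M. chi Sy Gy J L * chi Sy Gy J' L' * (\<Sum>K\<in>lev Sx (length I). tm K L K L'))
    - (if J = J' then (1/2) ^ length J * (\<Sum>L\<in>lev Sy (length J). \<Sum>K\<in>lev Sx (length I). tm K L K L) else 0)\<bar> \<le> \<eta>2"
 shows "\<bar>pair N (T (tens (chi Sx Gx I) (chi Sy Gy J))) (tens (chi Sx Gx I') (chi Sy Gy J'))
   - (if I = I' \<and> J = J' then (1/2) ^ length I * (1/2) ^ length J
     * (\<Sum>L\<in>lev Sy (length J). \<Sum>K\<in>lev Sx (length I). tm K L K L) else 0)\<bar> \<le> (card (Ww M))\<^sup>2 * \<eta>1 + \<eta>2"
proof -
 have SyN: "Sy \<subseteq> {..N}" using Sy M by auto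
 define X where "X L L' = (\<Sum>K\<in>Ww N. \<Sum>K'\<in>Ww N. chi Sx Gx I K * chi Sx Gx I' K' * tm K L K' L')" for L L'
 define Y where "Y L L' = (if I = I' then (1/2) ^ length I * (\<Sum>K\<in>lev Sx (length I). tm K L K L') else 0)" for L L'
 let ?c = "\<lambda>L L'. chi Sy Gy J L * chi Sy Gy J' L'"
 have c0: "chi Sy Gy J' L = 0" if "L \<notin> Ww M" for J' L using that Sy by (auto simp: chi_def)
 have "pair N (T (tens (chi Sx Gx I) (chi Sy Gy J))) (tens (chi Sx Gx I') (chi Sy Gy J'))
   = (\<Sum>L\<in>Ww N. \<Sum>L'\<in>Ww N. ?c L L' * X L L')"
  unfolding X_def by (intro pair_T_tens tens_chi_arrs Sx SyN)
 also have "... = (\<Sum>L\<in>Ww N. \<Sum>L'\<in>Ww M. ?c L L' * X L L')"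
  by (intro sum.cong refl sum.mono_neutral_right) (use M c0 in auto)
 also have "... = (\<Sum>L\<in>Ww M. \<Sum>L'\<in>Ww M. ?c L L' * X L L')"
  by (intro sum.mono_neutral_right) (use M c0 in auto)
 finally have 1: "pair N (T (tens (chi Sx Gx I) (chi Sy Gy J))) (tens (chi Sx Gx I') (chi Sy Gy J'))
   = (\<Sum>L\<in>Ww M. \<Sum>L'\<in>Ww M. ?c L L' * X L L')" .
 have "\<bar>(\<Sum>L\<in>Ww M. \<Sum>L'\<in>Ww M. ?c L L' * X L L') - (\<Sum>L\<in>Ww M. \<Sum>L'\<in>Ww M. ?c L L' * Y L L')\<bar>
   = \<bar>\<Sum>L\<in>Ww M. \<Sum>L'\<in>Ww M. ?c L L' * (X L L' - Y L L')\<bar>"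
  by (simp add: sum_subtractf right_diff_distrib)
 also have "... \<le> (\<Sum>L\<in>Ww M. \<Sum>L'\<in>Ww M. \<eta>1)"
 proof (intro order_trans[OF sum_abs] sum_mono order_trans[OF sum_abs])
  fix L L' assume L: "L \<in> Ww M" "L' \<in> Ww M"
  have "\<bar>?c L L' * (X L L' - Y L L')\<bar> = (\<bar>chi Sy Gy J L\<bar> * \<bar>chi Sy Gy J' L'\<bar>) * \<bar>X L L' - Y L L'\<bar>"
   by (simp add: abs_mult)
  also have "... \<le> (1 * 1) * \<eta>1"
   using hx[OF L] by (intro mult_mono chi_abs_le) (auto simp: X_def Y_def)
  finally show "\<bar>?c L L' * (X L L' - Y L L')\<bar> \<le> \<eta>1" by simp
 qed
 also have "... = (card (Ww M))\<^sup>2 * \<eta>1" by (simp add: power2_eq_square)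
 finally have 2: "\<bar>(\<Sum>L\<in>Ww M. \<Sum>L'\<in>Ww M. ?c L L' * X L L') - (\<Sum>L\<in>Ww M. \<Sum>L'\<in>Ww M. ?c L L' * Y L L')\<bar>
  \<le> (card (Ww M))\<^sup>2 * \<eta>1" .
 define Z where "Z = (\<Sum>L\<in>Ww M. \<Sum>L'\<in>Ww M. ?c L L' * (\<Sum>K\<in>lev Sx (length I). tm K L K L'))"
 define W where "W = (if J = J' then (1/2) ^ length J * (\<Sum>L\<in>lev Sy (length J). \<Sum>K\<in>lev Sx (length I). tm K L K L) else 0)"
 have ZW: "\<bar>Z - W\<bar> \<le> \<eta>2" using hy by (simp add: Z_def W_def)
 have 3: "(\<Sum>L\<in>Ww M. \<Sum>L'\<in>Ww M. ?c L L' * Y L L') = (if I = I' then (1/2) ^ length I * Z else 0)"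
  by (simp add: Y_def Z_def sum_distrib_left mult_ac)
 have 4: "\<bar>(if I = I' then (1/2) ^ length I * Z else 0) - (if I = I' then (1/2) ^ length I * W else 0)\<bar> \<le> \<eta>2"
 proof (cases "I = I'")
  case True
  have "\<bar>(1/2) ^ length I * Z - (1/2) ^ length I * W\<bar> = (1/2) ^ length I * \<bar>Z - W\<bar>"
   by (simp add: abs_mult right_diff_distrib[symmetric])
  also have "... \<le> 1 * \<bar>Z - W\<bar>" by (intro mult_right_mono power_le_one) auto
  finally show ?thesis using True ZW by simp
 qed (use ZW in auto)
 have 5: "(if I = I' \<and> J = J' then (1/2) ^ length I * (1/2) ^ length J
     * (\<Sum>L\<in>lev Sy (length J). \<Sum>K\<in>lev Sx (length I). tm K L K L) else 0)
   = (if I = I' then (1/2) ^ length I * W else 0)" by (simp add: W_def)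
 show ?thesis unfolding 5 1 using 2 4 unfolding 3 by linarith
qed

end

end

section \<open>Factoring the identity through a single large space\<close>

lemma half_power_small:
 fixes c \<epsilon> :: real
 assumes "0 \<le> c" "0 < \<epsilon>"
 obtains m where "c * (((1/2) ^ m) powr (1/2)) \<le> \<epsilon>"
proof -
 have "0 < \<epsilon> / (c + 1)" using assms by simp
 moreover have "sqrt (1/2) < 1" by (simp add: real_sqrt_lt_1_iff)
 ultimately obtain m where m: "sqrt (1/2) ^ m < \<epsilon> / (c + 1)"
  using real_arch_pow_inv by blast
 have "c * (((1/2) ^ m) powr (1/2)) = c * sqrt (1/2) ^ m"
  by (simp add: powr_half_sqrt real_sqrt_power)
 also have "... \<le> (c + 1) * (\<epsilon> / (c + 1))"
  using assms m by (intro mult_mono) auto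
 also have "... = \<epsilon>" using assms by simp
 finally show ?thesis using that by blast
qed

text \<open>A block vector occupies one level of the first variable, so smallness of the functional
  on that level, in each of the columns from \<open>Ww M\<close>, is enough.\<close>

lemma functional_on_blocks_le:
 fixes \<epsilon> :: real
 assumes f: "lin N f" and Sx: "Sx \<subseteq> {..N}" and Sy: "Sy \<subseteq> {..M}" and M: "M \<le> N" and I: "length I < card Sx"
  and small: "\<And>m L. m \<in> Sx ==> L \<in> Ww M ==> (\<Sum>K\<in>Lw m. \<bar>f (hb K L)\<bar>) \<le> \<epsilon>"
 shows "\<bar>f (tens (chi Sx Gx I) (chi Sy Gy J))\<bar> \<le> card (Ww M) * \<epsilon>"
proof -
 have fin: "finite Sx" using Sx by (rule finite_subset) simp
 obtain m where m: "m \<in> Sx" "card (Sx \<inter> {..<m}) = length I" using rank_surj[OF fin I] by blast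
 have mN: "m \<le> N" using m Sx by auto
 have SyN: "Sy \<subseteq> {..N}" using Sy M by auto
 let ?g = "\<lambda>K L. chi Sx Gx I K * chi Sy Gy J L * f (hb K L)"
 have "f (tens (chi Sx Gx I) (chi Sy Gy J)) = (\<Sum>K\<in>Ww N. \<Sum>L\<in>Ww N. ?g K L)"
  using lin_expand[OF f tens_chi_arrs[OF Sx SyN, of Gx I Gy J]] by (simp add: tens_def)
 also have "... = (\<Sum>L\<in>Ww N. \<Sum>K\<in>Ww N. ?g K L)" by (rule sum.swap)
 also have "... = (\<Sum>L\<in>Ww M. \<Sum>K\<in>Ww N. ?g K L)"
  by (intro sum.mono_neutral_right) (use M Sy in \<open>auto simp: chi_def\<close>)
 also have "... = (\<Sum>L\<in>Ww M. \<Sum>K\<in>Lw m. ?g K L)"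
  using sum_chi_level[OF fin m(1) mN m(2)[symmetric], of Gx "\<lambda>K. chi Sy Gy J _ * f (hb K _)"]
  by (simp add: mult.assoc)
 also have "\<bar>...\<bar> \<le> (\<Sum>L\<in>Ww M. \<Sum>K\<in>Lw m. \<bar>f (hb K L)\<bar>)"
 proof (intro order_trans[OF sum_abs] sum_mono order_trans[OF sum_abs])
  fix K L
  have "\<bar>chi Sx Gx I K * chi Sy Gy J L * f (hb K L)\<bar> \<le> 1 * 1 * \<bar>f (hb K L)\<bar>"
   unfolding abs_mult by (intro mult_mono chi_abs_le) auto
  then show "\<bar>?g K L\<bar> \<le> \<bar>f (hb K L)\<bar>" by simp
 qed
 also have "... \<le> (\<Sum>L\<in>Ww M. \<epsilon>)" by (intro sum_mono small m(1))
 finally show ?thesis by simp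
qed

context haar_norm
begin

text \<open>Let \<open>V\<close> be the set of levels where the functional is large. Testing with
  the signs of its own values there gives
  \<open>card V * \<epsilon> \<le> \<Gamma> * sqrt (card V)\<close>.\<close>

lemma few_large_levels:
 fixes \<Gamma> \<epsilon> :: real
 assumes F: "lin N F" and \<epsilon>: "0 < \<epsilon>" and L: "length L \<le> N"
  and bound: "\<And>a V. V \<subseteq> {..N} ==> (\<And>K L'. \<bar>a K L'\<bar> \<le> (if length K \<in> V \<and> L' = L then 1 else 0)) ==>
   \<bar>F a\<bar> \<le> \<Gamma> * sqrt (card V)"
 shows "card {m \<in> {..N}. \<epsilon> < (\<Sum>K\<in>Lw m. \<bar>F (hb K L)\<bar>)} \<le> (\<Gamma> / \<epsilon>)\<^sup>2"
proof -
 define V where "V = {m \<in> {..N}. \<epsilon> < (\<Sum>K\<in>Lw m. \<bar>F (hb K L)\<bar>)}"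
 define a where "a K L' = (if length K \<in> V \<and> L' = L then sgn (F (hb K L)) else 0)" for K L'
 have V: "V \<subseteq> {..N}" "finite V" by (auto simp: V_def)
 have a: "a \<in> arrs N" using V L by (auto simp: a_def arrs_def arrs2_def)
 have "F a = (\<Sum>K\<in>Ww N. \<Sum>L'\<in>Ww N. a K L' * F (hb K L'))" by (rule lin_expand[OF F a])
 also have "... = (\<Sum>K\<in>Ww N. if length K \<in> V then \<bar>F (hb K L)\<bar> else 0)"
 proof (intro sum.cong refl)
  fix K
  have "(\<Sum>L'\<in>Ww N. a K L' * F (hb K L')) = (\<Sum>L'\<in>Ww N. if L' = L then a K L * F (hb K L) else 0)"
   by (intro sum.cong refl) (auto simp: a_def)
  also have "... = a K L * F (hb K L)" using L by (simp add: sum.delta)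
  finally show "(\<Sum>L'\<in>Ww N. a K L' * F (hb K L')) = (if length K \<in> V then \<bar>F (hb K L)\<bar> else 0)"
   by (simp add: a_def abs_sgn mult.commute)
 qed
 also have "... = (\<Sum>K\<in>{K \<in> Ww N. length K \<in> V}. \<bar>F (hb K L)\<bar>)" by (simp only: sum.inter_filter finite_Ww)
 also have "... = (\<Sum>m\<in>V. \<Sum>K\<in>{K \<in> {K \<in> Ww N. length K \<in> V}. length K = m}. \<bar>F (hb K L)\<bar>)"
 proof (rule sum.group[symmetric])
  show "finite {K \<in> Ww N. length K \<in> V}" by (rule finite_subset[of _ "Ww N"]) auto
 qed (use V in auto)
 also have "... = (\<Sum>m\<in>V. \<Sum>K\<in>Lw m. \<bar>F (hb K L)\<bar>)"
  by (intro sum.cong refl) (use V in auto)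
 finally have Fa: "F a = (\<Sum>m\<in>V. \<Sum>K\<in>Lw m. \<bar>F (hb K L)\<bar>)" .
 have "card V * \<epsilon> = (\<Sum>m\<in>V. \<epsilon>)" by simp
 also have "... \<le> F a" unfolding Fa by (intro sum_mono) (auto simp: V_def)
 also have "... \<le> \<bar>F a\<bar>" by simp
 also have "... \<le> \<Gamma> * sqrt (card V)"
  by (rule bound[OF V(1)]) (auto simp: a_def abs_sgn_eq)
 finally have le: "card V * \<epsilon> \<le> \<Gamma> * sqrt (card V)" .
 have "real (card V) \<le> (\<Gamma> / \<epsilon>)\<^sup>2"
 proof (cases "card V = 0")
  case False
  then have s: "0 < sqrt (card V)" by simp
  have "real (card V) = sqrt (card V) * sqrt (card V)" by simp
  then have "sqrt (card V) * (sqrt (card V) * \<epsilon>) \<le> sqrt (card V) * \<Gamma>"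
   using le by (metis mult.assoc mult.commute)
  then have "sqrt (card V) * \<epsilon> \<le> \<Gamma>" using s by (simp only: mult_le_cancel_left_pos)
  then have "sqrt (card V) \<le> \<Gamma> / \<epsilon>" using \<epsilon> by (simp add: field_simps)
  then have "(sqrt (card V))\<^sup>2 \<le> (\<Gamma> / \<epsilon>)\<^sup>2" using s by (intro power_mono) auto
  then show ?thesis by simp
 qed simp
 then show ?thesis by (simp add: V_def)
qed

text \<open>The embedding \<open>A\<close> first divides by \<open>D\<close> or
  \<open>1 - D\<close>, whichever is at least \<open>1/2\<close>; unconditionality bounds this
  multiplier by 2. With \<open>W\<close> the number of words, the remaining error has entries at
  most \<open>2 * W^2 * 16 ^ n * \<eta>\<close> times \<open>\<nu> a\<close>, and passing from
  entries to the norm costs another \<open>W^2\<close>; the hypothesis on \<open>\<eta>\<close>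
  brings the total down to \<open>1/4\<close>. The last two conclusions transport smallness on block
  vectors to functionals composed with \<open>A\<close> and to images under
  \<open>B\<close>.\<close>

lemma factor_near_diagonal:
 fixes \<eta> :: real
 assumes T: "op_le (Cs N) (Cs N) \<Gamma> T"
  and Sx: "Sx \<subseteq> {..N}" "card Sx = Suc n" and Sy: "Sy \<subseteq> {..N}" "card Sy = Suc n"
  and D: "\<And>i j. i \<le> n ==> j \<le> n ==> if b then 1/2 \<le> D i j else D i j \<le> 1/2"
  and near: "\<And>I J I' J'. I \<in> Ww n ==> J \<in> Ww n ==> I' \<in> Ww n ==> J' \<in> Ww n ==>
   \<bar>pair N (T (tens (chi Sx Gx I) (chi Sy Gy J))) (tens (chi Sx Gx I') (chi Sy Gy J'))
    - (if I = I' \<and> J = J' then (1/2) ^ length I * (1/2) ^ length J * D (length I) (length J) else 0)\<bar> \<le> \<eta>"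
  and \<eta>: "0 \<le> \<eta>" "8 * real (card (Ww n)) ^ 4 * 16 ^ n * \<eta> \<le> 1"
 obtains A B where "op_le (Cs n) (Cs N) 2 A" "op_le (Cs N) (Cs n) 1 B"
  "\<And>a. a \<in> arrs n ==> \<nu> (B (if b then T (A a) else A a - T (A a)) - a) \<le> 1/4 * \<nu> a"
  "\<And>f c a. lin N f ==> (\<And>I J. I \<in> Ww n ==> \<bar>f (tens (chi Sx Gx I) (chi Sy Gy J))\<bar> \<le> c) ==>
   a \<in> arrs n ==> \<bar>f (A a)\<bar> \<le> 2 * (real (card (Ww n)))\<^sup>2 * 4 ^ n * c * \<nu> a"
  "\<And>h c. h \<in> arrs N ==> (\<And>I J. I \<in> Ww n ==> \<bar>pair N h (tens (chi Sx Gx I) (chi Sy Gy J))\<bar> \<le> c) ==>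
   \<nu> (B h) \<le> (real (card (Ww n)))\<^sup>2 * 4 ^ n * c"
proof -
 define W where "W = real (card (Ww n))"
 define Ah where "Ah I J = tens (chi Sx Gx I) (chi Sy Gy J)" for I J
 define A0 where "A0 a = upx Sx Gx (upy Sy Gy a)" for a
 define B where "B c = dny Sy Gy N (dnx Sx Gx N c)" for c
 define d where "d i j = (if b then D i j else 1 - D i j)" for i j
 define mu where "mu a = (\<lambda>I J. if length I \<le> n \<and> length J \<le> n then a I J / d (length I) (length J) else 0 :: real)" for a :: arr
 have A0: "op_le (Cs n) (Cs N) 1 A0" unfolding A0_def by (rule up_op_le[OF Sx Sy])
 have B: "op_le (Cs N) (Cs n) 1 B" unfolding B_def by (rule dn_op_le[OF Sx Sy])
 have A0hb: "A0 (hb I J) = Ah I J" for I J by (simp add: A0_def Ah_def up_hb)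
 have Bp: "B c I J = 2 ^ length I * 2 ^ length J * pair N c (Ah I J)" for c I J
  by (simp add: B_def Ah_def dn_pair)
 have BA0: "B (A0 a) = a" if "a \<in> arrs n" for a
 proof -
  have a: "a \<in> arrs2 n n" using that by (simp add: arrs_def)
  show ?thesis
   unfolding B_def A0_def using dnx_upx[OF Sx upy_arrs2[OF Sy(1) a]] dny_upy[OF Sy a] by simp
 qed
 have d: "1/2 \<le> d i j" if "i \<le> n" "j \<le> n" for i j using D[OF that] by (auto simp: d_def split: if_splits)
 have mu_arrs: "mu a \<in> arrs n" for a by (auto simp: mu_def arrs_def arrs2_def)
 have mu_le: "\<bar>mu a I J\<bar> \<le> 2 * \<bar>a I J\<bar>" for a I J
 proof (cases "length I \<le> n \<and> length J \<le> n")
  case True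
  then have "1/2 \<le> d (length I) (length J)" using d by blast
  then have "\<bar>a I J\<bar> / d (length I) (length J) \<le> \<bar>a I J\<bar> / (1/2)"
   by (intro divide_left_mono) auto
  then show ?thesis using True \<open>1/2 \<le> d (length I) (length J)\<close> by (simp add: mu_def abs_divide)
 qed (auto simp: mu_def)
 have mu_lin: "mu (a + a') = mu a + mu a'" "mu (c *\<^sub>R a) = c *\<^sub>R mu a" for a a' c
  by (auto simp: mu_def fun_eq_iff scaleR_fun_def add_divide_distrib)
 have mu_nu: "\<nu> (mu a) \<le> 2 * \<nu> a" if a: "a \<in> arrs n" for a
 proof -
  have "\<nu> (mu a) \<le> \<nu> (2 *\<^sub>R a)"
   using mu_le[of a] by (intro nu_mono[OF mu_arrs arrs_closed(4)[OF a]]) (auto simp: scaleR_fun_def abs_mult)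
  then show ?thesis using nu_scale[OF a, of 2] by simp
 qed
 have mu_op: "op_le (Cs n) (Cs n) 2 mu"
  by (rule op_leI) (auto simp: mu_arrs mu_lin mu_nu)
 define A where "A a = A0 (mu a)" for a
 have A: "op_le (Cs n) (Cs N) 2 A"
  unfolding A_def using op_le_comp[OF mu_op A0] by simp
 have mu_entry: "\<bar>mu a I J\<bar> \<le> 2 * 4 ^ n * \<nu> a" if "a \<in> arrs n" for a I J
  using mu_le[of a I J] abs_entry_le[OF that, of I J] by simp
 have linA0: "lin n (\<lambda>a. f (A0 a))" if f: "lin N f" for f
  using f op_leD[OF A0] unfolding lin_def by simp
 have double: "\<bar>\<Sum>I\<in>Ww n. \<Sum>J\<in>Ww n. mu a I J * g I J\<bar> \<le> W\<^sup>2 * (2 * 4 ^ n * \<nu> a * c)"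
  if a: "a \<in> arrs n" and g: "\<And>I J. I \<in> Ww n ==> J \<in> Ww n ==> \<bar>g I J\<bar> \<le> c" for a g c
 proof -
  have "\<bar>\<Sum>I\<in>Ww n. \<Sum>J\<in>Ww n. mu a I J * g I J\<bar> \<le> (\<Sum>I\<in>Ww n. \<Sum>J\<in>Ww n. 2 * 4 ^ n * \<nu> a * c)"
  proof (intro order_trans[OF sum_abs] sum_mono order_trans[OF sum_abs])
   fix I J assume IJ: "I \<in> Ww n" "J \<in> Ww n"
   show "\<bar>mu a I J * g I J\<bar> \<le> 2 * 4 ^ n * \<nu> a * c"
    unfolding abs_mult using mu_entry[OF a] g[OF IJ] nu_nonneg[OF a] by (intro mult_mono) auto
  qed
  then show ?thesis by (simp add: W_def power2_eq_square)
 qed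
 have pw: "2 ^ length I * 2 ^ length J \<le> (4::real) ^ n" if "I \<in> Ww n" "J \<in> Ww n" for I J :: "bool list"
 proof -
  have "2 ^ length I * 2 ^ length J \<le> (2::real) ^ n * 2 ^ n"
   using that by (intro mult_mono power_increasing) auto
  then show ?thesis by (simp add: power_mult_distrib[symmetric])
 qed
 have entry: "\<bar>B (T (A a)) I' J' - D (length I') (length J') * mu a I' J'\<bar> \<le> W\<^sup>2 * (2 * 4 ^ n * \<nu> a * (4 ^ n * \<eta>))"
  if a: "a \<in> arrs n" and I': "I' \<in> Ww n" "J' \<in> Ww n" for a I' J'
 proof -
  define w where "w = (2::real) ^ length I' * 2 ^ length J'"
  define E where "E I J = (if I = I' \<and> J = J' then (1/2) ^ length I * (1/2) ^ length J * D (length I) (length J) else 0)" for I J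
  have "B (T (A a)) I' J' = w * pair N (T (A0 (mu a))) (Ah I' J')" by (simp add: Bp A_def w_def)
  also have "pair N (T (A0 (mu a))) (Ah I' J') = (\<Sum>I\<in>Ww n. \<Sum>J\<in>Ww n. mu a I J * pair N (T (Ah I J)) (Ah I' J'))"
   using lin_expand[OF linA0[OF lin_pair_T[OF T]] mu_arrs[of a], of "Ah I' J'"] by (simp add: A0hb)
  finally have 1: "B (T (A a)) I' J' = (\<Sum>I\<in>Ww n. \<Sum>J\<in>Ww n. mu a I J * (w * pair N (T (Ah I J)) (Ah I' J')))"
   by (simp add: sum_distrib_left mult_ac)
  have "(\<Sum>I\<in>Ww n. \<Sum>J\<in>Ww n. mu a I J * (w * E I J))
    = (\<Sum>I\<in>Ww n. \<Sum>J\<in>Ww n. (if I = I' then 1 else 0) * (if J = J' then 1 else 0)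
      * (mu a I J * (w * ((1/2) ^ length I * (1/2) ^ length J * D (length I) (length J)))))"
   by (intro sum.cong refl) (auto simp: E_def)
  also have "... = mu a I' J' * (w * ((1/2) ^ length I' * (1/2) ^ length J' * D (length I') (length J')))"
   using I' by (intro sum_delta2) auto
  also have "... = D (length I') (length J') * mu a I' J'"
   by (simp add: w_def power_one_over field_simps)
  finally have 2: "D (length I') (length J') * mu a I' J' = (\<Sum>I\<in>Ww n. \<Sum>J\<in>Ww n. mu a I J * (w * E I J))" ..
  have "B (T (A a)) I' J' - D (length I') (length J') * mu a I' J'
    = (\<Sum>I\<in>Ww n. \<Sum>J\<in>Ww n. mu a I J * (w * (pair N (T (Ah I J)) (Ah I' J') - E I J)))"
   unfolding 1 2 by (simp add: sum_subtractf right_diff_distrib)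
  also have "\<bar>...\<bar> \<le> W\<^sup>2 * (2 * 4 ^ n * \<nu> a * (4 ^ n * \<eta>))"
  proof (rule double[OF a])
   fix I J assume IJ: "I \<in> Ww n" "J \<in> Ww n"
   have "\<bar>w * (pair N (T (Ah I J)) (Ah I' J') - E I J)\<bar> = w * \<bar>pair N (T (Ah I J)) (Ah I' J') - E I J\<bar>"
    by (simp add: abs_mult w_def)
   also have "... \<le> 4 ^ n * \<eta>"
    using near[OF IJ I'] pw[OF I'] by (intro mult_mono) (auto simp: w_def E_def Ah_def)
   finally show "\<bar>w * (pair N (T (Ah I J)) (Ah I' J') - E I J)\<bar> \<le> 4 ^ n * \<eta>" .
  qed
  finally show ?thesis .
 qed
 have final: "\<nu> (B (if b then T (A a) else A a - T (A a)) - a) \<le> 1/4 * \<nu> a" if a: "a \<in> arrs n" for a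
 proof -
  have Aa: "A a \<in> arrs N" "T (A a) \<in> arrs N" using op_leD(1)[OF A] op_leD(1)[OF T] a by auto
  let ?e = "B (if b then T (A a) else A a - T (A a)) - a"
  have mem: "?e \<in> arrs n"
   using op_leD(1)[OF B] Aa a by (auto intro!: arrs_closed)
  have am: "a I J = d (length I) (length J) * mu a I J" if "I \<in> Ww n" "J \<in> Ww n" for I J
   using d[of "length I" "length J"] that by (simp add: mu_def)
  have abs: "\<bar>?e I J\<bar> = \<bar>B (T (A a)) I J - D (length I) (length J) * mu a I J\<bar>"
   if IJ: "I \<in> Ww n" "J \<in> Ww n" for I J
  proof (cases b)
   case True
   then show ?thesis using am[OF IJ] by (simp add: d_def)
  next
   case False
   have "B (A a - T (A a)) = B (A a) - B (T (A a))"
    using bounded_op_diff[OF Cs_normed op_le_bounded[OF B]] Aa by simp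
   also have "B (A a) = mu a" using BA0[OF mu_arrs] by (simp add: A_def)
   finally have eq: "B (A a - T (A a)) = mu a - B (T (A a))" .
   have "B (A a - T (A a)) I J = mu a I J - B (T (A a)) I J" by (simp only: eq) simp
   then have "?e I J = D (length I) (length J) * mu a I J - B (T (A a)) I J"
    using False am[OF IJ] by (simp add: d_def algebra_simps)
   then show ?thesis by simp
  qed
  have "\<nu> ?e \<le> (card (Ww n))\<^sup>2 * (W\<^sup>2 * (2 * 4 ^ n * \<nu> a * (4 ^ n * \<eta>)))"
   by (rule nu_le_bound[OF mem]) (simp only: abs entry[OF a])
  also have "... = 1/4 * (8 * W ^ 4 * (4 ^ n * 4 ^ n) * \<eta>) * \<nu> a"
   by (simp add: W_def power2_eq_square power4_eq_xxxx)
  also have "(4::real) ^ n * 4 ^ n = 16 ^ n" by (simp add: power_mult_distrib[symmetric])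
  also have "1/4 * (8 * W ^ 4 * 16 ^ n * \<eta>) * \<nu> a \<le> 1/4 * 1 * \<nu> a"
   using \<eta> nu_nonneg[OF a] by (intro mult_right_mono mult_left_mono) (auto simp: W_def)
  finally show ?thesis by (simp only: mult_1_right)
 qed
 have func: "\<bar>f (A a)\<bar> \<le> 2 * W\<^sup>2 * 4 ^ n * c * \<nu> a"
  if f: "lin N f" and c: "\<And>I J. I \<in> Ww n ==> \<bar>f (Ah I J)\<bar> \<le> c" and a: "a \<in> arrs n" for f c a
 proof -
  have "f (A a) = (\<Sum>I\<in>Ww n. \<Sum>J\<in>Ww n. mu a I J * f (Ah I J))"
   using lin_expand[OF linA0[OF f] mu_arrs[of a]] by (simp add: A0hb A_def)
  also have "\<bar>...\<bar> \<le> W\<^sup>2 * (2 * 4 ^ n * \<nu> a * c)" by (intro double[OF a] c)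
  finally show ?thesis by (simp add: mult_ac)
 qed
 have vec: "\<nu> (B h) \<le> W\<^sup>2 * 4 ^ n * c"
  if h: "h \<in> arrs N" and c: "\<And>I J. I \<in> Ww n ==> \<bar>pair N h (Ah I J)\<bar> \<le> c" for h c
 proof -
  have Bh: "B h \<in> arrs n" using op_leD(1)[OF B] h by simp
  have "\<nu> (B h) \<le> (card (Ww n))\<^sup>2 * (4 ^ n * c)"
  proof (rule nu_le_bound[OF Bh])
   fix I J assume IJ: "I \<in> Ww n" "J \<in> Ww n"
   have "\<bar>B h I J\<bar> = 2 ^ length I * 2 ^ length J * \<bar>pair N h (Ah I J)\<bar>" by (simp add: Bp abs_mult)
   also have "... \<le> 4 ^ n * c" using pw[OF IJ] c[OF IJ(1)] by (intro mult_mono) auto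
   finally show "\<bar>B h I J\<bar> \<le> 4 ^ n * c" .
  qed
  then show ?thesis by (simp add: W_def mult.assoc)
 qed
 show ?thesis
  by (rule that[OF A B final]) (use func vec in \<open>auto simp: Ah_def W_def\<close>)
qed

text \<open>The order of the choices matters. The second-variable window is fixed first; its top
  \<open>Ny\<close> determines how many forms have to be diagonalized in the first variable and in
  how many columns the functionals must be small. Only then is the first-variable window placed,
  beyond \<open>mx\<close> and off the bad levels. The bound on the number of bad levels is uniform,
  so \<open>N0\<close> does not depend on \<open>T\<close>, \<open>f\<close> and
  \<open>h\<close>.\<close>

lemma haar_factorization:
 fixes \<Gamma> \<epsilon> :: real and k :: nat
 assumes \<Gamma>: "0 \<le> \<Gamma>" and \<epsilon>: "0 < \<epsilon>"
 obtains N0 where "\<And>N T f h. N0 \<le> N ==> op_le (Cs N) (Cs N) \<Gamma> T ==>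
  (\<And>s. s < k ==> lin N (f s)) ==> (\<And>s a. s < k ==> a \<in> arrs N ==> \<bar>f s a\<bar> \<le> \<Gamma> * \<nu> a) ==>
  (\<And>s. s < k ==> h s \<in> arrs N) ==> (\<And>s. s < k ==> \<nu> (h s) \<le> \<Gamma>) ==>
  \<exists>A B b. op_le (Cs n) (Cs N) 2 A \<and> op_le (Cs N) (Cs n) 1 B \<and>
   (\<forall>a\<in>arrs n. \<nu> (B (if b then T (A a) else A a - T (A a)) - a) \<le> 1/4 * \<nu> a) \<and>
   (\<forall>s<k. \<forall>a\<in>arrs n. \<bar>f s (A a)\<bar> \<le> \<epsilon> * \<nu> a) \<and> (\<forall>s<k. \<nu> (B (h s)) \<le> \<epsilon>)"
proof -
 define W where "W = real (card (Ww n))"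
 have "[] \<in> Ww n" by simp
 then have "0 < card (Ww n)" by (metis card_gt_0_iff empty_iff finite_Ww)
 then have W: "0 < W" by (simp add: W_def)
 \<comment> \<open>Words of lengths 0 to \<open>n\<close> need \<open>Suc n\<close> levels. The
   window sizes \<open>R1\<close> and \<open>R2\<close> are those demanded by
   \<open>bipartite_ramsey\<close>.\<close>
 define q where "q = Suc n"
 define R1 where "R1 = 2 * q"
 define R2 where "R2 = q * 2 ^ (2 * q)"
 define \<eta>3 where "\<eta>3 = 1 / (8 * W ^ 4 * 16 ^ n)"
 have \<eta>3: "0 < \<eta>3" "8 * W ^ 4 * 16 ^ n * \<eta>3 \<le> 1" using W by (auto simp: \<eta>3_def)
 define \<eta>2 where "\<eta>2 = \<eta>3 / 2"
 obtain my where my: "(q * W\<^sup>2 * (6 * \<Gamma>\<^sup>2)) * (((1/2) ^ my) powr (1/2)) \<le> \<eta>2\<^sup>2"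
  using half_power_small[of "q * W\<^sup>2 * (6 * \<Gamma>\<^sup>2)" "\<eta>2\<^sup>2"] \<eta>3 W by (auto simp: \<eta>2_def)
 define Ny where "Ny = my + R2"
 define V where "V = real (card (Ww Ny))"
 have "[] \<in> Ww Ny" by simp
 then have "0 < card (Ww Ny)" by (metis card_gt_0_iff empty_iff finite_Ww)
 then have V: "0 < V" by (simp add: V_def)
 define \<eta>1 where "\<eta>1 = \<eta>3 / (2 * V\<^sup>2)"
 have \<eta>1: "0 < \<eta>1" "V\<^sup>2 * \<eta>1 + \<eta>2 = \<eta>3" using \<eta>3 V by (auto simp: \<eta>1_def \<eta>2_def)
 obtain mx where mx: "(V\<^sup>2 * W\<^sup>2 * (6 * \<Gamma>\<^sup>2)) * (((1/2) ^ mx) powr (1/2)) \<le> \<eta>1\<^sup>2"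
  using half_power_small[of "V\<^sup>2 * W\<^sup>2 * (6 * \<Gamma>\<^sup>2)" "\<eta>1\<^sup>2"] \<eta>1 by auto
 define \<epsilon>x where "\<epsilon>x = \<epsilon> / (2 * W\<^sup>2 * 4 ^ n * V)"
 have \<epsilon>x: "0 < \<epsilon>x" "2 * W\<^sup>2 * 4 ^ n * (V * \<epsilon>x) = \<epsilon>" using \<epsilon> W V by (auto simp: \<epsilon>x_def)
 \<comment> \<open>Each of the \<open>k\<close> functionals and \<open>k\<close> vectors has, in
   each of the \<open>V\<close> columns, at most \<open>(\<Gamma> / \<epsilon>x)\<^sup>2\<close>
   large levels.\<close>
 obtain B0 :: nat where B0: "k * (V * (2 * (\<Gamma> / \<epsilon>x)\<^sup>2)) \<le> B0" using real_arch_simple by blast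
 define N0 where "N0 = max Ny (mx + (B0 + 1) * R1)"
 show ?thesis
 proof (rule that[of N0])
  fix N T and f :: "nat => arr => real" and h
  assume N: "N0 \<le> N" and T: "op_le (Cs N) (Cs N) \<Gamma> T"
   and f: "\<And>s. s < k ==> lin N (f s)" "\<And>s a. s < k ==> a \<in> arrs N ==> \<bar>f s a\<bar> \<le> \<Gamma> * \<nu> a"
   and h: "\<And>s. s < k ==> h s \<in> arrs N" "\<And>s. s < k ==> \<nu> (h s) \<le> \<Gamma>"
  have NyN: "Ny \<le> N" using N by (simp add: N0_def)
  define bad where "bad F L = {m \<in> {..N}. \<epsilon>x < (\<Sum>K\<in>Lw m. \<bar>F (hb K L)\<bar>)}" for F L
  define Bad where "Bad = (\<Union>s\<in>{..<k}. \<Union>L\<in>Ww Ny. bad (f s) L \<union> bad (pair N (h s)) L)"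
  have b1: "card (bad (f s) L) \<le> (\<Gamma> / \<epsilon>x)\<^sup>2" if s: "s < k" and L: "L \<in> Ww Ny" for s L
   unfolding bad_def
  proof (rule few_large_levels[OF f(1)[OF s] \<epsilon>x(1)])
   show LN: "length L \<le> N" using L NyN by simp
   fix a :: arr and Y assume Y: "Y \<subseteq> {..N}" and a: "\<And>K L'. \<bar>a K L'\<bar> \<le> (if length K \<in> Y \<and> L' = L then 1 else 0 :: real)"
   have "a K L' = 0" if "N < length K \<or> N < length L'" for K L'
    using a[of K L'] that Y LN by (auto split: if_splits)
   then have "a \<in> arrs N" by (auto simp: arrs_def arrs2_def)
   then have "\<bar>f s a\<bar> \<le> \<Gamma> * \<nu> a" by (rule f(2)[OF s])
   also have "... \<le> \<Gamma> * sqrt (card Y)" using \<Gamma> by (intro mult_left_mono nu_column[OF Y LN a])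
   finally show "\<bar>f s a\<bar> \<le> \<Gamma> * sqrt (card Y)" .
  qed
  have b2: "card (bad (pair N (h s)) L) \<le> (\<Gamma> / \<epsilon>x)\<^sup>2" if s: "s < k" and L: "L \<in> Ww Ny" for s L
   unfolding bad_def
  proof (rule few_large_levels[OF lin_pair \<epsilon>x(1)])
   show LN: "length L \<le> N" using L NyN by simp
   fix a :: arr and Y assume Y: "Y \<subseteq> {..N}" and a: "\<And>K L'. \<bar>a K L'\<bar> \<le> (if length K \<in> Y \<and> L' = L then 1 else 0 :: real)"
   have "\<bar>pair N (h s) a\<bar> \<le> \<nu> (h s) * sqrt (card Y)" by (rule pair_column[OF Y LN a h(1)[OF s]])
   also have "... \<le> \<Gamma> * sqrt (card Y)" using h(2)[OF s] by (intro mult_right_mono) auto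
   finally show "\<bar>pair N (h s) a\<bar> \<le> \<Gamma> * sqrt (card Y)" .
  qed
  have finBad: "finite Bad" by (auto simp: Bad_def bad_def)
  have cardBad: "card Bad \<le> B0"
  proof -
   have "real (card Bad) \<le> (\<Sum>s\<in>{..<k}. real (card (\<Union>L\<in>Ww Ny. bad (f s) L \<union> bad (pair N (h s)) L)))"
    unfolding Bad_def of_nat_sum[symmetric] of_nat_le_iff by (rule card_UN_le) simp
   also have "... \<le> (\<Sum>s\<in>{..<k}. \<Sum>L\<in>Ww Ny. real (card (bad (f s) L \<union> bad (pair N (h s)) L)))"
    unfolding of_nat_sum[symmetric] of_nat_le_iff by (intro sum_mono card_UN_le) simp
   also have "... \<le> (\<Sum>s\<in>{..<k}. \<Sum>L\<in>Ww Ny. 2 * (\<Gamma> / \<epsilon>x)\<^sup>2)"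
   proof (intro sum_mono)
    fix s L assume sL: "s \<in> {..<k}" "L \<in> Ww Ny"
    have "real (card (bad (f s) L \<union> bad (pair N (h s)) L)) \<le> card (bad (f s) L) + card (bad (pair N (h s)) L)"
     unfolding of_nat_add[symmetric] of_nat_le_iff by (rule card_Un_le)
    then show "real (card (bad (f s) L \<union> bad (pair N (h s)) L)) \<le> 2 * (\<Gamma> / \<epsilon>x)\<^sup>2"
     using b1[of s L] b2[of s L] sL by auto
   qed
   also have "... = k * (V * (2 * (\<Gamma> / \<epsilon>x)\<^sup>2))" by (simp add: V_def)
   finally show ?thesis using B0 by linarith
  qed
  obtain w where w: "w \<le> B0" "{mx + w * R1..<mx + (w + 1) * R1} \<inter> Bad = {}"
   using free_window[OF finBad cardBad] by blast
  define Wx where "Wx = {mx + w * R1..<mx + (w + 1) * R1}"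
  define Wy where "Wy = {my..<my + R2}"
  have "(w + 1) * R1 \<le> (B0 + 1) * R1" using w by (intro mult_right_mono) auto
  moreover have "mx + (B0 + 1) * R1 \<le> N" using N unfolding N0_def by (rule max.boundedE)
  ultimately have wR: "mx + (w + 1) * R1 \<le> N" by linarith
  have WxN: "Wx \<subseteq> {mx..N}"
  proof
   fix m assume "m \<in> Wx"
   then have "mx + w * R1 \<le> m" "m < mx + (w + 1) * R1" by (simp_all only: Wx_def atLeastLessThan_iff)
   then have "mx \<le> m" "m \<le> N" using wR by linarith+
   then show "m \<in> {mx..N}" by simp
  qed
  have WyN: "Wy \<subseteq> {my..Ny}" by (auto simp: Wy_def Ny_def)
  have cW: "finite Wx" "card Wx = 2 * q" "finite Wy" "card Wy = q * 2 ^ (2 * q)"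
   by (simp_all add: Wx_def Wy_def R1_def R2_def)
  \<comment> \<open>A pair of levels is coloured by the side of \<open>1/2\<close> on which its
    diagonal sum lies. This sum does not involve the signs, so the levels can be fixed before
    \<open>Gx\<close> and \<open>Gy\<close> are chosen.\<close>
  obtain b Sx Sy where S: "Sx \<subseteq> Wx" "Sy \<subseteq> Wy" "card Sx = q" "card Sy = q"
   and mono: "\<And>m l. m \<in> Sx ==> l \<in> Sy ==> (1/2 \<le> (\<Sum>L\<in>Lw l. \<Sum>K\<in>Lw m. tm N T K L K L)) = b"
   by (rule bipartite_ramsey[OF cW, where c = "\<lambda>m l. 1/2 \<le> (\<Sum>L\<in>Lw l. \<Sum>K\<in>Lw m. tm N T K L K L)"]) blast
  have Sx: "Sx \<subseteq> {mx..N}" "Sx \<subseteq> {..N}" "card Sx = Suc n" using S WxN by (auto simp: q_def)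
  have Sy: "Sy \<subseteq> {my..Ny}" "Sy \<subseteq> {..Ny}" "Sy \<subseteq> {..N}" "card Sy = Suc n" using S WyN NyN by (auto simp: q_def)
  have finS: "finite Sx" "finite Sy" using Sx(2) Sy(2) by (auto intro: finite_subset)
  define D where "D i j = (\<Sum>L\<in>lev Sy j. \<Sum>K\<in>lev Sx i. tm N T K L K L)" for i j
  have D: "if b then 1/2 \<le> D i j else D i j \<le> 1/2" if ij: "i \<le> n" "j \<le> n" for i j
  proof -
   obtain m where m: "m \<in> Sx" "card (Sx \<inter> {..<m}) = i" using rank_surj[OF finS(1), of i] ij Sx by auto
   obtain l where l: "l \<in> Sy" "card (Sy \<inter> {..<l}) = j" using rank_surj[OF finS(2), of j] ij Sy by auto
   show ?thesis
    using mono[OF m(1) l(1)] by (auto simp: D_def lev_eq_Lw[OF finS(1) m] lev_eq_Lw[OF finS(2) l])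
  qed
  \<comment> \<open>One sign choice has to serve all pairs of columns at once, so the family of
    forms is indexed by \<open>Ww Ny \<times> Ww Ny\<close>.\<close>
  obtain Gx where Gx: "\<And>L L' I I'. L \<in> Ww Ny ==> L' \<in> Ww Ny ==> length I \<le> n ==> length I' \<le> n ==>
   \<bar>(\<Sum>K\<in>Ww N. \<Sum>K'\<in>Ww N. chi Sx Gx I K * chi Sx Gx I' K' * tm N T K L K' L')
    - (if I = I' then (1/2) ^ length I * (\<Sum>K\<in>lev Sx (length I). tm N T K L K L') else 0)\<bar> \<le> \<eta>1"
  proof -
   have bf: "block_form Sx mx N \<Gamma> x ((\<lambda>(L, L') K K'. tm N T K L K' L') s)" if "s \<in> Ww Ny \<times> Ww Ny" for s
    using that NyN block_form_x[OF T Sx(1) _ _ \<Gamma>, of "fst s" "snd s"] by (auto simp: case_prod_unfold)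
   have small: "card (Ww Ny \<times> Ww Ny) * (card (Ww n))\<^sup>2 * (6 * (\<Gamma>\<^sup>2 * ((1/2) ^ mx) powr (1/2))) \<le> \<eta>1\<^sup>2"
    using mx by (simp add: card_cartesian_product V_def W_def power2_eq_square mult_ac)
   have fin: "finite (Ww Ny \<times> Ww Ny)" by simp
   show ?thesis
   proof (rule diagonalize[where t = "\<lambda>(L, L') K K'. tm N T K L K' L'", OF fin bf Sx(1,3) less_imp_le[OF \<eta>1(1)] small])
    fix G
    assume *: "\<And>s I I'. s \<in> Ww Ny \<times> Ww Ny ==> length I \<le> n ==> length I' \<le> n ==>
     \<bar>(\<Sum>K\<in>Ww N. \<Sum>K'\<in>Ww N. chi Sx G I K * chi Sx G I' K' * (case s of (L, L') => \<lambda>K K'. tm N T K L K' L') K K')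
      - (if I = I' then (1/2) ^ length I * (\<Sum>K\<in>lev Sx (length I). (case s of (L, L') => \<lambda>K K'. tm N T K L K' L') K K) else 0)\<bar> \<le> \<eta>1"
    show thesis
    proof (rule that[of G])
     fix L L' I I' :: "bool list" assume "L \<in> Ww Ny" "L' \<in> Ww Ny" and I: "length I \<le> n" "length I' \<le> n"
     then have "(L, L') \<in> Ww Ny \<times> Ww Ny" by simp
     from *[OF this I] show "\<bar>(\<Sum>K\<in>Ww N. \<Sum>K'\<in>Ww N. chi Sx G I K * chi Sx G I' K' * tm N T K L K' L')
      - (if I = I' then (1/2) ^ length I * (\<Sum>K\<in>lev Sx (length I). tm N T K L K L') else 0)\<bar> \<le> \<eta>1"
      by (simp only: prod.case)
    qed
   qed
  qed
  \<comment> \<open>After the first variable only one form for each rank \<open>i \<le> n\<close> is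
    left, which accounts for the factor \<open>q\<close> in the choice of \<open>my\<close>.\<close>
  obtain Gy where Gy: "\<And>i J J'. i \<le> n ==> length J \<le> n ==> length J' \<le> n ==>
   \<bar>(\<Sum>L\<in>Ww Ny. \<Sum>L'\<in>Ww Ny. chi Sy Gy J L * chi Sy Gy J' L' * (\<Sum>K\<in>lev Sx i. tm N T K L K L'))
    - (if J = J' then (1/2) ^ length J * (\<Sum>L\<in>lev Sy (length J). \<Sum>K\<in>lev Sx i. tm N T K L K L) else 0)\<bar> \<le> \<eta>2"
  proof -
   have bf: "block_form Sy my Ny \<Gamma> y ((\<lambda>i L L'. \<Sum>K\<in>lev Sx i. tm N T K L K L') i)" if i: "i \<in> {..n}" for i
   proof -
    obtain m where m: "m \<in> Sx" "card (Sx \<inter> {..<m}) = i" using rank_surj[OF finS(1), of i] i Sx by auto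
    have "m \<le> N" using m Sx by auto
    then show ?thesis using block_form_y[OF T Sy(1) NyN _ \<Gamma>, of m] by (simp add: lev_eq_Lw[OF finS(1) m])
   qed
   have small: "card {..n} * (card (Ww n))\<^sup>2 * (6 * (\<Gamma>\<^sup>2 * ((1/2) ^ my) powr (1/2))) \<le> \<eta>2\<^sup>2"
    using my by (simp add: q_def W_def algebra_simps)
   have \<eta>2: "0 \<le> \<eta>2" using \<eta>3 by (simp add: \<eta>2_def)
   show ?thesis
   proof (rule diagonalize[where t = "\<lambda>i L L'. \<Sum>K\<in>lev Sx i. tm N T K L K L'", OF _ bf Sy(1,4) \<eta>2 small])
    fix G
    assume *: "\<And>s I I'. s \<in> {..n} ==> length I \<le> n ==> length I' \<le> n ==>
     \<bar>(\<Sum>K\<in>Ww Ny. \<Sum>K'\<in>Ww Ny. chi Sy G I K * chi Sy G I' K' * (\<Sum>Ka\<in>lev Sx s. tm N T Ka K Ka K'))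
      - (if I = I' then (1/2) ^ length I * (\<Sum>K\<in>lev Sy (length I). \<Sum>Ka\<in>lev Sx s. tm N T Ka K Ka K) else 0)\<bar> \<le> \<eta>2"
    show thesis
     by (rule that[of G], rule *) auto
   qed auto
  qed
  have near: "\<bar>pair N (T (tens (chi Sx Gx I) (chi Sy Gy J))) (tens (chi Sx Gx I') (chi Sy Gy J'))
    - (if I = I' \<and> J = J' then (1/2) ^ length I * (1/2) ^ length J * D (length I) (length J) else 0)\<bar> \<le> \<eta>3"
   if "I \<in> Ww n" "J \<in> Ww n" "I' \<in> Ww n" "J' \<in> Ww n" for I J I' J'
  proof -
   have "\<bar>pair N (T (tens (chi Sx Gx I) (chi Sy Gy J))) (tens (chi Sx Gx I') (chi Sy Gy J'))
    - (if I = I' \<and> J = J' then (1/2) ^ length I * (1/2) ^ length J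
      * (\<Sum>L\<in>lev Sy (length J). \<Sum>K\<in>lev Sx (length I). tm N T K L K L) else 0)\<bar>
    \<le> (card (Ww Ny))\<^sup>2 * \<eta>1 + \<eta>2"
    by (rule matrix_near_diagonal[OF T Sx(2) Sy(2) NyN]) (use Gx Gy that in auto)
   moreover have "(real (card (Ww Ny)))\<^sup>2 * \<eta>1 + \<eta>2 = \<eta>3" using \<eta>1(2) by (simp add: V_def)
   ultimately show ?thesis by (simp only: D_def of_nat_power)
  qed
  obtain A B where A: "op_le (Cs n) (Cs N) 2 A" and B: "op_le (Cs N) (Cs n) 1 B"
   and fac: "\<And>a. a \<in> arrs n ==> \<nu> (B (if b then T (A a) else A a - T (A a)) - a) \<le> 1/4 * \<nu> a"
   and func: "\<And>f c a. lin N f ==> (\<And>I J. I \<in> Ww n ==> \<bar>f (tens (chi Sx Gx I) (chi Sy Gy J))\<bar> \<le> c) ==>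
    a \<in> arrs n ==> \<bar>f (A a)\<bar> \<le> 2 * (real (card (Ww n)))\<^sup>2 * 4 ^ n * c * \<nu> a"
   and vec: "\<And>h c. h \<in> arrs N ==> (\<And>I J. I \<in> Ww n ==> \<bar>pair N h (tens (chi Sx Gx I) (chi Sy Gy J))\<bar> \<le> c) ==>
    \<nu> (B h) \<le> (real (card (Ww n)))\<^sup>2 * 4 ^ n * c"
  proof (rule factor_near_diagonal[OF T Sx(2,3) Sy(3,4) D near less_imp_le[OF \<eta>3(1)] \<eta>3(2)[unfolded W_def]])
   fix A B
   assume 1: "op_le (Cs n) (Cs N) 2 A" and 2: "op_le (Cs N) (Cs n) 1 B"
    and 3: "\<And>a. a \<in> arrs n ==> \<nu> (B (if b then T (A a) else A a - T (A a)) - a) \<le> 1/4 * \<nu> a"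
    and 4: "\<And>f c a. lin N f ==> (\<And>I J. I \<in> Ww n ==> \<bar>f (tens (chi Sx Gx I) (chi Sy Gy J))\<bar> \<le> c) ==>
     a \<in> arrs n ==> \<bar>f (A a)\<bar> \<le> 2 * (real (card (Ww n)))\<^sup>2 * 4 ^ n * c * \<nu> a"
    and 5: "\<And>h c. h \<in> arrs N ==> (\<And>I J. I \<in> Ww n ==> \<bar>pair N h (tens (chi Sx Gx I) (chi Sy Gy J))\<bar> \<le> c) ==>
     \<nu> (B h) \<le> (real (card (Ww n)))\<^sup>2 * 4 ^ n * c"
   show thesis by (rule that[of A B]) (fact 1 2 3 4 5)+
  qed
  have good: "(\<Sum>K\<in>Lw m. \<bar>F (hb K L)\<bar>) \<le> \<epsilon>x"
   if "m \<in> Sx" "L \<in> Ww Ny" "s < k" "F = f s \<or> F = pair N (h s)" for m L s F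
  proof -
   have "m \<notin> Bad" using w(2) S(1) that(1) by (auto simp: Wx_def)
   then have "m \<notin> bad F L" using that unfolding Bad_def by blast
   then show ?thesis using that(1) Sx by (auto simp: bad_def)
  qed
  have blk: "\<bar>F (tens (chi Sx Gx I) (chi Sy Gy J))\<bar> \<le> V * \<epsilon>x"
   if F: "lin N F" and s: "s < k" "F = f s \<or> F = pair N (h s)" and I: "I \<in> Ww n" for F s I J
   unfolding V_def
   by (rule functional_on_blocks_le[OF F Sx(2) Sy(2) NyN]) (use I Sx good s in auto)
  have "\<bar>f s (A a)\<bar> \<le> \<epsilon> * \<nu> a" if s: "s < k" and a: "a \<in> arrs n" for s a
  proof -
   have "\<bar>f s (A a)\<bar> \<le> 2 * (real (card (Ww n)))\<^sup>2 * 4 ^ n * (V * \<epsilon>x) * \<nu> a"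
    by (rule func[OF f(1)[OF s] blk[OF f(1)[OF s] s] a]) auto
   then show ?thesis using \<epsilon>x(2) by (simp only: W_def)
  qed
  moreover have "\<nu> (B (h s)) \<le> \<epsilon>" if s: "s < k" for s
  proof -
   have "\<nu> (B (h s)) \<le> (real (card (Ww n)))\<^sup>2 * 4 ^ n * (V * \<epsilon>x)"
    by (rule vec[OF h(1)[OF s] blk[OF lin_pair s]]) auto
   also have "... \<le> \<epsilon>" using \<epsilon>x \<epsilon> by (simp add: W_def)
   finally show ?thesis .
  qed
  ultimately show "\<exists>A B b. op_le (Cs n) (Cs N) 2 A \<and> op_le (Cs N) (Cs n) 1 B \<and>
   (\<forall>a\<in>arrs n. \<nu> (B (if b then T (A a) else A a - T (A a)) - a) \<le> 1/4 * \<nu> a) \<and>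
   (\<forall>s<k. \<forall>a\<in>arrs n. \<bar>f s (A a)\<bar> \<le> \<epsilon> * \<nu> a) \<and> (\<forall>s<k. \<nu> (B (h s)) \<le> \<epsilon>)"
   using A B fac by blast
 qed
qed

end

section \<open>Tools for passing to the infinite sum\<close>

lemma op_le_const_mono:
 assumes "normed_space X" "op_le X Y C T" "C \<le> D"
 shows "op_le X Y D T"
proof (rule op_leI)
 fix x assume x: "x \<in> carr X"
 have "nrm Y (T x) \<le> C * nrm X x" by (rule op_leD(2)[OF assms(2) x])
 also have "... \<le> D * nrm X x" using assms(3) normed_spaceD(2)[OF assms(1) x] by (rule mult_right_mono)
 finally show "nrm Y (T x) \<le> D * nrm X x" .
qed (use op_leD[OF assms(2)] in auto)

lemma op_le_coord:
 assumes "1 \<le> r" "\<forall>n\<in>A. normed_space (X n)" "n \<in> A"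
 shows "op_le (lr_sum r A X) (X n) 1 (\<lambda>f. f n)"
 using assms lr_sum_coord(1) lr_sum_coord_le[OF assms(1,2) _ assms(3)]
 by (intro op_leI) (auto simp: scaleR_fun_def)

text \<open>In an \<open>\<ell>\<^sup>\<infinity>\<close>-sum a functional cannot be large on many disjointly supported subspaces.\<close>

lemma small_on_infinite_subset:
 fixes u :: "(nat => 'a::real_vector) => real"
 assumes X: "\<forall>n\<in>A. normed_space (X n)" and L: "L = lr_sum \<infinity> A X" and \<Lambda>: "infinite \<Lambda>" "\<Lambda> \<subseteq> A"
  and add: "\<And>f g. f \<in> carr L ==> g \<in> carr L ==> u (f + g) = u f + u g"
  and scale: "\<And>c f. f \<in> carr L ==> u (c *\<^sub>R f) = c * u f"
  and C: "\<And>f. f \<in> carr L ==> \<bar>u f\<bar> \<le> C * nrm L f" and e: "0 < e"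
 obtains \<Lambda>' where "infinite \<Lambda>'" "\<Lambda>' \<subseteq> \<Lambda>"
  "\<And>f. f \<in> carr L ==> (\<And>n. n \<notin> \<Lambda>' ==> f n = 0) ==> \<bar>u f\<bar> \<le> e * nrm L f"
proof -
 have r: "1 \<le> (\<infinity>::ereal)" by simp
 have A: "A \<noteq> {}" using \<Lambda> by auto
 have Ln: "normed_space L" unfolding L by (rule lr_sum_normed[OF r X A])
 obtain M0 :: nat where M0: "C < M0 * e" using ex_less_of_nat_mult[OF e] by blast
 define M where "M = Suc M0"
 have M: "0 < M" "C < M * e" using M0 e by (auto simp: M_def algebra_simps)
 obtain en :: "nat => nat" where en: "strict_mono en" "\<And>n. en n \<in> \<Lambda>"
  using infinite_enumerate[OF \<Lambda>(1)] by blast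
 have inj: "inj en" using en(1) strict_mono_imp_inj_on by blast
 \<comment> \<open>Residue classes give \<open>M\<close> disjoint infinite pieces. If the functional
   exceeded \<open>e\<close> on every one of them, the sum of \<open>M\<close> normalized witnesses
   would have norm at most 1 and a value of at least \<open>M * e > C\<close>.\<close>
 define La where "La j = en ` {i. i mod M = j}" for j
 have inf: "infinite (La j)" if "j < M" for j
 proof -
  have "inj (\<lambda>i. i * M + j)" using M by (auto simp: inj_def)
  then have "infinite (range (\<lambda>i. i * M + j))" by (simp add: range_inj_infinite)
  moreover have "range (\<lambda>i. i * M + j) \<subseteq> {i. i mod M = j}" using that by auto
  ultimately have "infinite {i. i mod M = j}" by (meson infinite_super)
  then show ?thesis unfolding La_def using inj by (meson finite_imageD inj_on_subset subset_UNIV)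
 qed
 have disj: "La i \<inter> La j = {}" if "i \<noteq> j" for i j
  using that inj by (auto simp: La_def inj_def)
 have sub: "La j \<subseteq> \<Lambda>" for j using en(2) by (auto simp: La_def)
 have "\<exists>j<M. \<forall>f\<in>carr L. (\<forall>n. n \<notin> La j --> f n = 0) --> \<bar>u f\<bar> \<le> e * nrm L f"
 proof (rule ccontr)
  assume "\<not> ?thesis"
  then have "\<exists>f. f \<in> carr L \<and> (\<forall>n. n \<notin> La j --> f n = 0) \<and> e * nrm L f < \<bar>u f\<bar>" if "j < M" for j
   using that by (metis not_le)
  then obtain f where f: "\<And>j. j < M ==> f j \<in> carr L" "\<And>j n. j < M ==> n \<notin> La j ==> f j n = 0"
    "\<And>j. j < M ==> e * nrm L (f j) < \<bar>u (f j)\<bar>"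
   by metis
  have pos: "0 < nrm L (f j)" if j: "j < M" for j
  proof (rule ccontr)
   assume "\<not> 0 < nrm L (f j)"
   then have "nrm L (f j) = 0" using normed_spaceD(2)[OF Ln f(1)[OF j]] by simp
   then show False using C[OF f(1)[OF j]] f(3)[OF j] by simp
  qed
  define g where "g j = (sgn (u (f j)) / nrm L (f j)) *\<^sub>R f j" for j
  have gL: "g j \<in> carr L" if "j < M" for j unfolding g_def by (rule normed_spaceD(9)[OF Ln f(1)[OF that]])
  have gn: "nrm L (g j) \<le> 1" if j: "j < M" for j
   using pos[OF j] normed_spaceD(4)[OF Ln f(1)[OF j]] by (simp add: g_def abs_sgn_eq)
  have g0: "g j n = 0" if "j < M" "n \<notin> La j" for j n using f(2)[OF that] by (simp add: g_def scaleR_fun_def)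
  have ug: "e < u (g j)" if j: "j < M" for j
  proof -
   have "u (g j) = \<bar>u (f j)\<bar> / nrm L (f j)"
    using scale[OF f(1)[OF j]] by (simp add: g_def abs_sgn)
   then have "u (g j) * nrm L (f j) = \<bar>u (f j)\<bar>" using pos[OF j] by simp
   then have "e * nrm L (f j) < u (g j) * nrm L (f j)" using f(3)[OF j] by simp
   then show ?thesis using pos[OF j] by (simp only: mult_less_cancel_right_pos)
  qed
  define s where "s k = (\<lambda>n. \<Sum>j<k. g j n)" for k
  have s: "s k \<in> carr L \<and> u (s k) = (\<Sum>j<k. u (g j))" if "k \<le> M" for k
   using that
  proof (induction k)
   case 0
   have z: "s 0 = 0" by (simp add: s_def fun_eq_iff)
   moreover have "u 0 = 0" using scale[OF normed_spaceD(6)[OF Ln], of 0] by simp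
   ultimately show ?case using normed_spaceD(6)[OF Ln] by (simp only: sum.empty lessThan_0)
  next
   case (Suc k)
   have eq: "s (Suc k) = s k + g k" by (simp add: s_def fun_eq_iff)
   have sk: "s k \<in> carr L" "u (s k) = (\<Sum>j<k. u (g j))" and gk: "g k \<in> carr L" using Suc gL[of k] by auto
   have "s k + g k \<in> carr L" by (rule normed_spaceD(7)[OF Ln sk(1) gk])
   moreover have "u (s k + g k) = (\<Sum>j<Suc k. u (g j))" using add[OF sk(1) gk] sk(2) by simp
   ultimately show ?case unfolding eq by blast
  qed
  have sn: "nrm L (s M) \<le> 1"
   unfolding L
  proof (rule lr_sum_nrm_le[OF r X _ A])
   show "s M \<in> carr (lr_sum \<infinity> A X)" using s[of M] L by simp
   fix F assume F: "finite F" "F \<subseteq> A"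
   have "nrm (X n) (s M n) \<le> 1" if n: "n \<in> A" for n
   proof (cases "\<exists>j<M. n \<in> La j")
    case True
    then obtain j where j: "j < M" "n \<in> La j" by blast
    have "g i n = 0" if "i < M" "i \<noteq> j" for i
     using g0[OF that(1)] disj[OF that(2)] j(2) by blast
    then have "s M n = (\<Sum>i\<in>{j}. g i n)"
     unfolding s_def using j by (intro sum.mono_neutral_right) auto
    then have "s M n = g j n" by simp
    then have "nrm (X n) (s M n) \<le> nrm L (g j)"
     using lr_sum_coord_le[OF r X _ n, of "g j"] gL[OF j(1)] L by simp
    then show ?thesis using gn[OF j(1)] by simp
   next
    case False
    then have "s M n = 0" unfolding s_def using g0 by (intro sum.neutral) auto
    then show ?thesis using normed_spaceD(10)[OF bspec[OF X n]] by simp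
   qed
   then show "lrf \<infinity> F (\<lambda>n. nrm (X n) (s M n)) \<le> 1" using F by (auto simp: lrf_def)
  qed
  have "M * e = (\<Sum>j<M. e)" by simp
  also have "... \<le> (\<Sum>j<M. u (g j))" by (intro sum_mono less_imp_le ug) simp
  also have "... = u (s M)" using s[of M] by simp
  also have "... \<le> C * nrm L (s M)" using C[of "s M"] s[of M] by simp
  also have "... \<le> C * 1"
  proof (rule mult_left_mono[OF sn])
   show "0 \<le> C"
   proof (rule ccontr)
    assume "\<not> 0 \<le> C"
    then have "C * nrm L (f 0) < 0" using pos[OF M(1)] by (simp add: mult_neg_pos)
    then show False using C[OF f(1)[OF M(1)]] by simp
   qed
  qed
  finally show False using M by simp
 qed
 then obtain j where j: "j < M" "\<forall>f\<in>carr L. (\<forall>n. n \<notin> La j --> f n = 0) --> \<bar>u f\<bar> \<le> e * nrm L f" by blast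
 show ?thesis by (rule that[OF inf[OF j(1)] sub]) (use j(2) in blast)
qed

lemma small_on_infinite_subset_family:
 fixes u :: "'s => (nat => 'a::real_vector) => real"
 assumes X: "\<forall>n\<in>A. normed_space (X n)" and L: "L = lr_sum \<infinity> A X"
  and add: "\<And>s f g. s \<in> S ==> f \<in> carr L ==> g \<in> carr L ==> u s (f + g) = u s f + u s g"
  and scale: "\<And>s c f. s \<in> S ==> f \<in> carr L ==> u s (c *\<^sub>R f) = c * u s f"
  and C: "\<And>s f. s \<in> S ==> f \<in> carr L ==> \<bar>u s f\<bar> \<le> C * nrm L f" and e: "0 < e"
  and S: "finite S" and \<Lambda>: "infinite \<Lambda>" "\<Lambda> \<subseteq> A"
 shows "\<exists>\<Lambda>'. infinite \<Lambda>' \<and> \<Lambda>' \<subseteq> \<Lambda> \<and>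
  (\<forall>s\<in>S. \<forall>f\<in>carr L. (\<forall>n. n \<notin> \<Lambda>' --> f n = 0) --> \<bar>u s f\<bar> \<le> e * nrm L f)"
 using S add scale C
proof (induction S rule: finite_induct)
 case empty
 then show ?case using \<Lambda> by blast
next
 case (insert s S)
 have "\<exists>\<Lambda>'. infinite \<Lambda>' \<and> \<Lambda>' \<subseteq> \<Lambda> \<and>
  (\<forall>s\<in>S. \<forall>f\<in>carr L. (\<forall>n. n \<notin> \<Lambda>' --> f n = 0) --> \<bar>u s f\<bar> \<le> e * nrm L f)"
  by (rule insert.IH) (use insert.prems in auto)
 then obtain \<Lambda>1 where 1: "infinite \<Lambda>1" "\<Lambda>1 \<subseteq> \<Lambda>"
   "\<forall>s\<in>S. \<forall>f\<in>carr L. (\<forall>n. n \<notin> \<Lambda>1 --> f n = 0) --> \<bar>u s f\<bar> \<le> e * nrm L f"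
  by blast
 obtain \<Lambda>2 where 2: "infinite \<Lambda>2" "\<Lambda>2 \<subseteq> \<Lambda>1"
   "\<And>f. f \<in> carr L ==> (\<And>n. n \<notin> \<Lambda>2 ==> f n = 0) ==> \<bar>u s f\<bar> \<le> e * nrm L f"
 proof (rule small_on_infinite_subset[OF X L 1(1), of "u s" C e])
  show "\<Lambda>1 \<subseteq> A" using 1(2) \<Lambda>(2) by blast
  show "u s (f + g) = u s f + u s g" if "f \<in> carr L" "g \<in> carr L" for f g
   by (rule insert.prems(1)[OF insertI1 that])
  show "u s (c *\<^sub>R f) = c * u s f" if "f \<in> carr L" for c f by (rule insert.prems(2)[OF insertI1 that])
  show "\<bar>u s f\<bar> \<le> C * nrm L f" if "f \<in> carr L" for f by (rule insert.prems(3)[OF insertI1 that])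
  fix \<Lambda>' assume a: "infinite \<Lambda>'" "\<Lambda>' \<subseteq> \<Lambda>1"
   "\<And>f. f \<in> carr L ==> (\<And>n. n \<notin> \<Lambda>' ==> f n = 0) ==> \<bar>u s f\<bar> \<le> e * nrm L f"
  show thesis by (rule that[of \<Lambda>']) (fact a)+
 qed (rule e)
 show ?case
 proof (intro exI conjI ballI impI)
  show "infinite \<Lambda>2" by (rule 2(1))
  show "\<Lambda>2 \<subseteq> \<Lambda>" using 1 2 by blast
  fix s' f assume s': "s' \<in> insert s S" and f: "f \<in> carr L" "\<forall>n. n \<notin> \<Lambda>2 --> f n = 0"
  show "\<bar>u s' f\<bar> \<le> e * nrm L f"
  proof (cases "s' = s")
   case True then show ?thesis using 2(3) f by blast
  next
   case False
   then show ?thesis using 1(3) s' f 2(2) by blast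
  qed
 qed
qed

context haar_norm
begin

text \<open>Entries are bounded by multiples of the norm and the norm by the sum of the entries, so
  convergence is entrywise.\<close>

lemma Cs_banach: "banach_space (Cs n)"
proof -
 have "\<exists>c\<in>arrs n. (\<lambda>k. \<nu> (u k - c)) \<longlonglongrightarrow> 0"
  if u: "\<And>k. u k \<in> arrs n" and ca: "\<And>e. e > 0 ==> \<exists>M. \<forall>k\<ge>M. \<forall>l\<ge>M. \<nu> (u k - u l) < e" for u
 proof -
  have "convergent (\<lambda>k. u k K L)" for K L
   unfolding Cauchy_convergent_iff[symmetric]
  proof (rule CauchyI)
   fix e :: real assume "0 < e"
   then obtain M where M: "\<forall>k\<ge>M. \<forall>l\<ge>M. \<nu> (u k - u l) < e / 4 ^ n" using ca[of "e / 4 ^ n"] by auto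
   have "norm (u k K L - u l K L) < e" if "k \<ge> M" "l \<ge> M" for k l
   proof -
    have "\<bar>(u k - u l) K L\<bar> \<le> 4 ^ n * \<nu> (u k - u l)" by (rule abs_entry_le[OF arrs_closed(3)[OF u u]])
    also have "... < 4 ^ n * (e / 4 ^ n)" using M that by (intro mult_strict_left_mono) auto
    finally show ?thesis by simp
   qed
   then show "\<exists>M. \<forall>k\<ge>M. \<forall>l\<ge>M. norm (u k K L - u l K L) < e" by blast
  qed
  then obtain c where c: "\<And>K L. (\<lambda>k. u k K L) \<longlonglongrightarrow> c K L"
   unfolding convergent_def by metis
  have cn: "c \<in> arrs n"
  proof -
   have "c K L = 0" if "n < length K \<or> n < length L" for K L
   proof -
    have "(\<lambda>k. u k K L) = (\<lambda>k. 0)" using arrsD[OF u that] by simp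
    then show ?thesis using c[of K L] LIMSEQ_unique tendsto_const by metis
   qed
   then show ?thesis by (simp add: arrs_def arrs2_def)
  qed
  have "(\<lambda>k. \<nu> (u k - c)) \<longlonglongrightarrow> 0"
  proof (rule tendsto_sandwich[of "\<lambda>_. 0" _ _ "\<lambda>k. \<Sum>K\<in>Ww n. \<Sum>L\<in>Ww n. \<bar>u k K L - c K L\<bar>"])
   show "\<forall>\<^sub>F k in sequentially. 0 \<le> \<nu> (u k - c)" by (intro always_eventually allI nu_nonneg[OF arrs_closed(3)[OF u cn]])
   show "\<forall>\<^sub>F k in sequentially. \<nu> (u k - c) \<le> (\<Sum>K\<in>Ww n. \<Sum>L\<in>Ww n. \<bar>u k K L - c K L\<bar>)"
    using nu_le_sum[OF arrs_closed(3)[OF u cn]] by (intro always_eventually allI) simp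
   show "(\<lambda>k. \<Sum>K\<in>Ww n. \<Sum>L\<in>Ww n. \<bar>u k K L - c K L\<bar>) \<longlonglongrightarrow> 0"
    by (intro tendsto_null_sum tendsto_rabs_zero) (use c LIM_zero in blast)
  qed simp
  then show ?thesis using cn by blast
 qed
 then show ?thesis unfolding banach_space_def Cs_simps using Cs_normed by blast
qed

lemma trunc_op_le: "op_le (Cs m) (Cs n) 1 (part (Ww n \<times> Ww n))"
proof (rule op_leI)
 fix a assume "a \<in> carr (Cs m)"
 then have a: "a \<in> arrs m" by simp
 show "part (Ww n \<times> Ww n) a \<in> carr (Cs n)" by (auto simp: part_def arrs_def arrs2_def)
 have "\<nu> (part (Ww n \<times> Ww n) a) \<le> \<nu> a"
  by (rule nu_mono[OF part_arrs[OF a] a]) (auto simp: part_def)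
 then show "nrm (Cs n) (part (Ww n \<times> Ww n) a) \<le> 1 * nrm (Cs m) a" by simp
qed (auto simp: part_def fun_eq_iff scaleR_fun_def)

lemma incl_op_le: "n \<le> m ==> op_le (Cs n) (Cs m) 1 (\<lambda>a. a)"
 by (rule op_leI) (auto intro: arrs_mono)

definition Xs :: "ereal => (nat => arr) nspace" where "Xs r = lr_sum r {1..} Cs"

lemma Cs_all_normed: "\<forall>n\<in>A. normed_space (Cs n)" using Cs_normed by blast

lemma Xs_normed: "1 \<le> r ==> normed_space (Xs r)"
 unfolding Xs_def by (rule lr_sum_normed[OF _ Cs_all_normed]) auto

lemma Xs_banach: "1 \<le> r ==> banach_space (Xs r)"
 unfolding Xs_def by (rule lr_sum_banach) (use Cs_banach in auto)

lemma Xs_single: "1 \<le> r ==> 1 \<le> n ==> op_le (Cs n) (Xs r) 1 (single n)"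
 unfolding Xs_def by (rule op_le_single[OF _ Cs_all_normed]) auto

lemma Xs_coord: "1 \<le> r ==> 1 \<le> n ==> op_le (Xs r) (Cs n) 1 (\<lambda>f. f n)"
 unfolding Xs_def by (rule op_le_coord[OF _ Cs_all_normed]) auto

lemma block_op_le:
 assumes r: "1 \<le> r" and Q: "op_le (Xs r) (Xs r) \<Gamma> Q" and \<Gamma>: "0 \<le> \<Gamma>" and mn: "1 \<le> m" "1 \<le> n"
 shows "op_le (Cs m) (Cs n) \<Gamma> (\<lambda>a. Q (single m a) n)"
 using op_le_comp[OF op_le_comp[OF Xs_single[OF r mn(1)] Q \<Gamma>] Xs_coord[OF r mn(2)]] by simp

lemma lin_entry:
 assumes "op_le (Cs m) (Cs n) \<Gamma> T" shows "lin m (\<lambda>a. T a K L)"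
 using op_leD(3,4)[OF assms] by (auto simp: lin_def scaleR_fun_def)

text \<open>The interaction with the finitely many indices in \<open>P\<close> is encoded by
  finitely many scalars and vectors: the entries of \<open>Q (single N a) j\<close> are functionals
  of \<open>a\<close>, and the images \<open>Q (single j (hb K L)) N\<close> are vectors of the
  \<open>N\<close>-th space. Their number \<open>k\<close> does not depend on \<open>N\<close>, so
  \<open>haar_factorization\<close> provides one threshold.\<close>

lemma selection_step:
 fixes \<Gamma> \<epsilon> :: real
 assumes r: "1 \<le> r" and Q: "op_le (Xs r) (Xs r) \<Gamma> Q" and \<Gamma>: "0 \<le> \<Gamma>" and \<epsilon>: "0 < \<epsilon>"
  and P: "finite P" "P \<subseteq> {1..}"
 obtains N0 where "1 \<le> N0" "\<And>N. N0 \<le> N ==> \<exists>A B b. op_le (Cs n) (Cs N) 2 A \<and> op_le (Cs N) (Cs n) 1 B \<and>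
   (\<forall>a\<in>arrs n. \<nu> (B (if b then Q (single N (A a)) N else A a - Q (single N (A a)) N) - a) \<le> 1/4 * \<nu> a) \<and>
   (\<forall>j\<in>P. \<forall>a\<in>arrs n. \<nu> (Q (single N (A a)) j) \<le> \<epsilon> * \<nu> a) \<and>
   (\<forall>j\<in>P. \<forall>c\<in>arrs j. \<nu> (B (Q (single j c) N)) \<le> \<epsilon> * \<nu> c)"
proof -
 obtain M where M: "\<And>j. j \<in> P ==> j \<le> M" using P(1) by (metis finite_nat_set_iff_bounded_le)
 define W where "W = real (card (Ww n))"
 define V where "V = real (card (Ww M))"
 have ge1: "1 \<le> real (card (Ww k))" for k
 proof -
  have "[] \<in> Ww k" by simp
  then have "0 < card (Ww k)" by (metis card_gt_0_iff empty_iff finite_Ww)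
  then show ?thesis by linarith
 qed
 have W: "1 \<le> W" and V: "1 \<le> V" using ge1 by (auto simp: W_def V_def)
 \<comment> \<open>All losses between entries and norms: the numbers of entries at index
   \<open>n\<close> and at indices from \<open>P\<close>, and the entry bounds \<open>4 ^ M\<close>
   and \<open>4 ^ n\<close>.\<close>
 define Z where "Z = W\<^sup>2 * V\<^sup>2 * 4 ^ M * 4 ^ n"
 have "1 \<le> W\<^sup>2" "1 \<le> V\<^sup>2" "1 \<le> (4::real) ^ M" "1 \<le> (4::real) ^ n" using W V by auto
 then have Z: "V\<^sup>2 \<le> Z" "0 < Z"
 proof -
  have "1 * V\<^sup>2 * 1 * 1 \<le> W\<^sup>2 * V\<^sup>2 * 4 ^ M * 4 ^ n"
   using W V by (intro mult_mono) auto
  then show "V\<^sup>2 \<le> Z" by (simp add: Z_def)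
  then show "0 < Z" using V by (smt (verit) zero_less_power)
 qed
 define \<epsilon>' where "\<epsilon>' = \<epsilon> / Z"
 have \<epsilon>': "0 < \<epsilon>'" "Z * \<epsilon>' = \<epsilon>" using Z \<epsilon> by (auto simp: \<epsilon>'_def)
 define S where "S = (SIGMA j:P. Ww j \<times> Ww j)"
 have finS: "finite S" using P by (simp add: S_def)
 obtain en where en: "bij_betw en {0..<card S} S" using ex_bij_betw_nat_finite[OF finS] by blast
 define k where "k = card S"
 have enS: "en s \<in> S" if "s < k" for s using en that by (auto simp: bij_betw_def k_def)
 have surj: "\<exists>s<k. en s = (j, K, L)" if "(j, K, L) \<in> S" for j K L
 proof -
  have "(j, K, L) \<in> en ` {0..<card S}" using en that by (simp add: bij_betw_def)
  then show ?thesis by (auto simp: k_def)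
 qed
 have Vj: "real (card (Ww j)) \<le> V" if "j \<in> P" for j
  unfolding V_def using M[OF that] by (auto intro!: card_mono)
 \<comment> \<open>Reading off an entry at an index \<open>j \<le> M\<close> costs at most
   \<open>4 ^ M\<close>. The enlarged constant serves the operator, the functionals and the vectors
   together.\<close>
 define \<Gamma>' where "\<Gamma>' = \<Gamma> * 4 ^ M"
 have \<Gamma>': "0 \<le> \<Gamma>'" "\<Gamma> \<le> \<Gamma>'" using \<Gamma> mult_left_mono[of 1 "4 ^ M" \<Gamma>] by (auto simp: \<Gamma>'_def)
 define f where "f N s a = (case en s of (j, K, L) => Q (single N a) j K L)" for N s a
 define h where "h N s = (case en s of (j, K, L) => Q (single j (hb K L)) N)" for N s
 obtain N1 where N1: "\<And>N T f h. N1 \<le> N ==> op_le (Cs N) (Cs N) \<Gamma>' T ==>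
  (\<And>s. s < k ==> lin N (f s)) ==> (\<And>s a. s < k ==> a \<in> arrs N ==> \<bar>f s a\<bar> \<le> \<Gamma>' * \<nu> a) ==>
  (\<And>s. s < k ==> h s \<in> arrs N) ==> (\<And>s. s < k ==> \<nu> (h s) \<le> \<Gamma>') ==>
  \<exists>A B b. op_le (Cs n) (Cs N) 2 A \<and> op_le (Cs N) (Cs n) 1 B \<and>
   (\<forall>a\<in>arrs n. \<nu> (B (if b then T (A a) else A a - T (A a)) - a) \<le> 1/4 * \<nu> a) \<and>
   (\<forall>s<k. \<forall>a\<in>arrs n. \<bar>f s (A a)\<bar> \<le> \<epsilon>' * \<nu> a) \<and> (\<forall>s<k. \<nu> (B (h s)) \<le> \<epsilon>')"
  using haar_factorization[OF \<Gamma>'(1) \<epsilon>'(1), where k = k and n = n] by blast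
 show ?thesis
 proof (rule that[of "max 1 N1"])
  fix N assume N: "max 1 N1 \<le> N"
  then have N1': "1 \<le> N" "N1 \<le> N" by auto
  have blk: "op_le (Cs m) (Cs l) \<Gamma> (\<lambda>a. Q (single m a) l)" if "1 \<le> m" "1 \<le> l" for m l
   by (rule block_op_le[OF r Q \<Gamma> that])
  have T: "op_le (Cs N) (Cs N) \<Gamma>' (\<lambda>a. Q (single N a) N)"
   by (rule op_le_const_mono[OF Cs_normed blk[OF N1'(1) N1'(1)] \<Gamma>'(2)])
  have d: "\<exists>j K L. en s = (j, K, L) \<and> j \<in> P \<and> 1 \<le> j \<and> j \<le> M \<and> length K \<le> j \<and> length L \<le> j" if "s < k" for s
   using enS[OF that] M P(2) by (auto simp: S_def)
  have "\<exists>A B b. op_le (Cs n) (Cs N) 2 A \<and> op_le (Cs N) (Cs n) 1 B \<and>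
   (\<forall>a\<in>arrs n. \<nu> (B (if b then Q (single N (A a)) N else A a - Q (single N (A a)) N) - a) \<le> 1/4 * \<nu> a) \<and>
   (\<forall>s<k. \<forall>a\<in>arrs n. \<bar>f N s (A a)\<bar> \<le> \<epsilon>' * \<nu> a) \<and> (\<forall>s<k. \<nu> (B (h N s)) \<le> \<epsilon>')"
  proof (rule N1[OF N1'(2) T])
   fix s assume "s < k"
   then obtain j K L where s: "en s = (j, K, L)" "j \<in> P" "1 \<le> j" "j \<le> M" "length K \<le> j" "length L \<le> j" using d by blast
   have fs: "f N s = (\<lambda>a. Q (single N a) j K L)" by (simp add: f_def s fun_eq_iff)
   show "lin N (f N s)" unfolding fs by (rule lin_entry[OF blk[OF N1'(1) s(3)]])
   show "\<bar>f N s a\<bar> \<le> \<Gamma>' * \<nu> a" if a: "a \<in> arrs N" for a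
   proof -
    have "\<bar>f N s a\<bar> \<le> 4 ^ j * \<nu> (Q (single N a) j)"
     unfolding fs using op_leD(1)[OF blk[OF N1'(1) s(3)], of a] a by (intro abs_entry_le) simp
    also have "... \<le> 4 ^ M * (\<Gamma> * \<nu> a)"
     using op_leD(1,2)[OF blk[OF N1'(1) s(3)], of a] a s(4) nu_nonneg[of "Q (single N a) j" j]
     by (intro mult_mono power_increasing) auto
    finally show ?thesis by (simp add: \<Gamma>'_def mult_ac)
   qed
   have hs: "h N s = Q (single j (hb K L)) N" by (simp add: h_def s)
   have hbj: "hb K L \<in> arrs j" using s by simp
   show "h N s \<in> arrs N" unfolding hs using op_leD(1)[OF blk[OF s(3) N1'(1)], of "hb K L"] hbj by simp
   have "\<nu> (h N s) \<le> \<Gamma> * \<nu> (hb K L)"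
    unfolding hs using op_leD(2)[OF blk[OF s(3) N1'(1)], of "hb K L"] hbj by simp
   also have "... \<le> \<Gamma> * 1" using s \<Gamma> by (intro mult_left_mono nu_hb_le) auto
   finally show "\<nu> (h N s) \<le> \<Gamma>'" using \<Gamma>' by simp
  qed
  then obtain A B b where A: "op_le (Cs n) (Cs N) 2 A" and B: "op_le (Cs N) (Cs n) 1 B"
   and fac: "\<forall>a\<in>arrs n. \<nu> (B (if b then Q (single N (A a)) N else A a - Q (single N (A a)) N) - a) \<le> 1/4 * \<nu> a"
   and fA: "\<And>s a. s < k ==> a \<in> arrs n ==> \<bar>f N s (A a)\<bar> \<le> \<epsilon>' * \<nu> a"
   and Bh: "\<And>s. s < k ==> \<nu> (B (h N s)) \<le> \<epsilon>'"
   by blast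
  have 1: "\<nu> (Q (single N (A a)) j) \<le> \<epsilon> * \<nu> a" if j: "j \<in> P" and a: "a \<in> arrs n" for j a
  proof -
   have j1: "1 \<le> j" using j P by auto
   have Aa: "A a \<in> arrs N" using op_leD(1)[OF A] a by simp
   have "\<nu> (Q (single N (A a)) j) \<le> (card (Ww j))\<^sup>2 * (\<epsilon>' * \<nu> a)"
   proof (rule nu_le_bound)
    show "Q (single N (A a)) j \<in> arrs j" using op_leD(1)[OF blk[OF N1'(1) j1]] Aa by simp
    fix K L assume KL: "K \<in> Ww j" "L \<in> Ww j"
    then have "(j, K, L) \<in> S" using j by (simp add: S_def)
    then obtain s where s: "s < k" "en s = (j, K, L)" using surj by blast
    show "\<bar>Q (single N (A a)) j K L\<bar> \<le> \<epsilon>' * \<nu> a" using fA[OF s(1) a] s(2) by (simp add: f_def)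
   qed
   also have "... \<le> Z * (\<epsilon>' * \<nu> a)"
   proof (rule mult_right_mono)
    have "(real (card (Ww j)))\<^sup>2 \<le> V\<^sup>2" using Vj[OF j] by (intro power_mono) auto
    then show "real ((card (Ww j))\<^sup>2) \<le> Z" using Z(1) by simp
   qed (use \<epsilon>' nu_nonneg[OF a] in auto)
   finally show ?thesis using \<epsilon>'(2) by (simp add: mult.assoc[symmetric])
  qed
  have 2: "\<nu> (B (Q (single j c) N)) \<le> \<epsilon> * \<nu> c" if j: "j \<in> P" and c: "c \<in> arrs j" for j c
  proof -
   have j1: "1 \<le> j" using j P by auto
   have comp: "op_le (Cs j) (Cs n) \<Gamma> (\<lambda>c. B (Q (single j c) N))"
    using op_le_comp[OF blk[OF j1 N1'(1)] B] by simp
   have "\<nu> (B (Q (single j c) N)) \<le> (card (Ww n))\<^sup>2 * ((card (Ww j))\<^sup>2 * (4 ^ j * \<nu> c * (4 ^ n * \<epsilon>')))"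
   proof (rule nu_le_bound)
    show "B (Q (single j c) N) \<in> arrs n" using op_leD(1)[OF comp] c by simp
    fix K' L' :: "bool list"
    have "B (Q (single j c) N) K' L' = (\<Sum>K\<in>Ww j. \<Sum>L\<in>Ww j. c K L * B (Q (single j (hb K L)) N) K' L')"
     by (rule lin_expand[OF lin_entry[OF comp] c])
    also have "\<bar>...\<bar> \<le> (\<Sum>K\<in>Ww j. \<Sum>L\<in>Ww j. 4 ^ j * \<nu> c * (4 ^ n * \<epsilon>'))"
    proof (intro order_trans[OF sum_abs] sum_mono order_trans[OF sum_abs])
     fix K L assume KL: "K \<in> Ww j" "L \<in> Ww j"
     then have "(j, K, L) \<in> S" using j by (simp add: S_def)
     then obtain s where s: "s < k" "en s = (j, K, L)" using surj by blast
     have Bm: "B (Q (single j (hb K L)) N) \<in> arrs n" using op_leD(1)[OF comp, of "hb K L"] KL by simp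
     have "\<bar>B (Q (single j (hb K L)) N) K' L'\<bar> \<le> 4 ^ n * \<nu> (B (Q (single j (hb K L)) N))"
      by (rule abs_entry_le[OF Bm])
     also have "... \<le> 4 ^ n * \<epsilon>'" using Bh[OF s(1)] s(2) by (simp add: h_def)
     finally show "\<bar>c K L * B (Q (single j (hb K L)) N) K' L'\<bar> \<le> 4 ^ j * \<nu> c * (4 ^ n * \<epsilon>')"
      unfolding abs_mult using abs_entry_le[OF c] nu_nonneg[OF c] by (intro mult_mono) auto
    qed
    also have "... = (card (Ww j))\<^sup>2 * (4 ^ j * \<nu> c * (4 ^ n * \<epsilon>'))" by (simp add: power2_eq_square)
    finally show "\<bar>B (Q (single j c) N) K' L'\<bar> \<le> (card (Ww j))\<^sup>2 * (4 ^ j * \<nu> c * (4 ^ n * \<epsilon>'))" .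
   qed
   also have "... \<le> W\<^sup>2 * (V\<^sup>2 * (4 ^ M * \<nu> c * (4 ^ n * \<epsilon>')))"
   proof -
    have "(real (card (Ww j)))\<^sup>2 \<le> V\<^sup>2" using Vj[OF j] by (intro power_mono) auto
    moreover have "(4::real) ^ j \<le> 4 ^ M" using M[OF j] by (intro power_increasing) auto
    ultimately have "(real (card (Ww j)))\<^sup>2 * (4 ^ j * \<nu> c * (4 ^ n * \<epsilon>')) \<le> V\<^sup>2 * (4 ^ M * \<nu> c * (4 ^ n * \<epsilon>'))"
     using nu_nonneg[OF c] \<epsilon>' by (intro mult_mono) auto
    then show ?thesis by (simp add: W_def mult_left_mono)
   qed
   also have "... = (Z * \<epsilon>') * \<nu> c" by (simp add: Z_def mult_ac)
   finally show ?thesis using \<epsilon>'(2) by simp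
  qed
  show "\<exists>A B b. op_le (Cs n) (Cs N) 2 A \<and> op_le (Cs N) (Cs n) 1 B \<and>
   (\<forall>a\<in>arrs n. \<nu> (B (if b then Q (single N (A a)) N else A a - Q (single N (A a)) N) - a) \<le> 1/4 * \<nu> a) \<and>
   (\<forall>j\<in>P. \<forall>a\<in>arrs n. \<nu> (Q (single N (A a)) j) \<le> \<epsilon> * \<nu> a) \<and>
   (\<forall>j\<in>P. \<forall>c\<in>arrs j. \<nu> (B (Q (single j c) N)) \<le> \<epsilon> * \<nu> c)"
   using A B fac 1 2 by blast
 qed simp
qed

end

section \<open>The gliding hump\<close>

context haar_norm
begin

text \<open>The decay \<open>(1/4) ^ n\<close> absorbs the number of earlier coordinates, and the
  factor \<open>1/64\<close> keeps the sum of all \<open>(2 * m + 2) * eps m\<close> below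
  \<open>1/4\<close>.\<close>

definition eps :: "nat => real" where "eps n = (1/4) ^ n / 64"

lemma eps_pos: "0 < eps n" by (simp add: eps_def)

lemma eps_antimono: "m \<le> n ==> eps n \<le> eps m"
 by (simp add: eps_def power_decreasing)

lemma eps_tail:
 assumes "finite F" "\<And>n. n \<in> F ==> m < n" shows "sum eps F \<le> eps m"
proof -
 have fin: "(\<Sum>n\<in>{m<..m + k}. eps n) \<le> eps m - eps (m + k)" for k
 proof (induction k)
  case (Suc k)
  have "{m<..m + Suc k} = insert (m + Suc k) {m<..m + k}" by auto
  then have "(\<Sum>n\<in>{m<..m + Suc k}. eps n) = eps (m + Suc k) + (\<Sum>n\<in>{m<..m + k}. eps n)" by simp
  also have "... \<le> eps (m + Suc k) + (eps m - eps (m + k))" using Suc by simp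
  also have "... \<le> eps m - eps (m + Suc k)" by (simp add: eps_def)
  finally show ?case .
 qed simp
 obtain k where k: "\<And>n. n \<in> F ==> n \<le> k" using assms(1) by (metis finite_nat_set_iff_bounded_le)
 have "sum eps F \<le> (\<Sum>n\<in>{m<..m + k}. eps n)"
  using assms k eps_pos by (intro sum_mono2) (auto simp: less_imp_le trans_le_add2)
 also have "... \<le> eps m" using fin[of k] eps_pos[of "m + k"] by linarith
 finally show ?thesis .
qed

type_synonym stage = "nat set \<times> nat set \<times> nat \<times> (arr => arr) \<times> (arr => arr) \<times> bool"

text \<open>The state at stage \<open>n\<close>: \<open>P\<close> contains the indices used before,
  \<open>N\<close> is the index chosen now, with its factorization \<open>A\<close>,
  \<open>B\<close> and its side \<open>b\<close>, and \<open>\<Lambda>\<close> is the supply for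
  later stages. The last clause controls whole vectors supported in \<open>\<Lambda>\<close>,
  because for \<open>r = \<infinity>\<close> estimates on single coordinates do not determine the
  operator.\<close>

definition good :: "ereal => ((nat => arr) => nat => arr) => nat => stage => bool" where
 "good r Q n = (\<lambda>(P, \<Lambda>, N, A, B, b). finite P \<and> P \<subseteq> {1..} \<and> infinite \<Lambda> \<and> \<Lambda> \<subseteq> {1..} \<and>
   (\<forall>j\<in>P. j < N) \<and> (\<forall>l\<in>\<Lambda>. N < l) \<and> 1 \<le> N \<and>
   op_le (Cs n) (Cs N) 2 A \<and> op_le (Cs N) (Cs n) 1 B \<and>
   (\<forall>a\<in>arrs n. \<nu> (B (if b then Q (single N (A a)) N else A a - Q (single N (A a)) N) - a) \<le> 1/4 * \<nu> a) \<and>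
   (\<forall>j\<in>P. \<forall>a\<in>arrs n. \<nu> (Q (single N (A a)) j) \<le> eps n * \<nu> a) \<and>
   (\<forall>j\<in>P. \<forall>c\<in>arrs j. \<nu> (B (Q (single j c) N)) \<le> eps n * \<nu> c) \<and>
   (r = \<infinity> --> (\<forall>f\<in>carr (Xs r). (\<forall>m. m \<notin> \<Lambda> --> f m = 0) --> \<nu> (Q f N) \<le> eps n * nrm (Xs r) f)))"

text \<open>The index is taken from the supply, beyond \<open>P\<close> and beyond the threshold of
  \<open>selection_step\<close>. For \<open>r = \<infinity>\<close> the supply is then thinned out,
  with one functional for each entry of the \<open>N\<close>-th coordinate of
  \<open>Q f\<close>.\<close>

lemma good_exists:
 assumes r: "1 \<le> r" and Q: "op_le (Xs r) (Xs r) \<Gamma> Q" and \<Gamma>: "0 \<le> \<Gamma>"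
  and P: "finite P" "P \<subseteq> {1..}" and \<Lambda>0: "infinite \<Lambda>0" "\<Lambda>0 \<subseteq> {1..}"
 obtains \<Lambda> N A B b where "good r Q n (P, \<Lambda>, N, A, B, b)" "N \<in> \<Lambda>0" "\<Lambda> \<subseteq> \<Lambda>0"
proof -
 obtain N0 where N0: "1 \<le> N0" "\<And>N. N0 \<le> N ==> \<exists>A B b. op_le (Cs n) (Cs N) 2 A \<and> op_le (Cs N) (Cs n) 1 B \<and>
   (\<forall>a\<in>arrs n. \<nu> (B (if b then Q (single N (A a)) N else A a - Q (single N (A a)) N) - a) \<le> 1/4 * \<nu> a) \<and>
   (\<forall>j\<in>P. \<forall>a\<in>arrs n. \<nu> (Q (single N (A a)) j) \<le> eps n * \<nu> a) \<and>
   (\<forall>j\<in>P. \<forall>c\<in>arrs j. \<nu> (B (Q (single j c) N)) \<le> eps n * \<nu> c)"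
  using selection_step[OF r Q \<Gamma> eps_pos P] by metis
 obtain M where M: "\<And>j. j \<in> P ==> j \<le> M" using P(1) by (metis finite_nat_set_iff_bounded_le)
 obtain N where N: "N \<in> \<Lambda>0" "max N0 M < N" using \<Lambda>0(1) by (meson infinite_nat_iff_unbounded)
 have N1: "1 \<le> N" "N0 \<le> N" "\<forall>j\<in>P. j < N" using N N0 M by fastforce+
 define \<Lambda>1 where "\<Lambda>1 = {l \<in> \<Lambda>0. N < l}"
 have inf1: "infinite \<Lambda>1"
 proof -
  have "\<Lambda>0 \<subseteq> \<Lambda>1 \<union> {..N}" by (auto simp: \<Lambda>1_def)
  then show ?thesis using \<Lambda>0(1) by (meson finite_UnI finite_atMost finite_subset)
 qed
 have "\<exists>\<Lambda>. infinite \<Lambda> \<and> \<Lambda> \<subseteq> \<Lambda>1 \<and>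
  (r = \<infinity> --> (\<forall>f\<in>carr (Xs r). (\<forall>m. m \<notin> \<Lambda> --> f m = 0) --> \<nu> (Q f N) \<le> eps n * nrm (Xs r) f))"
 proof (cases "r = \<infinity>")
  case False
  then show ?thesis using inf1 by blast
 next
  case True
  define W where "W = real (card (Ww N))"
  have "[] \<in> Ww N" by simp
  then have "0 < card (Ww N)" by (metis card_gt_0_iff empty_iff finite_Ww)
  then have W: "0 < W" by (simp add: W_def)
  define e where "e = eps n / W\<^sup>2"
  have e: "0 < e" "W\<^sup>2 * e = eps n" using W eps_pos[of n] by (auto simp: e_def)
  have QN: "op_le (Xs r) (Cs N) \<Gamma> (\<lambda>f. Q f N)"
   using op_le_comp[OF Q Xs_coord[OF r N1(1)]] by simp
  have "\<exists>\<Lambda>. infinite \<Lambda> \<and> \<Lambda> \<subseteq> \<Lambda>1 \<and>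
   (\<forall>s\<in>Ww N \<times> Ww N. \<forall>f\<in>carr (Xs r). (\<forall>m. m \<notin> \<Lambda> --> f m = 0) --> \<bar>Q f N (fst s) (snd s)\<bar> \<le> e * nrm (Xs r) f)"
  proof (rule small_on_infinite_subset_family[where X = Cs and A = "{1..}" and C = "4 ^ N * \<Gamma>"])
   show "Xs r = lr_sum \<infinity> {1..} Cs" using True by (simp add: Xs_def)
   show "\<Lambda>1 \<subseteq> {1..}" using \<Lambda>0 by (auto simp: \<Lambda>1_def)
   fix s :: "bool list \<times> bool list" and f assume f: "f \<in> carr (Xs r)"
   show "Q (f + g) N (fst s) (snd s) = Q f N (fst s) (snd s) + Q g N (fst s) (snd s)"
    if "g \<in> carr (Xs r)" for g using op_leD(3)[OF QN f that] by simp
   show "Q (c *\<^sub>R f) N (fst s) (snd s) = c * Q f N (fst s) (snd s)" for c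
    using op_leD(4)[OF QN f] by (simp add: scaleR_fun_def)
   have "\<bar>Q f N (fst s) (snd s)\<bar> \<le> 4 ^ N * \<nu> (Q f N)"
    using op_leD(1)[OF QN f] by (intro abs_entry_le) simp
   also have "... \<le> 4 ^ N * (\<Gamma> * nrm (Xs r) f)" using op_leD(2)[OF QN f] by (intro mult_left_mono) simp_all
   finally show "\<bar>Q f N (fst s) (snd s)\<bar> \<le> 4 ^ N * \<Gamma> * nrm (Xs r) f" by simp
  qed (use Cs_all_normed inf1 e in auto)
  then obtain \<Lambda> where \<Lambda>: "infinite \<Lambda>" "\<Lambda> \<subseteq> \<Lambda>1"
   "\<forall>s\<in>Ww N \<times> Ww N. \<forall>f\<in>carr (Xs r). (\<forall>m. m \<notin> \<Lambda> --> f m = 0) --> \<bar>Q f N (fst s) (snd s)\<bar> \<le> e * nrm (Xs r) f"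
   by blast
  have "\<nu> (Q f N) \<le> eps n * nrm (Xs r) f" if f: "f \<in> carr (Xs r)" "\<forall>m. m \<notin> \<Lambda> --> f m = 0" for f
  proof -
   have "\<nu> (Q f N) \<le> (card (Ww N))\<^sup>2 * (e * nrm (Xs r) f)"
   proof (rule nu_le_bound)
    show "Q f N \<in> arrs N" using op_leD(1)[OF QN f(1)] by simp
    show "\<bar>Q f N K L\<bar> \<le> e * nrm (Xs r) f" if "K \<in> Ww N" "L \<in> Ww N" for K L
     using bspec[OF bspec[OF \<Lambda>(3), of "(K, L)"] f(1)] that f(2) by simp
   qed
   also have "... = (W\<^sup>2 * e) * nrm (Xs r) f" by (simp add: W_def)
   finally show ?thesis by (simp only: e(2))
  qed
  then show ?thesis using \<Lambda>(1,2) by blast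
 qed
 then obtain \<Lambda> where \<Lambda>: "infinite \<Lambda>" "\<Lambda> \<subseteq> \<Lambda>1"
  "r = \<infinity> --> (\<forall>f\<in>carr (Xs r). (\<forall>m. m \<notin> \<Lambda> --> f m = 0) --> \<nu> (Q f N) \<le> eps n * nrm (Xs r) f)" by blast
 obtain A B b where AB: "op_le (Cs n) (Cs N) 2 A" "op_le (Cs N) (Cs n) 1 B"
   "\<forall>a\<in>arrs n. \<nu> (B (if b then Q (single N (A a)) N else A a - Q (single N (A a)) N) - a) \<le> 1/4 * \<nu> a"
   "\<forall>j\<in>P. \<forall>a\<in>arrs n. \<nu> (Q (single N (A a)) j) \<le> eps n * \<nu> a"
   "\<forall>j\<in>P. \<forall>c\<in>arrs j. \<nu> (B (Q (single j c) N)) \<le> eps n * \<nu> c"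
  using N0(2)[OF N1(2)] by blast
 have sub: "\<Lambda> \<subseteq> \<Lambda>0" "\<forall>l\<in>\<Lambda>. N < l" "\<Lambda> \<subseteq> {1..}" using \<Lambda>(2) \<Lambda>0(2) by (auto simp: \<Lambda>1_def)
 have "good r Q n (P, \<Lambda>, N, A, B, b)"
  unfolding good_def prod.case using P \<Lambda>(1) sub N1 AB \<Lambda>(3) by (intro conjI) assumption+
 then show ?thesis using that N(1) sub(1) by blast
qed

text \<open>Dependent choice over stages. The supplies decrease, so each later index belongs to all
  earlier supplies, and the sets \<open>P\<close> collect all earlier indices.\<close>

lemma good_sequence:
 assumes r: "1 \<le> r" and Q: "op_le (Xs r) (Xs r) \<Gamma> Q" and \<Gamma>: "0 \<le> \<Gamma>"
 obtains P \<Lambda> N A B b where "\<And>n. good r Q n (P n, \<Lambda> n, N n, A n, B n, b n)"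
  "\<And>i j. i < j ==> N i \<in> P j" "\<And>i j. i < j ==> N j \<in> \<Lambda> i"
proof -
 have "\<exists>f :: nat => stage. \<forall>n. good r Q n (f n) \<and>
  (case f n of (P, \<Lambda>, N, _) => case f (Suc n) of (P', \<Lambda>', N', _) => P' = insert N P \<and> N' \<in> \<Lambda> \<and> \<Lambda>' \<subseteq> \<Lambda>)"
 proof (rule dependent_nat_choice)
  obtain \<Lambda> N A B b where "good r Q 0 ({}, \<Lambda>, N, A, B, b)"
   by (rule good_exists[OF r Q \<Gamma>, of "{}" "{1..}"]) (auto simp: infinite_Ici)
  then show "\<exists>x. good r Q 0 x" by blast
 next
  fix x :: stage and n assume g: "good r Q n x"
  obtain P \<Lambda> N A B b where x: "x = (P, \<Lambda>, N, A, B, b)" by (cases x)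
  have *: "finite (insert N P)" "insert N P \<subseteq> {1..}" "infinite \<Lambda>" "\<Lambda> \<subseteq> {1..}"
   using g unfolding x good_def by auto
  obtain \<Lambda>' N' A' B' b' where "good r Q (Suc n) (insert N P, \<Lambda>', N', A', B', b')" "N' \<in> \<Lambda>" "\<Lambda>' \<subseteq> \<Lambda>"
   by (rule good_exists[OF r Q \<Gamma> *, of "Suc n"])
  then show "\<exists>y. good r Q (Suc n) y \<and>
    (case x of (P, \<Lambda>, N, _) => case y of (P', \<Lambda>', N', _) => P' = insert N P \<and> N' \<in> \<Lambda> \<and> \<Lambda>' \<subseteq> \<Lambda>)"
   unfolding x by (intro exI[of _ "(insert N P, \<Lambda>', N', A', B', b')"]) simp
 qed
 then obtain f :: "nat => stage" where f: "\<forall>n. good r Q n (f n) \<and>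
  (case f n of (P, \<Lambda>, N, _) => case f (Suc n) of (P', \<Lambda>', N', _) => P' = insert N P \<and> N' \<in> \<Lambda> \<and> \<Lambda>' \<subseteq> \<Lambda>)"
  by (rule exE)
 define P where "P n = fst (f n)" for n
 define \<Lambda> where "\<Lambda> n = fst (snd (f n))" for n
 define N where "N n = fst (snd (snd (f n)))" for n
 define A where "A n = fst (snd (snd (snd (f n))))" for n
 define B where "B n = fst (snd (snd (snd (snd (f n)))))" for n
 define b where "b n = snd (snd (snd (snd (snd (f n)))))" for n
 have fn: "f n = (P n, \<Lambda> n, N n, A n, B n, b n)" for n
  by (simp add: P_def \<Lambda>_def N_def A_def B_def b_def)
 have st: "P (Suc n) = insert (N n) (P n)" "N (Suc n) \<in> \<Lambda> n" "\<Lambda> (Suc n) \<subseteq> \<Lambda> n" for n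
  using f[rule_format, THEN conjunct2, of n] unfolding fn by simp_all
 have anti: "\<Lambda> j \<subseteq> \<Lambda> i" if "i \<le> j" for i j
  using that by (induction j rule: dec_induct) (use st(3) in auto)
 show ?thesis
 proof (rule that[of P \<Lambda> N A B b])
  show "good r Q n (P n, \<Lambda> n, N n, A n, B n, b n)" for n using f[rule_format, THEN conjunct1, of n] unfolding fn .
  show "N i \<in> P j" if "i < j" for i j
   using that by (induction j) (auto simp: st(1) less_Suc_eq)
  show "N j \<in> \<Lambda> i" if ij: "i < j" for i j
  proof -
   have k: "j = Suc (j - 1)" "i \<le> j - 1" using ij by auto
   then show ?thesis using st(2)[of "j - 1"] anti[OF k(2)] by auto
  qed
 qed
qed

end

context haar_norm
begin

text \<open>The selected operators are glued to \<open>A\<close> and \<open>B\<close> on the whole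
  sum. The composite \<open>U = B H A\<close>, where \<open>H\<close> is \<open>Q\<close> or
  \<open>Id - Q\<close>, has a diagonal within \<open>1/4\<close> of the identity and interactions
  adding up to at most \<open>1/4\<close>. So \<open>U\<close> has a right inverse, which is finally
  absorbed into \<open>A\<close>.\<close>

lemma factor_identity:
 assumes r: "1 \<le> r" and Q: "bounded_op (Xs r) (Xs r) Q"
 obtains b A B where "bounded_op (Xs r) (Xs r) A" "bounded_op (Xs r) (Xs r) B"
  "\<And>f. f \<in> carr (Xs r) ==> B (if b then Q (A f) else A f - Q (A f)) = f"
proof -
 let ?X = "Xs r"
 have X: "normed_space ?X" by (rule Xs_normed[OF r])
 obtain \<Gamma> where \<Gamma>: "0 \<le> \<Gamma>" "op_le ?X ?X \<Gamma> Q" using bounded_op_le[OF X Q] by blast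
 obtain P \<Lambda> N A0 B0 c where g: "\<And>n. good r Q n (P n, \<Lambda> n, N n, A0 n, B0 n, c n)"
  and NP: "\<And>i j. i < j ==> N i \<in> P j" and N\<Lambda>: "\<And>i j. i < j ==> N j \<in> \<Lambda> i"
 proof (rule good_sequence[OF r \<Gamma>(2,1)])
  fix P \<Lambda> N A B b
  assume a: "\<And>n. good r Q n (P n, \<Lambda> n, N n, A n, B n, b n)"
   "\<And>i j. i < j ==> N i \<in> P j" "\<And>i j. i < j ==> N j \<in> \<Lambda> i"
  show thesis by (rule that[of P \<Lambda> N A B b]) (fact a)+
 qed
 \<comment> \<open>The side may change from stage to stage. A subsequence with one side suffices: as
   \<open>n \<le> \<sigma> n\<close>, the space \<open>Cs n\<close> lies in
   \<open>Cs (\<sigma> n)\<close> isometrically and is recovered by truncation, which is built into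
   \<open>\<beta>\<close>.\<close>
 have "\<exists>b. infinite {n. c n = b}"
 proof (rule ccontr)
  assume "\<not> ?thesis"
  then have "finite ({n. c n = True} \<union> {n. c n = False})" by blast
  moreover have "{n. c n = True} \<union> {n. c n = False} = UNIV" by auto
  ultimately show False by (simp only: infinite_UNIV_nat)
 qed
 then obtain b where "infinite {n. c n = b}" by blast
 then obtain \<sigma> :: "nat => nat" where \<sigma>: "strict_mono \<sigma>" "\<And>n. c (\<sigma> n) = b"
  using infinite_enumerate by (metis (mono_tags, lifting) mem_Collect_eq)
 have \<sigma>_ge: "n \<le> \<sigma> n" for n using \<sigma>(1) by (rule strict_mono_imp_increasing)
 have \<sigma>_less: "\<sigma> i < \<sigma> j" if "i < j" for i j using \<sigma>(1) that by (rule strict_monoD)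
 define M where "M n = N (\<sigma> n)" for n
 define \<alpha> where "\<alpha> n = A0 (\<sigma> n)" for n
 define \<beta> where "\<beta> n a = part (Ww n \<times> Ww n) (B0 (\<sigma> n) a)" for n a
 note gd = g[unfolded good_def prod.case]
 have M1: "1 \<le> M n" for n using gd[of "\<sigma> n"] by (simp add: M_def)
 have M_less: "M i < M j" if "i < j" for i j
  using gd[of "\<sigma> j"] NP[OF \<sigma>_less[OF that]] by (simp add: M_def)
 have M_inj: "inj M" using M_less by (metis injI linorder_neqE_nat less_irrefl)
 have \<alpha>: "op_le (Cs n) (Cs (M n)) 2 (\<alpha> n)" for n
  using op_le_comp[OF incl_op_le[OF \<sigma>_ge] , of n "Cs (M n)" 2 "\<alpha> n"] gd[of "\<sigma> n"] by (simp add: M_def \<alpha>_def)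
 have B0: "op_le (Cs (M n)) (Cs (\<sigma> n)) 1 (B0 (\<sigma> n))" for n using gd[of "\<sigma> n"] by (simp add: M_def)
 have \<beta>: "op_le (Cs (M n)) (Cs n) 1 (\<beta> n)" for n
  unfolding \<beta>_def using op_le_comp[OF B0 trunc_op_le, of n n] by simp
 have \<beta>_le: "\<nu> (\<beta> n a) \<le> \<nu> (B0 (\<sigma> n) a)" if "a \<in> arrs (M n)" for n a
  unfolding \<beta>_def using op_leD(2)[OF trunc_op_le[of "\<sigma> n" n], of "B0 (\<sigma> n) a"] op_leD(1)[OF B0[of n], of a] that by simp
 define A where "A f = (\<lambda>m. if m \<in> M ` {1..} then \<alpha> (inv M m) (f (inv M m)) else 0)" for f
 define B where "B f = (\<lambda>n. if n \<in> {1..} then \<beta> n (f (M n)) else 0)" for f :: "nat => arr"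
 have invM: "inv M (M n) = n" for n by (simp add: M_inj)
 have A: "op_le ?X ?X 2 A"
  unfolding A_def Xs_def
 proof (rule lr_sum_map[OF r Cs_all_normed _ Cs_all_normed])
  show "inj_on (inv M) (M ` {1..})" by (auto simp: inj_on_def invM)
  show "op_le (Cs (inv M m)) (Cs m) 2 (\<alpha> (inv M m))" if "m \<in> M ` {1..}" for m
   using that \<alpha> by (auto simp: invM)
 qed (use M1 in \<open>auto simp: invM\<close>)
 have B: "op_le ?X ?X 1 B"
  unfolding B_def Xs_def
 proof (rule lr_sum_map[OF r Cs_all_normed _ Cs_all_normed])
  show "inj_on M {1..}" using M_inj inj_on_subset by blast
  show "op_le (Cs (M n)) (Cs n) 1 (\<beta> n)" for n by (rule \<beta>)
 qed (use M1 in auto)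
 have AM: "A f (M n) = \<alpha> n (f n)" if "1 \<le> n" for f n using that by (auto simp: A_def invM)
 have A_off: "A f m = 0" if "m \<notin> M ` {1..}" for f m using that by (simp add: A_def)
 have \<alpha>0: "\<alpha> n 0 = 0" for n using bounded_op_0[OF Cs_normed op_le_bounded[OF \<alpha>]] .
 define H where "H f = (if b then Q f else f - Q f)" for f
 have H: "bounded_op ?X ?X H"
  unfolding H_def using Q bounded_op_id_minus[OF X Q] by (cases b) auto
 note H_add = bounded_opD(2)[OF H]
 have cutc: "op_le ?X ?X 1 (cut F)" for F
  unfolding Xs_def by (rule op_le_cut[OF r Cs_all_normed]) simp
 have co: "f n \<in> arrs n" "\<nu> (f n) \<le> nrm ?X f" if "f \<in> carr ?X" "1 \<le> n" for f n
  using op_leD(1,2)[OF Xs_coord[OF r that(2)] that(1)] by auto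
 have coQ: "Q f n \<in> arrs n" if "f \<in> carr ?X" "1 \<le> n" for f n
  using co(1)[OF op_leD(1)[OF \<Gamma>(2) that(1)] that(2)] .
 define U where "U f = B (H (A f))" for f
 \<comment> \<open>Each earlier coordinate contributes at most \<open>2 * eps m\<close>, where the 2
   is the norm of \<open>A\<close>; all later coordinates together contribute at most
   \<open>2 * eps m\<close>.\<close>
 define \<delta> where "\<delta> m = (2 * real m + 2) * eps m" for m
 have coord: "\<nu> ((U f - f) m) \<le> 1/4 * \<nu> (f m) + \<delta> m * nrm ?X f" if f: "f \<in> carr ?X" and m: "1 \<le> m" for f m
 proof -
  let ?l = "cut {..<m} f" and ?u = "cut {m<..} f" and ?s = "single m (f m)"
  have fm: "f m \<in> arrs m" using co[OF f m] by simp
  have sX: "?s \<in> carr ?X" using op_leD(1)[OF Xs_single[OF r m]] fm by simp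
  have lX: "?l \<in> carr ?X" "?u \<in> carr ?X" using op_leD(1)[OF cutc f] by blast+
  have ul: "nrm ?X ?u \<le> nrm ?X f" using op_leD(2)[OF cutc f] by simp
  have dec: "f = ?s + (?l + ?u)" by (auto simp: fun_eq_iff cut_def single_def)
  have luX: "?l + ?u \<in> carr ?X" using normed_spaceD(7)[OF X lX] .
  have Af: "A f = A ?s + (A ?l + A ?u)"
   using op_leD(3)[OF A sX luX] op_leD(3)[OF A lX] dec by simp
  have As: "A ?s = single (M m) (\<alpha> m (f m))"
  proof
   fix k
   show "A ?s k = single (M m) (\<alpha> m (f m)) k"
   proof (cases "k \<in> M ` {1..}")
    case True
    then obtain j where j: "1 \<le> j" "k = M j" by auto
    then show ?thesis using AM[OF j(1), of ?s] M_inj \<alpha>0 by (auto simp: single_def inj_eq)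
   next
    case False
    then show ?thesis using A_off[OF False] m by (auto simp: single_def)
   qed
  qed
  have AX: "A ?s \<in> carr ?X" "A ?l \<in> carr ?X" "A ?u \<in> carr ?X"
   using op_leD(1)[OF A] sX lX by blast+
  have Alu: "A ?l + A ?u \<in> carr ?X" using normed_spaceD(7)[OF X AX(2,3)] .
  have HA: "H (A f) = H (A ?s) + (H (A ?l) + H (A ?u))"
   unfolding Af using H_add[OF AX(1) Alu] H_add[OF AX(2,3)] by simp
  have Hc: "H g (M m) \<in> arrs (M m)" if "g \<in> carr ?X" for g
   using co(1)[OF bounded_opD(1)[OF H that] M1] .
  have Uf: "U f m = \<beta> m (H (A ?s) (M m)) + (\<beta> m (H (A ?l) (M m)) + \<beta> m (H (A ?u) (M m)))"
  proof -
   have "U f m = \<beta> m (H (A f) (M m))" using m by (simp add: U_def B_def)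
   also have "H (A f) (M m) = H (A ?s) (M m) + (H (A ?l) (M m) + H (A ?u) (M m))"
    by (simp only: HA plus_fun_apply)
   finally have e: "U f m = \<beta> m (H (A ?s) (M m) + (H (A ?l) (M m) + H (A ?u) (M m)))" .
   have b2: "\<beta> m (u + v) = \<beta> m u + \<beta> m v" if "u \<in> arrs (M m)" "v \<in> arrs (M m)" for u v
    by (rule op_leD(3)[OF \<beta>[of m]]) (simp_all only: Cs_simps that)
   show ?thesis
    unfolding e b2[OF Hc[OF AX(1)] arrs_closed(2)[OF Hc[OF AX(2)] Hc[OF AX(3)]]] b2[OF Hc[OF AX(2)] Hc[OF AX(3)]] ..
  qed
  \<comment> \<open>Where \<open>g\<close> vanishes the identity contributes nothing, so there
    \<open>H\<close> agrees with \<open>Q\<close> up to a sign.\<close>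
  have Hoff: "\<nu> (\<beta> m (H g (M m))) \<le> \<nu> (B0 (\<sigma> m) (Q g (M m)))" "\<nu> (\<beta> m (H g (M m))) \<le> \<nu> (Q g (M m))"
   if gX: "g \<in> carr ?X" and g0: "g (M m) = 0" for g
  proof -
   have Qg: "Q g (M m) \<in> arrs (M m)" by (rule coQ[OF gX M1])
   have "\<nu> (\<beta> m (H g (M m))) = \<nu> (\<beta> m (Q g (M m)))"
   proof (cases b)
    case False
    then have "H g (M m) = (-1) *\<^sub>R Q g (M m)" using g0 by (simp add: H_def)
    then have "\<beta> m (H g (M m)) = (-1) *\<^sub>R \<beta> m (Q g (M m))" using op_leD(4)[OF \<beta>[of m], of "Q g (M m)" "-1"] Qg by (simp only: Cs_simps)
    moreover have "\<beta> m (Q g (M m)) \<in> arrs m" using op_leD(1)[OF \<beta>[of m]] Qg by simp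
    ultimately show ?thesis using nu_scale[of "\<beta> m (Q g (M m))" m "-1"] by simp
   qed (simp add: H_def)
   then show "\<nu> (\<beta> m (H g (M m))) \<le> \<nu> (B0 (\<sigma> m) (Q g (M m)))" "\<nu> (\<beta> m (H g (M m))) \<le> \<nu> (Q g (M m))"
    using \<beta>_le[OF Qg] op_leD(2)[OF \<beta>[of m], of "Q g (M m)"] Qg by simp_all
  qed
  have main: "\<nu> (\<beta> m (H (A ?s) (M m)) - f m) \<le> 1/4 * \<nu> (f m)"
  proof -
   let ?t = "B0 (\<sigma> m) (H (A ?s) (M m))"
   have fs: "f m \<in> arrs (\<sigma> m)" using arrs_mono[OF \<sigma>_ge fm] .
   have t: "?t \<in> arrs (\<sigma> m)" using op_leD(1)[OF B0[of m]] Hc[OF AX(1)] by simp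
   have "H (A ?s) (M m) = (if c (\<sigma> m) then Q (single (N (\<sigma> m)) (A0 (\<sigma> m) (f m))) (N (\<sigma> m))
     else A0 (\<sigma> m) (f m) - Q (single (N (\<sigma> m)) (A0 (\<sigma> m) (f m))) (N (\<sigma> m)))"
    unfolding As H_def \<sigma>(2) by (simp add: M_def \<alpha>_def single_def)
   then have "\<nu> (?t - f m) \<le> 1/4 * \<nu> (f m)" using gd[of "\<sigma> m"] fs by simp
   moreover have "\<beta> m (H (A ?s) (M m)) - f m = part (Ww m \<times> Ww m) (?t - f m)"
    using part_all[OF fm] unfolding \<beta>_def by (simp add: part_def fun_eq_iff) metis
   moreover have "\<nu> (part (Ww m \<times> Ww m) (?t - f m)) \<le> \<nu> (?t - f m)"
    using op_leD(2)[OF trunc_op_le[of "\<sigma> m" m], of "?t - f m"] arrs_closed(3)[OF t fs] by simp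
   ultimately show ?thesis by simp
  qed
  \<comment> \<open>The earlier coordinates are added one at a time. The sum starts at index 1, so
    coordinate 0 is zero and needs a case of its own.\<close>
  have lower: "\<nu> (\<beta> m (H (A ?l) (M m))) \<le> 2 * real m * eps m * nrm ?X f"
  proof -
   have "\<nu> (B0 (\<sigma> m) (Q (A (cut {..<k} f)) (M m))) \<le> 2 * real k * eps m * nrm ?X f" if "k \<le> m" for k
    using that
   proof (induction k)
    case 0
    have "A (cut {..<0} f) = 0"
     using bounded_op_0[OF X op_le_bounded[OF A]] by (simp add: cut_def zero_fun_def)
    moreover have "Q 0 = 0" by (rule bounded_op_0[OF X Q])
    moreover have "B0 (\<sigma> m) 0 = 0" by (rule bounded_op_0[OF Cs_normed op_le_bounded[OF B0]])
    ultimately have "B0 (\<sigma> m) (Q (A (cut {..<0} f)) (M m)) = 0" by (simp only: zero_fun_apply)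
    moreover have "\<nu> 0 = 0" using nu_zero[OF arrs_closed(1)] by simp
    ultimately show ?case by (simp only:; simp)
   next
    case (Suc k)
    have kX: "cut {..<k} f \<in> carr ?X" using op_leD(1)[OF cutc f] .
    show ?case
    proof (cases "k = 0")
     case True
     have "f 0 = 0" using lr_sum_coord(2)[of f r "{1..}" Cs 0] f by (simp add: Xs_def)
     then have "cut {..<Suc k} f = cut {..<k} f" using True by (auto simp: cut_def fun_eq_iff)
     then show ?thesis using Suc True eps_pos[of m] normed_spaceD(2)[OF X f]
      by (simp add: mult_nonneg_nonneg less_imp_le order_trans)
    next
     case False
     then have k: "1 \<le> k" "k < m" using Suc by auto
     have fk: "f k \<in> arrs k" "\<nu> (f k) \<le> nrm ?X f" using co[OF f k(1)] by auto
     have ak: "\<alpha> k (f k) \<in> arrs (M k)" "\<nu> (\<alpha> k (f k)) \<le> 2 * \<nu> (f k)"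
      using op_leD(1,2)[OF \<alpha>[of k], of "f k"] fk by auto
     have skX: "single k (f k) \<in> carr ?X" using op_leD(1)[OF Xs_single[OF r k(1)]] fk by simp
     have "A (single k (f k)) = single (M k) (\<alpha> k (f k))"
     proof
      fix i
      show "A (single k (f k)) i = single (M k) (\<alpha> k (f k)) i"
      proof (cases "i \<in> M ` {1..}")
       case True
       then obtain j where j: "1 \<le> j" "i = M j" by auto
       then show ?thesis using AM[OF j(1), of "single k (f k)"] M_inj \<alpha>0 by (auto simp: single_def inj_eq)
      next
       case False
       then show ?thesis using A_off[OF False] k by (auto simp: single_def)
      qed
     qed
     moreover have "cut {..<Suc k} f = single k (f k) + cut {..<k} f"
      by (auto simp: cut_def single_def fun_eq_iff less_Suc_eq)
     ultimately have Ac: "A (cut {..<Suc k} f) = single (M k) (\<alpha> k (f k)) + A (cut {..<k} f)"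
      using op_leD(3)[OF A skX kX] by simp
     have sM: "single (M k) (\<alpha> k (f k)) \<in> carr ?X" using op_leD(1)[OF Xs_single[OF r M1]] ak by simp
     have AkX: "A (cut {..<k} f) \<in> carr ?X" using op_leD(1)[OF A kX] .
     let ?p = "Q (single (M k) (\<alpha> k (f k))) (M m)" and ?q = "Q (A (cut {..<k} f)) (M m)"
     have pq: "?p \<in> arrs (M m)" "?q \<in> arrs (M m)" using coQ[OF sM M1] coQ[OF AkX M1] by auto
     have "Q (A (cut {..<Suc k} f)) (M m) = ?p + ?q"
      unfolding Ac op_leD(3)[OF \<Gamma>(2) sM AkX] by simp
     then have "B0 (\<sigma> m) (Q (A (cut {..<Suc k} f)) (M m)) = B0 (\<sigma> m) ?p + B0 (\<sigma> m) ?q"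
      using op_leD(3)[OF B0[of m], of ?p ?q] pq by simp
     then have "\<nu> (B0 (\<sigma> m) (Q (A (cut {..<Suc k} f)) (M m))) \<le> \<nu> (B0 (\<sigma> m) ?p) + \<nu> (B0 (\<sigma> m) ?q)"
      using nu_triangle[of "B0 (\<sigma> m) ?p" "\<sigma> m" "B0 (\<sigma> m) ?q"] op_leD(1)[OF B0[of m]] pq by simp
     also have "\<nu> (B0 (\<sigma> m) ?p) \<le> eps (\<sigma> m) * \<nu> (\<alpha> k (f k))"
     proof -
      have "N (\<sigma> k) \<in> P (\<sigma> m)" by (rule NP[OF \<sigma>_less[OF k(2)]])
      then show ?thesis using gd[of "\<sigma> m"] ak(1) by (simp add: M_def)
     qed
     also have "... \<le> eps m * (2 * nrm ?X f)"
      using eps_antimono[OF \<sigma>_ge[of m]] ak fk eps_pos[of m] nu_nonneg[OF ak(1)] by (intro mult_mono) (auto simp: less_imp_le)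
     also have "\<nu> (B0 (\<sigma> m) ?q) \<le> 2 * real k * eps m * nrm ?X f" using Suc by simp
     finally show ?thesis by (simp add: algebra_simps)
    qed
   qed
   from this[of m] have "\<nu> (B0 (\<sigma> m) (Q (A ?l) (M m))) \<le> 2 * real m * eps m * nrm ?X f" by simp
   moreover have "A ?l (M m) = 0" using AM[OF m, of ?l] \<alpha>0 by (simp add: cut_def)
   ultimately show ?thesis using Hoff(1)[OF AX(2)] by simp
  qed
  \<comment> \<open>For \<open>r = \<infinity>\<close> the image of the later part is supported in
    the supply of the stage and is estimated as a whole. For finite \<open>r\<close> the estimate is
    assembled from single coordinates, using that \<open>eps\<close> is summable beyond
    \<open>m\<close>.\<close>
  have upper: "\<nu> (\<beta> m (H (A ?u) (M m))) \<le> 2 * eps m * nrm ?X f"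
  proof -
   have Au0: "A ?u (M m) = 0" using AM[OF m, of ?u] \<alpha>0 by (simp add: cut_def)
   have "\<nu> (Q (A ?u) (M m)) \<le> 2 * eps m * nrm ?X f"
   proof (cases "r = \<infinity>")
    case True
    have "A ?u k = 0" if k: "k \<notin> \<Lambda> (\<sigma> m)" for k
    proof (cases "k \<in> M ` {1..}")
     case True
     then obtain j where j: "1 \<le> j" "k = M j" by auto
     have "\<not> m < j" using N\<Lambda>[OF \<sigma>_less[of m j]] k j by (auto simp: M_def)
     then show ?thesis using AM[OF j(1), of ?u] j \<alpha>0 by (simp add: cut_def)
    qed (rule A_off)
    then have "\<nu> (Q (A ?u) (M m)) \<le> eps (\<sigma> m) * nrm ?X (A ?u)"
     using gd[of "\<sigma> m"] True AX(3) by (simp add: M_def)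
    also have "... \<le> eps m * (2 * nrm ?X f)"
     using eps_antimono[OF \<sigma>_ge[of m]] op_leD(2)[OF A lX(2)] ul eps_pos[of m] normed_spaceD(2)[OF X AX(3)]
     by (intro mult_mono) (auto simp: less_imp_le)
    finally show ?thesis by simp
   next
    case False
    define Z where "Z g = Q (A (cut {m<..} g)) (M m)" for g
    have "op_le ?X (Cs (M m)) (\<Gamma> * 2 * 1) Z"
     unfolding Z_def using op_le_comp[OF op_le_comp[OF op_le_comp[OF cutc A] \<Gamma>(2,1)] Xs_coord[OF r M1[of m]]] by (simp add: mult_ac)
    then have Zb: "bounded_op (lr_sum r {1..} Cs) (Cs (M m)) Z"
     unfolding Xs_def by (rule op_le_bounded)
    have Zs: "\<nu> (Z (single n a)) \<le> (if m < n then eps n else 0) * \<nu> a" if n: "1 \<le> n" and a: "a \<in> arrs n" for n a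
    proof (cases "m < n")
     case False
     then have "cut {m<..} (single n a) = 0" by (auto simp: cut_def single_def fun_eq_iff)
     then have "Z (single n a) = 0"
      using bounded_op_0[OF X op_le_bounded[OF A]] bounded_op_0[OF X Q] by (simp only: Z_def zero_fun_apply)
     moreover have "\<nu> 0 = 0" using nu_zero[OF arrs_closed(1)] by simp
     ultimately show ?thesis using False by (simp only:; simp)
    next
     case True
     have "cut {m<..} (single n a) = single n a" using True by (auto simp: cut_def single_def fun_eq_iff)
     moreover have "A (single n a) = single (M n) (\<alpha> n a)"
     proof
      fix i
      show "A (single n a) i = single (M n) (\<alpha> n a) i"
      proof (cases "i \<in> M ` {1..}")
       case True
       then obtain j where j: "1 \<le> j" "i = M j" by auto
       then show ?thesis using AM[OF j(1), of "single n a"] M_inj \<alpha>0 by (auto simp: single_def inj_eq)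
      next
       case False
       then show ?thesis using A_off[OF False] n by (auto simp: single_def)
      qed
     qed
     ultimately have "Z (single n a) = Q (single (N (\<sigma> n)) (A0 (\<sigma> n) a)) (N (\<sigma> m))"
      by (simp add: Z_def M_def \<alpha>_def)
     moreover have "N (\<sigma> m) \<in> P (\<sigma> n)" by (rule NP[OF \<sigma>_less[OF True]])
     moreover have "a \<in> arrs (\<sigma> n)" by (rule arrs_mono[OF \<sigma>_ge a])
     ultimately have "\<nu> (Z (single n a)) \<le> eps (\<sigma> n) * \<nu> a" using gd[of "\<sigma> n"] by simp
     also have "... \<le> eps n * \<nu> a" using eps_antimono[OF \<sigma>_ge[of n]] nu_nonneg[OF a] by (rule mult_right_mono)
     finally show ?thesis using True by simp
    qed
    have "nrm (Cs (M m)) (Z f) \<le> eps m * nrm (lr_sum r {1..} Cs) f"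
    proof (rule lr_sum_op_small[OF r False Cs_all_normed _ Cs_normed Zb, where e = "\<lambda>n. if m < n then eps n else 0"])
     show "(\<Sum>n\<in>F. if m < n then eps n else 0) \<le> eps m" if "finite F" "F \<subseteq> {1..}" for F
     proof -
      have "(\<Sum>n\<in>F. if m < n then eps n else 0) = sum eps {n \<in> F. m < n}"
       using that by (simp only: sum.inter_filter)
      also have "... \<le> eps m" by (rule eps_tail) (use that in auto)
      finally show ?thesis .
     qed
     show "f \<in> carr (lr_sum r {1..} Cs)" using f by (simp only: Xs_def)
     show "0 \<le> (if m < n then eps n else 0)" for n using eps_pos[of n] by auto
     show "nrm (Cs (M m)) (Z (single n a)) \<le> (if m < n then eps n else 0) * nrm (Cs n) a"
      if "n \<in> {1..}" "a \<in> carr (Cs n)" for n a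
      unfolding Cs_simps by (rule Zs) (use that in simp_all)
    qed simp
    then have "\<nu> (Q (A ?u) (M m)) \<le> eps m * nrm ?X f" by (simp add: Z_def Xs_def)
    also have "... \<le> 2 * eps m * nrm ?X f" using eps_pos[of m] normed_spaceD(2)[OF X f] by simp
    finally show ?thesis .
   qed
   then show ?thesis using Hoff(2)[OF AX(3) Au0] by simp
  qed
  have bm: "\<beta> m (H g (M m)) \<in> arrs m" if "g \<in> carr ?X" for g
   using op_leD(1)[OF \<beta>[of m]] Hc[OF that] by simp
  have "(U f - f) m = (\<beta> m (H (A ?s) (M m)) - f m) + (\<beta> m (H (A ?l) (M m)) + \<beta> m (H (A ?u) (M m)))"
   unfolding minus_apply[of "U f"] Uf by (rule diff_add_eq[symmetric])
  then have "\<nu> ((U f - f) m) \<le> \<nu> (\<beta> m (H (A ?s) (M m)) - f m) + \<nu> (\<beta> m (H (A ?l) (M m)) + \<beta> m (H (A ?u) (M m)))"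
   using nu_triangle[OF arrs_closed(3)[OF bm[OF AX(1)] fm] arrs_closed(2)[OF bm[OF AX(2)] bm[OF AX(3)]]] by (simp only:)
  also have "\<nu> (\<beta> m (H (A ?l) (M m)) + \<beta> m (H (A ?u) (M m))) \<le> \<nu> (\<beta> m (H (A ?l) (M m))) + \<nu> (\<beta> m (H (A ?u) (M m)))"
   by (rule nu_triangle[OF bm[OF AX(2)] bm[OF AX(3)]])
  finally have "\<nu> ((U f - f) m) \<le> 1/4 * \<nu> (f m) + (2 * real m * eps m * nrm ?X f + 2 * eps m * nrm ?X f)"
   using main lower upper by linarith
  also have "2 * real m * eps m * nrm ?X f + 2 * eps m * nrm ?X f = \<delta> m * nrm ?X f"
   by (simp only: \<delta>_def distrib_right)
  finally show ?thesis .
 qed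
 have Ub: "bounded_op ?X ?X U"
  unfolding U_def
  by (rule bounded_op_comp[OF X X bounded_op_comp[OF X X op_le_bounded[OF A] H] op_le_bounded[OF B]])
 have near: "nrm ?X (U f - f) \<le> 1/2 * nrm ?X f" if f: "f \<in> carr ?X" for f
 proof -
  have UfX: "U f - f \<in> carr ?X" using normed_spaceD(8)[OF X bounded_opD(1)[OF Ub f] f] .
  have nf: "0 \<le> nrm ?X f" using normed_spaceD(2)[OF X f] .
  have \<delta>0: "0 \<le> \<delta> m" for m using eps_pos[of m] by (simp add: \<delta>_def)
  \<comment> \<open>From \<open>k + 1 \<le> 2 ^ k\<close> follows
    \<open>\<delta> k \<le> 1/32 * (1/2) ^ k\<close>, a geometric series.\<close>
  have sum\<delta>: "sum \<delta> F \<le> 1/4" if F: "finite F" for F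
  proof -
   have "(\<Sum>m<k. \<delta> m) \<le> 1/16 * (2 - 2 * (1/2) ^ k)" for k
   proof (induction k)
    case (Suc k)
    have "real k + 1 \<le> 2 ^ k"
     using of_nat_mono[of "Suc k" "2 ^ k", where 'a = real] by (simp add: Suc_le_eq)
    then have "\<delta> k \<le> 2 * 2 ^ k * ((1/4) ^ k / 64)"
     unfolding \<delta>_def eps_def by (intro mult_right_mono) auto
    also have "... = 1/32 * (2 * (1/4)) ^ k" unfolding power_mult_distrib by simp
    also have "... = 1/32 * (1/2) ^ k" by simp
    finally have "\<delta> k \<le> 1/32 * (1/2) ^ k" .
    moreover have "0 \<le> (1/2 :: real) ^ k" by simp
    moreover have "(1/2 :: real) ^ Suc k = (1/2) ^ k / 2" by simp
    moreover have "d \<le> 1/16 * (u * 2 - 2 * v)" if "d \<le> 1/32 * u" "0 \<le> u" "v = u / 2" for d u v :: real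
     using that by (simp add: field_simps)
    ultimately have "\<delta> k \<le> 1/16 * ((1/2) ^ k * 2 - 2 * (1/2) ^ Suc k)" by blast
    then show ?case using Suc by (simp add: algebra_simps)
   qed simp
   moreover have "1/16 * (2 - 2 * (1/2) ^ k) \<le> (1/4 :: real)" for k :: nat by (simp add: field_simps)
   ultimately have le: "(\<Sum>m<k. \<delta> m) \<le> 1/4" for k by (rule order_trans)
   obtain k where "F \<subseteq> {..<k}" using F by (metis finite_nat_iff_bounded)
   then have "sum \<delta> F \<le> (\<Sum>m<k. \<delta> m)" using \<delta>0 by (intro sum_mono2) auto
   then show ?thesis using le[of k] by simp
  qed
  have "nrm (lr_sum r {1..} Cs) (U f - f) \<le> 1/2 * nrm ?X f"
  proof (rule lr_sum_nrm_le[OF r Cs_all_normed])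
   show "U f - f \<in> carr (lr_sum r {1..} Cs)" using UfX by (simp add: Xs_def)
   fix F :: "nat set" assume F: "finite F" "F \<subseteq> {1..}"
   have c0: "0 \<le> \<nu> (f m)" "0 \<le> \<nu> ((U f - f) m)" if "m \<in> F" for m
    using nu_nonneg[OF co(1)[OF f]] nu_nonneg[OF co(1)[OF UfX]] that F by auto
   have "lrf r F (\<lambda>m. nrm (Cs m) ((U f - f) m)) \<le> lrf r F (\<lambda>m. 1/4 * \<nu> (f m) + \<delta> m * nrm ?X f)"
    using coord[OF f] c0 F by (intro lrf_mono[OF r]) auto
   also have "... \<le> lrf r F (\<lambda>m. 1/4 * \<nu> (f m)) + lrf r F (\<lambda>m. \<delta> m * nrm ?X f)"
    using c0 \<delta>0 nf F by (intro lrf_triangle[OF r]) auto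
   also have "lrf r F (\<lambda>m. 1/4 * \<nu> (f m)) = 1/4 * lrf r F (\<lambda>m. nrm (Cs m) (f m))"
    using lrf_scale[OF r F(1), of "1/4" "\<lambda>m. \<nu> (f m)"] c0 by simp
   also have "lrf r F (\<lambda>m. nrm (Cs m) (f m)) \<le> nrm ?X f"
    unfolding Xs_def using f F by (intro lr_sum_nrm_ge[OF r Cs_all_normed]) (auto simp: Xs_def)
   also have "lrf r F (\<lambda>m. \<delta> m * nrm ?X f) \<le> (\<Sum>m\<in>F. \<delta> m * nrm ?X f)"
    using \<delta>0 nf F by (intro lrf_le_sum[OF r]) auto
   also have "... = sum \<delta> F * nrm ?X f" by (simp add: sum_distrib_right)
   also have "... \<le> 1/4 * nrm ?X f" using sum\<delta>[OF F(1)] nf by (rule mult_right_mono)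
   finally show "lrf r F (\<lambda>m. nrm (Cs m) ((U f - f) m)) \<le> 1/2 * nrm ?X f" by linarith
  qed simp
  then show ?thesis by (simp add: Xs_def)
 qed
 have "\<exists>V. bounded_op ?X ?X V \<and> (\<forall>f\<in>carr ?X. U (V f) = f)"
  by (rule near_identity_right_inverse[OF Xs_banach[OF r] Ub near]) auto
 then obtain V where V: "bounded_op ?X ?X V" "\<And>f. f \<in> carr ?X ==> U (V f) = f" by blast
 show ?thesis
 proof (rule that[of "\<lambda>f. A (V f)" B b])
  show "bounded_op ?X ?X (\<lambda>f. A (V f))" by (rule bounded_op_comp[OF X X V(1) op_le_bounded[OF A]])
  show "bounded_op ?X ?X B" by (rule op_le_bounded[OF B])
  show "B (if b then Q (A (V f)) else A (V f) - Q (A (V f))) = f" if "f \<in> carr ?X" for f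
   using V(2)[OF that] by (simp only: U_def H_def)
 qed
qed

end

section \<open>Primariness of the sums of coefficient spaces\<close>

context haar_norm
begin

text \<open>After flattening, position \<open>k\<close> of the power carries \<open>Cs (m k)\<close>
  with \<open>m k \<le> k\<close>. This space is complemented in \<open>Cs k\<close> by truncation
  with constant 1, so the power sits inside the original sum coordinate by coordinate.\<close>

lemma power_complemented:
 assumes r: "1 \<le> r"
 shows "complemented (lr_sum r UNIV (\<lambda>_::nat. Xs r)) (Xs r)"
proof -
 define m where "m k = snd (prod_decode k)" for k
 define B where "B = {k. m k \<in> {1..}}"
 have mk: "m k \<le> k" for k using le_prod_encode_2[of "m k" "fst (prod_decode k)"] by (simp add: m_def)
 have B1: "B \<subseteq> {1..}"
 proof
  fix k assume "k \<in> B"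
  then have "1 \<le> m k" by (simp add: B_def)
  then show "k \<in> {1..}" using mk[of k] by simp
 qed
 have "prod_encode (0, 1) \<in> B" by (simp add: B_def m_def)
 then have Bne: "B \<noteq> {}" by blast
 let ?M = "lr_sum r B (\<lambda>k. Cs (m k))"
 have nM: "\<forall>k\<in>B. normed_space (Cs (m k))" using Cs_normed by blast
 have M: "normed_space ?M" by (rule lr_sum_normed[OF r nM Bne])
 have W: "normed_space (lr_sum r UNIV (\<lambda>_::nat. Xs r))" by (rule lr_sum_normed[OF r]) (use Xs_normed[OF r] in auto)
 have "isomorphic_spaces (lr_sum r UNIV (\<lambda>_::nat. Xs r)) ?M"
  using lr_flatten[OF r Cs_all_normed, of "{1..}"] by (simp add: Xs_def B_def m_def)
 then have c1: "complemented (lr_sum r UNIV (\<lambda>_::nat. Xs r)) ?M" by (rule isomorphic_complemented)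
 have i: "op_le ?M (Xs r) 1 (\<lambda>f k. if k \<in> B then f k else 0)"
  unfolding Xs_def by (rule lr_sum_map[OF r nM Bne Cs_all_normed]) (use B1 mk incl_op_le in auto)
 have p: "op_le (Xs r) ?M 1 (\<lambda>f k. if k \<in> B then part (Ww (m k) \<times> Ww (m k)) (f k) else 0)"
  unfolding Xs_def by (rule lr_sum_map[OF r Cs_all_normed _ nM Bne]) (use B1 trunc_op_le in auto)
 have "complemented ?M (Xs r)"
  unfolding complemented_def
 proof (intro exI conjI ballI)
  show "bounded_op ?M (Xs r) (\<lambda>f k. if k \<in> B then f k else 0)" by (rule op_le_bounded[OF i])
  show "bounded_op (Xs r) ?M (\<lambda>f k. if k \<in> B then part (Ww (m k) \<times> Ww (m k)) (f k) else 0)" by (rule op_le_bounded[OF p])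
  fix f assume f: "f \<in> carr ?M"
  show "(\<lambda>k. if k \<in> B then part (Ww (m k) \<times> Ww (m k)) (if k \<in> B then f k else 0) else 0) = f"
   using lr_sum_coord[OF f] part_all by (auto simp: fun_eq_iff)
 qed
 then show ?thesis by (rule complemented_trans[OF W M Xs_normed[OF r] c1])
qed

text \<open>Let \<open>H\<close> be the one of \<open>Q\<close> and \<open>Id - Q\<close> through
  which the identity factors. Its range is complemented in the space because \<open>H\<close> is a
  projection, and the space is complemented in the range through \<open>H (A f)\<close> and
  \<open>B\<close>. By \<open>pelczynski\<close> both are isomorphic to the same power.\<close>

theorem Xs_primary:
 assumes r: "1 \<le> r"
 shows "primary (Xs r)"
proof -
 let ?X = "Xs r" and ?W = "lr_sum r UNIV (\<lambda>_::nat. Xs r)"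
 have X: "normed_space ?X" by (rule Xs_normed[OF r])
 have nX: "\<forall>n\<in>UNIV. normed_space ?X" using X by blast
 have W: "normed_space ?W" by (rule lr_sum_normed[OF r nX]) simp
 have XW: "complemented ?X ?W"
  unfolding complemented_def
 proof (intro exI conjI ballI)
  show "bounded_op ?X ?W (single 0)" by (rule op_le_bounded[OF op_le_single[OF r nX]]) simp
  show "bounded_op ?W ?X (\<lambda>f. f 0)" by (rule op_le_bounded[OF op_le_coord[OF r nX]]) simp
 qed (simp add: single_def)
 have WX: "complemented ?W ?X" by (rule power_complemented[OF r])
 have isoX: "isomorphic_spaces ?X ?W" by (rule pelczynski[OF r X X XW WX])
 have "isomorphic_spaces (op_range ?X Q) ?X \<or> isomorphic_spaces (op_range ?X (\<lambda>x. x - Q x)) ?X"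
  if Qp: "bounded_projection ?X Q" for Q
 proof -
  have Q: "bounded_op ?X ?X Q" and QQ: "\<And>x. x \<in> carr ?X ==> Q (Q x) = Q x"
   using Qp by (auto simp: bounded_projection_def)
  obtain b A B where A: "bounded_op ?X ?X A" and B: "bounded_op ?X ?X B"
   and id: "\<And>f. f \<in> carr ?X ==> B (if b then Q (A f) else A f - Q (A f)) = f"
   by (rule factor_identity[OF r Q]) blast
  define H where "H f = (if b then Q f else f - Q f)" for f
  have H: "bounded_op ?X ?X H"
   unfolding H_def using Q bounded_op_id_minus[OF X Q] by (cases b) auto
  have HH: "H (H f) = H f" if f: "f \<in> carr ?X" for f
  proof -
   have "Q (f - Q f) = 0" using bounded_op_diff[OF X Q f bounded_opD(1)[OF Q f]] QQ[OF f] by simp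
   then show ?thesis using QQ[OF f] by (simp add: H_def)
  qed
  let ?Y = "op_range ?X H"
  have Y: "normed_space ?Y" by (rule op_range_normed[OF X H])
  have Yc: "y \<in> carr ?X" "H y = y" if "y \<in> carr ?Y" for y
   using that bounded_opD(1)[OF H] HH by (auto simp: op_range_def)
  have HY: "bounded_op ?X ?Y H"
   using H unfolding bounded_op_def op_range_def by simp
  have inc: "bounded_op ?Y ?X (\<lambda>y. y)"
  proof (rule bounded_opI[where C = 1])
   show "nrm ?X y \<le> 1 * nrm ?Y y" for y by (simp add: op_range_def)
  qed (simp_all add: Yc(1))
  have YX: "complemented ?Y ?X"
   unfolding complemented_def
  proof (intro exI conjI ballI)
   show "bounded_op ?Y ?X (\<lambda>y. y)" by (rule inc)
   show "bounded_op ?X ?Y H" by (rule HY)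
  qed (rule Yc(2))
  have XY: "complemented ?X ?Y"
   unfolding complemented_def
  proof (intro exI conjI ballI)
   show "bounded_op ?X ?Y (\<lambda>f. H (A f))" by (rule bounded_op_comp[OF X X A HY])
   show "bounded_op ?Y ?X (\<lambda>y. B y)" using bounded_op_comp[OF Y X inc B] .
   show "B (H (A f)) = f" if "f \<in> carr ?X" for f using id[OF that] by (simp add: H_def)
  qed
  have "isomorphic_spaces ?Y ?W"
   by (rule pelczynski[OF r Y X complemented_trans[OF Y X W YX XW] complemented_trans[OF W X Y WX XY]])
  then have iso: "isomorphic_spaces ?Y ?X"
   by (rule isomorphic_spaces_trans[OF Y W X _ isomorphic_spaces_sym[OF isoX]])
  show ?thesis
  proof (cases b)
   case True
   then have "H = Q" by (simp add: H_def fun_eq_iff)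
   then show ?thesis using iso by simp
  next
   case False
   then have "H = (\<lambda>x. x - Q x)" by (simp add: H_def fun_eq_iff)
   then show ?thesis using iso by simp
  qed
 qed
 then show ?thesis unfolding primary_def using Xs_banach[OF r] by blast
qed

end

section \<open>Mixed norms of square functions\<close>

lemma powr_convex_on: "1 \<le> p ==> convex_on {0..} (\<lambda>t::real. t powr p)"
 by (intro convex_onI) (use powr_convex2[of p] in auto)

lemma powr_jensen:
 fixes w t :: "'a => real"
 assumes p: "1 \<le> p" and F: "finite F" and w: "\<And>i. i \<in> F ==> 0 \<le> w i" "sum w F = 1"
  and t: "\<And>i. i \<in> F ==> 0 \<le> t i"
 shows "(\<Sum>i\<in>F. w i * t i) powr p \<le> (\<Sum>i\<in>F. w i * t i powr p)"
proof -
 have "F \<noteq> {}" using w(2) by auto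
 then show ?thesis
  using convex_on_sum[OF F _ powr_convex_on[OF p] w(2), of t] w(1) t by simp
qed

text \<open>The Lp norm on the unit interval of a function constant on the dyadic intervals of level
  \<open>M\<close>, written as a function of words.\<close>

definition mp :: "real => nat => (bool list => real) => real" where
 "mp p M f = wlp p (\<lambda>_. 1 / 2 ^ M) (Lw M) f"

lemma mp_nonneg [simp]: "0 \<le> mp p M f" by (simp add: mp_def)

lemma mp_cong: "(\<And>w. w \<in> Lw M ==> f w = g w) ==> mp p M f = mp p M g"
 by (simp add: mp_def wlp_def)

lemma mp_mono: "1 \<le> p ==> (\<And>w. w \<in> Lw M ==> 0 \<le> f w) ==> (\<And>w. w \<in> Lw M ==> f w \<le> g w) ==> mp p M f \<le> mp p M g"
 unfolding mp_def by (rule wlp_mono) auto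

lemma mp_scale: "1 \<le> p ==> 0 \<le> c ==> (\<And>w. w \<in> Lw M ==> 0 \<le> f w) ==> mp p M (\<lambda>w. c * f w) = c * mp p M f"
 unfolding mp_def by (rule wlp_scale) auto

lemma mp_triangle: "1 \<le> p ==> (\<And>w. w \<in> Lw M ==> 0 \<le> f w) ==> (\<And>w. w \<in> Lw M ==> 0 \<le> g w) ==>
  mp p M (\<lambda>w. f w + g w) \<le> mp p M f + mp p M g"
 unfolding mp_def by (rule wlp_triangle) auto

lemma mp_powr: "1 \<le> p ==> mp p M f powr p = (\<Sum>w\<in>Lw M. f w powr p) / 2 ^ M"
 unfolding mp_def by (subst wlp_powr) (auto simp: sum_divide_distrib)

lemma mp_alt: "mp p M f = ((\<Sum>w\<in>Lw M. f w powr p) / 2 ^ M) powr (1 / p)"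
 by (simp add: mp_def wlp_def sum_divide_distrib)

lemma mp_leI: "1 \<le> p ==> 0 \<le> C ==> (\<Sum>w\<in>Lw M. f w powr p) / 2 ^ M \<le> C powr p ==> mp p M f \<le> C"
 unfolding mp_def by (rule wlp_leI) (auto simp: sum_divide_distrib)

lemma mp_const: "1 \<le> p ==> 0 \<le> c ==> mp p M (\<lambda>_. c) = c"
 by (simp add: mp_alt powr_powr)

lemma mp_zero: "mp p M (\<lambda>_. 0) = 0"
 by (simp add: mp_alt)

lemma mp_eq_0: "1 \<le> p ==> mp p M f = 0 ==> w \<in> Lw M ==> f w = 0"
 using wlp_eq_0[of p "Lw M" "\<lambda>_. 1 / 2 ^ M" f w] by (simp add: mp_def)

lemma mp_sum:
 assumes p: "1 \<le> p" and A: "finite A" and f: "\<And>i w. i \<in> A ==> 0 \<le> f i w"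
 shows "mp p M (\<lambda>w. \<Sum>i\<in>A. f i w) \<le> (\<Sum>i\<in>A. mp p M (f i))"
 using A f
proof (induction A rule: finite_induct)
 case (insert i A)
 have "mp p M (\<lambda>w. f i w + (\<Sum>j\<in>A. f j w)) \<le> mp p M (f i) + mp p M (\<lambda>w. \<Sum>j\<in>A. f j w)"
  by (rule mp_triangle[OF p]) (use insert in \<open>auto intro: sum_nonneg\<close>)
 then show ?case using insert by fastforce
qed (simp add: mp_zero)

lemma fibre_card:
 assumes "z \<in> Lw (card (S \<inter> {..<M}))"
 shows "real (card {x \<in> Lw M. phi S G x = z}) * 2 ^ card (S \<inter> {..<M}) = 2 ^ M"
proof -
 have "length z = card (S \<inter> {..<M})" using assms by (simp add: Lw_def)
 then have "card {x \<in> Lw M. phi S G x = z} * 2 ^ card (S \<inter> {..<M}) = 2 ^ M"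
  using phi_fibre_card[of z S M G] by simp
 from arg_cong[OF this, of real] show ?thesis by simp
qed

lemma sum_fibres: "(\<Sum>z\<in>Lw (card (S \<inter> {..<M})). \<Sum>x\<in>{x \<in> Lw M. phi S G x = z}. h x) = sum h (Lw M)"
 by (rule sum.group[OF finite_Lw finite_Lw]) (auto simp: Lw_def length_phi)

text \<open>All fibres of \<open>phi\<close> have the same size, so it preserves the uniform
  measure.\<close>

lemma mp_phi:
 assumes p: "1 \<le> p"
 shows "mp p M (\<lambda>x. f (phi S G x)) = mp p (card (S \<inter> {..<M})) f"
proof -
 let ?k = "card (S \<inter> {..<M})"
 have "(\<Sum>x\<in>Lw M. f (phi S G x) powr p) = (\<Sum>z\<in>Lw ?k. \<Sum>x\<in>{x \<in> Lw M. phi S G x = z}. f (phi S G x) powr p)"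
  by (rule sum_fibres[symmetric])
 also have "... = (\<Sum>z\<in>Lw ?k. real (card {x \<in> Lw M. phi S G x = z}) * f z powr p)"
  by (intro sum.cong refl) simp
 also have "... = (\<Sum>z\<in>Lw ?k. 2 ^ M / 2 ^ ?k * f z powr p)"
  by (intro sum.cong refl) (use fibre_card[of _ S M G] in \<open>auto simp: field_simps\<close>)
 finally have "(\<Sum>x\<in>Lw M. f (phi S G x) powr p) = 2 ^ M / 2 ^ ?k * (\<Sum>z\<in>Lw ?k. f z powr p)"
  by (simp only: sum_distrib_left)
 then show ?thesis by (simp add: mp_alt)
qed

text \<open>The average over fibres is a conditional expectation; Jensen's inequality on each fibre
  gives the contraction.\<close>

lemma mp_fibre_average:
 assumes p: "1 \<le> p" and f: "\<And>x. 0 \<le> f x"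
 shows "mp p (card (S \<inter> {..<M})) (\<lambda>z. 2 ^ card (S \<inter> {..<M}) / 2 ^ M * (\<Sum>x\<in>{x \<in> Lw M. phi S G x = z}. f x)) \<le> mp p M f"
proof (rule mp_leI[OF p])
 let ?k = "card (S \<inter> {..<M})" and ?F = "\<lambda>z. {x \<in> Lw M. phi S G x = z}"
 have "(2 ^ ?k / 2 ^ M * (\<Sum>x\<in>?F z. f x)) powr p \<le> 2 ^ ?k / 2 ^ M * (\<Sum>x\<in>?F z. f x powr p)" if z: "z \<in> Lw ?k" for z
 proof -
  have fin: "finite (?F z)" by (rule finite_subset[OF _ finite_Lw[of M]]) auto
  have "(\<Sum>x\<in>?F z. 2 ^ ?k / 2 ^ M * f x) powr p \<le> (\<Sum>x\<in>?F z. 2 ^ ?k / 2 ^ M * f x powr p)"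
   by (rule powr_jensen[OF p fin]) (use f fibre_card[OF z, of G] in \<open>auto simp: field_simps\<close>)
  then show ?thesis by (simp only: sum_distrib_left)
 qed
 then have "(\<Sum>z\<in>Lw ?k. (2 ^ ?k / 2 ^ M * (\<Sum>x\<in>?F z. f x)) powr p) \<le> (\<Sum>z\<in>Lw ?k. 2 ^ ?k / 2 ^ M * (\<Sum>x\<in>?F z. f x powr p))"
  by (rule sum_mono)
 also have "... = 2 ^ ?k / 2 ^ M * (\<Sum>x\<in>Lw M. f x powr p)"
  by (simp only: sum_distrib_left[symmetric] sum_fibres)
 finally have "(\<Sum>z\<in>Lw ?k. (2 ^ ?k / 2 ^ M * (\<Sum>x\<in>?F z. f x)) powr p) / 2 ^ ?k
   \<le> 2 ^ ?k / 2 ^ M * (\<Sum>x\<in>Lw M. f x powr p) / 2 ^ ?k" by (rule divide_right_mono) simp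
 also have "... = mp p M f powr p" by (simp add: mp_powr[OF p])
 finally show "(\<Sum>z\<in>Lw ?k. (2 ^ ?k / 2 ^ M * (\<Sum>x\<in>?F z. f x)) powr p) / 2 ^ ?k \<le> mp p M f powr p" .
qed simp

lemma mp_indicator:
 assumes p: "1 \<le> p" and P: "P \<subseteq> Lw M" and c: "0 \<le> c"
 shows "mp p M (\<lambda>w. if w \<in> P then c else 0) = (real (card P) / 2 ^ M) powr (1 / p) * c"
proof -
 have "(\<Sum>w\<in>Lw M. (if w \<in> P then c else 0) powr p) = (\<Sum>w\<in>Lw M. if w \<in> P then c powr p else 0)"
  by (intro sum.cong) auto
 also have "... = real (card P) * c powr p"
  using P by (simp add: sum.inter_restrict[symmetric] Int_absorb1)
 finally have "mp p M (\<lambda>w. if w \<in> P then c else 0) = (real (card P) / 2 ^ M * c powr p) powr (1 / p)"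
  by (simp add: mp_alt)
 also have "... = (real (card P) / 2 ^ M) powr (1 / p) * c"
  using p c by (subst powr_mult) (auto simp: powr_powr)
 finally show ?thesis .
qed

text \<open>Hoelder's inequality against an indicator, obtained from Jensen's inequality for the
  uniform measure on \<open>P\<close>.\<close>

lemma mp_holder_indicator:
 assumes p: "1 \<le> p" and P: "P \<subseteq> Lw M" and f: "\<And>w. 0 \<le> f w"
 shows "(\<Sum>w\<in>P. f w) / 2 ^ M \<le> mp p M f * (real (card P) / 2 ^ M) powr (1 - 1 / p)"
proof (cases "P = {}")
 case False
 have fin: "finite P" using P finite_subset by fastforce
 then have cP: "0 < real (card P)" using False by (simp add: card_gt_0_iff)
 let ?d = "real (card P) / 2 ^ M" and ?m = "(\<Sum>w\<in>P. f w) / card P"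
 have d: "0 < ?d" using cP by simp
 have "(\<Sum>w\<in>P. 1 / card P * f w) powr p \<le> (\<Sum>w\<in>P. 1 / card P * f w powr p)"
  by (rule powr_jensen[OF p fin]) (use f cP in auto)
 then have "?m powr p \<le> (\<Sum>w\<in>P. f w powr p) / card P"
  by (simp add: sum_divide_distrib)
 also have "... \<le> (\<Sum>w\<in>Lw M. f w powr p) / card P"
  using P by (intro divide_right_mono sum_mono2) auto
 finally have "?d * ?m powr p \<le> ?d * ((\<Sum>w\<in>Lw M. f w powr p) / card P)" using d by (simp only: mult_le_cancel_left_pos)
 also have "... = mp p M f powr p" unfolding mp_powr[OF p] using cP by simp
 finally have "(?d * ?m powr p) powr (1 / p) \<le> (mp p M f powr p) powr (1 / p)"
  using p d by (intro powr_mono2) auto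
 moreover have "(?d * ?m powr p) powr (1 / p) = ?d powr (1 / p) * ?m"
  using p d f by (subst powr_mult) (auto simp: powr_powr sum_nonneg)
 moreover have "(mp p M f powr p) powr (1 / p) = mp p M f" using p by (simp add: powr_powr)
 ultimately have "?d powr (1 / p) * ?m \<le> mp p M f" by simp
 then have "?d powr (1 / p) * ?m * ?d powr (1 - 1 / p) \<le> mp p M f * ?d powr (1 - 1 / p)"
  by (rule mult_right_mono) simp
 moreover have "?d powr (1 / p) * ?m * ?d powr (1 - 1 / p) = ?m * ?d"
  using d by (simp add: powr_add[symmetric] mult.assoc mult.left_commute)
 moreover have "?m * ?d = (\<Sum>w\<in>P. f w) / 2 ^ M" using cP by simp
 ultimately show ?thesis by simp
qed simp

lemma mean_le_mp:
 assumes p: "1 \<le> p" and f: "\<And>w. 0 \<le> f w"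
 shows "(\<Sum>w\<in>Lw M. f w) / 2 ^ M \<le> mp p M f"
 using mp_holder_indicator[where M = M and P = "Lw M", OF p order_refl f] by simp

section \<open>Square functions under re-coding\<close>

lemma L2_set_sum_le:
 assumes "finite F"
 shows "L2_set (\<lambda>t. \<Sum>x\<in>F. f x t) A \<le> (\<Sum>x\<in>F. L2_set (f x) A)"
 using assms
proof (induction F rule: finite_induct)
 case (insert x F)
 have "L2_set (\<lambda>t. f x t + (\<Sum>x\<in>F. f x t)) A \<le> L2_set (f x) A + L2_set (\<lambda>t. \<Sum>x\<in>F. f x t) A"
  by (rule L2_set_triangle_ineq)
 then show ?case using insert by simp
qed (simp add: L2_set_0')

text \<open>The square function at a point coded by words \<open>x\<close> and \<open>y\<close> of
  full length: on each level the interval containing the point is a prefix of its word.\<close>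

definition sf :: "nat => nat => arr => bool list => bool list => real" where
 "sf n l a x y = L2_set (\<lambda>t. a (take (fst t) x) (take (snd t) y)) ({..n} \<times> {..l})"

definition mixed :: "real => real => nat => nat => arr => real" where
 "mixed p q n l a = mp p n (\<lambda>x. mp q l (\<lambda>y. sf n l a x y))"

lemma sf_nonneg [simp]: "0 \<le> sf n l a x y" by (simp add: sf_def)

lemma sf_tr: "sf n l (tr a) x y = sf l n a y x"
proof -
 have "(\<Sum>t\<in>{..n} \<times> {..l}. (a (take (snd t) y) (take (fst t) x))\<^sup>2)
   = (\<Sum>t\<in>{..l} \<times> {..n}. (a (take (fst t) y) (take (snd t) x))\<^sup>2)"
  by (rule sum.reindex_bij_witness[of _ prod.swap prod.swap]) auto
 then show ?thesis by (simp add: sf_def L2_set_def tr_def)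
qed

lemma sf_alt: "sf n l a x y = sqrt (\<Sum>i\<le>n. \<Sum>j\<le>l. (a (take i x) (take j y))\<^sup>2)"
 by (simp add: sf_def L2_set_def sum.cartesian_product case_prod_unfold)

text \<open>Along the branch \<open>x\<close> only levels in \<open>S\<close> carry coefficients,
  namely those of prefixes of \<open>phi S G x\<close> whose lengths are the ranks; distinct levels
  have distinct ranks, so no term occurs twice. Branches of length \<open>Suc N\<close> are used
  because \<open>N\<close> itself may belong to \<open>S\<close>; their codes then have length
  \<open>Suc n\<close>.\<close>

lemma sf_upx:
 assumes S: "S \<subseteq> {..N}" "card S = Suc n" and x: "x \<in> Lw (Suc N)"
 shows "sf (Suc N) l (upx S G a) x y \<le> sf (Suc n) l a (phi S G x) y"
proof -
 let ?r = "\<lambda>i. card (S \<inter> {..<i})" and ?g = "\<lambda>k. \<Sum>j\<le>l. (a (take k (phi S G x)) (take j y))\<^sup>2"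
 have fin: "finite S" using finite_subset[OF S(1)] by simp
 have e: "(\<Sum>j\<le>l. (upx S G a (take i x) (take j y))\<^sup>2) = (if i \<in> S then ?g (?r i) else 0)" if i: "i \<le> Suc N" for i
 proof -
  have "length (take i x) = i" "phi S G (take i x) = take (?r i) (phi S G x)"
   using i x phi_take[of i x S G] by (auto simp: Lw_def)
  then show ?thesis by (auto simp: upx_def intro!: sum.cong)
 qed
 have "(\<Sum>i\<le>Suc N. \<Sum>j\<le>l. (upx S G a (take i x) (take j y))\<^sup>2) = (\<Sum>i\<le>Suc N. if i \<in> S then ?g (?r i) else 0)"
  by (intro sum.cong refl e) simp
 also have "... = (\<Sum>i\<in>{..Suc N} \<inter> S. ?g (?r i))" by (rule sum.inter_restrict[symmetric]) simp
 also have "{..Suc N} \<inter> S = S" using S(1) by auto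
 also have "(\<Sum>i\<in>S. ?g (?r i)) = sum ?g (?r ` S)"
  by (rule sum.reindex_cong[symmetric, of ?r]) (use rank_inj[OF fin] in \<open>auto simp: inj_on_def\<close>)
 also have "... \<le> sum ?g {..Suc n}"
  using card_rank_le[OF S] by (intro sum_mono2) (auto intro!: sum_nonneg simp: le_SucI)
 finally show ?thesis unfolding sf_alt by (rule real_sqrt_le_mono)
qed

lemma phi_append: "phi S G (K @ u) = phi S G K @ phi {s. s + length K \<in> S} {v. K @ v \<in> G} u"
proof -
 have u: "[0..<length (K @ u)] = [0..<length K] @ map (\<lambda>i. i + length K) [0..<length u]"
  unfolding length_append upt_add_eq_append[OF le0] by (simp add: map_add_upt add.commute)
 show ?thesis
  unfolding phi_def u filter_append map_append filter_map map_map comp_def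
  by (intro arg_cong2[where f = append] map_cong) (auto simp: nth_append)
qed

text \<open>The uniform distribution on the fibre of \<open>z\<close>, seen on the first
  \<open>m\<close> letters, is uniform on the fibre of the matching prefix of \<open>z\<close>.
  Indeed every admissible \<open>K\<close> has equally many extensions, counted by re-coding the
  remaining letters with the shifted set \<open>S\<close> and the part of \<open>G\<close> below
  \<open>K\<close>.\<close>

lemma fibre_prefix_sum:
 fixes g :: "bool list => real"
 assumes mM: "m \<le> M" and z: "z \<in> Lw (card (S \<inter> {..<M}))"
 defines "k \<equiv> card (S \<inter> {..<m})" and "n \<equiv> card (S \<inter> {..<M})"
 shows "2 ^ n / 2 ^ M * (\<Sum>x\<in>{x \<in> Lw M. phi S G x = z}. g (take m x))
  = 2 ^ k / 2 ^ m * (\<Sum>K\<in>{K \<in> Lw m. phi S G K = take k z}. g K)"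
proof -
 have kn: "k \<le> n" unfolding k_def n_def using mM by (intro card_mono) auto
 have c: "real (card {x \<in> Lw M. phi S G x = z \<and> take m x = K}) = 2 ^ (M - m) / 2 ^ (n - k)"
  if K: "K \<in> Lw m" "phi S G K = take k z" for K
 proof -
  let ?S = "{s. s + m \<in> S}" and ?G = "{v. K @ v \<in> G}"
  have lK: "length K = m" using K by (simp add: Lw_def)
  have "(\<lambda>s. s + m) ` (?S \<inter> {..<M - m}) = S \<inter> {m..<M}"
  proof (intro set_eqI iffI)
   fix i assume "i \<in> S \<inter> {m..<M}"
   then show "i \<in> (\<lambda>s. s + m) ` (?S \<inter> {..<M - m})" by (intro image_eqI[of _ _ "i - m"]) auto
  qed auto
  then have "card (?S \<inter> {..<M - m}) = card (S \<inter> {m..<M})"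
   using card_image[of "\<lambda>s. s + m" "?S \<inter> {..<M - m}"] by (simp add: inj_on_def)
  also have "S \<inter> {m..<M} = S \<inter> {..<M} - S \<inter> {..<m}" by auto
  also have "card ... = n - k" unfolding n_def k_def using mM by (intro card_Diff_subset) auto
  finally have cS: "card (?S \<inter> {..<M - m}) = n - k" .
  have dz: "drop k z \<in> Lw (card (?S \<inter> {..<M - m}))"
   unfolding cS using z by (simp add: Lw_def n_def)
  have split: "phi S G (K @ u) = z \<longleftrightarrow> phi ?S ?G u = drop k z" for u
   unfolding phi_append lK K(2) by (metis append_take_drop_id same_append_eq)
  have "{x \<in> Lw M. phi S G x = z \<and> take m x = K} = (\<lambda>u. K @ u) ` {u \<in> Lw (M - m). phi ?S ?G u = drop k z}"
  proof (intro set_eqI iffI)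
   fix x assume x: "x \<in> {x \<in> Lw M. phi S G x = z \<and> take m x = K}"
   then have "x = K @ drop m x" by (metis (mono_tags, lifting) append_take_drop_id mem_Collect_eq)
   moreover have "drop m x \<in> Lw (M - m)" using x by (simp add: Lw_def)
   ultimately show "x \<in> (\<lambda>u. K @ u) ` {u \<in> Lw (M - m). phi ?S ?G u = drop k z}"
    using x split[of "drop m x"] by (intro image_eqI[of _ _ "drop m x"]) auto
  next
   fix x assume "x \<in> (\<lambda>u. K @ u) ` {u \<in> Lw (M - m). phi ?S ?G u = drop k z}"
   then obtain u where u: "x = K @ u" "length u = M - m" "phi ?S ?G u = drop k z" by (auto simp: Lw_def)
   then show "x \<in> {x \<in> Lw M. phi S G x = z \<and> take m x = K}" using mM lK split[of u] by (simp add: Lw_def)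
  qed
  then have "card {x \<in> Lw M. phi S G x = z \<and> take m x = K} = card {u \<in> Lw (M - m). phi ?S ?G u = drop k z}"
   by (simp add: card_image inj_on_def)
  then show ?thesis using fibre_card[OF dz, of ?G] unfolding cS by (simp add: field_simps)
 qed
 let ?A = "{x \<in> Lw M. phi S G x = z}" and ?B = "{K \<in> Lw m. phi S G K = take k z}"
 have "(\<Sum>x\<in>?A. g (take m x)) = (\<Sum>K\<in>?B. \<Sum>x\<in>{x \<in> ?A. take m x = K}. g (take m x))"
 proof (rule sum.group[symmetric])
  show "finite ?A" "finite ?B" by (rule finite_subset[OF _ finite_Lw[of M]] finite_subset[OF _ finite_Lw[of m]], blast)+
  show "take m ` ?A \<subseteq> ?B" using mM phi_take[of m _ S G] by (auto simp: Lw_def k_def)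
 qed
 also have "... = (\<Sum>K\<in>?B. 2 ^ (M - m) / 2 ^ (n - k) * g K)"
 proof (rule sum.cong[OF refl])
  fix K assume K: "K \<in> ?B"
  have "{x \<in> ?A. take m x = K} = {x \<in> Lw M. phi S G x = z \<and> take m x = K}" by auto
  then have "(\<Sum>x\<in>{x \<in> ?A. take m x = K}. g (take m x)) = real (card {x \<in> Lw M. phi S G x = z \<and> take m x = K}) * g K"
   by simp
  then show "(\<Sum>x\<in>{x \<in> ?A. take m x = K}. g (take m x)) = 2 ^ (M - m) / 2 ^ (n - k) * g K" using c[of K] K by simp
 qed
 also have "... = 2 ^ (M - m) / 2 ^ (n - k) * sum g ?B" by (simp only: sum_distrib_left)
 finally have "2 ^ n / 2 ^ M * (\<Sum>x\<in>?A. g (take m x)) = (2 ^ n / 2 ^ M * (2 ^ (M - m) / 2 ^ (n - k))) * sum g ?B"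
  by (simp only: mult.assoc)
 also have "2 ^ n / 2 ^ M * (2 ^ (M - m) / 2 ^ (n - k)) = (2 ^ k / 2 ^ m :: real)"
  using mM kn by (simp add: power_diff)
 finally show ?thesis .
qed

lemma L2_set_le_inj:
 assumes "finite B" "inj_on h A" "h ` A \<subseteq> B" "\<And>t. t \<in> A ==> \<bar>f t\<bar> \<le> \<bar>g (h t)\<bar>"
 shows "L2_set f A \<le> L2_set g B"
proof -
 have "(\<Sum>t\<in>A. (f t)\<^sup>2) \<le> (\<Sum>t\<in>A. (g (h t))\<^sup>2)" by (intro sum_mono abs_le_square_iff[THEN iffD1] assms(4))
 also have "... = (\<Sum>t\<in>h ` A. (g t)\<^sup>2)" by (simp add: sum.reindex[OF assms(2)])
 also have "... \<le> (\<Sum>t\<in>B. (g t)\<^sup>2)" by (rule sum_mono2[OF assms(1,3)]) simp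
 finally show ?thesis by (simp add: L2_set_def)
qed

text \<open>The coefficients of \<open>dnx S G N b\<close> along \<open>z\<close> are averages, over
  the branches \<open>x\<close> in the fibre of \<open>z\<close>, of signed coefficients of
  \<open>b\<close> along \<open>x\<close>. The triangle inequality for \<open>L2_set\<close> takes
  the average out of the square function, where the signs disappear.\<close>

lemma sf_dnx:
 assumes S: "S \<subseteq> {..N}" "card S = Suc n" and b: "b \<in> arrs2 N l" and z: "z \<in> Lw (Suc n)"
 shows "sf (Suc n) l (dnx S G N b) z y
  \<le> 2 ^ Suc n / 2 ^ Suc N * (\<Sum>x\<in>{x \<in> Lw (Suc N). phi S G x = z}. sf (Suc N) l b x y)"
proof -
 let ?F = "{x \<in> Lw (Suc N). phi S G x = z}" and ?c = "2 ^ Suc n / 2 ^ Suc N :: real"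
 let ?A = "{..Suc n} \<times> {..l}" and ?A' = "{..n} \<times> {..l}" and ?B = "{..Suc N} \<times> {..l}"
 have fin: "finite S" using finite_subset[OF S(1)] by simp
 have finF: "finite ?F" by (rule finite_subset[OF _ finite_Lw[of "Suc N"]]) blast
 have SN: "S \<inter> {..<Suc N} = S" using S(1) by auto
 have "\<exists>m. m \<in> S \<and> card (S \<inter> {..<m}) = k" if "k \<le> n" for k
  using rank_surj[OF fin, of k] S(2) that by (metis le_imp_less_Suc)
 then obtain m where m: "m k \<in> S" "card (S \<inter> {..<m k}) = k" if "k \<le> n" for k by metis
 have mN: "m k \<le> N" if "k \<le> n" for k using m(1)[OF that] S(1) by auto
 define \<sigma> :: "bool list => real" where "\<sigma> K = (if K \<in> G then -1 else 1)" for K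
 \<comment> \<open>\<open>m k\<close> is the level of rank \<open>k\<close> in \<open>S\<close>. The
   branch \<open>z\<close> has length \<open>Suc n\<close>, but rank \<open>Suc n\<close> is not
   attained; there both sides are 0.\<close>
 define v where "v x t = (if fst t \<le> n then \<sigma> (take (m (fst t)) x) * b (take (m (fst t)) x) (take (snd t) y) else 0)" for x t
 have eq: "dnx S G N b (take (fst t) z) (take (snd t) y) = (\<Sum>x\<in>?F. ?c * v x t)" if "t \<in> ?A" for t
 proof (cases "fst t \<le> n")
  case True
  let ?k = "fst t" and ?L = "take (snd t) y"
  have lk: "length (take ?k z) = card (S \<inter> {..<m ?k})" using z True m(2)[OF True] by (simp add: Lw_def)
  have "dnx S G N b (take ?k z) ?L = 2 ^ ?k * (\<Sum>K\<in>Lw (m ?k). chi S G (take ?k z) K * (wt K * b K ?L))"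
   unfolding dnx_def sum_chi_level[OF fin m(1)[OF True] mN[OF True] lk] using z True by (simp add: Lw_def)
  also have "(\<Sum>K\<in>Lw (m ?k). chi S G (take ?k z) K * (wt K * b K ?L))
    = (\<Sum>K\<in>Lw (m ?k). if phi S G K = take ?k z then (1/2) ^ m ?k * (\<sigma> K * b K ?L) else 0)"
   using m(1)[OF True] by (intro sum.cong refl) (auto simp: chi_def \<sigma>_def wt_def Lw_def)
  also have "... = (\<Sum>K\<in>{K \<in> Lw (m ?k). phi S G K = take ?k z}. (1/2) ^ m ?k * (\<sigma> K * b K ?L))"
   by (rule sum.inter_filter[symmetric]) simp
  also have "2 ^ ?k * ... = 2 ^ ?k / 2 ^ m ?k * (\<Sum>K\<in>{K \<in> Lw (m ?k). phi S G K = take ?k z}. \<sigma> K * b K ?L)"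
   by (simp only: sum_distrib_left[symmetric] power_one_over) (simp add: divide_inverse)
  also have "... = ?c * (\<Sum>x\<in>?F. \<sigma> (take (m ?k) x) * b (take (m ?k) x) ?L)"
   using fibre_prefix_sum[where m = "m ?k" and M = "Suc N" and z = z and S = S and G = G and g = "\<lambda>K. \<sigma> K * b K ?L"]
    mN[OF True] z m(2)[OF True] S(2) unfolding SN by simp
  finally show ?thesis using True by (simp add: v_def sum_distrib_left)
 next
  case False
  then have "n < length (take (fst t) z)" using that z by (auto simp: Lw_def)
  then show ?thesis using arrs2D[OF dnx_arrs2[OF S b]] False by (simp add: v_def)
 qed
 have vb: "L2_set (v x) ?A \<le> sf (Suc N) l b x y" for x
 proof -
  have "L2_set (v x) ?A = L2_set (v x) ?A'"
   unfolding L2_set_def by (intro arg_cong[where f = sqrt] sum.mono_neutral_right) (auto simp: v_def)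
  also have "... \<le> sf (Suc N) l b x y"
   unfolding sf_def
  proof (rule L2_set_le_inj[where h = "\<lambda>t. (m (fst t), snd t)"])
   show "inj_on (\<lambda>t. (m (fst t), snd t)) ?A'"
    using m(2) by (intro inj_onI) (metis atMost_iff fst_conv mem_Times_iff prod.collapse prod.inject)
   show "(\<lambda>t. (m (fst t), snd t)) ` ?A' \<subseteq> ?B" using mN by (auto intro: le_SucI)
  qed (auto simp: v_def \<sigma>_def)
  finally show ?thesis .
 qed
 have "sf (Suc n) l (dnx S G N b) z y = L2_set (\<lambda>t. \<Sum>x\<in>?F. ?c * v x t) ?A"
  unfolding sf_def by (rule L2_set_cong[OF refl eq])
 also have "... \<le> (\<Sum>x\<in>?F. L2_set (\<lambda>t. ?c * v x t) ?A)" by (rule L2_set_sum_le[OF finF])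
 also have "... = ?c * (\<Sum>x\<in>?F. L2_set (v x) ?A)"
  unfolding sum_distrib_left by (intro sum.cong refl L2_set_right_distrib[symmetric]) simp
 also have "... \<le> ?c * (\<Sum>x\<in>?F. sf (Suc N) l b x y)"
  by (intro mult_left_mono sum_mono vb) simp
 finally show ?thesis .
qed

context
 fixes p q :: real
 assumes p: "1 \<le> p" and q: "1 \<le> q"
begin

lemma mixed_mono:
 assumes "\<And>x y. x \<in> Lw n ==> y \<in> Lw l ==> sf n l a x y \<le> sf n l b x y"
 shows "mixed p q n l a \<le> mixed p q n l b"
 unfolding mixed_def by (intro mp_mono[OF p] mp_mono[OF q] assms) simp_all

lemma mixed_upx:
 assumes S: "S \<subseteq> {..N}" "card S = Suc n"
 shows "mixed p q (Suc N) l (upx S G a) \<le> mixed p q (Suc n) l a"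
proof -
 have SN: "S \<inter> {..<Suc N} = S" using S(1) by auto
 have "mixed p q (Suc N) l (upx S G a) \<le> mp p (Suc N) (\<lambda>x. mp q l (\<lambda>y. sf (Suc n) l a (phi S G x) y))"
  unfolding mixed_def by (intro mp_mono[OF p] mp_mono[OF q] sf_upx[OF S]) simp_all
 then show ?thesis
  using mp_phi[OF p, where M = "Suc N" and S = S and G = G and f = "\<lambda>x. mp q l (\<lambda>y. sf (Suc n) l a x y)"]
  unfolding SN S(2) mixed_def by simp
qed

lemma mixed_upy:
 assumes S: "S \<subseteq> {..N}" "card S = Suc n"
 shows "mixed p q l (Suc N) (upy S G a) \<le> mixed p q l (Suc n) a"
proof -
 have SN: "S \<inter> {..<Suc N} = S" using S(1) by auto
 have s: "sf l (Suc N) (upy S G a) x y \<le> sf l (Suc n) a x (phi S G y)" if "y \<in> Lw (Suc N)" for x y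
  using sf_upx[OF S that, of l G "tr a" x] by (simp only: upy_def sf_tr)
 have "mixed p q l (Suc N) (upy S G a) \<le> mp p l (\<lambda>x. mp q (Suc N) (\<lambda>y. sf l (Suc n) a x (phi S G y)))"
  unfolding mixed_def by (intro mp_mono[OF p] mp_mono[OF q] s) simp_all
 also have "... = mixed p q l (Suc n) a"
  unfolding mixed_def
  using mp_phi[OF q, where M = "Suc N" and S = S and G = G and f = "\<lambda>y. sf l (Suc n) a x y" for x]
  unfolding SN S(2) by simp
 finally show ?thesis .
qed

text \<open>Minkowski's inequality moves the fibre average out of the inner norm; the outer norm
  then contracts under averaging. For \<open>mixed_dny\<close> the averaging acts in the inner norm
  for each fixed \<open>x\<close>.\<close>

lemma mixed_dnx:
 assumes S: "S \<subseteq> {..N}" "card S = Suc n" and b: "b \<in> arrs2 N l"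
 shows "mixed p q (Suc n) l (dnx S G N b) \<le> mixed p q (Suc N) l b"
proof -
 let ?F = "\<lambda>z. {x \<in> Lw (Suc N). phi S G x = z}" and ?c = "2 ^ Suc n / 2 ^ Suc N :: real"
 have SN: "S \<inter> {..<Suc N} = S" using S(1) by auto
 have finF: "finite (?F z)" for z by (rule finite_subset[OF _ finite_Lw[of "Suc N"]]) blast
 have i: "mp q l (\<lambda>y. sf (Suc n) l (dnx S G N b) z y) \<le> ?c * (\<Sum>x\<in>?F z. mp q l (\<lambda>y. sf (Suc N) l b x y))"
  if z: "z \<in> Lw (Suc n)" for z
 proof -
  have "mp q l (\<lambda>y. sf (Suc n) l (dnx S G N b) z y) \<le> mp q l (\<lambda>y. ?c * (\<Sum>x\<in>?F z. sf (Suc N) l b x y))"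
   by (rule mp_mono[OF q]) (simp, rule sf_dnx[OF S b z])
  also have "... = ?c * mp q l (\<lambda>y. \<Sum>x\<in>?F z. sf (Suc N) l b x y)"
   by (rule mp_scale[OF q]) (auto intro!: sum_nonneg)
  also have "... \<le> ?c * (\<Sum>x\<in>?F z. mp q l (\<lambda>y. sf (Suc N) l b x y))"
   by (intro mult_left_mono mp_sum[OF q finF]) auto
  finally show ?thesis .
 qed
 have "mixed p q (Suc n) l (dnx S G N b) \<le> mp p (Suc n) (\<lambda>z. ?c * (\<Sum>x\<in>?F z. mp q l (\<lambda>y. sf (Suc N) l b x y)))"
  unfolding mixed_def by (rule mp_mono[OF p _ i]) simp_all
 also have "... \<le> mp p (Suc N) (\<lambda>x. mp q l (\<lambda>y. sf (Suc N) l b x y))"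
  using mp_fibre_average[OF p, where M = "Suc N" and S = S and G = G and f = "\<lambda>x. mp q l (\<lambda>y. sf (Suc N) l b x y)"]
  unfolding SN S(2) by simp
 finally show ?thesis unfolding mixed_def .
qed

lemma mixed_dny:
 assumes S: "S \<subseteq> {..N}" "card S = Suc n" and b: "b \<in> arrs2 l N"
 shows "mixed p q l (Suc n) (dny S G N b) \<le> mixed p q l (Suc N) b"
proof -
 let ?F = "\<lambda>z. {y \<in> Lw (Suc N). phi S G y = z}" and ?c = "2 ^ Suc n / 2 ^ Suc N :: real"
 have SN: "S \<inter> {..<Suc N} = S" using S(1) by auto
 have tb: "tr b \<in> arrs2 N l" using b by (auto simp: tr_def arrs2_def)
 have s: "sf l (Suc n) (dny S G N b) x z \<le> ?c * (\<Sum>y\<in>?F z. sf l (Suc N) b x y)" if "z \<in> Lw (Suc n)" for x z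
  using sf_dnx[OF S tb that, of G x] by (simp only: dny_def sf_tr)
 have i: "mp q (Suc n) (\<lambda>z. sf l (Suc n) (dny S G N b) x z) \<le> mp q (Suc N) (\<lambda>y. sf l (Suc N) b x y)" for x
 proof -
  have "mp q (Suc n) (\<lambda>z. sf l (Suc n) (dny S G N b) x z) \<le> mp q (Suc n) (\<lambda>z. ?c * (\<Sum>y\<in>?F z. sf l (Suc N) b x y))"
   by (rule mp_mono[OF q _ s]) simp_all
  also have "... \<le> mp q (Suc N) (\<lambda>y. sf l (Suc N) b x y)"
   using mp_fibre_average[OF q, where M = "Suc N" and S = S and G = G and f = "\<lambda>y. sf l (Suc N) b x y"]
   unfolding SN S(2) by simp
  finally show ?thesis .
 qed
 show ?thesis unfolding mixed_def by (rule mp_mono[OF p _ i]) simp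
qed

text \<open>In the frame of levels \<open>m\<close> and \<open>m'\<close> only the full words
  matter, so the square function is at most the indicator of the product of the two blocks.\<close>

lemma mixed_level:
 assumes P: "P \<subseteq> Lw m" "P' \<subseteq> Lw m'" and a: "\<And>K L. \<bar>a K L\<bar> \<le> (if K \<in> P \<and> L \<in> P' then 1 else 0)"
 shows "mixed p q m m' a \<le> (real (card P) / 2 ^ m) powr (1 / p) * (real (card P') / 2 ^ m') powr (1 / q)"
proof -
 let ?d = "(real (card P') / 2 ^ m') powr (1 / q)"
 have s: "sf m m' a x y \<le> (if x \<in> P \<and> y \<in> P' then 1 else 0)" if xy: "x \<in> Lw m" "y \<in> Lw m'" for x y
 proof -
  let ?e = "if x \<in> P \<and> y \<in> P' then 1 else 0 :: real"
  have "(a (take i x) (take j y))\<^sup>2 \<le> (if i = m then if j = m' then ?e else 0 else 0)" if ij: "i \<le> m" "j \<le> m'" for i j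
  proof -
   have l: "length (take i x) = i" "length (take j y) = j" "take m x = x" "take m' y = y"
    using ij xy by (auto simp: Lw_def)
   have "\<bar>a (take i x) (take j y)\<bar> \<le> (if i = m then if j = m' then ?e else 0 else 0)"
    using a[of "take i x" "take j y"] P l by (auto simp: Lw_def split: if_splits)
   then have "\<bar>a (take i x) (take j y)\<bar>\<^sup>2 \<le> (if i = m then if j = m' then ?e else 0 else 0)\<^sup>2"
    by (rule power_mono) simp
   also have "... = (if i = m then if j = m' then ?e else 0 else 0)" by simp
   finally show ?thesis by simp
  qed
  then have "(\<Sum>i\<le>m. \<Sum>j\<le>m'. (a (take i x) (take j y))\<^sup>2) \<le> (\<Sum>i\<le>m. \<Sum>j\<le>m'. if i = m then if j = m' then ?e else 0 else 0)"
   by (intro sum_mono) simp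
  also have "... = (\<Sum>i\<le>m. if i = m then ?e else 0)" by (intro sum.cong refl) simp
  also have "... = ?e" by simp
  finally have "sf m m' a x y \<le> sqrt ?e" unfolding sf_alt by (rule real_sqrt_le_mono)
  then show ?thesis by (simp split: if_splits)
 qed
 have i: "mp q m' (\<lambda>y. sf m m' a x y) \<le> (if x \<in> P then ?d else 0)" if x: "x \<in> Lw m" for x
 proof -
  have "mp q m' (\<lambda>y. sf m m' a x y) \<le> mp q m' (\<lambda>y. if x \<in> P \<and> y \<in> P' then 1 else 0)"
   by (rule mp_mono[OF q _ s[OF x]]) simp_all
  also have "... = (if x \<in> P then ?d else 0)"
   using mp_indicator[OF q P(2), of 1] by (simp add: mp_zero)
  finally show ?thesis .
 qed
 have "mixed p q m m' a \<le> mp p m (\<lambda>x. if x \<in> P then ?d else 0)"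
  unfolding mixed_def by (rule mp_mono[OF p _ i]) simp_all
 then show ?thesis using mp_indicator[OF p P(1), of ?d] by simp
qed

lemma sf_ge: "i \<le> n ==> j \<le> l ==> \<bar>a (take i x) (take j y)\<bar> \<le> sf n l a x y"
 using L2_set_le_inj[of "{..n} \<times> {..l}" id "{(i, j)}" "\<lambda>t. a (take (fst t) x) (take (snd t) y)" "\<lambda>t. a (take (fst t) x) (take (snd t) y)"]
 by (simp add: sf_def)

lemma pair_abs_le:
 assumes AB: "A \<subseteq> Ww N" "B \<subseteq> Ww N" and a: "\<And>K L. \<bar>a K L\<bar> \<le> (if K \<in> A \<and> L \<in> B then 1 else 0)"
 shows "\<bar>pair N c a\<bar> \<le> (\<Sum>K\<in>A. \<Sum>L\<in>B. wt K * wt L * \<bar>c K L\<bar>)"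
proof -
 have fin: "finite A" "finite B" using AB finite_Ww finite_subset by blast+
 have "\<bar>pair N c a\<bar> \<le> (\<Sum>K\<in>Ww N. \<Sum>L\<in>Ww N. \<bar>wt K * wt L * (c K L * a K L)\<bar>)"
  unfolding pair_def by (intro order_trans[OF sum_abs] sum_mono sum_abs)
 also have "... \<le> (\<Sum>K\<in>Ww N. \<Sum>L\<in>Ww N. if K \<in> A then if L \<in> B then wt K * wt L * \<bar>c K L\<bar> else 0 else 0)"
 proof (intro sum_mono)
  fix K L
  have "\<bar>c K L\<bar> * \<bar>a K L\<bar> \<le> \<bar>c K L\<bar> * (if K \<in> A \<and> L \<in> B then 1 else 0)"
   by (intro mult_left_mono a) simp
  then have "wt K * wt L * (\<bar>c K L\<bar> * \<bar>a K L\<bar>) \<le> wt K * wt L * (\<bar>c K L\<bar> * (if K \<in> A \<and> L \<in> B then 1 else 0))"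
   by (rule mult_left_mono) simp
  moreover have "\<bar>wt K * wt L * (c K L * a K L)\<bar> = wt K * wt L * (\<bar>c K L\<bar> * \<bar>a K L\<bar>)" by (simp add: abs_mult)
  ultimately show "\<bar>wt K * wt L * (c K L * a K L)\<bar> \<le> (if K \<in> A then if L \<in> B then wt K * wt L * \<bar>c K L\<bar> else 0 else 0)"
   by (cases "K \<in> A"; cases "L \<in> B") (simp_all only: if_True if_False simp_thms mult_1_right mult_zero_right)
 qed
 also have "... = (\<Sum>K\<in>Ww N. if K \<in> A then \<Sum>L\<in>Ww N. if L \<in> B then wt K * wt L * \<bar>c K L\<bar> else 0 else 0)"
  by (intro sum.cong) auto
 also have "... = (\<Sum>K\<in>A. \<Sum>L\<in>B. wt K * wt L * \<bar>c K L\<bar>)"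
  using AB by (simp add: sum.inter_restrict[symmetric] Int_absorb1)
 finally show ?thesis .
qed

lemma level_mean:
 assumes "i \<le> N"
 shows "(\<Sum>K\<in>Lw i. g K) / 2 ^ i = (\<Sum>x\<in>Lw N. g (take i x)) / (2 ^ N :: real)"
 using fibre_prefix_sum[OF assms, where z = "[]" and S = "{}" and G = "{}" and g = g] by (simp add: Lw_def phi_def)

end

section \<open>Verification of the axioms for mixed norms\<close>

text \<open>The hypothesis on \<open>\<nu>\<close> asks for one value in every frame that contains
  the array. This permits enlarging the frame by one level for re-coding and shrinking it to a level
  or a column for the pairing estimates.\<close>

lemma haar_norm_mixed:
 assumes p: "1 \<le> p" and q: "1 \<le> q" and \<nu>: "\<And>a n l. a \<in> arrs2 n l ==> \<nu> a = mixed p q n l a"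
 shows "haar_norm \<nu> (1 / p) (1 / q)"
proof
 have S1: "arrs2 n l \<subseteq> arrs2 (Suc n) l" "arrs2 n l \<subseteq> arrs2 n (Suc l)" for n l by (auto simp: arrs2_def)
 have \<nu>n: "\<nu> a = mixed p q n n a" if "a \<in> arrs n" for a n using \<nu> that by (simp add: arrs_def)
 show "0 \<le> 1 / p" "1 / p \<le> 1" "0 \<le> 1 / q" "1 / q \<le> 1" using p q by auto
 fix n a assume a: "a \<in> arrs n"
 show "0 \<le> \<nu> a" using \<nu>n[OF a] by (simp add: mixed_def)
 show "\<nu> (r *\<^sub>R a) = \<bar>r\<bar> * \<nu> a" for r
 proof -
  have s: "sf n n (r *\<^sub>R a) x y = \<bar>r\<bar> * sf n n a x y" for x y
   unfolding sf_def L2_set_right_distrib[OF abs_ge_zero] L2_set_def by (simp add: scaleR_fun_def power_mult_distrib sum_distrib_left[symmetric] real_sqrt_mult)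
  have "mixed p q n n (r *\<^sub>R a) = mp p n (\<lambda>x. mp q n (\<lambda>y. \<bar>r\<bar> * sf n n a x y))"
   unfolding mixed_def by (intro mp_cong s)
  also have "... = mp p n (\<lambda>x. \<bar>r\<bar> * mp q n (\<lambda>y. sf n n a x y))"
   by (intro mp_cong mp_scale[OF q]) simp_all
  also have "... = \<bar>r\<bar> * mixed p q n n a" unfolding mixed_def by (rule mp_scale[OF p]) simp_all
  finally show ?thesis unfolding \<nu>n[OF a] \<nu>n[OF arrs_closed(4)[OF a]] .
 qed
 show "\<nu> a = 0 \<longleftrightarrow> a = 0"
 proof
  assume z: "\<nu> a = 0"
  show "a = 0"
  proof (intro ext)
   fix K L
   show "a K L = 0 K L"
   proof (cases "length K \<le> n \<and> length L \<le> n")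
    case True
    let ?x = "K @ replicate (n - length K) True" and ?y = "L @ replicate (n - length L) True"
    have xy: "?x \<in> Lw n" "?y \<in> Lw n" using True by (auto simp: Lw_def)
    have "sf n n a ?x ?y = 0"
     using z unfolding \<nu>n[OF a] mixed_def by (blast dest: mp_eq_0[OF p _ xy(1)] mp_eq_0[OF q _ xy(2)])
    then show ?thesis using sf_ge[OF p q, of "length K" n "length L" n a ?x ?y] True by simp
   qed (use arrsD[OF a] in auto)
  qed
 next
  assume "a = 0"
  then have "sf n n a = (\<lambda>_ _. 0)" by (intro ext) (simp add: sf_def L2_set_0')
  then show "\<nu> a = 0" unfolding \<nu>n[OF a] mixed_def by (simp add: mp_zero)
 qed
 fix b assume b: "b \<in> arrs n"
 show "\<nu> (a + b) \<le> \<nu> a + \<nu> b"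
 proof -
  have "sf n n (a + b) x y \<le> sf n n a x y + sf n n b x y" for x y
   unfolding sf_def plus_fun_apply by (rule L2_set_triangle_ineq)
  then have "mixed p q n n (a + b) \<le> mp p n (\<lambda>x. mp q n (\<lambda>y. sf n n a x y + sf n n b x y))"
   unfolding mixed_def by (intro mp_mono[OF p] mp_mono[OF q]) simp_all
  also have "... \<le> mp p n (\<lambda>x. mp q n (\<lambda>y. sf n n a x y) + mp q n (\<lambda>y. sf n n b x y))"
   by (intro mp_mono[OF p] mp_triangle[OF q]) simp_all
  also have "... \<le> mixed p q n n a + mixed p q n n b"
   unfolding mixed_def by (rule mp_triangle[OF p]) simp_all
  finally show ?thesis unfolding \<nu>n[OF a] \<nu>n[OF b] \<nu>n[OF arrs_closed(2)[OF a b]] .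
 qed
next
 have \<nu>n: "\<nu> a = mixed p q n n a" if "a \<in> arrs n" for a n using \<nu> that by (simp add: arrs_def)
 fix a b n assume a: "a \<in> arrs n" and b: "b \<in> arrs n" and ab: "\<And>K L. \<bar>a K L\<bar> \<le> \<bar>b K L\<bar>"
 have "sf n n a x y \<le> sf n n b x y" for x y
  unfolding sf_def by (rule L2_set_le_inj[of _ id]) (use ab in auto)
 then show "\<nu> a \<le> \<nu> b" unfolding \<nu>n[OF a] \<nu>n[OF b] by (intro mixed_mono[OF p q])
next
 have S1: "arrs2 n l \<subseteq> arrs2 (Suc n) l" "arrs2 n l \<subseteq> arrs2 n (Suc l)" for n l by (auto simp: arrs2_def)
 fix S :: "nat set" and N n l :: nat and G and a :: arr assume S: "S \<subseteq> {..N}" "card S = Suc n"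
 show "\<nu> (upx S G a) \<le> \<nu> a" if "a \<in> arrs2 n l"
  unfolding \<nu>[OF subsetD[OF S1(1) that]] \<nu>[OF subsetD[OF S1(1) upx_arrs2[OF S(1) that]]] by (rule mixed_upx[OF p q S])
 show "\<nu> (upy S G a) \<le> \<nu> a" if "a \<in> arrs2 l n"
  unfolding \<nu>[OF subsetD[OF S1(2) that]] \<nu>[OF subsetD[OF S1(2) upy_arrs2[OF S(1) that]]] by (rule mixed_upy[OF p q S])
 show "\<nu> (dnx S G N a) \<le> \<nu> a" if "a \<in> arrs2 N l"
  unfolding \<nu>[OF subsetD[OF S1(1) that]] \<nu>[OF subsetD[OF S1(1) dnx_arrs2[OF S that]]] by (rule mixed_dnx[OF p q S that])
 show "\<nu> (dny S G N a) \<le> \<nu> a" if "a \<in> arrs2 l N"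
  unfolding \<nu>[OF subsetD[OF S1(2) that]] \<nu>[OF subsetD[OF S1(2) dny_arrs2[OF S that]]] by (rule mixed_dny[OF p q S that])
next
 have mono: "\<nu> (part Q c) \<le> \<nu> c" if c: "c \<in> arrs N" for Q c N
 proof -
  have "sf N N (part Q c) x y \<le> sf N N c x y" for x y
   unfolding sf_def by (rule L2_set_le_inj[of _ id]) (auto simp: part_def)
  then show ?thesis
   using \<nu>[of c N N] \<nu>[of "part Q c" N N] c part_arrs[OF c, of Q] mixed_mono[OF p q, of N N "part Q c" c]
   by (simp add: arrs_def)
 qed
 fix P P' :: "bool list set" and m m' :: nat and a :: arr
 assume P: "P \<subseteq> Lw m" "P' \<subseteq> Lw m'" and a: "\<And>K L. \<bar>a K L\<bar> \<le> (if K \<in> P \<and> L \<in> P' then 1 else 0)"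
 show "\<nu> a \<le> (real (card P) / 2 ^ m) powr (1 / p) * (real (card P') / 2 ^ m') powr (1 / q)"
 proof -
  have "a K L = 0" if "m < length K \<or> m' < length L" for K L
  proof -
   have "K \<notin> P \<or> L \<notin> P'" using that P by (auto simp: Lw_def)
   then show ?thesis using a[of K L] by auto
  qed
  then have "a \<in> arrs2 m m'" by (simp add: arrs2_def)
  then show ?thesis using \<nu> mixed_level[OF p q P a] by simp
 qed
 fix N c assume N: "m \<le> N" "m' \<le> N" and c: "c \<in> arrs N"
 \<comment> \<open>Hoelder's inequality in the inner and then in the outer variable, applied to the
   part of \<open>c\<close> on the levels \<open>m\<close> and \<open>m'\<close>, where the square
   function dominates \<open>\<bar>c x y\<bar>\<close>.\<close>
 show "\<bar>pair N c a\<bar> \<le> \<nu> c * ((real (card P) / 2 ^ m) powr (1 - 1 / p) * (real (card P') / 2 ^ m') powr (1 - 1 / q))"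
 proof -
  let ?d = "(real (card P) / 2 ^ m) powr (1 - 1 / p)" and ?d' = "(real (card P') / 2 ^ m') powr (1 - 1 / q)"
  let ?f = "\<lambda>x. mp q m' (\<lambda>y. \<bar>c x y\<bar>)" and ?c = "part (Lw m \<times> Lw m') c"
  have PN: "P \<subseteq> Ww N" "P' \<subseteq> Ww N" using P N by (auto simp: Lw_def Ww_def)
  have w: "wt K = 1 / 2 ^ m" if "K \<in> P" for K using that P(1) by (auto simp: wt_def Lw_def power_one_over)
  have w': "wt L = 1 / 2 ^ m'" if "L \<in> P'" for L using that P(2) by (auto simp: wt_def Lw_def power_one_over)
  have "\<bar>pair N c a\<bar> \<le> (\<Sum>K\<in>P. \<Sum>L\<in>P'. wt K * wt L * \<bar>c K L\<bar>)" by (rule pair_abs_le[OF p q PN a])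
  also have "... = (\<Sum>K\<in>P. \<Sum>L\<in>P'. \<bar>c K L\<bar> / 2 ^ m' / 2 ^ m)" by (intro sum.cong refl) (simp add: w w')
  also have "... = (\<Sum>K\<in>P. (\<Sum>L\<in>P'. \<bar>c K L\<bar>) / 2 ^ m') / 2 ^ m" by (simp only: sum_divide_distrib)
  also have "... \<le> (\<Sum>K\<in>P. ?f K * ?d') / 2 ^ m"
   by (intro divide_right_mono sum_mono mp_holder_indicator[OF q P(2)]) simp_all
  also have "... = (\<Sum>K\<in>P. ?f K) / 2 ^ m * ?d'" by (simp add: sum_distrib_right[symmetric])
  also have "... \<le> mp p m ?f * ?d * ?d'"
   by (intro mult_right_mono mp_holder_indicator[OF p P(1)]) simp_all
  also have "mp p m ?f \<le> mixed p q m m' ?c"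
   unfolding mixed_def
  proof (intro mp_mono[OF p] mp_mono[OF q])
   fix x y assume "x \<in> Lw m" "y \<in> Lw m'"
   then show "\<bar>c x y\<bar> \<le> sf m m' ?c x y"
    using sf_ge[OF p q order_refl order_refl, of ?c m x m' y] by (simp add: part_def Lw_def)
  qed simp_all
  also have "mixed p q m m' ?c = \<nu> ?c" by (rule \<nu>[symmetric]) (auto simp: arrs2_def part_def Lw_def)
  also have "... \<le> \<nu> c" by (rule mono[OF c])
  finally show ?thesis by (simp add: mult_right_mono mult.assoc)
 qed
next
 have mono: "\<nu> (part Q c) \<le> \<nu> c" if c: "c \<in> arrs N" for Q c N
 proof -
  have "sf N N (part Q c) x y \<le> sf N N c x y" for x y
   unfolding sf_def by (rule L2_set_le_inj[of _ id]) (auto simp: part_def)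
  then show ?thesis
   using \<nu>[of c N N] \<nu>[of "part Q c" N N] c part_arrs[OF c, of Q] mixed_mono[OF p q, of N N "part Q c" c]
   by (simp add: arrs_def)
 qed
 fix T :: "nat set" and N :: nat and L0 :: "bool list" and a :: arr
 assume T: "T \<subseteq> {..N}" and L0: "length L0 \<le> N" and a: "\<And>K L. \<bar>a K L\<bar> \<le> (if length K \<in> T \<and> L = L0 then 1 else 0)"
 have finT: "finite T" using finite_subset[OF T] by simp
 let ?l = "length L0"
 show "\<nu> a \<le> sqrt (card T)"
 proof -
  have a0: "a K L = 0" if "length K \<notin> T \<or> L \<noteq> L0" for K L using a[of K L] that by auto
  have aN: "a \<in> arrs2 N ?l"
   unfolding arrs2_def
  proof (intro CollectI allI impI)
   fix K L :: "bool list" assume "N < length K \<or> ?l < length L"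
   then have "length K \<notin> T \<or> L \<noteq> L0" using T by auto
   then show "a K L = 0" by (rule a0)
  qed
  have s: "sf N ?l a x y \<le> sqrt (card T)" if x: "x \<in> Lw N" and y: "y \<in> Lw ?l" for x y
  proof -
   have "(a (take i x) (take j y))\<^sup>2 \<le> (if j = ?l then if i \<in> T then 1 else 0 else 0)" if ij: "i \<le> N" "j \<le> ?l" for i j
   proof -
    have l: "length (take i x) = i" "length (take j y) = j" using ij x y by (auto simp: Lw_def)
    have "\<bar>a (take i x) (take j y)\<bar> \<le> (if j = ?l then if i \<in> T then 1 else 0 else 0)"
     using a[of "take i x" "take j y"] l by (auto split: if_splits)
    then have "\<bar>a (take i x) (take j y)\<bar>\<^sup>2 \<le> (if j = ?l then if i \<in> T then 1 else 0 else 0)\<^sup>2"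
     by (rule power_mono) simp
    also have "... = (if j = ?l then if i \<in> T then 1 else 0 else 0)" by simp
    finally show ?thesis by simp
   qed
   then have "(\<Sum>i\<le>N. \<Sum>j\<le>?l. (a (take i x) (take j y))\<^sup>2) \<le> (\<Sum>i\<le>N. \<Sum>j\<le>?l. if j = ?l then if i \<in> T then 1 else 0 else 0)"
    by (intro sum_mono) simp
   also have "... = (\<Sum>i\<le>N. if i \<in> T then 1 else 0)" by (intro sum.cong refl) simp
   also have "... = card T" using T by (simp add: sum.inter_restrict[symmetric] Int_absorb1)
   finally show ?thesis unfolding sf_alt by (rule real_sqrt_le_mono)
  qed
  have "\<nu> a \<le> mp p N (\<lambda>x. mp q ?l (\<lambda>y. sqrt (card T)))"
   unfolding \<nu>[OF aN] mixed_def by (intro mp_mono[OF p] mp_mono[OF q] s) simp_all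
  then show ?thesis by (simp add: mp_const[OF p] mp_const[OF q])
 qed
 fix c assume c: "c \<in> arrs N"
 show "\<bar>pair N c a\<bar> \<le> \<nu> c * sqrt (card T)"
 proof -
  let ?c = "part (UNIV \<times> {L0}) c" and ?A = "\<Union>i\<in>T. Lw i"
  \<comment> \<open>The square function of the column along the branch \<open>x\<close>. The
    Cauchy-Schwarz inequality over the levels in \<open>T\<close> produces
    \<open>sqrt (card T)\<close>; in the inner mean the cell \<open>L0\<close> alone already
    contributes \<open>wt L0 * h x\<close>.\<close>
  define h where "h x = L2_set (\<lambda>i. c (take i x) L0) {..N}" for x
  have AN: "?A \<subseteq> Ww N" "{L0} \<subseteq> Ww N" using T L0 by (auto simp: Lw_def Ww_def)
  have aA: "\<bar>a K L\<bar> \<le> (if K \<in> ?A \<and> L \<in> {L0} then 1 else 0)" for K L using a[of K L] by (auto simp: Lw_def)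
  have hT: "(\<Sum>i\<in>T. \<bar>c (take i x) L0\<bar>) \<le> sqrt (card T) * h x" for x
  proof -
   have "(\<Sum>i\<in>T. \<bar>c (take i x) L0\<bar>) \<le> L2_set (\<lambda>i. c (take i x) L0) T * sqrt (card T)"
    using L2_set_mult_ineq[of "\<lambda>i. c (take i x) L0" "\<lambda>_. 1" T] by (simp add: L2_set_constant)
   also have "L2_set (\<lambda>i. c (take i x) L0) T \<le> h x"
    unfolding h_def by (rule L2_set_le_inj[of _ id]) (use T in auto)
   finally show ?thesis by (simp add: mult.commute mult_right_mono)
  qed
  have hs: "wt L0 * h x \<le> mp q ?l (\<lambda>y. sf N ?l ?c x y)" for x
  proof -
   have "h x \<le> sf N ?l ?c x L0"
    unfolding h_def sf_def by (rule L2_set_le_inj[of _ "\<lambda>i. (i, ?l)"]) (auto simp: inj_on_def part_def)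
   also have "... \<le> (\<Sum>y\<in>Lw ?l. sf N ?l ?c x y)"
    by (rule member_le_sum) (auto simp: Lw_def[of ?l] finite_Lw[of ?l, unfolded Lw_def])
   finally have "h x / 2 ^ ?l \<le> (\<Sum>y\<in>Lw ?l. sf N ?l ?c x y) / 2 ^ ?l" by (rule divide_right_mono) simp
   also have "... \<le> mp q ?l (\<lambda>y. sf N ?l ?c x y)" by (rule mean_le_mp[OF q]) simp
   finally show ?thesis by (simp add: wt_def power_one_over)
  qed
  have "\<bar>pair N c a\<bar> \<le> (\<Sum>K\<in>?A. \<Sum>L\<in>{L0}. wt K * wt L * \<bar>c K L\<bar>)" by (rule pair_abs_le[OF p q AN aA])
  also have "... = (\<Sum>K\<in>?A. wt L0 * (wt K * \<bar>c K L0\<bar>))" by (simp add: mult_ac)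
  also have "... = wt L0 * (\<Sum>K\<in>?A. wt K * \<bar>c K L0\<bar>)" by (simp only: sum_distrib_left)
  also have "(\<Sum>K\<in>?A. wt K * \<bar>c K L0\<bar>) = (\<Sum>i\<in>T. \<Sum>K\<in>Lw i. wt K * \<bar>c K L0\<bar>)"
   by (rule sum.UNION_disjoint[OF finT]) (auto simp: Lw_def finite_Lw[unfolded Lw_def])
  also have "... = (\<Sum>i\<in>T. (\<Sum>K\<in>Lw i. \<bar>c K L0\<bar>) / 2 ^ i)"
   unfolding sum_divide_distrib by (intro sum.cong refl) (auto simp: wt_def Lw_def power_one_over)
  also have "... = (\<Sum>i\<in>T. (\<Sum>x\<in>Lw N. \<bar>c (take i x) L0\<bar>) / 2 ^ N)"
   by (intro sum.cong refl level_mean[OF p q]) (use T in auto)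
  also have "... = (\<Sum>x\<in>Lw N. \<Sum>i\<in>T. \<bar>c (take i x) L0\<bar>) / 2 ^ N"
   unfolding sum_divide_distrib[symmetric] by (subst sum.swap) (rule refl)
  also have "wt L0 * ... \<le> wt L0 * ((\<Sum>x\<in>Lw N. sqrt (card T) * h x) / 2 ^ N)"
   by (intro mult_left_mono divide_right_mono sum_mono hT) simp_all
  also have "... = sqrt (card T) * ((\<Sum>x\<in>Lw N. wt L0 * h x) / 2 ^ N)"
   by (simp add: sum_distrib_left[symmetric])
  also have "... \<le> sqrt (card T) * ((\<Sum>x\<in>Lw N. mp q ?l (\<lambda>y. sf N ?l ?c x y)) / 2 ^ N)"
   by (intro mult_left_mono divide_right_mono sum_mono hs) simp_all
  also have "... \<le> sqrt (card T) * mixed p q N ?l ?c"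
   unfolding mixed_def by (intro mult_left_mono mean_le_mp[OF p]) simp_all
  also have "mixed p q N ?l ?c = \<nu> ?c"
   by (rule \<nu>[symmetric]) (use arrsD[OF c] in \<open>auto simp: arrs2_def part_def\<close>)
  also have "sqrt (card T) * \<nu> ?c \<le> sqrt (card T) * \<nu> c" by (intro mult_left_mono mono[OF c]) simp
  finally show ?thesis by (simp add: mult.commute)
 qed
qed

section \<open>Duality\<close>

lemma pair_restrict:
 assumes "N \<le> M" "c \<in> arrs N \<or> a \<in> arrs N" shows "pair M c a = pair N c a"
proof -
 let ?g = "\<lambda>t. wt (fst t) * wt (snd t) * (c (fst t) (snd t) * a (fst t) (snd t))"
 have "sum ?g (Ww M \<times> Ww M) = sum ?g (Ww N \<times> Ww N)"
 proof (rule sum.mono_neutral_right)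
  show "Ww N \<times> Ww N \<subseteq> Ww M \<times> Ww M" using assms(1) by (auto simp: Ww_def)
  show "\<forall>t\<in>Ww M \<times> Ww M - Ww N \<times> Ww N. ?g t = 0"
  proof
   fix t assume "t \<in> Ww M \<times> Ww M - Ww N \<times> Ww N"
   then have "N < length (fst t) \<or> N < length (snd t)" by (auto simp: Ww_def)
   then show "?g t = 0" using assms(2) arrsD[of c N "fst t" "snd t"] arrsD[of a N "fst t" "snd t"] by auto
  qed
 qed simp
 then show ?thesis by (simp add: pair_def sum.cartesian_product case_prod_unfold)
qed

lemma pair_part: "(\<And>K L. (K, L) \<notin> Q ==> c K L = 0) ==> pair M c (part Q a) = pair M c a"
 unfolding pair_def by (intro sum.cong refl) (auto simp: part_def)

lemma pair_tr: "pair M (tr a) (tr b) = pair M a b"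
 unfolding pair_def tr_def by (subst sum.swap) (intro sum.cong refl, simp add: mult_ac)

text \<open>For given \<open>K\<close> only \<open>I = phi S G K\<close> can have a nonzero
  \<open>chi S G I K\<close>, and \<open>wt I * 2 ^ length I = 1\<close> removes the normalization
  of \<open>dnx\<close>.\<close>

lemma pair_upx:
 assumes S: "S \<subseteq> {..N}" and N: "N \<le> M" and b: "b \<in> arrs2 N l"
 shows "pair M (upx S G a) b = pair M a (dnx S G N b)"
proof -
 have u: "(\<Sum>I\<in>Ww M. chi S G I K * a I L) = upx S G a K L" if K: "K \<in> Ww N" for K L
 proof -
  have "length (phi S G K) \<le> length K" unfolding length_phi using card_mono[of "{..<length K}" "S \<inter> {..<length K}"] by simp
  then have pM: "phi S G K \<in> Ww M" using K N by (simp add: Ww_def)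
  have "(\<Sum>I\<in>Ww M. chi S G I K * a I L) = (\<Sum>I\<in>Ww M. if I = phi S G K then upx S G a K L else 0)"
   by (intro sum.cong refl) (auto simp: chi_def upx_def)
  then show ?thesis using pM by simp
 qed
 have w: "wt I * 2 ^ length I = 1" for I by (simp add: wt_def power_mult_distrib[symmetric])
 have "pair M a (dnx S G N b) = (\<Sum>I\<in>Ww M. \<Sum>L\<in>Ww M. \<Sum>K\<in>Ww N. wt K * wt L * (chi S G I K * a I L * b K L))"
 proof -
  have "wt I * wt L * (a I L * dnx S G N b I L) = (\<Sum>K\<in>Ww N. wt K * wt L * (chi S G I K * a I L * b K L))" for I L
  proof -
   have "wt I * wt L * (a I L * dnx S G N b I L) = (wt I * 2 ^ length I) * (wt L * (a I L * (\<Sum>K\<in>Ww N. chi S G I K * (wt K * b K L))))"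
    by (simp only: dnx_def mult_ac)
   also have "... = (\<Sum>K\<in>Ww N. wt K * wt L * (chi S G I K * a I L * b K L))"
    unfolding w sum_distrib_left by (intro sum.cong refl) (simp add: mult_ac)
   finally show ?thesis .
  qed
  then show ?thesis by (simp only: pair_def)
 qed
 also have "... = (\<Sum>L\<in>Ww M. \<Sum>I\<in>Ww M. \<Sum>K\<in>Ww N. wt K * wt L * (chi S G I K * a I L * b K L))" by (rule sum.swap)
 also have "... = (\<Sum>L\<in>Ww M. \<Sum>K\<in>Ww N. \<Sum>I\<in>Ww M. wt K * wt L * (chi S G I K * a I L * b K L))"
  by (rule sum.cong[OF refl]) (rule sum.swap)
 also have "... = (\<Sum>L\<in>Ww M. \<Sum>K\<in>Ww N. wt K * wt L * (upx S G a K L * b K L))"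
  by (intro sum.cong refl) (simp only: u[symmetric] sum_distrib_right sum_distrib_left)
 also have "... = (\<Sum>L\<in>Ww M. \<Sum>K\<in>Ww M. wt K * wt L * (upx S G a K L * b K L))"
  using N arrs2D[OF b] by (intro sum.cong refl sum.mono_neutral_left) (auto simp: Ww_def finite_Ww[unfolded Ww_def])
 also have "... = pair M (upx S G a) b" unfolding pair_def by (rule sum.swap)
 finally show ?thesis by simp
qed

lemma pair_upy:
 assumes S: "S \<subseteq> {..N}" and N: "N \<le> M" and b: "b \<in> arrs2 l N"
 shows "pair M (upy S G a) b = pair M a (dny S G N b)"
proof -
 have tb: "tr b \<in> arrs2 N l" using b by (auto simp: tr_def arrs2_def)
 have t: "tr (tr z) = z" for z by (simp add: tr_def)
 have "pair M (upy S G a) b = pair M (tr (upx S G (tr a))) (tr (tr b))" by (simp only: upy_def t)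
 also have "... = pair M (tr a) (dnx S G N (tr b))" unfolding pair_tr by (rule pair_upx[OF S N tb])
 also have "... = pair M (tr (tr a)) (tr (dnx S G N (tr b)))" by (rule pair_tr[symmetric])
 also have "... = pair M a (dny S G N b)" by (simp only: dny_def t)
 finally show ?thesis .
qed

lemma arrs2_arrs: "n \<le> M ==> l \<le> M ==> a \<in> arrs2 n l ==> a \<in> arrs M"
 by (auto simp: arrs_def arrs2_def)

lemma part_arrs2: "part (Ww n \<times> Ww l) a \<in> arrs2 n l"
 by (auto simp: arrs2_def part_def)

context haar_norm
begin

text \<open>The supremum runs over all \<open>N\<close>, so the dual norm depends on the array
  alone, as \<open>haar_norm\<close> requires. Truncating the test array to a frame of
  \<open>c\<close> shows that larger frames give no larger values.\<close>

definition dual_nu :: "arr => real" where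
 "dual_nu c = Sup {\<bar>pair N c a\<bar> | N a. a \<in> arrs N \<and> \<nu> a \<le> 1}"

lemma nu_part: "a \<in> arrs n ==> \<nu> (part Q a) \<le> \<nu> a"
 by (rule nu_mono[OF part_arrs]) (assumption, assumption, simp add: part_def)

lemma nu_0 [simp]: "\<nu> 0 = 0" using nu_zero[OF arrs_closed(1)] by simp

lemma pair_bounded:
 assumes c: "c \<in> arrs n" and a: "a \<in> arrs N"
 shows "\<exists>a'\<in>arrs n. \<nu> a' \<le> \<nu> a \<and> pair N c a = pair n c a'"
proof
 let ?a = "part (Ww n \<times> Ww n) a" and ?M = "max n N"
 show "?a \<in> arrs n" using part_arrs2[of n n a] by (simp add: arrs_def)
 have "pair N c a = pair ?M c a" using pair_restrict[of N ?M c a] a by simp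
 also have "... = pair n c a" using pair_restrict[of n ?M c a] c by simp
 also have "... = pair n c ?a" by (rule pair_part[symmetric]) (use arrsD[OF c] in \<open>auto simp: Ww_def\<close>)
 finally show "\<nu> ?a \<le> \<nu> a \<and> pair N c a = pair n c ?a" using nu_part[OF a] by blast
qed

lemma pair_le_sum:
 assumes a: "a \<in> arrs n"
 shows "\<bar>pair n c a\<bar> \<le> (\<Sum>K\<in>Ww n. \<Sum>L\<in>Ww n. \<bar>c K L\<bar> * 4 ^ n) * \<nu> a"
proof -
 have "\<bar>pair n c a\<bar> \<le> (\<Sum>K\<in>Ww n. \<Sum>L\<in>Ww n. \<bar>wt K * wt L * (c K L * a K L)\<bar>)"
  unfolding pair_def by (intro order_trans[OF sum_abs] sum_mono sum_abs)
 also have "... \<le> (\<Sum>K\<in>Ww n. \<Sum>L\<in>Ww n. \<bar>c K L\<bar> * 4 ^ n * \<nu> a)"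
 proof (intro sum_mono)
  fix K L
  have "\<bar>wt K * wt L * (c K L * a K L)\<bar> = (wt K * wt L) * (\<bar>c K L\<bar> * \<bar>a K L\<bar>)" by (simp add: abs_mult)
  also have "... \<le> 1 * (\<bar>c K L\<bar> * \<bar>a K L\<bar>)"
   using mult_mono[OF wt_le_1[of K] wt_le_1[of L]] by (intro mult_right_mono) simp_all
  also have "... \<le> \<bar>c K L\<bar> * (4 ^ n * \<nu> a)" unfolding mult_1_left by (rule mult_left_mono[OF abs_entry_le[OF a]]) simp
  finally show "\<bar>wt K * wt L * (c K L * a K L)\<bar> \<le> \<bar>c K L\<bar> * 4 ^ n * \<nu> a" by (simp only: mult.assoc)
 qed
 finally show ?thesis by (simp only: sum_distrib_right)
qed

lemma dual_set_bdd:
 assumes c: "c \<in> arrs n" shows "bdd_above {\<bar>pair N c a\<bar> | N a. a \<in> arrs N \<and> \<nu> a \<le> 1}"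
proof (rule bdd_aboveI)
 let ?B = "\<Sum>K\<in>Ww n. \<Sum>L\<in>Ww n. \<bar>c K L\<bar> * 4 ^ n"
 fix t assume "t \<in> {\<bar>pair N c a\<bar> | N a. a \<in> arrs N \<and> \<nu> a \<le> 1}"
 then obtain N a where a: "t = \<bar>pair N c a\<bar>" "a \<in> arrs N" "\<nu> a \<le> 1" by blast
 obtain a' where a': "a' \<in> arrs n" "\<nu> a' \<le> \<nu> a" "pair N c a = pair n c a'" using pair_bounded[OF c a(2)] by blast
 have "0 \<le> ?B" by (intro sum_nonneg) simp
 then have "?B * \<nu> a' \<le> ?B * 1" using a a' by (intro mult_left_mono) auto
 then show "t \<le> ?B" using pair_le_sum[OF a'(1), of c] a(1) a'(3) by simp
qed

lemma dual_nu_nonneg: assumes c: "c \<in> arrs n" shows "0 \<le> dual_nu c"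
proof -
 have "\<bar>pair n c 0\<bar> \<le> dual_nu c"
  unfolding dual_nu_def
 proof (rule cSup_upper[OF _ dual_set_bdd[OF c]])
  show "\<bar>pair n c 0\<bar> \<in> {\<bar>pair N c a\<bar> | N a. a \<in> arrs N \<and> \<nu> a \<le> 1}"
   by (intro CollectI exI[of _ n] exI[of _ 0]) (simp only: arrs_closed(1) nu_0 zero_le_one simp_thms)
 qed
 then show ?thesis by linarith
qed

lemma pair_le_dual_nu:
 assumes c: "c \<in> arrs N" and a: "a \<in> arrs N" shows "\<bar>pair N c a\<bar> \<le> dual_nu c * \<nu> a"
proof (cases "\<nu> a = 0")
 case True
 then show ?thesis using pair_le_sum[OF a, of c] by simp
next
 case False
 then have pos: "0 < \<nu> a" using nu_nonneg[OF a] by simp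
 let ?a = "(1 / \<nu> a) *\<^sub>R a"
 have sa: "?a \<in> arrs N" using a by (rule arrs_closed(4))
 have "\<nu> ?a = 1" unfolding nu_scale[OF a] using pos by simp
 then have "\<bar>pair N c ?a\<bar> \<le> dual_nu c"
  unfolding dual_nu_def using sa by (intro cSup_upper[OF _ dual_set_bdd[OF c]] CollectI exI[of _ N] exI[of _ ?a] conjI refl) simp_all
 moreover have "pair N c ?a = (1 / \<nu> a) * pair N c a"
  unfolding pair_commute[of N c] by (rule pair_scale)
 ultimately show ?thesis using pos by (simp add: abs_mult field_simps)
qed

lemma dual_nu_le:
 assumes c: "c \<in> arrs n" and C: "0 \<le> C" "\<And>a. a \<in> arrs n ==> \<bar>pair n c a\<bar> \<le> C * \<nu> a"
 shows "dual_nu c \<le> C"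
 unfolding dual_nu_def
proof (rule cSup_least)
 show "{\<bar>pair N c a\<bar> | N a. a \<in> arrs N \<and> \<nu> a \<le> 1} \<noteq> {}"
  using arrs_closed(1)[of n] nu_0 zero_le_one by (metis (mono_tags, lifting) Collect_empty_eq)
 fix t assume "t \<in> {\<bar>pair N c a\<bar> | N a. a \<in> arrs N \<and> \<nu> a \<le> 1}"
 then obtain N a where a: "t = \<bar>pair N c a\<bar>" "a \<in> arrs N" "\<nu> a \<le> 1" by blast
 obtain a' where a': "a' \<in> arrs n" "\<nu> a' \<le> \<nu> a" "pair N c a = pair n c a'" using pair_bounded[OF c a(2)] by blast
 have "C * \<nu> a' \<le> C * 1" using a a' C(1) by (intro mult_left_mono) auto
 then show "t \<le> C" using C(2)[OF a'(1)] a(1) a'(3) by simp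
qed

lemma dual_nu_scale_le:
 assumes c: "c \<in> arrs n" shows "dual_nu (r *\<^sub>R c) \<le> \<bar>r\<bar> * dual_nu c"
proof (rule dual_nu_le[OF arrs_closed(4)[OF c]])
 show "0 \<le> \<bar>r\<bar> * dual_nu c" using dual_nu_nonneg[OF c] by simp
 fix a assume a: "a \<in> arrs n"
 show "\<bar>pair n (r *\<^sub>R c) a\<bar> \<le> \<bar>r\<bar> * dual_nu c * \<nu> a"
  unfolding pair_scale abs_mult mult.assoc by (intro mult_left_mono pair_le_dual_nu[OF c a]) simp
qed

text \<open>Each axiom comes from its partner for \<open>\<nu>\<close>. Unconditionality follows by
  moving the signs of the dominating array onto the test array; the bound for an \<open>up\<close>
  map follows by adjointness from the bound for the \<open>dn\<close> map and conversely; the level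
  and column bounds change places with the pairing bounds.\<close>

lemma dual_haar_norm: "haar_norm dual_nu (1 - x) (1 - y)"
proof
 show "0 \<le> 1 - x" "1 - x \<le> 1" "0 \<le> 1 - y" "1 - y \<le> 1" using xy by auto
 fix n c assume c: "c \<in> arrs n"
 show "0 \<le> dual_nu c" by (rule dual_nu_nonneg[OF c])
 show "dual_nu c = 0 \<longleftrightarrow> c = 0"
 proof
  assume z: "dual_nu c = 0"
  show "c = 0"
  proof (intro ext)
   fix K L
   show "c K L = 0 K L"
   proof (cases "length K \<le> n \<and> length L \<le> n")
    case True
    then have KL: "K \<in> Ww n" "L \<in> Ww n" by (auto simp: Ww_def)
    have "\<bar>pair n c (hb K L)\<bar> \<le> dual_nu c * \<nu> (hb K L)" by (rule pair_le_dual_nu[OF c]) (use True in simp)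
    then have "wt K * wt L * c K L = 0" unfolding pair_hb[OF KL] z by simp
    then show ?thesis using wt_pos[of K] wt_pos[of L] by (simp only: mult_eq_0_iff) auto
   qed (use arrsD[OF c] in auto)
  qed
 next
  assume z: "c = 0"
  have "pair n 0 a = 0" for a by (simp add: pair_def)
  then have "dual_nu c \<le> 0" unfolding z by (intro dual_nu_le[OF arrs_closed(1)[of n]]) simp_all
  then show "dual_nu c = 0" using dual_nu_nonneg[OF c] by linarith
 qed
 show "dual_nu (r *\<^sub>R c) = \<bar>r\<bar> * dual_nu c" for r
 proof (cases "r = 0")
  case True
  then show ?thesis using dual_nu_scale_le[OF c, of r] dual_nu_nonneg[OF arrs_closed(4)[OF c, of r]] by simp
 next
  case False
  have "dual_nu c = dual_nu ((1 / r) *\<^sub>R (r *\<^sub>R c))" using False by (simp only: scaleR_scaleR) simp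
  also have "... \<le> \<bar>1 / r\<bar> * dual_nu (r *\<^sub>R c)" by (rule dual_nu_scale_le[OF arrs_closed(4)[OF c]])
  finally have "\<bar>r\<bar> * dual_nu c \<le> dual_nu (r *\<^sub>R c)" using False by (simp add: field_simps)
  then show ?thesis using dual_nu_scale_le[OF c, of r] by linarith
 qed
 fix b assume b: "b \<in> arrs n"
 show "dual_nu (c + b) \<le> dual_nu c + dual_nu b"
 proof (rule dual_nu_le[OF arrs_closed(2)[OF c b]])
  show "0 \<le> dual_nu c + dual_nu b" using dual_nu_nonneg[OF c] dual_nu_nonneg[OF b] by simp
  fix a assume a: "a \<in> arrs n"
  show "\<bar>pair n (c + b) a\<bar> \<le> (dual_nu c + dual_nu b) * \<nu> a"
   unfolding pair_add distrib_right using pair_le_dual_nu[OF c a] pair_le_dual_nu[OF b a] by linarith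
 qed
next
 fix c b n assume c: "c \<in> arrs n" and b: "b \<in> arrs n" and cb: "\<And>K L. \<bar>c K L\<bar> \<le> \<bar>b K L\<bar>"
 show "dual_nu c \<le> dual_nu b"
 proof (rule dual_nu_le[OF c dual_nu_nonneg[OF b]])
  fix a assume a: "a \<in> arrs n"
  define a' where "a' = (\<lambda>K L. sgn (b K L) * \<bar>a K L\<bar>)"
  have a': "a' \<in> arrs n" unfolding arrs_def arrs2_def a'_def using arrsD[OF a] by simp
  have "\<nu> a' \<le> \<nu> a" by (rule nu_mono[OF a' a]) (simp add: a'_def abs_mult abs_sgn_eq)
  have "\<bar>pair n c a\<bar> \<le> (\<Sum>K\<in>Ww n. \<Sum>L\<in>Ww n. \<bar>wt K * wt L * (c K L * a K L)\<bar>)"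
   unfolding pair_def by (intro order_trans[OF sum_abs] sum_mono sum_abs)
  also have "... \<le> (\<Sum>K\<in>Ww n. \<Sum>L\<in>Ww n. wt K * wt L * (b K L * a' K L))"
  proof (intro sum_mono)
   fix K L
   have e: "b K L * a' K L = \<bar>b K L\<bar> * \<bar>a K L\<bar>" by (simp add: a'_def abs_sgn mult.assoc)
   have "\<bar>wt K * wt L * (c K L * a K L)\<bar> = wt K * wt L * (\<bar>c K L\<bar> * \<bar>a K L\<bar>)" by (simp add: abs_mult)
   also have "... \<le> wt K * wt L * (\<bar>b K L\<bar> * \<bar>a K L\<bar>)" by (intro mult_left_mono mult_right_mono cb) simp_all
   finally show "\<bar>wt K * wt L * (c K L * a K L)\<bar> \<le> wt K * wt L * (b K L * a' K L)" unfolding e .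
  qed
  also have "... = pair n b a'" by (simp only: pair_def)
  also have "... \<le> dual_nu b * \<nu> a'" using pair_le_dual_nu[OF b a'] by linarith
  also have "... \<le> dual_nu b * \<nu> a" by (intro mult_left_mono dual_nu_nonneg[OF b]) fact
  finally show "\<bar>pair n c a\<bar> \<le> dual_nu b * \<nu> a" .
 qed
next
 fix S :: "nat set" and N n l :: nat and G and a :: arr assume S: "S \<subseteq> {..N}" "card S = Suc n"
 have nN: "n \<le> N" by (rule card_le_Suc_bound[OF S])
 define M where "M = max N l"
 have M: "N \<le> M" "l \<le> M" "n \<le> M" using nN by (auto simp: M_def)
 show "dual_nu (upx S G a) \<le> dual_nu a" if a: "a \<in> arrs2 n l"
 proof -
  have aM: "a \<in> arrs M" by (rule arrs2_arrs[OF M(3,2) a])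
  have u2: "upx S G a \<in> arrs2 N l" by (rule upx_arrs2[OF S(1) a])
  have uM: "upx S G a \<in> arrs M" by (rule arrs2_arrs[OF M(1,2) u2])
  show ?thesis
  proof (rule dual_nu_le[OF uM dual_nu_nonneg[OF aM]])
   fix b assume b: "b \<in> arrs M"
   let ?b = "part (Ww N \<times> Ww l) b"
   have "pair M (upx S G a) b = pair M (upx S G a) ?b"
    by (rule pair_part[symmetric]) (use arrs2D[OF u2] in \<open>auto simp: Ww_def\<close>)
   also have "... = pair M a (dnx S G N ?b)" by (rule pair_upx[OF S(1) M(1) part_arrs2])
   also have "\<bar>...\<bar> \<le> dual_nu a * \<nu> (dnx S G N ?b)"
    by (rule pair_le_dual_nu[OF aM arrs2_arrs[OF M(3,2) dnx_arrs2[OF S part_arrs2]]])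
   also have "... \<le> dual_nu a * \<nu> b"
    by (intro mult_left_mono dual_nu_nonneg[OF aM] order_trans[OF nu_dnx[OF S part_arrs2] nu_part[OF b]])
   finally show "\<bar>pair M (upx S G a) b\<bar> \<le> dual_nu a * \<nu> b" .
  qed
 qed
 show "dual_nu (upy S G a) \<le> dual_nu a" if a: "a \<in> arrs2 l n"
 proof -
  have aM: "a \<in> arrs M" by (rule arrs2_arrs[OF M(2,3) a])
  have u2: "upy S G a \<in> arrs2 l N" by (rule upy_arrs2[OF S(1) a])
  have uM: "upy S G a \<in> arrs M" by (rule arrs2_arrs[OF M(2,1) u2])
  show ?thesis
  proof (rule dual_nu_le[OF uM dual_nu_nonneg[OF aM]])
   fix b assume b: "b \<in> arrs M"
   let ?b = "part (Ww l \<times> Ww N) b"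
   have "pair M (upy S G a) b = pair M (upy S G a) ?b"
    by (rule pair_part[symmetric]) (use arrs2D[OF u2] in \<open>auto simp: Ww_def\<close>)
   also have "... = pair M a (dny S G N ?b)" by (rule pair_upy[OF S(1) M(1) part_arrs2])
   also have "\<bar>...\<bar> \<le> dual_nu a * \<nu> (dny S G N ?b)"
    by (rule pair_le_dual_nu[OF aM arrs2_arrs[OF M(2,3) dny_arrs2[OF S part_arrs2]]])
   also have "... \<le> dual_nu a * \<nu> b"
    by (intro mult_left_mono dual_nu_nonneg[OF aM] order_trans[OF nu_dny[OF S part_arrs2] nu_part[OF b]])
   finally show "\<bar>pair M (upy S G a) b\<bar> \<le> dual_nu a * \<nu> b" .
  qed
 qed
 show "dual_nu (dnx S G N a) \<le> dual_nu a" if a: "a \<in> arrs2 N l"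
 proof -
  have aM: "a \<in> arrs M" by (rule arrs2_arrs[OF M(1,2) a])
  have d2: "dnx S G N a \<in> arrs2 n l" by (rule dnx_arrs2[OF S a])
  have dM: "dnx S G N a \<in> arrs M" by (rule arrs2_arrs[OF M(3,2) d2])
  show ?thesis
  proof (rule dual_nu_le[OF dM dual_nu_nonneg[OF aM]])
   fix b assume b: "b \<in> arrs M"
   let ?b = "part (Ww n \<times> Ww l) b"
   have "pair M (dnx S G N a) b = pair M (dnx S G N a) ?b"
    by (rule pair_part[symmetric]) (use arrs2D[OF d2] in \<open>auto simp: Ww_def\<close>)
   also have "... = pair M (upx S G ?b) a" unfolding pair_upx[OF S(1) M(1) a] by (rule pair_commute)
   also have "... = pair M a (upx S G ?b)" by (rule pair_commute)
   also have "\<bar>...\<bar> \<le> dual_nu a * \<nu> (upx S G ?b)"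
    by (rule pair_le_dual_nu[OF aM arrs2_arrs[OF M(1,2) upx_arrs2[OF S(1) part_arrs2]]])
   also have "... \<le> dual_nu a * \<nu> b"
    by (intro mult_left_mono dual_nu_nonneg[OF aM] order_trans[OF nu_upx[OF S part_arrs2] nu_part[OF b]])
   finally show "\<bar>pair M (dnx S G N a) b\<bar> \<le> dual_nu a * \<nu> b" .
  qed
 qed
 show "dual_nu (dny S G N a) \<le> dual_nu a" if a: "a \<in> arrs2 l N"
 proof -
  have aM: "a \<in> arrs M" by (rule arrs2_arrs[OF M(2,1) a])
  have d2: "dny S G N a \<in> arrs2 l n" by (rule dny_arrs2[OF S a])
  have dM: "dny S G N a \<in> arrs M" by (rule arrs2_arrs[OF M(2,3) d2])
  show ?thesis
  proof (rule dual_nu_le[OF dM dual_nu_nonneg[OF aM]])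
   fix b assume b: "b \<in> arrs M"
   let ?b = "part (Ww l \<times> Ww n) b"
   have "pair M (dny S G N a) b = pair M (dny S G N a) ?b"
    by (rule pair_part[symmetric]) (use arrs2D[OF d2] in \<open>auto simp: Ww_def\<close>)
   also have "... = pair M (upy S G ?b) a" unfolding pair_upy[OF S(1) M(1) a] by (rule pair_commute)
   also have "... = pair M a (upy S G ?b)" by (rule pair_commute)
   also have "\<bar>...\<bar> \<le> dual_nu a * \<nu> (upy S G ?b)"
    by (rule pair_le_dual_nu[OF aM arrs2_arrs[OF M(2,1) upy_arrs2[OF S(1) part_arrs2]]])
   also have "... \<le> dual_nu a * \<nu> b"
    by (intro mult_left_mono dual_nu_nonneg[OF aM] order_trans[OF nu_upy[OF S part_arrs2] nu_part[OF b]])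
   finally show "\<bar>pair M (dny S G N a) b\<bar> \<le> dual_nu a * \<nu> b" .
  qed
 qed
next
 fix P P' :: "bool list set" and m m' :: nat and a :: arr
 assume P: "P \<subseteq> Lw m" "P' \<subseteq> Lw m'" and a: "\<And>K L. \<bar>a K L\<bar> \<le> (if K \<in> P \<and> L \<in> P' then 1 else 0)"
 have aM: "a \<in> arrs M" if M: "m \<le> M" "m' \<le> M" for M
  unfolding arrs_def arrs2_def
 proof (intro CollectI allI impI)
  fix K L :: "bool list" assume "M < length K \<or> M < length L"
  then have "K \<notin> P \<or> L \<notin> P'" using P M by (auto simp: Lw_def)
  then show "a K L = 0" using a[of K L] by auto
 qed
 show "dual_nu a \<le> (real (card P) / 2 ^ m) powr (1 - x) * (real (card P') / 2 ^ m') powr (1 - y)"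
 proof (rule dual_nu_le[OF aM[OF max.cobounded1 max.cobounded2]])
  fix b assume b: "b \<in> arrs (max m m')"
  show "\<bar>pair (max m m') a b\<bar> \<le> (real (card P) / 2 ^ m) powr (1 - x) * (real (card P') / 2 ^ m') powr (1 - y) * \<nu> b"
   using pair_level[OF max.cobounded1 max.cobounded2 P a b] unfolding pair_commute[of _ a b] by (simp only: mult.commute[of "\<nu> b"])
 qed simp
 fix N c assume N: "m \<le> N" "m' \<le> N" and c: "c \<in> arrs N"
 have "\<bar>pair N c a\<bar> \<le> dual_nu c * \<nu> a" by (rule pair_le_dual_nu[OF c aM[OF N]])
 also have "... \<le> dual_nu c * ((real (card P) / 2 ^ m) powr x * (real (card P') / 2 ^ m') powr y)"
  by (rule mult_left_mono[OF nu_level[OF P a] dual_nu_nonneg[OF c]])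
 finally show "\<bar>pair N c a\<bar> \<le> dual_nu c * ((real (card P) / 2 ^ m) powr (1 - (1 - x)) * (real (card P') / 2 ^ m') powr (1 - (1 - y)))"
  by simp
next
 fix T :: "nat set" and N :: nat and L0 :: "bool list" and a :: arr
 assume T: "T \<subseteq> {..N}" and L0: "length L0 \<le> N" and a: "\<And>K L. \<bar>a K L\<bar> \<le> (if length K \<in> T \<and> L = L0 then 1 else 0)"
 have aN: "a \<in> arrs N"
  unfolding arrs_def arrs2_def
 proof (intro CollectI allI impI)
  fix K L :: "bool list" assume "N < length K \<or> N < length L"
  then have "\<not> (length K \<in> T \<and> L = L0)" using T L0 by auto
  then show "a K L = 0" using a[of K L] by auto
 qed
 show "dual_nu a \<le> sqrt (card T)"
 proof (rule dual_nu_le[OF aN])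
  fix b assume b: "b \<in> arrs N"
  show "\<bar>pair N a b\<bar> \<le> sqrt (card T) * \<nu> b"
   using pair_column[OF T L0 a b] unfolding pair_commute[of _ a b] by (simp only: mult.commute[of "\<nu> b"])
 qed simp
 fix c assume c: "c \<in> arrs N"
 have "\<bar>pair N c a\<bar> \<le> dual_nu c * \<nu> a" by (rule pair_le_dual_nu[OF c aN])
 also have "... \<le> dual_nu c * sqrt (card T)" by (rule mult_left_mono[OF nu_column[OF T L0 a] dual_nu_nonneg[OF c]])
 finally show "\<bar>pair N c a\<bar> \<le> dual_nu c * sqrt (card T)" .
qed

end

section \<open>Dyadic intervals and the Haar system\<close>

text \<open>The left end point of the interval coded by a word; the first letter is the leading
  binary digit.\<close>

fun pos :: "bool list => real" where
 "pos [] = 0"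
| "pos (b # w) = (if b then 1 / 2 else 0) + pos w / 2"

definition intv :: "bool list => real set" where
 "intv w = {pos w ..< pos w + (1/2) ^ length w}"

lemma pos_bounds: "0 \<le> pos w" "pos w + (1/2) ^ length w \<le> 1"
 by (induction w) auto

lemma pos_append: "pos (K @ u) = pos K + pos u * (1/2) ^ length K"
 by (induction K) (simp_all add: add_divide_distrib)

lemma intv_bounds: "t \<in> intv w ==> 0 \<le> t \<and> t < 1"
 using pos_bounds[of w] by (auto simp: intv_def)

text \<open>Doubling maps either half of the unit interval onto the whole and removes the first
  letter. The inductions for disjointness and covering use this step.\<close>

lemma intv_Cons: "t \<in> intv (b # w) \<longleftrightarrow> 2 * t - (if b then 1 else 0) \<in> intv w"
 by (auto simp: intv_def field_simps)

lemma intv_disjoint: "t \<in> intv w ==> t \<in> intv v ==> length w = length v ==> w = v"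
proof (induction w arbitrary: v t)
 case (Cons b w)
 obtain b' v' where v: "v = b' # v'" using Cons.prems(3) by (cases v) auto
 have m: "2 * t - (if b then 1 else 0) \<in> intv w" "2 * t - (if b' then 1 else 0) \<in> intv v'"
  using Cons.prems(1,2) unfolding v intv_Cons by simp_all
 have "b = b'" using intv_bounds[OF m(1)] intv_bounds[OF m(2)] by (cases b; cases b') auto
 then show ?case using Cons.IH[OF m(1), of v'] m(2) Cons.prems(3) v by simp
qed simp

lemma intv_cover: "0 \<le> t ==> t < 1 ==> \<exists>w\<in>Lw n. t \<in> intv w"
proof (induction n arbitrary: t)
 case 0
 then show ?case by (intro bexI[of _ "[]"]) (auto simp: intv_def Lw_def)
next
 case (Suc n)
 have "0 \<le> 2 * t - (if 1/2 \<le> t then 1 else 0) \<and> 2 * t - (if 1/2 \<le> t then 1 else 0) < 1" using Suc.prems by auto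
 then obtain w where w: "w \<in> Lw n" "2 * t - (if 1/2 \<le> t then 1 else 0) \<in> intv w" using Suc.IH by blast
 then show ?case by (intro bexI[of _ "(1/2 \<le> t) # w"]) (auto simp: intv_Cons Lw_def)
qed

lemma intv_append: "intv (K @ u) \<subseteq> intv K"
proof
 fix t assume t: "t \<in> intv (K @ u)"
 let ?e = "(1/2 :: real) ^ length K"
 have "pos u * ?e + (1/2) ^ length u * ?e \<le> 1 * ?e"
  unfolding distrib_right[symmetric] by (rule mult_right_mono[OF pos_bounds(2)]) simp
 moreover have "0 \<le> pos u * ?e" using pos_bounds(1)[of u] by simp
 moreover have "pos K + pos u * ?e \<le> t" "t < pos K + pos u * ?e + (1/2) ^ length u * ?e"
  using t by (auto simp: intv_def pos_append power_add mult_ac)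
 ultimately show "t \<in> intv K" by (simp add: intv_def)
qed

lemma intv_take:
 assumes t: "t \<in> intv w" and l: "length K \<le> length w"
 shows "t \<in> intv K \<longleftrightarrow> take (length K) w = K"
proof -
 have "t \<in> intv (take (length K) w)"
  using intv_append[of "take (length K) w" "drop (length K) w"] t by auto
 then show ?thesis using intv_disjoint[of t "take (length K) w" K] l by auto
qed

lemma intv_inf_sup: "Inf (intv w) = pos w" "Sup (intv w) = pos w + (1/2) ^ length w"
 unfolding intv_def by (simp_all add: cInf_atLeastLessThan cSup_atLeastLessThan)

lemma intv_inj: "intv w = intv v \<longleftrightarrow> w = v"
proof
 assume e: "intv w = intv v"
 then have "(1/2 :: real) ^ length w = (1/2) ^ length v"
  using intv_inf_sup[of w] intv_inf_sup[of v] by simp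
 then have "length w = length v" using power_inject_exp'[of "1/2 :: real" "length w" "length v"] by simp
 moreover have "pos w \<in> intv w" by (simp add: intv_def)
 ultimately show "w = v" using e intv_disjoint by blast
qed simp

lemma pos_nat: "\<exists>k < 2 ^ length w. pos w = real k / 2 ^ length w"
proof (induction w)
 case (Cons b w)
 then obtain k where k: "k < 2 ^ length w" "pos w = real k / 2 ^ length w" by blast
 then show ?case
  by (intro exI[of _ "(if b then 2 ^ length w else 0) + k"]) (auto simp: field_simps)
qed simp

lemma nat_pos: "k < 2 ^ n ==> \<exists>w\<in>Lw n. pos w = real k / 2 ^ n"
proof (induction n arbitrary: k)
 case (Suc n)
 show ?case
 proof (cases "k < 2 ^ n")
  case True
  then obtain w where "w \<in> Lw n" "pos w = real k / 2 ^ n" using Suc.IH by blast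
  then show ?thesis by (intro bexI[of _ "False # w"]) (auto simp: Lw_def)
 next
  case False
  then have "k - 2 ^ n < 2 ^ n" using Suc.prems by simp
  then obtain w where "w \<in> Lw n" "pos w = real (k - 2 ^ n) / 2 ^ n" using Suc.IH by blast
  then show ?thesis using False by (intro bexI[of _ "True # w"]) (auto simp: Lw_def field_simps of_nat_diff)
 qed
qed (auto simp: Lw_def)

lemma dyadic_eq: "dyadic = range intv"
proof (intro set_eqI iffI)
 fix I assume "I \<in> dyadic"
 then obtain k n where k: "k \<le> 2 ^ n - (1::nat)" "I = {real k / 2 ^ n ..< (real k + 1) / 2 ^ n}" by (auto simp: dyadic_def)
 have "0 < (2::nat) ^ n" by simp
 then have "k < 2 ^ n" using k(1) by linarith
 then obtain w where "w \<in> Lw n" "pos w = real k / 2 ^ n" using nat_pos by blast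
 moreover have "(real k + 1) / 2 ^ n = real k / 2 ^ n + (1/2) ^ n" by (simp add: power_one_over add_divide_distrib)
 ultimately have "I = intv w" unfolding k(2) by (simp add: intv_def Lw_def)
 then show "I \<in> range intv" by blast
next
 fix I assume "I \<in> range intv"
 then obtain w where w: "I = intv w" by blast
 obtain k where k: "k < 2 ^ length w" "pos w = real k / 2 ^ length w" using pos_nat by blast
 have "I = {real k / 2 ^ length w ..< (real k + 1) / 2 ^ length w}"
  using k by (simp add: w intv_def power_one_over add_divide_distrib)
 moreover have "k \<le> 2 ^ length w - 1" using k(1) by simp
 ultimately show "I \<in> dyadic" unfolding dyadic_def by blast
qed

lemma measure_intv: "measure lborel (intv w) = (1/2) ^ length w"
 by (simp add: intv_def)

lemma dyadic_upto_eq: "dyadic_upto n = intv ` Ww n"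
proof -
 have "1 / 2 ^ n \<le> measure lborel (intv w) \<longleftrightarrow> length w \<le> n" for w
  unfolding measure_intv power_one_over[symmetric] by (rule power_decreasing_iff) simp_all
 then show ?thesis by (auto simp: dyadic_upto_def dyadic_eq Ww_def)
qed

section \<open>Haar functions evaluated on words and their independence\<close>

text \<open>The constant value of the Haar function of \<open>K\<close> on the interval of a longer
  word \<open>w\<close>: the letter after the prefix \<open>K\<close> tells the half.\<close>

definition hw :: "bool list => bool list => real" where
 "hw K w = (if take (length K) w = K then if w ! length K then -1 else 1 else 0)"

lemma haar_intv:
 assumes t: "t \<in> intv w" and l: "length K < length w" shows "haar (intv K) t = hw K w"
proof (cases "take (length K) w = K")
 case True
 then have tK: "t \<in> intv K" using intv_take[OF t, of K] l by simp
 have "take (Suc (length K)) w = K @ [w ! length K]" using True l by (simp add: take_Suc_conv_app_nth)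
 then have "t \<in> intv (K @ [w ! length K])" using intv_take[OF t, of "K @ [w ! length K]"] l by simp
 then have "t < pos K + (1/2) ^ length K / 2 \<longleftrightarrow> \<not> w ! length K"
  by (auto simp: intv_def pos_append split: if_splits)
 then show ?thesis using tK True by (auto simp: haar_def hw_def intv_inf_sup field_simps)
next
 case False
 then show ?thesis using intv_take[OF t, of K] l by (simp add: haar_def hw_def)
qed

lemma haar_sq: "(haar (intv K) t)\<^sup>2 = (if t \<in> intv K then 1 else 0)"
 by (simp add: haar_def)

text \<open>Descending induction on the length of \<open>K\<close>. The words \<open>?u\<close> and
  \<open>?v\<close> extend \<open>K\<close> and differ only in the letter after it. Longer words
  have vanishing coefficients already, and every other word of at most the length of
  \<open>K\<close> takes the same value on both. Length \<open>Suc n\<close> is needed to see the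
  halves on level \<open>n\<close>.\<close>

lemma hw_separates:
 assumes c: "\<And>w. w \<in> Lw (Suc n) ==> (\<Sum>K\<in>Ww n. c K * hw K w) = 0" and K: "K \<in> Ww n"
 shows "c K = 0"
 using K
proof (induction "n - length K" arbitrary: K rule: less_induct)
 case less
 let ?r = "replicate (n - length K) False"
 let ?u = "K @ [False] @ ?r" and ?v = "K @ [True] @ ?r"
 have uv: "?u \<in> Lw (Suc n)" "?v \<in> Lw (Suc n)" using less.prems by (auto simp: Lw_def Ww_def)
 have "c K' * (hw K' ?u - hw K' ?v) = (if K' = K then 2 * c K else 0)" if K': "K' \<in> Ww n" for K'
 proof (cases "length K < length K'")
  case True
  then have "c K' = 0" using less.hyps[of K'] K' less.prems by (auto simp: Ww_def)
  then show ?thesis using True by auto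
 next
  case False
  show ?thesis
  proof (cases "length K' = length K")
   case True
   then show ?thesis by (auto simp: hw_def nth_append)
  next
   case F: False
   then have "length K' < length K" using False by simp
   then have "hw K' ?u = hw K' ?v" by (simp add: hw_def nth_append)
   then show ?thesis using F by auto
  qed
 qed
 then have "(\<Sum>K'\<in>Ww n. c K' * (hw K' ?u - hw K' ?v)) = (\<Sum>K'\<in>Ww n. if K' = K then 2 * c K else 0)"
  by (intro sum.cong refl)
 also have "... = 2 * c K" using less.prems by (simp add: finite_Ww)
 finally show ?case using c[OF uv(1)] c[OF uv(2)] by (simp add: right_diff_distrib sum_subtractf)
qed

definition hv :: "bool list \<times> bool list => real \<times> real => real" where
 "hv t = haar2 (intv (fst t)) (intv (snd t))"

text \<open>The sum runs over the support instead of a frame, so the same map serves all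
  \<open>n\<close>.\<close>

definition synth :: "arr => real \<times> real => real" where
 "synth a = (\<Sum>t\<in>{t. a (fst t) (snd t) \<noteq> 0}. a (fst t) (snd t) *\<^sub>R hv t)"

lemma support_arrs: "a \<in> arrs n ==> {t. a (fst t) (snd t) \<noteq> 0} \<subseteq> Ww n \<times> Ww n"
proof
 fix t assume a: "a \<in> arrs n" and "t \<in> {t. a (fst t) (snd t) \<noteq> 0}"
 then have "\<not> (n < length (fst t) \<or> n < length (snd t))" using arrsD[OF a, of "fst t" "snd t"] by auto
 then show "t \<in> Ww n \<times> Ww n" by (simp add: mem_Times_iff Ww_def not_less)
qed

lemma synth_eq: "a \<in> arrs n ==> synth a = (\<Sum>t\<in>Ww n \<times> Ww n. a (fst t) (snd t) *\<^sub>R hv t)"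
 unfolding synth_def by (rule sum.mono_neutral_left[OF _ support_arrs]) (simp_all add: fun_eq_iff scaleR_fun_def)

lemma synth_apply: "a \<in> arrs n ==> synth a z = (\<Sum>t\<in>Ww n \<times> Ww n. a (fst t) (snd t) * hv t z)"
proof -
 assume a: "a \<in> arrs n"
 have s: "(\<Sum>t\<in>A. f t) z = (\<Sum>t\<in>A. f t z)" for A and f :: "bool list \<times> bool list => real \<times> real => real"
  by (induction A rule: infinite_finite_induct) simp_all
 show ?thesis unfolding synth_eq[OF a] s by (simp add: scaleR_fun_def)
qed

lemma synth_linear:
 assumes "a \<in> arrs n" "b \<in> arrs n"
 shows "synth (a + b) = synth a + synth b" "synth (r *\<^sub>R a) = r *\<^sub>R synth a"
 unfolding synth_eq[OF arrs_closed(2)[OF assms]] synth_eq[OF assms(1)] synth_eq[OF assms(2)] synth_eq[OF arrs_closed(4)[OF assms(1)]]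
 by (simp_all only: plus_fun_apply scaleR_add_left sum.distrib scaleR_sum_right) (simp add: scaleR_fun_def mult.assoc)

lemma synth_inj:
 assumes a: "a \<in> arrs n" and z: "synth a = 0" shows "a = 0"
proof -
 have e: "(\<Sum>K\<in>Ww n. (\<Sum>L\<in>Ww n. a K L * hw L v) * hw K w) = 0" if "w \<in> Lw (Suc n)" "v \<in> Lw (Suc n)" for w v
 proof -
  have "pos w \<in> intv w" "pos v \<in> intv v" by (auto simp: intv_def)
  then have "(\<Sum>K\<in>Ww n. (\<Sum>L\<in>Ww n. a K L * hw L v) * hw K w) = (\<Sum>K\<in>Ww n. \<Sum>L\<in>Ww n. a K L * (haar (intv K) (pos w) * haar (intv L) (pos v)))"
   unfolding sum_distrib_right using that by (intro sum.cong refl) (simp add: haar_intv Lw_def Ww_def)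
  also have "... = synth a (pos w, pos v)"
   unfolding synth_apply[OF a] by (simp add: sum.cartesian_product case_prod_unfold hv_def haar2_def)
  finally show ?thesis using z by simp
 qed
 show ?thesis
 proof (intro ext)
  fix K L
  show "a K L = 0 K L"
  proof (cases "K \<in> Ww n \<and> L \<in> Ww n")
   case True
   have "(\<Sum>L\<in>Ww n. a K L * hw L v) = 0" if "v \<in> Lw (Suc n)" for v
    by (rule hw_separates[OF e[OF _ that]]) (use True in auto)
   then have "a K L = 0" by (rule hw_separates) (use True in auto)
   then show ?thesis by simp
  qed (use arrsD[OF a, of K L] in \<open>simp add: Ww_def not_le\<close>)
 qed
qed

lemma synth_hb: "synth (hb K L) = hv (K, L)"
proof -
 have "{t. hb K L (fst t) (snd t) \<noteq> 0} = {(K, L)}" by (auto simp: hb_def)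
 then show ?thesis by (simp add: synth_def) (simp add: hb_def)
qed

lemma hv_inj: "inj hv"
proof (rule injI)
 fix s t assume e: "hv s = hv t"
 obtain K L K' L' where st: "s = (K, L)" "t = (K', L')" by (cases s, cases t) auto
 define n where "n = Max {length K, length L, length K', length L'}"
 have "length K \<le> n" "length L \<le> n" "length K' \<le> n" "length L' \<le> n" by (auto simp: n_def)
 then have h: "hb K L \<in> arrs n" "hb K' L' \<in> arrs n" by simp_all
 have "synth (hb K L + (-1) *\<^sub>R hb K' L') = synth (hb K L) + (-1) *\<^sub>R synth (hb K' L')"
  using synth_linear(1)[OF h(1) arrs_closed(4)[OF h(2), of "-1"]] synth_linear(2)[OF h(2,2), of "-1"] by (simp only:)
 also have "... = 0" using e unfolding synth_hb st by (simp add: scaleR_fun_def fun_eq_iff)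
 finally have "hb K L + (-1) *\<^sub>R hb K' L' = 0"
  by (rule synth_inj[OF arrs_closed(2)[OF h(1) arrs_closed(4)[OF h(2)]]])
 then have "(hb K L + (-1) *\<^sub>R hb K' L') K L = 0" by (simp only: zero_fun_apply)
 then show "s = t" unfolding st by (simp add: hb_def scaleR_fun_def split: if_splits)
qed

lemma haar_system_eq: "haar_system = range hv"
proof (intro set_eqI iffI)
 fix g assume "g \<in> haar_system"
 then obtain K L where "g = haar2 (intv K) (intv L)" unfolding haar_system_def dyadic_eq by blast
 then have "g = hv (K, L)" by (simp add: hv_def)
 then show "g \<in> range hv" by blast
next
 fix g assume "g \<in> range hv"
 then show "g \<in> haar_system" unfolding haar_system_def dyadic_eq hv_def by blast
qed

lemma finite_arrs:
 assumes "finite Q" obtains n where "Q \<subseteq> Ww n \<times> Ww n"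
proof -
 define n where "n = Max (insert 0 ((\<lambda>t. length (fst t)) ` Q \<union> (\<lambda>t. length (snd t)) ` Q))"
 have "length (fst t) \<le> n" "length (snd t) \<le> n" if "t \<in> Q" for t
  unfolding n_def using assms that by (auto intro!: Max_ge)
 then have "Q \<subseteq> Ww n \<times> Ww n" by (auto simp: Ww_def mem_Times_iff)
 then show ?thesis by (rule that)
qed

lemma haar_independent: "independent haar_system"
 unfolding independent_explicit_finite_subsets
proof (intro allI impI ballI)
 fix S u g assume S: "S \<subseteq> haar_system" "finite S" and z: "(\<Sum>v\<in>S. u v *\<^sub>R v) = 0" and g: "g \<in> S"
 define Q where "Q = hv -` S"
 have SQ: "S = hv ` Q" using S(1) unfolding Q_def haar_system_eq by blast
 have Q: "finite Q" unfolding Q_def using S(2) hv_inj by (rule finite_vimageI)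
 obtain n where n: "Q \<subseteq> Ww n \<times> Ww n" using finite_arrs[OF Q] by blast
 define a where "a K L = (if (K, L) \<in> Q then u (hv (K, L)) else 0)" for K L
 have a: "a \<in> arrs n" using n by (auto simp: arrs_def arrs2_def a_def Ww_def)
 have "synth a = (\<Sum>t\<in>Q. a (fst t) (snd t) *\<^sub>R hv t)"
  unfolding synth_eq[OF a] by (rule sum.mono_neutral_right) (use n in \<open>auto simp: a_def\<close>)
 also have "... = (\<Sum>t\<in>Q. u (hv t) *\<^sub>R hv t)" by (intro sum.cong refl) (auto simp: a_def)
 also have "... = (\<Sum>v\<in>S. u v *\<^sub>R v)"
  unfolding SQ using inj_on_subset[OF hv_inj] by (subst sum.reindex) auto
 finally have "synth a = 0" unfolding z .
 then have a0: "a = 0" by (rule synth_inj[OF a])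
 obtain t where t: "t \<in> Q" "g = hv t" using g SQ by blast
 have "a (fst t) (snd t) = 0" unfolding a0 by simp
 then show "u g = 0" using t by (simp add: a_def)
qed

text \<open>The function \<open>f\<close> has finite support in the Haar system and reproduces
  \<open>synth a\<close>; by independence it is the representation.\<close>

lemma haar_coeff_synth:
 assumes a: "a \<in> arrs n" shows "haar_coeff (synth a) (intv K) (intv L) = a K L"
proof -
 define f where "f g = (if g \<in> range hv then a (fst (inv hv g)) (snd (inv hv g)) else 0)" for g
 have fh: "f (hv t) = a (fst t) (snd t)" for t by (simp add: f_def inv_f_f[OF hv_inj])
 let ?Q = "{t. a (fst t) (snd t) \<noteq> 0}"
 have Q: "finite ?Q" by (rule finite_subset[OF support_arrs[OF a]]) simp
 have fQ: "{g. f g \<noteq> 0} = hv ` ?Q"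
 proof (intro set_eqI iffI)
  fix g assume g: "g \<in> {g. f g \<noteq> 0}"
  then obtain t where "g = hv t" by (auto simp: f_def split: if_splits)
  then show "g \<in> hv ` ?Q" using g fh by auto
 qed (auto simp: fh)
 have "(\<Sum>g | f g \<noteq> 0. f g *\<^sub>R g) = synth a"
  unfolding fQ synth_def using inj_on_subset[OF hv_inj] by (subst sum.reindex) (auto simp: fh)
 moreover have "synth a \<in> span haar_system"
  unfolding synth_def haar_system_eq by (intro span_sum span_scale span_base) simp
 moreover have "g \<in> haar_system" if "f g \<noteq> 0" for g
  using that by (auto simp: f_def haar_system_eq split: if_splits)
 moreover have "finite {g. f g \<noteq> 0}" unfolding fQ using Q by (rule finite_imageI)
 ultimately have "representation haar_system (synth a) = f"
  by (intro representation_eqI haar_independent)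
 then show ?thesis unfolding haar_coeff_def using fh[of "(K, L)"] by (simp add: hv_def)
qed

section \<open>Integrals of step functions and the Hardy norm\<close>

text \<open>The half-open dyadic intervals cover the closed unit interval except for the point 1;
  the assumption \<open>G 1 = 0\<close> makes the step representation valid there as well.\<close>

lemma integral_step:
 fixes g :: "bool list => real" and G :: "real => real"
 assumes G: "\<And>w t. w \<in> Lw n ==> t \<in> intv w ==> G t = g w" and G1: "G 1 = 0"
 shows "(LBINT t:{0..1}. G t) = (\<Sum>w\<in>Lw n. g w) / 2 ^ n"
proof -
 have e: "indicator {0..1} t *\<^sub>R G t = (\<Sum>w\<in>Lw n. indicator (intv w) t * g w)" for t :: real
 proof (cases "0 \<le> t \<and> t < 1")
  case True
  then obtain v where v: "v \<in> Lw n" "t \<in> intv v" using intv_cover by blast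
  have "(\<Sum>w\<in>Lw n. indicator (intv w) t * g w) = (\<Sum>w\<in>Lw n. if w = v then g v else 0)"
  proof (rule sum.cong[OF refl])
   fix w assume "w \<in> Lw n"
   then have "t \<in> intv w \<longleftrightarrow> w = v" using intv_disjoint[OF _ v(2), of w] v by (auto simp: Lw_def)
   then show "indicator (intv w) t * g w = (if w = v then g v else 0)" by (simp add: indicator_def)
  qed
  also have "... = g v" using v(1) by (simp add: finite_Lw)
  finally show ?thesis using True G[OF v] by simp
 next
  case False
  then have "(\<Sum>w\<in>Lw n. indicator (intv w) t * g w) = 0"
   using intv_bounds[of t] by (intro sum.neutral) (auto simp: indicator_def)
  moreover have "indicator {0..1} t *\<^sub>R G t = 0" using False G1 by (cases "t = 1") (auto simp: indicator_def)
  ultimately show ?thesis by simp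
 qed
 have i: "integrable lborel (\<lambda>t. indicator (intv w) t * g w)" for w
  by (intro integrable_mult_left integrable_real_indicator) (auto simp: intv_def)
 have "(LBINT t:{0..1}. G t) = (\<integral>t. (\<Sum>w\<in>Lw n. indicator (intv w) t * g w) \<partial>lborel)"
  unfolding set_lebesgue_integral_def e ..
 also have "... = (\<Sum>w\<in>Lw n. \<integral>t. indicator (intv w) t * g w \<partial>lborel)" by (rule Bochner_Integration.integral_sum) (rule i)
 also have "... = (\<Sum>w\<in>Lw n. g w / 2 ^ n)"
  by (intro sum.cong refl) (simp add: measure_intv Lw_def power_one_over)
 finally show ?thesis by (simp only: sum_divide_distrib)
qed

lemma sum_prefixes:
 assumes w: "w \<in> Lw n" shows "(\<Sum>K\<in>Ww n. if take (length K) w = K then g K else 0) = (\<Sum>i\<le>n. g (take i w))"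
proof -
 have "(\<Sum>K\<in>Ww n. if take (length K) w = K then g K else 0) = sum g {K \<in> Ww n. take (length K) w = K}"
  by (rule sum.inter_filter[symmetric]) simp
 also have "{K \<in> Ww n. take (length K) w = K} = (\<lambda>i. take i w) ` {..n}"
  using w by (force simp: Ww_def Lw_def image_iff)
 also have "sum g ... = (\<Sum>i\<le>n. g (take i w))"
 proof (rule sum.reindex_cong[OF _ refl refl])
  show "inj_on (\<lambda>i. take i w) {..n}"
  proof (rule inj_onI)
   fix i j assume ij: "i \<in> {..n}" "j \<in> {..n}" and e: "take i w = take j w"
   have "length (take i w) = length (take j w)" unfolding e ..
   then show "i = j" using ij w by (simp add: Lw_def)
  qed
 qed
 finally show ?thesis .
qed

text \<open>Squares of Haar functions are indicators, so the integrand is constant on products of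
  dyadic intervals of levels \<open>n\<close> and \<open>l\<close>, where it equals the square of
  \<open>sf\<close>. Both integrals become finite means.\<close>

lemma hardy_norm_synth:
 assumes p: "1 \<le> p" and q: "1 \<le> q" and a: "a \<in> arrs2 n l"
 shows "hardy_norm p q (synth a) = mixed p q n l a"
proof -
 let ?m = "max n l" and ?Q = "{t. a (fst t) (snd t) \<noteq> 0}"
 have am: "a \<in> arrs ?m" using a by (auto simp: arrs_def arrs2_def)
 have Qsub: "?Q \<subseteq> Ww n \<times> Ww l" using arrs2D[OF a] by (force simp: Ww_def)
 define J where "J x y = (\<Sum>(I, J) \<in> {(I, J) \<in> dyadic \<times> dyadic. haar_coeff (synth a) I J \<noteq> 0}.
       \<bar>haar_coeff (synth a) I J\<bar>\<^sup>2 * (haar2 I J (x, y))\<^sup>2)" for x y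
 have Jset: "{(I, J) \<in> dyadic \<times> dyadic. haar_coeff (synth a) I J \<noteq> 0} = (\<lambda>t. (intv (fst t), intv (snd t))) ` ?Q"
  (is "?A = ?B")
 proof (intro set_eqI iffI)
  fix z assume "z \<in> ?A"
  then obtain K L where "z = (intv K, intv L)" "a K L \<noteq> 0"
   unfolding dyadic_eq by (auto simp: haar_coeff_synth[OF am])
  then show "z \<in> ?B" by (intro image_eqI[of _ _ "(K, L)"]) auto
 qed (auto simp: haar_coeff_synth[OF am] dyadic_eq)
 have Jinj: "inj_on (\<lambda>t. (intv (fst t), intv (snd t))) ?Q" by (auto simp: inj_on_def intv_inj)
 have J: "J x y = (\<Sum>K\<in>Ww n. \<Sum>L\<in>Ww l. (a K L)\<^sup>2 * ((if x \<in> intv K then 1 else 0) * (if y \<in> intv L then 1 else 0)))" for x y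
 proof -
  have "J x y = (\<Sum>t\<in>?Q. (a (fst t) (snd t))\<^sup>2 * ((if x \<in> intv (fst t) then 1 else 0) * (if y \<in> intv (snd t) then 1 else 0)))"
   unfolding J_def Jset sum.reindex[OF Jinj]
   by (intro sum.cong refl) (simp only: o_def case_prod_conv haar_coeff_synth[OF am] haar2_def power_mult_distrib haar_sq power2_abs)
  also have "... = (\<Sum>t\<in>Ww n \<times> Ww l. (a (fst t) (snd t))\<^sup>2 * ((if x \<in> intv (fst t) then 1 else 0) * (if y \<in> intv (snd t) then 1 else 0)))"
   by (rule sum.mono_neutral_left) (use Qsub in auto)
  finally show ?thesis by (simp only: sum.cartesian_product case_prod_unfold)
 qed
 have J1: "J x y = 0" if "x = 1 \<or> y = 1" for x y
  unfolding J using that intv_bounds[of 1] by (intro sum.neutral ballI) auto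
 have Jsf: "J x y = (sf n l a w v)\<^sup>2" if w: "w \<in> Lw n" "x \<in> intv w" and v: "v \<in> Lw l" "y \<in> intv v" for x y w v
 proof -
  have "J x y = (\<Sum>K\<in>Ww n. if take (length K) w = K then \<Sum>L\<in>Ww l. if take (length L) v = L then (a K L)\<^sup>2 else 0 else 0)"
   unfolding J
  proof (rule sum.cong[OF refl])
   fix K assume K: "K \<in> Ww n"
   have x: "x \<in> intv K \<longleftrightarrow> take (length K) w = K" using intv_take[OF w(2), of K] K w(1) by (simp add: Ww_def Lw_def)
   have y: "y \<in> intv L \<longleftrightarrow> take (length L) v = L" if "L \<in> Ww l" for L using intv_take[OF v(2), of L] that v(1) by (simp add: Ww_def Lw_def)
   show "(\<Sum>L\<in>Ww l. (a K L)\<^sup>2 * ((if x \<in> intv K then 1 else 0) * (if y \<in> intv L then 1 else 0)))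
    = (if take (length K) w = K then \<Sum>L\<in>Ww l. if take (length L) v = L then (a K L)\<^sup>2 else 0 else 0)"
    unfolding x using y by (auto intro!: sum.cong)
  qed
  also have "... = (\<Sum>i\<le>n. \<Sum>j\<le>l. (a (take i w) (take j v))\<^sup>2)"
   unfolding sum_prefixes[OF w(1)] sum_prefixes[OF v(1)] ..
  also have "... = (sf n l a w v)\<^sup>2" unfolding sf_alt by (simp add: sum_nonneg)
  finally show ?thesis .
 qed
 have inner: "(LBINT y:{0..1}. J x y powr (q / 2)) = (mp q l (\<lambda>v. sf n l a w v)) powr q" if w: "w \<in> Lw n" "x \<in> intv w" for x w
 proof -
  have "(LBINT y:{0..1}. J x y powr (q / 2)) = (\<Sum>v\<in>Lw l. sf n l a w v powr q) / 2 ^ l"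
  proof (rule integral_step)
   fix v y assume v: "v \<in> Lw l" "y \<in> intv v"
   have "((sf n l a w v)\<^sup>2) powr (q / 2) = sf n l a w v powr q"
    by (cases "sf n l a w v = 0") (simp_all add: powr_numeral[symmetric] powr_powr del: powr_numeral)
   then show "J x y powr (q / 2) = sf n l a w v powr q" using Jsf[OF w v] by simp
  qed (simp add: J1)
  then show ?thesis by (simp only: mp_powr[OF q])
 qed
 have "(LBINT x:{0..1}. (LBINT y:{0..1}. J x y powr (q / 2)) powr (p / q)) = (\<Sum>w\<in>Lw n. mp q l (\<lambda>v. sf n l a w v) powr p) / 2 ^ n"
 proof (rule integral_step)
  fix w x assume w: "w \<in> Lw n" "x \<in> intv w"
  show "(LBINT y:{0..1}. J x y powr (q / 2)) powr (p / q) = mp q l (\<lambda>v. sf n l a w v) powr p"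
   unfolding inner[OF w] using q by (simp add: powr_powr)
 qed (simp add: J1)
 then show ?thesis unfolding hardy_norm_def J_def mixed_def mp_alt[of p] by simp
qed

lemma hardy_norm_haar: "1 \<le> p ==> 1 \<le> q ==> haar_norm (\<lambda>a. hardy_norm p q (synth a)) (1 / p) (1 / q)"
 by (rule haar_norm_mixed) (assumption, assumption, rule hardy_norm_synth)

definition coeffs :: "(real \<times> real => real) => arr" where
 "coeffs f = (\<lambda>K L. haar_coeff f (intv K) (intv L))"

lemma coeffs_synth: "a \<in> arrs n ==> coeffs (synth a) = a"
 by (simp add: coeffs_def haar_coeff_synth)

lemma carr_hardy: "carr (hardy p q n) = synth ` arrs n"
proof -
 let ?B = "{haar2 I J | I J. I \<in> dyadic_upto n \<and> J \<in> dyadic_upto n}"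
 have B: "?B = hv ` (Ww n \<times> Ww n)"
  unfolding dyadic_upto_eq hv_def by force
 have "span ?B \<subseteq> synth ` arrs n"
 proof (rule span_minimal)
  show "?B \<subseteq> synth ` arrs n"
   unfolding B
  proof
   fix g assume "g \<in> hv ` (Ww n \<times> Ww n)"
   then obtain K L where "g = synth (hb K L)" "K \<in> Ww n" "L \<in> Ww n" by (auto simp: synth_hb)
   then show "g \<in> synth ` arrs n" by (simp add: Ww_def)
  qed
  show "subspace (synth ` arrs n)"
   unfolding subspace_def
  proof (intro conjI ballI allI)
   show "0 \<in> synth ` arrs n" by (rule image_eqI[OF _ arrs_closed(1)]) (simp add: synth_def)
   fix f g c assume f: "f \<in> synth ` arrs n"
   then obtain a where a: "f = synth a" "a \<in> arrs n" by blast
   show "c *\<^sub>R f \<in> synth ` arrs n"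
    by (rule image_eqI[OF _ arrs_closed(4)[OF a(2)]]) (simp only: a(1) synth_linear(2)[OF a(2,2)])
   assume "g \<in> synth ` arrs n"
   then obtain b where b: "g = synth b" "b \<in> arrs n" by blast
   show "f + g \<in> synth ` arrs n"
    by (rule image_eqI[OF _ arrs_closed(2)[OF a(2) b(2)]]) (simp only: a(1) b(1) synth_linear(1)[OF a(2) b(2)])
  qed
 qed
 moreover have "synth ` arrs n \<subseteq> span ?B"
 proof
  fix f assume "f \<in> synth ` arrs n"
  then obtain a where a: "f = synth a" "a \<in> arrs n" by blast
  show "f \<in> span ?B"
   unfolding a(1) synth_eq[OF a(2)] B by (intro span_sum span_scale span_base) simp
 qed
 ultimately show ?thesis by (auto simp: hardy_def)
qed

section \<open>Transfer to the Hardy spaces and their duals\<close>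

lemma isometry_transfer:
 assumes X: "normed_space X" and Y: "carr Y = T ` carr X"
  and add: "\<And>x y. x \<in> carr X ==> y \<in> carr X ==> T (x + y) = T x + T y"
  and sc: "\<And>c x. x \<in> carr X ==> T (c *\<^sub>R x) = c *\<^sub>R T x"
  and nT: "\<And>x. x \<in> carr X ==> nrm Y (T x) = nrm X x" and S: "\<And>x. x \<in> carr X ==> S (T x) = x"
 shows "normed_space Y" "op_le X Y 1 T" "op_le Y X 1 S"
proof -
 have X0: "0 \<in> carr X" using X by (simp add: normed_space_def subspace_def)
 have Xa: "x + y \<in> carr X" if "x \<in> carr X" "y \<in> carr X" for x y using X that by (simp add: normed_space_def subspace_def)
 have Xs: "c *\<^sub>R x \<in> carr X" if "x \<in> carr X" for c x using X that by (simp add: normed_space_def subspace_def)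
 have Xn: "0 \<le> nrm X x" "nrm X x = 0 \<longleftrightarrow> x = 0" "nrm X (c *\<^sub>R x) = \<bar>c\<bar> * nrm X x" if "x \<in> carr X" for c x
  using X that by (simp_all add: normed_space_def)
 have Xt: "nrm X (x + y) \<le> nrm X x + nrm X y" if "x \<in> carr X" "y \<in> carr X" for x y
  using X that by (simp add: normed_space_def)
 have T0: "T 0 = 0" using sc[OF X0, of 0] by simp
 show "op_le X Y 1 T" by (rule op_leI) (simp_all add: Y add sc nT)
 show "op_le Y X 1 S"
 proof (rule op_leI)
  fix f g c assume f: "f \<in> carr Y"
  then obtain x where x: "f = T x" "x \<in> carr X" using Y by blast
  show "S f \<in> carr X" using x S by simp
  show "nrm X (S f) \<le> 1 * nrm Y f" using x S nT by simp
  show "S (c *\<^sub>R f) = c *\<^sub>R S f" using S[OF Xs[OF x(2)], of c] unfolding sc[OF x(2)] x(1) S[OF x(2)] .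
  assume "g \<in> carr Y"
  then obtain y where y: "g = T y" "y \<in> carr X" using Y by blast
  show "S (f + g) = S f + S g"
   using S[OF Xa[OF x(2) y(2)]] unfolding add[OF x(2) y(2)] x(1) y(1) S[OF x(2)] S[OF y(2)] .
 qed
 show "normed_space Y"
  unfolding normed_space_def subspace_def
 proof (intro conjI ballI allI)
  show "0 \<in> carr Y" unfolding Y using imageI[OF X0, of T] T0 by simp
  fix f g c assume f: "f \<in> carr Y"
  then obtain x where x: "f = T x" "x \<in> carr X" using Y by blast
  show "c *\<^sub>R f \<in> carr Y" unfolding x(1) Y sc[OF x(2), symmetric] by (rule imageI[OF Xs[OF x(2)]])
  show "0 \<le> nrm Y f" unfolding x(1) nT[OF x(2)] by (rule Xn(1)[OF x(2)])
  show "nrm Y f = 0 \<longleftrightarrow> f = 0"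
   unfolding x(1) nT[OF x(2)] Xn(2)[OF x(2)] using T0 S[OF x(2)] S[OF X0] by auto
  show "nrm Y (c *\<^sub>R f) = \<bar>c\<bar> * nrm Y f"
   unfolding x(1) sc[OF x(2), symmetric] nT[OF Xs[OF x(2)]] nT[OF x(2)] by (rule Xn(3)[OF x(2)])
  assume "g \<in> carr Y"
  then obtain y where y: "g = T y" "y \<in> carr X" using Y by blast
  show "f + g \<in> carr Y" unfolding x(1) y(1) Y add[OF x(2) y(2), symmetric] by (rule imageI[OF Xa[OF x(2) y(2)]])
  show "nrm Y (f + g) \<le> nrm Y f + nrm Y g"
   unfolding x(1) y(1) add[OF x(2) y(2), symmetric] nT[OF Xa[OF x(2) y(2)]] nT[OF x(2)] nT[OF y(2)]
   by (rule Xt[OF x(2) y(2)])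
 qed
qed

text \<open>The isometries of the summands have constant 1 in both directions, so they glue to an
  isomorphism of the sums, along which primariness is transported.\<close>

lemma (in haar_norm) primary_isometric:
 fixes Y :: "nat => 'b::real_vector nspace"
 assumes r: "1 \<le> r" and Y: "\<And>n. carr (Y n) = T n ` arrs n"
  and add: "\<And>n a b. a \<in> arrs n ==> b \<in> arrs n ==> T n (a + b) = T n a + T n b"
  and sc: "\<And>n c a. a \<in> arrs n ==> T n (c *\<^sub>R a) = c *\<^sub>R T n a"
  and nT: "\<And>n a. a \<in> arrs n ==> nrm (Y n) (T n a) = \<nu> a" and S: "\<And>n a. a \<in> arrs n ==> S n (T n a) = a"
 shows "primary (lr_sum r {1..} Y)"
proof -
 have t: "normed_space (Y n)" "op_le (Cs n) (Y n) 1 (T n)" "op_le (Y n) (Cs n) 1 (S n)" for n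
  by (rule isometry_transfer[where X = "Cs n" and Y = "Y n" and T = "T n" and S = "S n", OF Cs_normed];
    simp only: Cs_simps Y add sc nT S)+
 have ne: "{1::nat..} \<noteq> {}" by simp
 have nY: "\<forall>n\<in>{1..}. normed_space (Y n)" using t(1) by blast
 have "isomorphic_spaces (lr_sum r {1..} Cs) (lr_sum r {1..} Y)"
 proof (rule lr_sum_isomorphic[OF r ne Cs_all_normed nY t(2,3)])
  show "S n (T n a) = a" if "a \<in> carr (Cs n)" for n a using that unfolding Cs_simps by (rule S)
  show "T n (S n f) = f" if f: "f \<in> carr (Y n)" for n f
  proof -
   obtain a where "f = T n a" "a \<in> arrs n" using f Y by blast
   then show ?thesis by (simp only: S)
  qed
 qed
 then show ?thesis
  using primary_isomorphic[OF Xs_primary[OF r] lr_sum_normed[OF r nY ne]] unfolding Xs_def by blast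
qed

lemma hardy_sum_primary:
 assumes p: "1 \<le> p" and q: "1 \<le> q" and r: "1 \<le> r"
 shows "primary (lr_sum r {1..} (hardy p q))"
proof -
 interpret haar_norm "\<lambda>a. hardy_norm p q (synth a)" "1 / p" "1 / q" by (rule hardy_norm_haar[OF p q])
 show ?thesis
 proof (rule primary_isometric[OF r, where T = "\<lambda>_. synth" and S = "\<lambda>_. coeffs"])
  show "carr (hardy p q n) = synth ` arrs n" for n by (rule carr_hardy)
  show "nrm (hardy p q n) (synth a) = hardy_norm p q (synth a)" for n a by (simp add: hardy_def)
  show "coeffs (synth a) = a" if "a \<in> arrs n" for n a by (rule coeffs_synth[OF that])
 qed (rule synth_linear; assumption)+
qed

text \<open>Every functional on the finite dimensional space is given by \<open>pair\<close> with
  exactly one array, and its dual norm is then \<open>dual_nu\<close> of that array. Thus the spaces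
  are again of the abstract kind, with exponents \<open>1 - 1 / p\<close> and
  \<open>1 - 1 / q\<close>.\<close>

lemma hardy_dual_sum_primary:
 assumes p: "1 \<le> p" and q: "1 \<le> q" and r: "1 \<le> r"
 shows "primary (lr_sum r {1..} (\<lambda>n. dual_space (hardy p q n)))"
proof -
 let ?\<nu> = "\<lambda>a. hardy_norm p q (synth a)"
 interpret H: haar_norm ?\<nu> "1 / p" "1 / q" by (rule hardy_norm_haar[OF p q])
 interpret D: haar_norm H.dual_nu "1 - 1 / p" "1 - 1 / q" by (rule H.dual_haar_norm)
 have nrm: "nrm (hardy p q n) f = hardy_norm p q f" for n f by (simp add: hardy_def)
 \<comment> \<open>The value 0 off the carrier matches the normalization of functionals in
   \<open>dual_space\<close>.\<close>
 define T where "T n c = (\<lambda>f. if f \<in> carr (hardy p q n) then pair n c (coeffs f) else 0)" for n c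
 \<comment> \<open>Pairing with \<open>hb K L\<close> yields the entry times
   \<open>wt K * wt L\<close>; the powers of two undo this weight.\<close>
 define S where "S n \<phi> = (\<lambda>K L. if K \<in> Ww n \<and> L \<in> Ww n then 2 ^ length K * 2 ^ length L * \<phi> (synth (hb K L)) else 0)"
  for n and \<phi> :: "(real \<times> real => real) => real"
 have sc: "synth a \<in> carr (hardy p q n)" if "a \<in> arrs n" for a n unfolding carr_hardy by (rule imageI[OF that])
 have Ts: "T n c (synth a) = pair n c a" if "a \<in> arrs n" for n c a
  unfolding T_def using sc[OF that] coeffs_synth[OF that] by simp
 have wt: "2 ^ length K * wt K = 1" for K by (simp add: wt_def power_mult_distrib[symmetric])
 have pl: "pair n c (a + b) = pair n c a + pair n c b" "pair n c (r *\<^sub>R a) = r * pair n c a"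
  if "a \<in> arrs n" "b \<in> arrs n" for n c a b r
  using lin_pair[of n c] that unfolding lin_def by blast+
 show ?thesis
 proof (rule D.primary_isometric[OF r, where T = T and S = S])
  fix n
  have Tc: "T n c \<in> carr (dual_space (hardy p q n))" if c: "c \<in> arrs n" for c
  proof -
   have t1: "T n c (f + g) = T n c f + T n c g" if "f \<in> carr (hardy p q n)" "g \<in> carr (hardy p q n)" for f g
   proof -
    obtain a b where ab: "f = synth a" "a \<in> arrs n" "g = synth b" "b \<in> arrs n" using \<open>f \<in> _\<close> \<open>g \<in> _\<close> unfolding carr_hardy by blast
    show ?thesis
     unfolding ab(1,3) synth_linear(1)[OF ab(2,4), symmetric] Ts[OF arrs_closed(2)[OF ab(2,4)]] Ts[OF ab(2)] Ts[OF ab(4)]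
     by (rule pl(1)[OF ab(2,4)])
   qed
   have t2: "T n c (k *\<^sub>R f) = k * T n c f" "\<bar>T n c f\<bar> \<le> H.dual_nu c * nrm (hardy p q n) f"
    if f: "f \<in> carr (hardy p q n)" for k f
   proof -
    obtain a where a: "f = synth a" "a \<in> arrs n" using f unfolding carr_hardy by blast
    show "T n c (k *\<^sub>R f) = k * T n c f"
     unfolding a(1) synth_linear(2)[OF a(2,2), symmetric] Ts[OF arrs_closed(4)[OF a(2)]] Ts[OF a(2)] by (rule pl(2)[OF a(2,2)])
    show "\<bar>T n c f\<bar> \<le> H.dual_nu c * nrm (hardy p q n) f"
     unfolding nrm a(1) Ts[OF a(2)] by (rule H.pair_le_dual_nu[OF c a(2)])
   qed
   have t3: "T n c f = 0" if "f \<notin> carr (hardy p q n)" for f using that by (simp add: T_def)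
   have t4: "\<exists>C. \<forall>f\<in>carr (hardy p q n). \<bar>T n c f\<bar> \<le> C * nrm (hardy p q n) f"
    by (intro exI ballI) (rule t2(2))
   show ?thesis
    unfolding dual_space_def nspace.simps mem_Collect_eq
    by (intro conjI t4 ballI allI impI) (simp_all only: t1 t2(1) t3 simp_thms)
  qed
  have TS: "T n (S n \<phi>) = \<phi>" "S n \<phi> \<in> arrs n" if \<phi>: "\<phi> \<in> carr (dual_space (hardy p q n))" for \<phi>
  proof -
   have \<phi>a: "\<And>f g. f \<in> carr (hardy p q n) ==> g \<in> carr (hardy p q n) ==> \<phi> (f + g) = \<phi> f + \<phi> g"
    and \<phi>s: "\<And>c f. f \<in> carr (hardy p q n) ==> \<phi> (c *\<^sub>R f) = c * \<phi> f"
    and \<phi>0: "\<And>f. f \<notin> carr (hardy p q n) ==> \<phi> f = 0"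
    using \<phi> by (simp_all add: dual_space_def)
   have lin: "lin n (\<lambda>a. \<phi> (synth a))"
    unfolding lin_def
   proof (intro conjI ballI allI)
    fix a b c assume a: "a \<in> arrs n"
    show "\<phi> (synth (c *\<^sub>R a)) = c * \<phi> (synth a)" unfolding synth_linear(2)[OF a a] by (rule \<phi>s[OF sc[OF a]])
    assume b: "b \<in> arrs n"
    show "\<phi> (synth (a + b)) = \<phi> (synth a) + \<phi> (synth b)" unfolding synth_linear(1)[OF a b] by (rule \<phi>a[OF sc[OF a] sc[OF b]])
   qed
   show "S n \<phi> \<in> arrs n" by (auto simp: S_def arrs_def arrs2_def Ww_def)
   show "T n (S n \<phi>) = \<phi>"
   proof
    fix f
    show "T n (S n \<phi>) f = \<phi> f"
    proof (cases "f \<in> carr (hardy p q n)")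
     case True
     then obtain a where a: "f = synth a" "a \<in> arrs n" unfolding carr_hardy by blast
     have "pair n (S n \<phi>) a = (\<Sum>K\<in>Ww n. \<Sum>L\<in>Ww n. a K L * \<phi> (synth (hb K L)))"
      unfolding pair_def
     proof (intro sum.cong refl)
      fix K L assume "K \<in> Ww n" "L \<in> Ww n"
      then have "wt K * wt L * (S n \<phi> K L * a K L) = (2 ^ length K * wt K) * (2 ^ length L * wt L) * (a K L * \<phi> (synth (hb K L)))"
       unfolding S_def by (simp only: simp_thms if_True mult_ac)
      then show "wt K * wt L * (S n \<phi> K L * a K L) = a K L * \<phi> (synth (hb K L))" unfolding wt by (simp only: mult_1_left)
     qed
     then show ?thesis unfolding a(1) Ts[OF a(2)] lin_expand[OF lin a(2)] .
    next
     case False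
     then show ?thesis using \<phi>0 by (simp add: T_def)
    qed
   qed
  qed
  show "carr (dual_space (hardy p q n)) = T n ` arrs n"
  proof (intro set_eqI iffI)
   fix \<phi> assume "\<phi> \<in> carr (dual_space (hardy p q n))"
   then show "\<phi> \<in> T n ` arrs n" using TS[of \<phi>] by (intro image_eqI[of _ _ "S n \<phi>"]) simp_all
  qed (use Tc in blast)
  fix a assume a: "a \<in> arrs n"
  show "T n (c *\<^sub>R a) = c *\<^sub>R T n a" for c
   unfolding T_def scaleR_fun_def[of c "\<lambda>f. if f \<in> carr (hardy p q n) then pair n a (coeffs f) else 0"]
   by (intro ext) (auto simp: pair_scale)
  show "T n (a + b) = T n a + T n b" for b
  proof
   fix f
   have e: "T n c f = (if f \<in> carr (hardy p q n) then pair n c (coeffs f) else 0)" for c by (simp only: T_def)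
   show "T n (a + b) f = (T n a + T n b) f"
    unfolding plus_fun_apply[of "T n a" "T n b" f] e by (cases "f \<in> carr (hardy p q n)") (simp_all only: if_True if_False pair_add add_0)
  qed
  \<comment> \<open>The dual norm tests with arrays of the frame \<open>n\<close>, whereas
    \<open>dual_nu\<close> tests with all frames; by \<open>pair_bounded\<close> both give the same
    set of values.\<close>
  have "{\<bar>T n a f\<bar> | f. f \<in> carr (hardy p q n) \<and> nrm (hardy p q n) f \<le> 1} = {\<bar>pair N a b\<bar> | N b. b \<in> arrs N \<and> ?\<nu> b \<le> 1}"
  proof (intro set_eqI iffI)
   fix t assume "t \<in> {\<bar>T n a f\<bar> | f. f \<in> carr (hardy p q n) \<and> nrm (hardy p q n) f \<le> 1}"
   then obtain b where b: "t = \<bar>T n a (synth b)\<bar>" "b \<in> arrs n" "?\<nu> b \<le> 1" unfolding carr_hardy nrm by blast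
   then show "t \<in> {\<bar>pair N a b\<bar> | N b. b \<in> arrs N \<and> ?\<nu> b \<le> 1}" unfolding Ts[OF b(2)] by blast
  next
   fix t assume "t \<in> {\<bar>pair N a b\<bar> | N b. b \<in> arrs N \<and> ?\<nu> b \<le> 1}"
   then obtain N b where b: "t = \<bar>pair N a b\<bar>" "b \<in> arrs N" "?\<nu> b \<le> 1" by blast
   obtain b' where b': "b' \<in> arrs n" "?\<nu> b' \<le> ?\<nu> b" "pair N a b = pair n a b'" using H.pair_bounded[OF a b(2)] by blast
   have "t = \<bar>T n a (synth b')\<bar>" unfolding b(1) b'(3) Ts[OF b'(1)] ..
   moreover have "nrm (hardy p q n) (synth b') \<le> 1" unfolding nrm using b'(2) b(3) by linarith
   ultimately show "t \<in> {\<bar>T n a f\<bar> | f. f \<in> carr (hardy p q n) \<and> nrm (hardy p q n) f \<le> 1}" using sc[OF b'(1)] by blast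
  qed
  then show "nrm (dual_space (hardy p q n)) (T n a) = H.dual_nu a"
   unfolding H.dual_nu_def dual_space_def by simp
  show "S n (T n a) = a"
  proof (intro ext)
   fix K L
   show "S n (T n a) K L = a K L"
   proof (cases "K \<in> Ww n \<and> L \<in> Ww n")
    case True
    then have h: "hb K L \<in> arrs n" by (simp add: Ww_def)
    have "S n (T n a) K L = 2 ^ length K * 2 ^ length L * pair n a (hb K L)" using True by (simp add: S_def Ts[OF h])
    also have "... = (2 ^ length K * wt K) * (2 ^ length L * wt L) * a K L" using True by (simp add: pair_hb)
    finally show ?thesis unfolding wt by simp
   next
    case False
    then show ?thesis using arrsD[OF a, of K L] by (auto simp: S_def Ww_def)
   qed
  qed
 qed
qed

theorem theorem2p2:
  fixes p q :: real and r :: ereal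
  assumes "1 \<le> p" and "1 \<le> q" and "1 \<le> r"
  shows "primary (lr_sum r {1..} (hardy p q)) \<and>
    primary (lr_sum r {1..} (\<lambda>n. dual_space (hardy p q n))) \<and>
    (\<forall>s::real. 1 < s \<longrightarrow>
       primary (lr_sum r {1..} (hardy 1 s)) \<and>
       primary (lr_sum r {1..} (hardy s 1)) \<and>
       primary (lr_sum r {1..} (BMO_hardy s)) \<and>
       primary (lr_sum r {1..} (hardy_BMO s)))"
proof (intro conjI allI impI)
  fix s :: real assume s: "1 < s"
  then have c: "1 \<le> conj_exp s" by (simp add: conj_exp_def)
  have "BMO_hardy s = (\<lambda>n. dual_space (hardy 1 (conj_exp s) n))" "hardy_BMO s = (\<lambda>n. dual_space (hardy (conj_exp s) 1 n))"
    by (simp_all add: BMO_hardy_def hardy_BMO_def fun_eq_iff)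
  then show "primary (lr_sum r {1..} (BMO_hardy s))" "primary (lr_sum r {1..} (hardy_BMO s))"
    using hardy_dual_sum_primary[OF order_refl c assms(3)] hardy_dual_sum_primary[OF c order_refl assms(3)] by simp_all
  have s1: "1 \<le> s" using s by simp
  show "primary (lr_sum r {1..} (hardy 1 s))" by (rule hardy_sum_primary[OF order_refl s1 assms(3)])
  show "primary (lr_sum r {1..} (hardy s 1))" by (rule hardy_sum_primary[OF s1 order_refl assms(3)])
qed (rule hardy_sum_primary hardy_dual_sum_primary; fact assms)+

end
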